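(* Let $k\ge1$ be an integer and $\rho>0$. There exist constants $C_1,C_2>0$, independent of the mesh (i.e. of the polyhedron $E$ and of its size), such that for every polyhedron $E$ satisfying the mesh regularity assumption (M) with parameter $\rho$, the bilinear form on $\mathbf V^f_{k-1}(E)\times\mathbf V^f_{k-1}(E)$ $$S^E_f(\mathbf v_h,\mathbf w_h)=h_E\sum_{F\subseteq\partial E}(\mathbf v_h\cdot\mathbf n_F,\mathbf w_h\cdot\mathbf n_F)_F+h_E^2(\mathrm{div}\,\mathbf v_h,\mathrm{div}\,\mathbf w_h)_E+(\mathbf\Pi^{0,E}_{k+1}\mathbf v_h,\mathbf\Pi^{0,E}_{k+1}\mathbf w_h)_E$$ satisfies $$C_1\|\mathbf v_h\|_E^2\le S^E_f(\mathbf v_h,\mathbf v_h)\le C_2\|\mathbf v_h\|_E^2\qquad\forall\mathbf v_h\in\mathbf V^f_{k-1}(E).$$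
   Context: (M): $E\subset\mathbb R^3$ is a polyhedron with diameter $h_E$; $E$ is star-shaped with respect to a ball of radius $\ge\rho h_E$; every face $F$ (diameter $h_F$) is star-shaped with respect to a disk of radius $\ge\rho h_F$; every edge $e$ of every face $F$ satisfies $h_e\ge\rho h_F\ge\rho^2h_E$. $(\cdot,\cdot)_D$ and $\|\cdot\|_D$ are the $L^2(D)$ inner product and norm; $\mathbf n_F$ is the unit outer normal on the face $F$; $\mathbb P_k(D)$: polynomials of degree at most $k$ on $D$; $\mathbf\Pi^{0,E}_{k+1}$ is the $\mathbf L^2(E)$-orthogonal projection onto $(\mathbb P_{k+1}(E))^3$. $\mathbf V^f_{k-1}(E)=\{\mathbf v_h\in\mathbf L^2(E):\mathrm{div}\,\mathbf v_h\in\mathbb P_{k-1}(E),\ \mathbf{curl}\,\mathbf v_h\in(\mathbb P_k(E))^3,\ \mathbf v_h\cdot\mathbf n_F\in\mathbb P_{k-1}(F)\ \forall F\subseteq\partial E\}$. *)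

theory Defs
  imports "HOL-Analysis.Analysis"
begin

section \<open>Polyhedra and mesh regularity\<close>

text \<open>
  The library's \<open>polyhedron\<close> is a convex notion; mesh elements need not be convex.
  Faces and edges are data of a polyhedron, as in a polyhedral mesh: coplanar neighbouring faces
  and collinear neighbouring edges (hanging nodes) are allowed, so that the decomposition into
  maximal planar faces is one instance.  Faces are closed, the polyhedron itself is open.
\<close>

definition polygon_with_edges :: "(real^3) set \<Rightarrow> (real^3) set set \<Rightarrow> bool" where
  "polygon_with_edges F es \<longleftrightarrow>
     compact F \<and> aff_dim F = 2 \<and> closure (rel_interior F) = F \<and> connected (rel_interior F) \<and>
     finite es \<and> (\<forall>e\<in>es. \<exists>a b. a \<noteq> b \<and> e = closed_segment a b) \<and>
     \<Union>es = rel_frontier F \<and>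
     (\<forall>e\<in>es. \<forall>e'\<in>es. e \<noteq> e' \<longrightarrow>
        e \<inter> e' \<subseteq> {x. x extreme_point_of e} \<inter> {x. x extreme_point_of e'})"

definition polyhedral_domain ::
  "(real^3) set \<Rightarrow> (real^3) set set \<Rightarrow> ((real^3) set \<Rightarrow> (real^3) set set) \<Rightarrow> bool" where
  "polyhedral_domain E Fs edges \<longleftrightarrow>
     E \<noteq> {} \<and> open E \<and> bounded E \<and> connected E \<and> interior (closure E) = E \<and>
     finite Fs \<and> (\<forall>F\<in>Fs. polygon_with_edges F (edges F)) \<and>
     \<Union>Fs = frontier E \<and>
     (\<forall>F\<in>Fs. \<forall>F'\<in>Fs. F \<noteq> F' \<longrightarrow> rel_interior F \<inter> F' = {})"

definition star_shaped_wrt :: "'a::real_vector set \<Rightarrow> 'a set \<Rightarrow> bool" where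
  "star_shaped_wrt S B \<longleftrightarrow> B \<subseteq> S \<and> (\<forall>b\<in>B. \<forall>x\<in>S. closed_segment b x \<subseteq> S)"

definition mesh_regular ::
  "real \<Rightarrow> (real^3) set \<Rightarrow> (real^3) set set \<Rightarrow> ((real^3) set \<Rightarrow> (real^3) set set) \<Rightarrow> bool" where
  "mesh_regular \<rho> E Fs edges \<longleftrightarrow>
     (\<exists>c r. r \<ge> \<rho> * diameter E \<and> star_shaped_wrt E (ball c r)) \<and>
     (\<forall>F\<in>Fs. \<exists>c r. c \<in> affine hull F \<and> r \<ge> \<rho> * diameter F \<and>
        star_shaped_wrt F (ball c r \<inter> affine hull F)) \<and>
     (\<forall>F\<in>Fs. \<forall>e\<in>edges F.
        diameter e \<ge> \<rho> * diameter F \<and> \<rho> * diameter F \<ge> \<rho>\<^sup>2 * diameter E)"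

section \<open>Lebesgue spaces on elements and faces\<close>

definition L2 :: "'a measure \<Rightarrow> ('a \<Rightarrow> 'b::euclidean_space) set" where
  "L2 M = {f \<in> borel_measurable M. integrable M (\<lambda>x. (norm (f x))\<^sup>2)}"

definition l2_inner :: "'a measure \<Rightarrow> ('a \<Rightarrow> 'b::euclidean_space) \<Rightarrow> ('a \<Rightarrow> 'b) \<Rightarrow> real" where
  "l2_inner M f g = (LINT x|M. f x \<bullet> g x)"

definition l2_norm :: "'a measure \<Rightarrow> ('a \<Rightarrow> 'b::euclidean_space) \<Rightarrow> real" where
  "l2_norm M f = sqrt (l2_inner M f f)"

text \<open>
  Area measure on a planar set, transported from the plane by an isometric affine chart of
  its affine hull; the result does not depend on the chart.
\<close>

definition isometric_chart :: "(real^2 \<Rightarrow> real^3) \<Rightarrow> (real^3) set \<Rightarrow> bool" where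
  "isometric_chart T P \<longleftrightarrow>
     (\<exists>a L. linear L \<and> (\<forall>y. norm (L y) = norm y) \<and> T = (\<lambda>y. a + L y)) \<and> range T = P"

definition area_on :: "(real^3) set \<Rightarrow> (real^3) measure" where
  "area_on F = (let T = (SOME T. isometric_chart T (affine hull F))
                in embed_measure (lebesgue_on (T -` F)) T)"

section \<open>Polynomials of bounded total degree\<close>

text \<open>
  Polynomials on a subset (an element or a face) are represented by polynomials on the
  whole space, of which only the restriction matters.
\<close>

definition polys :: "nat \<Rightarrow> (real^3 \<Rightarrow> real) set" where
  "polys m = {p. \<exists>c :: (3 \<Rightarrow> nat) \<Rightarrow> real. \<forall>x.
     p x = (\<Sum>\<alpha> | (\<Sum>i\<in>UNIV. \<alpha> i) \<le> m. c \<alpha> * (\<Prod>i\<in>UNIV. (x $ i) ^ \<alpha> i))}"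

lemma finite_multi_indices: "finite {\<alpha> :: 3 \<Rightarrow> nat. (\<Sum>i\<in>UNIV. \<alpha> i) \<le> m}"
proof (rule finite_subset)
  show "{\<alpha> :: 3 \<Rightarrow> nat. (\<Sum>i\<in>UNIV. \<alpha> i) \<le> m} \<subseteq> PiE UNIV (\<lambda>_. {..m})"
  proof
    fix \<alpha> :: "3 \<Rightarrow> nat"
    assume "\<alpha> \<in> {\<alpha>. (\<Sum>i\<in>UNIV. \<alpha> i) \<le> m}"
    then have "\<alpha> j \<le> m" for j
      using member_le_sum[of j UNIV \<alpha>] by simp
    then show "\<alpha> \<in> PiE UNIV (\<lambda>_. {..m})"
      by (simp add: PiE_def)
  qed
  show "finite (PiE (UNIV :: 3 set) (\<lambda>_. {..m}))"
    by (intro finite_PiE) auto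
qed

definition vpolys :: "nat \<Rightarrow> (real^3 \<Rightarrow> real^3) set" where
  "vpolys m = {q. \<forall>i. (\<lambda>x. q x $ i) \<in> polys m}"

section \<open>Weak divergence, weak curl, normal trace\<close>

definition partial :: "3 \<Rightarrow> (real^3 \<Rightarrow> real) \<Rightarrow> real^3 \<Rightarrow> real" where
  "partial i f x = frechet_derivative f (at x) (axis i 1)"

primrec times_cont_diff :: "nat \<Rightarrow> (real^3 \<Rightarrow> real) \<Rightarrow> bool" where
  "times_cont_diff 0 f \<longleftrightarrow> continuous_on UNIV f"
| "times_cont_diff (Suc n) f \<longleftrightarrow>
     (\<forall>x. f differentiable at x) \<and> (\<forall>i. times_cont_diff n (partial i f))"

definition smooth :: "(real^3 \<Rightarrow> real) \<Rightarrow> bool" where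
  "smooth f \<longleftrightarrow> (\<forall>n. times_cont_diff n f)"

definition compactly_supported_in :: "(real^3) set \<Rightarrow> (real^3 \<Rightarrow> 'b::zero) \<Rightarrow> bool" where
  "compactly_supported_in E f \<longleftrightarrow> compact (closure {x. f x \<noteq> 0}) \<and> closure {x. f x \<noteq> 0} \<subseteq> E"

definition grad :: "(real^3 \<Rightarrow> real) \<Rightarrow> real^3 \<Rightarrow> real^3" where
  "grad f x = (\<chi> i. partial i f x)"

definition curl :: "(real^3 \<Rightarrow> real^3) \<Rightarrow> real^3 \<Rightarrow> real^3" where
  "curl u x = vector
     [partial 2 (\<lambda>y. u y $ 3) x - partial 3 (\<lambda>y. u y $ 2) x,
      partial 3 (\<lambda>y. u y $ 1) x - partial 1 (\<lambda>y. u y $ 3) x,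
      partial 1 (\<lambda>y. u y $ 2) x - partial 2 (\<lambda>y. u y $ 1) x]"

definition has_weak_div :: "(real^3) set \<Rightarrow> (real^3 \<Rightarrow> real^3) \<Rightarrow> (real^3 \<Rightarrow> real) \<Rightarrow> bool" where
  "has_weak_div E v d \<longleftrightarrow>
     (\<forall>\<phi>. smooth \<phi> \<and> compactly_supported_in E \<phi> \<longrightarrow>
        l2_inner (lebesgue_on E) v (grad \<phi>) = - l2_inner (lebesgue_on E) d \<phi>)"

definition has_weak_curl :: "(real^3) set \<Rightarrow> (real^3 \<Rightarrow> real^3) \<Rightarrow> (real^3 \<Rightarrow> real^3) \<Rightarrow> bool" where
  "has_weak_curl E v c \<longleftrightarrow>
     (\<forall>\<psi>. (\<forall>i. smooth (\<lambda>x. \<psi> x $ i)) \<and> compactly_supported_in E \<psi> \<longrightarrow>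
        l2_inner (lebesgue_on E) v (curl \<psi>) = l2_inner (lebesgue_on E) c \<psi>)"

text \<open>Determined up to null sets for fields with square integrable weak divergence.\<close>

definition weak_div :: "(real^3) set \<Rightarrow> (real^3 \<Rightarrow> real^3) \<Rightarrow> real^3 \<Rightarrow> real" where
  "weak_div E v = (SOME d. d \<in> L2 (lebesgue_on E) \<and> has_weak_div E v d)"

text \<open>
  The outward normal trace of a field with square integrable divergence is the functional
  on the boundary defined by Green's formula (so for a field smooth up to the boundary it is the
  scalar product with the unit outer normal).  The predicate says that it is given by a
  square integrable function \<open>g F\<close> on each face \<open>F\<close>.
\<close>

definition has_normal_trace ::
  "(real^3) set \<Rightarrow> (real^3) set set \<Rightarrow> (real^3 \<Rightarrow> real^3) \<Rightarrow> ((real^3) set \<Rightarrow> real^3 \<Rightarrow> real) \<Rightarrow> bool"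
  where
  "has_normal_trace E Fs v g \<longleftrightarrow>
     (\<forall>F\<in>Fs. g F \<in> L2 (area_on F)) \<and>
     (\<forall>\<phi>. smooth \<phi> \<longrightarrow>
        l2_inner (lebesgue_on E) v (grad \<phi>) + l2_inner (lebesgue_on E) (weak_div E v) \<phi>
          = (\<Sum>F\<in>Fs. l2_inner (area_on F) (g F) \<phi>))"

definition normal_trace ::
  "(real^3) set \<Rightarrow> (real^3) set set \<Rightarrow> (real^3 \<Rightarrow> real^3) \<Rightarrow> (real^3) set \<Rightarrow> real^3 \<Rightarrow> real" where
  "normal_trace E Fs v = (SOME g. has_normal_trace E Fs v g)"

section \<open>The face space and its stabilization\<close>

text \<open>\<open>face_space k\<close> is the space with lower index \<open>k - 1\<close>.\<close>

definition face_space :: "nat \<Rightarrow> (real^3) set \<Rightarrow> (real^3) set set \<Rightarrow> (real^3 \<Rightarrow> real^3) set" where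
  "face_space k E Fs =
     {v \<in> L2 (lebesgue_on E).
        (\<exists>d\<in>polys (k - 1). has_weak_div E v d) \<and>
        (\<exists>c\<in>vpolys k. has_weak_curl E v c) \<and>
        (\<exists>g. (\<forall>F\<in>Fs. g F \<in> polys (k - 1)) \<and> has_normal_trace E Fs v g)}"

definition l2_proj :: "nat \<Rightarrow> (real^3) set \<Rightarrow> (real^3 \<Rightarrow> real^3) \<Rightarrow> real^3 \<Rightarrow> real^3" where
  "l2_proj m E v = (THE q. q \<in> vpolys m \<and>
     (\<forall>r\<in>vpolys m. l2_inner (lebesgue_on E) (\<lambda>x. v x - q x) r = 0))"

definition S_f ::
  "nat \<Rightarrow> (real^3) set \<Rightarrow> (real^3) set set \<Rightarrow> (real^3 \<Rightarrow> real^3) \<Rightarrow> (real^3 \<Rightarrow> real^3) \<Rightarrow> real" where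
  "S_f k E Fs v w =
     diameter E * (\<Sum>F\<in>Fs. l2_inner (area_on F) (normal_trace E Fs v F) (normal_trace E Fs w F))
     + (diameter E)\<^sup>2 * l2_inner (lebesgue_on E) (weak_div E v) (weak_div E w)
     + l2_inner (lebesgue_on E) (l2_proj (k + 1) E v) (l2_proj (k + 1) E w)"

end

theory Submission
  imports Defs
begin

text \<open>
  For the upper bound, the divergence and the normal trace of \<open>v\<close> are polynomials, so testing the
  weak definitions with polynomials times bump functions bounds them by \<open>v\<close> alone (inverse
  estimates). The constants scale correctly because the norms of polynomials of bounded degree on
  comparable balls are equivalent.

  For the lower bound, the curl \<open>w\<close> of \<open>v\<close> is a divergence-free polynomial field, and the Koszul
  homotopy with respect to the center of the star-shaped element gives a polynomial field \<open>q\<close> of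
  degree \<open>k + 1\<close> with \<open>curl q = w\<close> and \<open>\<parallel>q\<parallel> \<le> C \<parallel>v\<parallel>\<close>. The field \<open>u = v - q\<close> is curl-free, hence a limit
  of gradients \<open>grad \<psi>\<close>: contract the element slightly towards its center and mollify. By Green's
  formula \<open>(v, grad \<psi>)\<close> only involves the divergence and the normal trace of \<open>v\<close>, and the Poincare and
  trace inequalities on the element bound it by \<open>\<parallel>grad \<psi>\<parallel>\<close>. On the other hand \<open>(v, q) = (\<Pi> v, q)\<close>.
  Adding up, \<open>\<parallel>v\<parallel>\<^sup>2 = (v, u) + (v, q)\<close> is bounded by the stabilization times \<open>\<parallel>v\<parallel>\<close>.
\<close>

section \<open>Square integrable functions\<close>

text \<open>The elements form an infinite family of possibly nonconvex shapes, so no constant can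
  come from finitely many reference elements; each one has to drop out of an explicit inequality.
  Polynomial bounds are therefore obtained on balls, by one-variable interpolation along segments,
  and reach \<open>E\<close> through the inclusions of \<open>E\<close> between the balls of radius
  \<rho> h and h about c. Sums over faces must not cost the number of faces: bumps at different
  faces have disjoint supports, and the cones from c over different faces are disjoint. A further
  obstacle is that \<open>weak_div\<close> and \<open>normal_trace\<close> are picked by
  \<open>SOME\<close>; uniqueness almost everywhere has to be shown before the polynomial
  representatives from \<open>face_space\<close> may replace them. Star-shapedness is exploited for
  a whole ball: it keeps the planes of the faces away from c, leaves room for mollifying after a
  contraction, and supplies the set over which the Poincare inequality averages.\<close>

lemma L2_integrable_norm2: "f \<in> L2 M \<Longrightarrow> integrable M (\<lambda>x. (norm (f x))\<^sup>2)"
  by (simp add: L2_def)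

lemma L2_measurable [measurable_dest]: "f \<in> L2 M \<Longrightarrow> f \<in> borel_measurable M"
  by (simp add: L2_def)

lemma L2_integrable_norm_mult:
  fixes f :: "'a \<Rightarrow> 'b::euclidean_space" and g :: "'a \<Rightarrow> 'c::euclidean_space"
  assumes "f \<in> L2 M" "g \<in> L2 M"
  shows "integrable M (\<lambda>x. norm (f x) * norm (g x))"
proof (rule Bochner_Integration.integrable_bound)
  show "integrable M (\<lambda>x. (norm (f x))\<^sup>2 + (norm (g x))\<^sup>2)"
    using assms by (simp add: L2_def)
  show "(\<lambda>x. norm (f x) * norm (g x)) \<in> borel_measurable M"
    using assms by measurable
  have "a * b \<le> a\<^sup>2 + b\<^sup>2" if "0 \<le> a" "0 \<le> b" for a b :: real
    using sum_squares_bound[of a b] mult_nonneg_nonneg[OF that] by linarith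
  then show "AE x in M. norm (norm (f x) * norm (g x)) \<le> norm ((norm (f x))\<^sup>2 + (norm (g x))\<^sup>2)"
    by simp
qed

lemma L2_integrable_inner:
  assumes "f \<in> L2 M" "g \<in> L2 M"
  shows "integrable M (\<lambda>x. f x \<bullet> g x)"
proof (rule Bochner_Integration.integrable_bound[OF L2_integrable_norm_mult[OF assms]])
  show "(\<lambda>x. f x \<bullet> g x) \<in> borel_measurable M"
    using assms by measurable
  show "AE x in M. norm (f x \<bullet> g x) \<le> norm (norm (f x) * norm (g x))"
    by (simp add: Cauchy_Schwarz_ineq2)
qed

lemma L2_add [intro]:
  assumes "f \<in> L2 M" "g \<in> L2 M"
  shows "(\<lambda>x. f x + g x) \<in> L2 M"
proof -
  have "integrable M (\<lambda>x. (norm (f x))\<^sup>2 + 2 * (f x \<bullet> g x) + (norm (g x))\<^sup>2)"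
    using assms L2_integrable_inner[OF assms] by (simp add: L2_def)
  moreover have "(norm (f x + g x))\<^sup>2 = (norm (f x))\<^sup>2 + 2 * (f x \<bullet> g x) + (norm (g x))\<^sup>2" for x
    by (simp add: power2_norm_eq_inner algebra_simps inner_commute)
  ultimately have "integrable M (\<lambda>x. (norm (f x + g x))\<^sup>2)"
    by simp
  then show ?thesis
    unfolding L2_def using assms by (simp add: L2_measurable)
qed

lemma L2_scaleR [intro]: "f \<in> L2 M \<Longrightarrow> (\<lambda>x. c *\<^sub>R f x) \<in> L2 M"
  using borel_measurable_scaleR[of "\<lambda>_. c" M f] by (simp add: L2_def power_mult_distrib)

lemma L2_diff [intro]:
  assumes "f \<in> L2 M" "g \<in> L2 M"
  shows "(\<lambda>x. f x - g x) \<in> L2 M"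
  using L2_add[OF assms(1) L2_scaleR[OF assms(2), of "-1"]] by simp

lemma L2_zero [intro]: "(\<lambda>x. 0) \<in> L2 M"
  by (simp add: L2_def)

lemma L2_sum [intro]: "(\<And>i. i \<in> I \<Longrightarrow> f i \<in> L2 M) \<Longrightarrow> (\<lambda>x. \<Sum>i\<in>I. f i x) \<in> L2 M"
  by (induction I rule: infinite_finite_induct) auto

lemma L2_component:
  assumes "f \<in> L2 M" "b \<in> Basis"
  shows "(\<lambda>x. f x \<bullet> b) \<in> L2 M"
proof -
  have "integrable M (\<lambda>x. (f x \<bullet> b)\<^sup>2)"
    using assms
    by (intro Bochner_Integration.integrable_bound[OF L2_integrable_norm2[OF assms(1)]])
       (auto simp: L2_def Basis_le_norm simp flip: abs_le_square_iff)
  moreover have "(\<lambda>x. f x \<bullet> b) \<in> borel_measurable M"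
    using assms by measurable
  ultimately show ?thesis
    by (simp add: L2_def)
qed

lemma L2_vec_nth: "f \<in> L2 M \<Longrightarrow> (\<lambda>x. f x $ i) \<in> L2 M" for f :: "'a \<Rightarrow> real^'n::finite"
  using L2_component[of f M "axis i 1"] by (simp add: inner_axis)

lemma L2_bounded:
  fixes f :: "'a \<Rightarrow> 'b::euclidean_space"
  assumes "finite_measure M" "f \<in> borel_measurable M" "\<And>x. x \<in> space M \<Longrightarrow> norm (f x) \<le> B"
  shows "f \<in> L2 M"
proof -
  interpret finite_measure M by fact
  have "integrable M (\<lambda>x. (norm (f x))\<^sup>2)"
    using assms by (intro integrable_const_bound[where B = "B\<^sup>2"])
      (auto intro!: power_mono AE_I2)
  then show ?thesis
    using assms by (simp add: L2_def)
qed

lemma L2_mult_bounded: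
  fixes f :: "'a \<Rightarrow> real"
  assumes "f \<in> L2 M" "g \<in> borel_measurable M" "\<And>x. x \<in> space M \<Longrightarrow> \<bar>g x\<bar> \<le> B"
  shows "(\<lambda>x. f x * g x) \<in> L2 M"
proof -
  have "integrable M (\<lambda>x. B\<^sup>2 * (norm (f x))\<^sup>2)"
    using assms by (simp add: L2_def)
  then have "integrable M (\<lambda>x. (f x * g x)\<^sup>2)"
  proof (rule Bochner_Integration.integrable_bound)
    show "AE x in M. norm ((f x * g x)\<^sup>2) \<le> norm (B\<^sup>2 * (norm (f x))\<^sup>2)"
    proof (rule AE_I2)
      fix x assume "x \<in> space M"
      then have "\<bar>g x\<bar>\<^sup>2 \<le> B\<^sup>2"
        using assms(3) by (intro power_mono) auto
      then show "norm ((f x * g x)\<^sup>2) \<le> norm (B\<^sup>2 * (norm (f x))\<^sup>2)"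
        by (simp add: power_mult_distrib mult.commute[of "B\<^sup>2"] mult_left_mono)
    qed
    show "(\<lambda>x. (f x * g x)\<^sup>2) \<in> borel_measurable M"
      using assms by measurable
  qed
  moreover have "(\<lambda>x. f x * g x) \<in> borel_measurable M"
    using assms by measurable
  ultimately show ?thesis
    by (simp add: L2_def)
qed

lemma L2_integrable:
  fixes f :: "'a \<Rightarrow> real"
  assumes "finite_measure M" "f \<in> L2 M"
  shows "integrable M f"
proof -
  have "(\<lambda>_. 1 :: real) \<in> L2 M"
    by (rule L2_bounded[where B = 1]) (use assms in auto)
  then show ?thesis
    using L2_integrable_inner[OF assms(2)] by fastforce
qed

lemma l2_inner_commute: "l2_inner M f g = l2_inner M g f"
  by (simp add: l2_inner_def inner_commute)

lemma l2_inner_add_left: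
  "f \<in> L2 M \<Longrightarrow> g \<in> L2 M \<Longrightarrow> w \<in> L2 M \<Longrightarrow>
    l2_inner M (\<lambda>x. f x + g x) w = l2_inner M f w + l2_inner M g w"
  by (simp add: l2_inner_def inner_add_left L2_integrable_inner)

lemma l2_inner_diff_left:
  "f \<in> L2 M \<Longrightarrow> g \<in> L2 M \<Longrightarrow> w \<in> L2 M \<Longrightarrow>
    l2_inner M (\<lambda>x. f x - g x) w = l2_inner M f w - l2_inner M g w"
  by (simp add: l2_inner_def inner_diff_left L2_integrable_inner)

lemma l2_inner_add_right:
  "f \<in> L2 M \<Longrightarrow> g \<in> L2 M \<Longrightarrow> w \<in> L2 M \<Longrightarrow>
    l2_inner M w (\<lambda>x. f x + g x) = l2_inner M w f + l2_inner M w g"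
  by (simp add: l2_inner_def inner_add_right L2_integrable_inner)

lemma l2_inner_diff_right:
  "f \<in> L2 M \<Longrightarrow> g \<in> L2 M \<Longrightarrow> w \<in> L2 M \<Longrightarrow>
    l2_inner M w (\<lambda>x. f x - g x) = l2_inner M w f - l2_inner M w g"
  by (simp add: l2_inner_def inner_diff_right L2_integrable_inner)

lemma l2_inner_scaleR_left: "l2_inner M (\<lambda>x. c *\<^sub>R f x) g = c * l2_inner M f g"
  by (simp add: l2_inner_def)

lemma l2_inner_scaleR_right: "l2_inner M f (\<lambda>x. c *\<^sub>R g x) = c * l2_inner M f g"
  by (simp add: l2_inner_def)

lemma l2_inner_sum_right:
  assumes "w \<in> L2 M" "\<And>i. i \<in> I \<Longrightarrow> f i \<in> L2 M"
  shows "l2_inner M w (\<lambda>x. \<Sum>i\<in>I. f i x) = (\<Sum>i\<in>I. l2_inner M w (f i))"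
  using assms by (simp add: l2_inner_def inner_sum_right L2_integrable_inner)

lemma l2_inner_self_nonneg: "0 \<le> l2_inner M f f"
  by (simp add: l2_inner_def)

lemma l2_norm_nonneg: "0 \<le> l2_norm M f"
  by (simp add: l2_norm_def l2_inner_self_nonneg)

lemma l2_norm_power2: "(l2_norm M f)\<^sup>2 = l2_inner M f f"
  by (simp add: l2_norm_def l2_inner_self_nonneg)

lemma l2_norm_power2_eq_integral: "(l2_norm M f)\<^sup>2 = (LINT x|M. (norm (f x))\<^sup>2)"
  by (simp add: l2_norm_power2 l2_inner_def power2_norm_eq_inner)

lemma l2_norm_scaleR: "l2_norm M (\<lambda>x. c *\<^sub>R f x) = \<bar>c\<bar> * l2_norm M f"
  by (simp add: l2_norm_def l2_inner_scaleR_left l2_inner_scaleR_right real_sqrt_mult)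

lemma l2_norm_minus_commute: "l2_norm M (\<lambda>x. f x - g x) = l2_norm M (\<lambda>x. g x - f x)"
  using l2_norm_scaleR[of M "-1" "\<lambda>x. f x - g x"] by simp

text \<open>Functions are not identified modulo null sets, so \<open>l2_inner\<close> is only
  positive semidefinite. The nonnegative quadratic in t may then have leading coefficient 0, and
  that case is treated apart.\<close>

lemma l2_Cauchy_Schwarz:
  assumes "f \<in> L2 M" "g \<in> L2 M"
  shows "\<bar>l2_inner M f g\<bar> \<le> l2_norm M f * l2_norm M g"
proof -
  define a b c where "a = l2_inner M f f" and "b = l2_inner M f g" and "c = l2_inner M g g"
  have q: "0 \<le> a - 2 * t * b + t\<^sup>2 * c" for t
  proof -
    have t: "(\<lambda>x. t *\<^sub>R g x) \<in> L2 M"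
      using assms by auto
    have "0 \<le> l2_inner M (\<lambda>x. f x - t *\<^sub>R g x) (\<lambda>x. f x - t *\<^sub>R g x)"
      by (rule l2_inner_self_nonneg)
    also have "\<dots> = a - 2 * t * b + t\<^sup>2 * c"
      using assms t L2_diff[OF assms(1) t]
      by (simp add: a_def b_def c_def l2_inner_diff_left l2_inner_diff_right l2_inner_scaleR_left
          l2_inner_scaleR_right l2_inner_commute[of M g f] power2_eq_square algebra_simps)
    finally show ?thesis .
  qed
  have c: "0 \<le> c"
    by (simp add: c_def l2_inner_self_nonneg)
  have "b\<^sup>2 \<le> a * c"
  proof (cases "c = 0")
    case True
    have "b = 0"
    proof (rule ccontr)
      assume "b \<noteq> 0"
      \<comment> \<open>With c = 0 this t turns the quadratic into a - (a + 1) = -1.\<close>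
      with q[of "(a + 1) / (2 * b)"] True show False
        by (simp add: field_simps)
    qed
    then show ?thesis
      using True by simp
  next
    case False
    with q[of "b / c"] c show ?thesis
      by (simp add: field_simps power2_eq_square)
  qed
  then have "\<bar>b\<bar> \<le> sqrt (a * c)"
    by (metis real_sqrt_abs real_sqrt_le_mono)
  then show ?thesis
    by (simp add: a_def b_def c_def l2_norm_def real_sqrt_mult)
qed

lemma l2_norm_triangle:
  assumes "f \<in> L2 M" "g \<in> L2 M"
  shows "l2_norm M (\<lambda>x. f x + g x) \<le> l2_norm M f + l2_norm M g"
proof (rule power2_le_imp_le)
  have "(l2_norm M (\<lambda>x. f x + g x))\<^sup>2 = (l2_norm M f)\<^sup>2 + 2 * l2_inner M f g + (l2_norm M g)\<^sup>2"
    using assms L2_add[OF assms]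
    by (simp add: l2_norm_power2 l2_inner_add_left l2_inner_add_right l2_inner_commute[of M g f])
  then show "(l2_norm M (\<lambda>x. f x + g x))\<^sup>2 \<le> (l2_norm M f + l2_norm M g)\<^sup>2"
    using l2_Cauchy_Schwarz[OF assms] by (simp add: power2_sum)
qed (simp add: l2_norm_nonneg)

lemma l2_norm_triangle_diff:
  assumes "f \<in> L2 M" "g \<in> L2 M"
  shows "l2_norm M (\<lambda>x. f x - g x) \<le> l2_norm M f + l2_norm M g"
  using l2_norm_triangle[OF assms(1) L2_scaleR[OF assms(2), of "-1"]]
  using l2_norm_scaleR[of M "-1" g] by simp

lemma l2_norm_bounded:
  fixes f :: "'a \<Rightarrow> 'b::euclidean_space"
  assumes "finite_measure M" "f \<in> borel_measurable M" "\<And>x. x \<in> space M \<Longrightarrow> norm (f x) \<le> B"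
  shows "(l2_norm M f)\<^sup>2 \<le> B\<^sup>2 * measure M (space M)"
proof -
  interpret finite_measure M by fact
  have "(l2_norm M f)\<^sup>2 \<le> (LINT x|M. B\<^sup>2)"
    unfolding l2_norm_power2_eq_integral
    using L2_bounded[OF assms] assms(3)
    by (intro integral_mono) (auto simp: L2_def intro!: power_mono)
  then show ?thesis
    by (simp add: mult.commute)
qed

lemma l2_norm_mono:
  assumes "g \<in> L2 M" "f \<in> borel_measurable M" "\<And>x. x \<in> space M \<Longrightarrow> norm (f x) \<le> norm (g x)"
  shows "l2_norm M f \<le> l2_norm M g"
proof (rule power2_le_imp_le)
  show "(l2_norm M f)\<^sup>2 \<le> (l2_norm M g)\<^sup>2"
    unfolding l2_norm_power2_eq_integral
  proof (rule integral_mono_AE')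
    show "AE x in M. (norm (f x))\<^sup>2 \<le> (norm (g x))\<^sup>2"
      using assms(3) by (intro AE_I2 power_mono) auto
  qed (use assms in \<open>auto simp: L2_def\<close>)
qed (simp add: l2_norm_nonneg)

lemma l2_inner_AE_cong:
  assumes "f \<in> borel_measurable M" "f' \<in> borel_measurable M" "g \<in> borel_measurable M"
    "g' \<in> borel_measurable M" "AE x in M. f x = f' x" "AE x in M. g x = g' x"
  shows "l2_inner M f g = l2_inner M f' g'"
  unfolding l2_inner_def
proof (rule integral_cong_AE)
  show "AE x in M. f x \<bullet> g x = f' x \<bullet> g' x"
    using assms(5,6) by eventually_elim simp
qed (use assms in \<open>measurable\<close>)

section \<open>Orthogonal projection onto a finite span\<close>

text \<open>Gram-Schmidt along the index set, for a family that may be linearly dependent: the new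
  function is replaced by its residual e against the old ones, and if e has norm 0, the coefficient
  0 works by Cauchy-Schwarz.\<close>

lemma l2_projection_exists:
  fixes v :: "'a \<Rightarrow> 'b::euclidean_space"
  assumes "finite I" "\<And>i. i \<in> I \<Longrightarrow> b i \<in> L2 M" "v \<in> L2 M"
  shows "\<exists>c. \<forall>i\<in>I. l2_inner M (\<lambda>x. v x - (\<Sum>j\<in>I. c j *\<^sub>R b j x)) (b i) = 0"
  using assms
proof (induction I arbitrary: v rule: finite_induct)
  case empty
  then show ?case by simp
next
  case (insert k I)
  have L2b: "\<And>i. i \<in> I \<Longrightarrow> b i \<in> L2 M" and L2k: "b k \<in> L2 M"
    using insert.prems by auto
  obtain c where c: "\<And>i. i \<in> I \<Longrightarrow> l2_inner M (\<lambda>x. v x - (\<Sum>j\<in>I. c j *\<^sub>R b j x)) (b i) = 0"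
    using insert.IH[OF L2b insert.prems(2)] by blast
  obtain a where a: "\<And>i. i \<in> I \<Longrightarrow> l2_inner M (\<lambda>x. b k x - (\<Sum>j\<in>I. a j *\<^sub>R b j x)) (b i) = 0"
    using insert.IH[OF L2b L2k] by blast
  define e where "e = (\<lambda>x. b k x - (\<Sum>j\<in>I. a j *\<^sub>R b j x))"
  define w where "w = (\<lambda>x. v x - (\<Sum>j\<in>I. c j *\<^sub>R b j x))"
  have e: "e \<in> L2 M" and w: "w \<in> L2 M"
    unfolding e_def w_def using L2b L2k insert.prems(2) by (auto intro!: L2_diff L2_sum L2_scaleR)
  define t where "t = (if l2_inner M e e = 0 then 0 else l2_inner M w e / l2_inner M e e)"
  have te: "l2_inner M w e = t * l2_inner M e e"
  proof (cases "l2_inner M e e = 0")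
    case True
    then have "l2_norm M e = 0"
      by (simp add: l2_norm_def)
    then have "l2_inner M w e = 0"
      using l2_Cauchy_Schwarz[OF w e] by simp
    then show ?thesis
      using True by simp
  qed (simp add: t_def)
  have we: "(\<lambda>x. w x - t *\<^sub>R e x) \<in> L2 M"
    using w e by auto
  \<comment> \<open>The coefficients of w - t e, rewritten in the original family instead of the one
    containing e.\<close>
  define d where "d = (\<lambda>j. if j = k then t else c j - t * a j)"
  have d: "(\<lambda>x. v x - (\<Sum>j\<in>insert k I. d j *\<^sub>R b j x)) = (\<lambda>x. w x - t *\<^sub>R e x)"
  proof
    fix x
    have "(\<Sum>j\<in>I. d j *\<^sub>R b j x) = (\<Sum>j\<in>I. (c j - t * a j) *\<^sub>R b j x)"
      using insert.hyps by (intro sum.cong) (auto simp: d_def)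
    also have "\<dots> = (\<Sum>j\<in>I. c j *\<^sub>R b j x) - t *\<^sub>R (\<Sum>j\<in>I. a j *\<^sub>R b j x)"
      by (simp add: scaleR_sum_right scaleR_diff_left sum_subtractf)
    finally show "v x - (\<Sum>j\<in>insert k I. d j *\<^sub>R b j x) = w x - t *\<^sub>R e x"
      using insert.hyps by (simp add: d_def e_def w_def algebra_simps)
  qed
  have I: "l2_inner M (\<lambda>x. w x - t *\<^sub>R e x) (b i) = 0" if "i \<in> I" for i
    using c[OF that, folded w_def] a[OF that, folded e_def] L2b[OF that] w e
    by (simp add: l2_inner_diff_left L2_scaleR l2_inner_scaleR_left)
  have "l2_inner M (\<lambda>x. w x - t *\<^sub>R e x) e = 0"
    using w e te by (simp add: l2_inner_diff_left L2_scaleR l2_inner_scaleR_left)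
  moreover have "l2_inner M W e = l2_inner M W (b k) - (\<Sum>j\<in>I. a j * l2_inner M W (b j))"
    if "W \<in> L2 M" for W
  proof -
    have "(\<lambda>x. \<Sum>j\<in>I. a j *\<^sub>R b j x) \<in> L2 M"
      using L2b by (intro L2_sum L2_scaleR)
    then show ?thesis
      unfolding e_def using that L2k L2b
      by (simp add: l2_inner_diff_right l2_inner_sum_right l2_inner_scaleR_right L2_scaleR)
  qed
  ultimately have "l2_inner M (\<lambda>x. w x - t *\<^sub>R e x) (b k) = 0"
    using I we by simp
  with I show ?case
    unfolding d[symmetric] by blast
qed

section \<open>Smooth functions\<close>

lemma partial_eq: "(f has_derivative f') (at x) \<Longrightarrow> partial i f x = f' (axis i 1)"
  unfolding partial_def using frechet_derivative_at by metis

lemma times_cont_diff_continuous: "times_cont_diff n f \<Longrightarrow> continuous_on UNIV f"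
  by (cases n) (auto intro!: differentiable_imp_continuous_on simp: differentiable_on_def)

lemma times_cont_diff_Suc: "times_cont_diff (Suc n) f \<Longrightarrow> times_cont_diff n f"
proof (induction n arbitrary: f)
  case 0
  then show ?case
    by (metis times_cont_diff_continuous times_cont_diff.simps(1))
next
  case (Suc n)
  then show ?case
    by (metis times_cont_diff.simps(2))
qed

lemma smooth_partial [intro]: "smooth f \<Longrightarrow> smooth (partial i f)"
  unfolding smooth_def by (metis times_cont_diff.simps(2))

lemma smooth_differentiable [intro]: "smooth f \<Longrightarrow> f differentiable at x"
  unfolding smooth_def by (metis times_cont_diff.simps(2))

lemma smooth_continuous [intro]: "smooth f \<Longrightarrow> continuous_on S f"
  unfolding smooth_def using times_cont_diff_continuous continuous_on_subset by blast

text \<open>It suffices to exhibit a class closed under partial derivatives. For parameter integrals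
  this is the class of all integrals with the same affine argument and arbitrary weight and
  kernel.\<close>

lemma smooth_coinduct:
  assumes "f \<in> X" "\<And>f x. f \<in> X \<Longrightarrow> f differentiable at x" "\<And>f i. f \<in> X \<Longrightarrow> partial i f \<in> X"
  shows "smooth f"
proof -
  have "f \<in> X \<Longrightarrow> times_cont_diff n f" for n f
    by (induction n arbitrary: f)
       (use assms in \<open>auto simp: continuous_at_imp_continuous_on differentiable_imp_continuous_within\<close>)
  then show ?thesis
    using assms(1) by (simp add: smooth_def)
qed

lemma differentiable_has_derivative_partial:
  assumes "f differentiable at x"
  shows "(f has_derivative (\<lambda>h. \<Sum>i\<in>UNIV. partial i f x * h $ i)) (at x)"
proof -
  obtain D where D: "(f has_derivative D) (at x)"
    using assms differentiable_def by blast
  interpret D: linear D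
    using D has_derivative_linear by blast
  have "D h = (\<Sum>i\<in>UNIV. partial i f x * h $ i)" for h
  proof -
    have "h = (\<Sum>i\<in>UNIV. h $ i *\<^sub>R axis i 1)"
      by (simp add: vec_eq_iff axis_def if_distrib[of "\<lambda>y. _ * y"] cong: if_cong)
    then have "D h = D (\<Sum>i\<in>UNIV. h $ i *\<^sub>R axis i 1)"
      by simp
    then show ?thesis
      using partial_eq[OF D] by (simp add: D.sum D.scale mult.commute)
  qed
  then show ?thesis
    using D by presburger
qed

lemma differentiable_has_derivative_grad:
  assumes "f differentiable at x"
  shows "(f has_derivative (\<lambda>h. grad f x \<bullet> h)) (at x)"
  using differentiable_has_derivative_partial[OF assms] by (simp add: grad_def inner_vec_def)

lemma smooth_has_derivative_grad: "smooth f \<Longrightarrow> (f has_derivative (\<lambda>h. grad f x \<bullet> h)) (at x)"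
  using differentiable_has_derivative_grad by blast

lemma grad_eq:
  assumes "(f has_derivative (\<lambda>h. g \<bullet> h)) (at x)"
  shows "grad f x = g"
  using partial_eq[OF assms] by (simp add: grad_def vec_eq_iff inner_axis)

lemma smooth_const [intro]: "smooth (\<lambda>_. c)"
proof (rule smooth_coinduct[where X = "range (\<lambda>c _. c)"])
  fix f :: "real^3 \<Rightarrow> real" and i
  assume "f \<in> range (\<lambda>c _. c)"
  then obtain c where "f = (\<lambda>_. c)"
    by blast
  moreover from this have "partial i f = (\<lambda>_. 0)"
    by (auto intro!: partial_eq)
  ultimately show "partial i f \<in> range (\<lambda>c _. c)"
    by auto
qed auto

lemma times_cont_diff_add:
  "times_cont_diff n f \<Longrightarrow> times_cont_diff n g \<Longrightarrow> times_cont_diff n (\<lambda>x. f x + g x)"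
proof (induction n arbitrary: f g)
  case 0
  then show ?case
    by (auto intro: continuous_on_add)
next
  case (Suc n)
  have "partial i (\<lambda>x. f x + g x) = (\<lambda>x. partial i f x + partial i g x)" for i
    using Suc.prems
    by (intro ext partial_eq[THEN trans, OF has_derivative_add[OF
            differentiable_has_derivative_grad differentiable_has_derivative_grad]])
       (auto simp: inner_axis grad_def)
  then show ?case
    using Suc by auto
qed

lemma times_cont_diff_mult:
  "times_cont_diff n f \<Longrightarrow> times_cont_diff n g \<Longrightarrow> times_cont_diff n (\<lambda>x. f x * g x)"
proof (induction n arbitrary: f g)
  case 0
  then show ?case
    by (auto intro: continuous_on_mult)
next
  case (Suc n)
  have "partial i (\<lambda>x. f x * g x) = (\<lambda>x. f x * partial i g x + partial i f x * g x)" for i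
    using Suc.prems
    by (intro ext partial_eq[THEN trans, OF has_derivative_mult[OF
            differentiable_has_derivative_grad differentiable_has_derivative_grad]])
       (auto simp: inner_axis grad_def)
  moreover have "times_cont_diff n f" "times_cont_diff n g"
    using Suc.prems times_cont_diff_Suc by blast+
  ultimately show ?case
    using Suc by (auto intro!: times_cont_diff_add)
qed

lemma smooth_add [intro]: "smooth f \<Longrightarrow> smooth g \<Longrightarrow> smooth (\<lambda>x. f x + g x)"
  by (simp add: smooth_def times_cont_diff_add)

lemma smooth_mult [intro]: "smooth f \<Longrightarrow> smooth g \<Longrightarrow> smooth (\<lambda>x. f x * g x)"
  by (simp add: smooth_def times_cont_diff_mult)

lemma smooth_sum [intro]: "(\<And>i. i \<in> I \<Longrightarrow> smooth (f i)) \<Longrightarrow> smooth (\<lambda>x. \<Sum>i\<in>I. f i x)"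
  by (induction I rule: infinite_finite_induct) auto

lemma smooth_diff [intro]: "smooth f \<Longrightarrow> smooth g \<Longrightarrow> smooth (\<lambda>x. f x - g x)"
  using smooth_add[of f "\<lambda>x. (-1) * g x"] smooth_mult[OF smooth_const[of "-1"], of g] by simp

lemma smooth_power [intro]: "smooth f \<Longrightarrow> smooth (\<lambda>x. f x ^ n)"
  by (induction n) auto

lemma partial_add:
  "f differentiable at x \<Longrightarrow> g differentiable at x \<Longrightarrow>
    partial i (\<lambda>x. f x + g x) x = partial i f x + partial i g x"
  by (rule partial_eq[THEN trans, OF has_derivative_add[OF
            differentiable_has_derivative_grad differentiable_has_derivative_grad]])
     (auto simp: inner_axis grad_def)

lemma partial_diff:
  "f differentiable at x \<Longrightarrow> g differentiable at x \<Longrightarrow>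
    partial i (\<lambda>x. f x - g x) x = partial i f x - partial i g x"
  by (rule partial_eq[THEN trans, OF has_derivative_diff[OF
            differentiable_has_derivative_grad differentiable_has_derivative_grad]])
     (auto simp: inner_axis grad_def)

lemma partial_mult:
  "f differentiable at x \<Longrightarrow> g differentiable at x \<Longrightarrow>
    partial i (\<lambda>x. f x * g x) x = f x * partial i g x + partial i f x * g x"
  by (rule partial_eq[THEN trans, OF has_derivative_mult[OF
            differentiable_has_derivative_grad differentiable_has_derivative_grad]])
     (auto simp: inner_axis grad_def)

lemma partial_sum:
  assumes "\<And>j. j \<in> I \<Longrightarrow> f j differentiable at x"
  shows "partial i (\<lambda>x. \<Sum>j\<in>I. f j x) x = (\<Sum>j\<in>I. partial i (f j) x)"
proof -
  have "((\<lambda>x. \<Sum>j\<in>I. f j x) has_derivative (\<lambda>h. \<Sum>j\<in>I. grad (f j) x \<bullet> h)) (at x)"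
    using assms by (intro has_derivative_sum differentiable_has_derivative_grad)
  from partial_eq[OF this] show ?thesis
    by (simp add: inner_axis grad_def)
qed

lemma partial_const [simp]: "partial i (\<lambda>_. c) = (\<lambda>_. 0)"
  by (rule ext, rule partial_eq) simp

lemma partial_bounded_linear: "bounded_linear l \<Longrightarrow> partial i l x = l (axis i 1)"
  by (simp add: bounded_linear_imp_has_derivative partial_eq)

lemma smooth_bounded_linear [intro]:
  assumes "bounded_linear l"
  shows "smooth l"
proof -
  have "partial i l = (\<lambda>_. l (axis i 1))" for i
    using partial_bounded_linear[OF assms] by blast
  then have "times_cont_diff (Suc n) l" for n
    using bounded_linear_imp_differentiable[OF assms] smooth_const[unfolded smooth_def] by simp
  then show ?thesis
    unfolding smooth_def using times_cont_diff_Suc by blast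
qed

lemma smooth_component [intro]: "smooth (\<lambda>x. x $ i)"
  by (intro smooth_bounded_linear bounded_linear_vec_nth)

lemma partial_component: "partial i (\<lambda>x. x $ j) x = (if i = j then 1 else 0)"
  by (simp add: partial_bounded_linear bounded_linear_vec_nth axis_def)

lemma smooth_real_polynomial_function:
  "real_polynomial_function (p :: real^3 \<Rightarrow> real) \<Longrightarrow> smooth p"
  by (induction rule: real_polynomial_function.induct) auto

lemma smooth_norm_power2 [intro]: "smooth (\<lambda>x. (norm (x - a))\<^sup>2)"
proof -
  have "(\<lambda>x. (norm (x - a))\<^sup>2) = (\<lambda>x. \<Sum>i\<in>UNIV. (x $ i - a $ i)\<^sup>2)"
    unfolding power2_norm_eq_inner by (simp add: fun_eq_iff inner_vec_def power2_eq_square)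
  then show ?thesis
    by (auto intro!: smooth_sum smooth_power smooth_diff)
qed

lemma times_cont_diff_affine:
  "times_cont_diff n f \<Longrightarrow> times_cont_diff n (\<lambda>x. f (a + b *\<^sub>R x))"
proof (induction n arbitrary: f)
  case 0
  then show ?case
    by (auto intro!: continuous_on_compose2[of UNIV f] continuous_intros)
next
  case (Suc n)
  have d: "((\<lambda>x. f (a + b *\<^sub>R x)) has_derivative (\<lambda>h. grad f (a + b *\<^sub>R x) \<bullet> (b *\<^sub>R h))) (at x)" for x
    using Suc.prems
    by (intro has_derivative_compose[where f = "\<lambda>x. a + b *\<^sub>R x", OF _ differentiable_has_derivative_grad])
       (auto intro!: derivative_eq_intros)
  have "partial i (\<lambda>x. f (a + b *\<^sub>R x)) = (\<lambda>x. b * partial i f (a + b *\<^sub>R x))" for i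
    using partial_eq[OF d] by (auto simp: inner_axis grad_def)
  moreover have "times_cont_diff n (\<lambda>_. b)"
    using smooth_const by (simp add: smooth_def)
  ultimately show ?case
    using Suc d by (auto simp: differentiable_def intro!: times_cont_diff_mult)
qed

lemma smooth_affine [intro]: "smooth f \<Longrightarrow> smooth (\<lambda>x. f (a + b *\<^sub>R x))"
  by (simp add: smooth_def times_cont_diff_affine)

lemma partial_affine:
  assumes "smooth f"
  shows "partial i (\<lambda>x. f (a + b *\<^sub>R x)) x = b * partial i f (a + b *\<^sub>R x)"
proof -
  have d: "((\<lambda>x. f (a + b *\<^sub>R x)) has_derivative (\<lambda>h. grad f (a + b *\<^sub>R x) \<bullet> (b *\<^sub>R h))) (at x)"
    using assms
    by (intro has_derivative_compose[where f = "\<lambda>x. a + b *\<^sub>R x", OF _ smooth_has_derivative_grad])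
       (auto intro!: derivative_eq_intros)
  show ?thesis
    using partial_eq[OF d] by (auto simp: inner_axis grad_def)
qed

text \<open>The whole sequence \<open>D\<close> of successive derivatives, with the starting index n
  left arbitrary, closes the induction: a partial derivative of D n o f is D (n + 1) o f times a
  partial derivative of f.\<close>

lemma times_cont_diff_compose_real:
  assumes "\<And>n t. (D n has_real_derivative D (Suc n) t) (at t)"
    and "smooth f"
  shows "times_cont_diff m (\<lambda>x. D n (f x))"
proof (induction m arbitrary: n)
  case 0
  have "continuous_on UNIV (D n)"
    using assms(1) DERIV_isCont continuous_at_imp_continuous_on by blast
  then show ?case
    using assms(2) by (auto intro!: continuous_on_compose2[of UNIV "D n"])
next
  case (Suc m)
  have d: "((\<lambda>x. D n (f x)) has_derivative (\<lambda>h. D (Suc n) (f x) * (grad f x \<bullet> h))) (at x)" for x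
    using assms(1)[of n "f x"]
    by (intro has_derivative_compose[OF smooth_has_derivative_grad[OF assms(2)]])
       (simp add: has_field_derivative_def)
  have "partial i (\<lambda>x. D n (f x)) = (\<lambda>x. D (Suc n) (f x) * partial i f x)" for i
    using partial_eq[OF d] by (auto simp: inner_axis grad_def)
  moreover have "times_cont_diff m (partial i f)" for i
    using assms(2) smooth_partial smooth_def by blast
  moreover have "(\<lambda>x. D n (f x)) differentiable at x" for x
    using d differentiable_def by blast
  ultimately show ?case
    using Suc by (simp add: times_cont_diff_mult)
qed

lemma smooth_compose_real:
  assumes "\<And>n t. (D n has_real_derivative D (Suc n) t) (at t)" "smooth f"
  shows "smooth (\<lambda>x. D n (f x))"
  using times_cont_diff_compose_real[of D, OF assms] by (simp add: smooth_def)

lemma partial_compose_real: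
  assumes "(s has_real_derivative s') (at (f x))" "smooth f"
  shows "partial i (\<lambda>x. s (f x)) x = s' * partial i f x"
proof -
  have d: "((\<lambda>x. s (f x)) has_derivative (\<lambda>h. s' * (grad f x \<bullet> h))) (at x)"
    using assms(1)
    by (intro has_derivative_compose[OF smooth_has_derivative_grad[OF assms(2)]])
       (simp add: has_field_derivative_def)
  show ?thesis
    using partial_eq[OF d] by (auto simp: inner_axis grad_def)
qed

text \<open>Mean value theorem twice: in direction i for the difference of two parallel restrictions
  of f, then in direction j for the partial derivative. The left side is symmetric in i and j, which
  yields the commutation of partial derivatives below as s tends to 0.\<close>

lemma smooth_second_difference:
  assumes f: "smooth f" and "0 < s"
  shows "\<exists>z\<in>cball x (2 * s).
    f (x + s *\<^sub>R axis i 1 + s *\<^sub>R axis j 1) - f (x + s *\<^sub>R axis i 1) - f (x + s *\<^sub>R axis j 1) + f x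
      = s\<^sup>2 * partial j (partial i f) z"
proof -
  have line: "((\<lambda>t. f (a + t *\<^sub>R axis i 1)) has_real_derivative partial i f (a + t *\<^sub>R axis i 1)) (at t)"
    if "smooth f" for f a t and i :: 3
  proof -
    have "((\<lambda>t. f (a + t *\<^sub>R axis i 1)) has_derivative
        (\<lambda>h. grad f (a + t *\<^sub>R axis i 1) \<bullet> (h *\<^sub>R axis i 1))) (at t)"
      using that
      by (intro has_derivative_compose[where f = "\<lambda>t. a + t *\<^sub>R axis i 1", OF _ smooth_has_derivative_grad])
         (auto intro!: derivative_eq_intros)
    then show ?thesis
      by (simp add: has_field_derivative_def inner_axis grad_def mult_commute_abs)
  qed
  define g where "g t = f (x + s *\<^sub>R axis j 1 + t *\<^sub>R axis i 1) - f (x + t *\<^sub>R axis i 1)" for t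
  have dg: "(g has_real_derivative
      (partial i f (x + s *\<^sub>R axis j 1 + t *\<^sub>R axis i 1) - partial i f (x + t *\<^sub>R axis i 1))) (at t)" for t
    unfolding g_def by (intro DERIV_diff line f)
  obtain t where t: "0 < t" "t < s"
    "g s - g 0 = (s - 0) * (partial i f (x + s *\<^sub>R axis j 1 + t *\<^sub>R axis i 1) - partial i f (x + t *\<^sub>R axis i 1))"
    using MVT2[OF \<open>0 < s\<close> dg] by blast
  obtain u where u: "0 < u" "u < s"
    "partial i f (x + t *\<^sub>R axis i 1 + s *\<^sub>R axis j 1) - partial i f (x + t *\<^sub>R axis i 1 + 0 *\<^sub>R axis j 1)
      = (s - 0) * partial j (partial i f) (x + t *\<^sub>R axis i 1 + u *\<^sub>R axis j 1)"
    using MVT2[OF \<open>0 < s\<close> line[OF smooth_partial[OF f]]] by blast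
  have "norm (t *\<^sub>R axis i 1 + u *\<^sub>R axis j (1::real)) \<le> 2 * s"
    using norm_triangle_ineq[of "t *\<^sub>R axis i 1" "u *\<^sub>R axis j (1::real)"] t u by simp
  then have "x + t *\<^sub>R axis i 1 + u *\<^sub>R axis j 1 \<in> cball x (2 * s)"
    by (simp add: dist_norm norm_minus_commute add.commute add.left_commute)
  moreover have "f (x + s *\<^sub>R axis i 1 + s *\<^sub>R axis j 1) - f (x + s *\<^sub>R axis i 1) - f (x + s *\<^sub>R axis j 1) + f x
      = s\<^sup>2 * partial j (partial i f) (x + t *\<^sub>R axis i 1 + u *\<^sub>R axis j 1)"
    using t(3) u(3) by (simp add: g_def add_ac power2_eq_square)
  ultimately show ?thesis
    by blast
qed

lemma partial_commute:
  assumes "smooth f"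
  shows "partial i (partial j f) x = partial j (partial i f) x"
proof -
  define s where "s n = 1 / real (Suc n)" for n
  have s: "0 < s n" for n
    by (simp add: s_def)
  have s0: "(\<lambda>n. 2 * s n) \<longlonglongrightarrow> 0"
    unfolding s_def using tendsto_mult[OF tendsto_const lim_inverse_n'[THEN LIMSEQ_Suc]] by fastforce
  obtain z where z: "\<And>n. z n \<in> cball x (2 * s n)"
    "\<And>n. f (x + s n *\<^sub>R axis i 1 + s n *\<^sub>R axis j 1) - f (x + s n *\<^sub>R axis i 1) - f (x + s n *\<^sub>R axis j 1) + f x
      = (s n)\<^sup>2 * partial j (partial i f) (z n)"
    using smooth_second_difference[OF assms s, where x = x and i = i and j = j] by metis
  obtain w where w: "\<And>n. w n \<in> cball x (2 * s n)"
    "\<And>n. f (x + s n *\<^sub>R axis j 1 + s n *\<^sub>R axis i 1) - f (x + s n *\<^sub>R axis j 1) - f (x + s n *\<^sub>R axis i 1) + f x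
      = (s n)\<^sup>2 * partial i (partial j f) (w n)"
    using smooth_second_difference[OF assms s, where x = x and i = j and j = i] by metis
  have eq: "partial i (partial j f) (w n) = partial j (partial i f) (z n)" for n
  proof -
    have "(s n)\<^sup>2 * partial i (partial j f) (w n) = (s n)\<^sup>2 * partial j (partial i f) (z n)"
      unfolding z(2)[symmetric] w(2)[symmetric] by (simp add: add_ac)
    then show ?thesis
      using s[of n] by simp
  qed
  have lim: "y \<longlonglongrightarrow> x" if "\<And>n. y n \<in> cball x (2 * s n)" for y
    using that s
    by (intro metric_tendsto_imp_tendsto[OF s0]) (auto simp: dist_commute less_imp_le)
  have cont: "(\<lambda>n. g (y n)) \<longlonglongrightarrow> g x" if "smooth g" "y \<longlonglongrightarrow> x" for g y
    using smooth_continuous[OF that(1), of UNIV] that(2)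
    by (simp add: continuous_on_tendsto_compose)
  have "(\<lambda>n. partial i (partial j f) (w n)) \<longlonglongrightarrow> partial i (partial j f) x"
    using assms w(1) by (intro cont lim smooth_partial)
  moreover have "(\<lambda>n. partial j (partial i f) (z n)) \<longlonglongrightarrow> partial j (partial i f) x"
    using assms z(1) by (intro cont lim smooth_partial)
  ultimately show ?thesis
    unfolding eq by (rule LIMSEQ_unique)
qed

section \<open>Bump functions\<close>

text \<open>The derivative of p(1/t) exp(-1/t) is (1/t)^2 (p - p')(1/t) exp(-1/t); the recursion is
  this formula in the variable 1/t.\<close>

primrec exp_inverse_poly :: "nat \<Rightarrow> real poly" where
  "exp_inverse_poly 0 = 1"
| "exp_inverse_poly (Suc n) = monom 1 2 * (exp_inverse_poly n - pderiv (exp_inverse_poly n))"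

text \<open>The \<open>n\<close>-th derivative of the function equal to \<open>exp (- 1 / t)\<close> for \<open>t > 0\<close> and \<open>0\<close> otherwise.\<close>

definition exp_inverse_deriv :: "nat \<Rightarrow> real \<Rightarrow> real" where
  "exp_inverse_deriv n t = (if 0 < t then poly (exp_inverse_poly n) (1 / t) * exp (- (1 / t)) else 0)"

lemma poly_times_exp_minus_tendsto: "((\<lambda>y. poly p y * exp (- y)) \<longlongrightarrow> 0) at_top" for p :: "real poly"
proof -
  have *: "((\<lambda>y. (\<Sum>i\<le>degree p. coeff p i * (y ^ i / exp y))) \<longlongrightarrow> (\<Sum>i\<le>degree p. coeff p i * 0)) at_top"
    by (intro tendsto_sum tendsto_mult tendsto_const tendsto_power_div_exp_0)
  have "(\<lambda>y. \<Sum>i\<le>degree p. coeff p i * (y ^ i / exp y)) = (\<lambda>y. poly p y * exp (- y))"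
    by (simp add: poly_altdef fun_eq_iff sum_distrib_right exp_minus divide_inverse mult.assoc)
  then show ?thesis
    using * by simp
qed

lemma exp_inverse_deriv_has_derivative:
  "(exp_inverse_deriv n has_real_derivative exp_inverse_deriv (Suc n) t) (at t)"
proof -
  consider "t > 0" | "t < 0" | "t = 0"
    by linarith
  then show ?thesis
  proof cases
    case 1
    have "((\<lambda>t. poly (exp_inverse_poly n) (1 / t) * exp (- (1 / t))) has_real_derivative
        exp_inverse_deriv (Suc n) t) (at t)"
      using 1 by (auto intro!: derivative_eq_intros poly_DERIV[THEN DERIV_chain2]
          simp: exp_inverse_deriv_def poly_monom field_simps power2_eq_square)
    then show ?thesis
    proof (rule has_field_derivative_transform_within_open)
      show "open {0 :: real<..}" "t \<in> {0<..}"
        using 1 by auto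
    qed (simp add: exp_inverse_deriv_def)
  next
    case 2
    have "((\<lambda>t. 0) has_real_derivative exp_inverse_deriv (Suc n) t) (at t)"
      using 2 by (simp add: exp_inverse_deriv_def)
    then show ?thesis
    proof (rule has_field_derivative_transform_within_open)
      show "open {..<0 :: real}" "t \<in> {..<0}"
        using 2 by auto
    qed (simp add: exp_inverse_deriv_def)
  next
    case 3
    \<comment> \<open>The difference quotient at 0 from the right is (1/h) p(1/h) exp(-1/h);
      \<open>pCons 0\<close> supplies the factor 1/h.\<close>
    have "((\<lambda>h. poly (pCons 0 (exp_inverse_poly n)) (inverse h) * exp (- inverse h)) \<longlongrightarrow> 0) (at_right 0)"
      using poly_times_exp_minus_tendsto filterlim_inverse_at_top_right
      by (rule filterlim_compose)
    then have "((\<lambda>h. exp_inverse_deriv n h / h) \<longlongrightarrow> 0) (at_right 0)"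
      by (rule Lim_transform_eventually)
         (auto simp: eventually_at_right_field exp_inverse_deriv_def field_simps intro!: exI[of _ 1])
    moreover have "((\<lambda>h. exp_inverse_deriv n h / h) \<longlongrightarrow> 0) (at_left 0)"
      by (rule Lim_transform_eventually[OF tendsto_const])
         (auto simp: eventually_at_left_field exp_inverse_deriv_def intro!: exI[of _ "-1"])
    ultimately have "((\<lambda>h. exp_inverse_deriv n h / h) \<longlongrightarrow> 0) (at 0)"
      by (simp add: filterlim_split_at)
    then show ?thesis
      using 3 by (simp add: DERIV_def exp_inverse_deriv_def)
  qed
qed

definition bump :: "real^3 \<Rightarrow> real \<Rightarrow> real^3 \<Rightarrow> real" where
  "bump a R x = exp_inverse_deriv 0 (1 - (norm (x - a))\<^sup>2 / R\<^sup>2)"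

lemma smooth_bump [intro]: "smooth (bump a R)"
proof -
  have "smooth (\<lambda>x. 1 - (1 / R\<^sup>2) * (norm (x - a))\<^sup>2)"
    by (intro smooth_diff smooth_mult smooth_const smooth_norm_power2)
  from smooth_compose_real[of exp_inverse_deriv, OF exp_inverse_deriv_has_derivative this, of 0]
  show ?thesis
    by (simp add: bump_def[abs_def])
qed

lemma bump_nonneg: "0 \<le> bump a R x"
  by (simp add: bump_def exp_inverse_deriv_def)

lemma bump_le_1: "bump a R x \<le> 1"
  by (simp add: bump_def exp_inverse_deriv_def)

lemma bump_eq_0: "R > 0 \<Longrightarrow> x \<notin> ball a R \<Longrightarrow> bump a R x = 0"
proof -
  assume R: "R > 0" and x: "x \<notin> ball a R"
  then have "R\<^sup>2 \<le> (norm (x - a))\<^sup>2"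
    by (intro power_mono) (auto simp: dist_norm norm_minus_commute)
  then have "1 \<le> (norm (x - a))\<^sup>2 / R\<^sup>2"
    using R by (subst le_divide_eq) auto
  then show ?thesis
    by (simp add: bump_def exp_inverse_deriv_def)
qed

lemma bump_pos: "R > 0 \<Longrightarrow> x \<in> ball a R \<Longrightarrow> 0 < bump a R x"
proof -
  assume R: "R > 0" and x: "x \<in> ball a R"
  then have "(norm (x - a))\<^sup>2 < R\<^sup>2"
    by (intro power_strict_mono) (auto simp: dist_norm norm_minus_commute)
  then show ?thesis
    using R by (simp add: bump_def exp_inverse_deriv_def field_simps)
qed

text \<open>This uniform lower bound on the half ball, independent of \<open>R\<close>, is what
  converts pairings of p with p times a bump into norms of p over that ball. The radial argument
  stays above 1/2 there, which gives exp(-2).\<close>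

lemma bump_ge:
  assumes "R > 0" "x \<in> cball a (R / 2)"
  shows "exp (-2) \<le> bump a R x"
proof -
  define t where "t = 1 - (norm (x - a))\<^sup>2 / R\<^sup>2"
  have "(norm (x - a))\<^sup>2 \<le> (R / 2)\<^sup>2"
    using assms by (intro power_mono) (auto simp: dist_norm norm_minus_commute)
  then have "(norm (x - a))\<^sup>2 / R\<^sup>2 \<le> 1 / 4"
    using assms(1) by (simp add: field_simps power2_eq_square)
  then have "1 / 2 \<le> t"
    unfolding t_def by linarith
  then have "1 / t \<le> 2" "0 < t"
    by (auto simp: field_simps)
  then show ?thesis
    by (simp add: bump_def exp_inverse_deriv_def flip: t_def)
qed

text \<open>The factor 2 comes from the inner function 1 - |x - a|^2 / R^2, whose partial
  derivatives are at most 2 / R on the ball.\<close>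

definition bump_grad_bound :: real where
  "bump_grad_bound = 2 * (SUP t\<in>{0..1}. \<bar>exp_inverse_deriv 1 t\<bar>)"

lemma exp_inverse_deriv_1_bound: "t \<in> {0..1} \<Longrightarrow> \<bar>exp_inverse_deriv 1 t\<bar> \<le> bump_grad_bound / 2"
proof -
  assume t: "t \<in> {0..1}"
  have "continuous_on {0..1} (exp_inverse_deriv 1)"
    using exp_inverse_deriv_has_derivative DERIV_isCont continuous_at_imp_continuous_on by blast
  then have "compact ((\<lambda>t. \<bar>exp_inverse_deriv 1 t\<bar>) ` {0..1})"
    by (intro compact_continuous_image continuous_on_rabs) auto
  then have "bdd_above ((\<lambda>t. \<bar>exp_inverse_deriv 1 t\<bar>) ` {0..1})"
    by (intro bounded_imp_bdd_above compact_imp_bounded)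
  then show ?thesis
    using t by (auto simp: bump_grad_bound_def intro: cSUP_upper2)
qed

lemma bump_grad_bound_nonneg: "0 \<le> bump_grad_bound"
  using order_trans[OF abs_ge_zero exp_inverse_deriv_1_bound[of 0]] by simp

lemma partial_norm_power2: "partial i (\<lambda>x. (norm (x - a))\<^sup>2) x = 2 * (x $ i - a $ i)"
proof -
  have "((\<lambda>x. (norm (x - a))\<^sup>2) has_derivative (\<lambda>h. 2 * ((x - a) \<bullet> h))) (at x)"
    unfolding power2_norm_eq_inner
    by (auto intro!: derivative_eq_intros simp: inner_commute)
  from partial_eq[OF this] show ?thesis
    by (simp add: inner_axis)
qed

lemma partial_bump_bound:
  assumes "R > 0"
  shows "\<bar>partial i (bump a R) x\<bar> \<le> bump_grad_bound / R"
proof -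
  define t where "t = 1 - (norm (x - a))\<^sup>2 / R\<^sup>2"
  have sm: "smooth (\<lambda>x. 1 - (1 / R\<^sup>2) * (norm (x - a))\<^sup>2)"
    by (intro smooth_diff smooth_mult smooth_const smooth_norm_power2)
  have "(exp_inverse_deriv 0 has_real_derivative exp_inverse_deriv 1 t)
      (at (1 - (1 / R\<^sup>2) * (norm (x - a))\<^sup>2))"
    using exp_inverse_deriv_has_derivative[of 0] by (simp add: t_def)
  from partial_compose_real[where f = "\<lambda>x. 1 - (1 / R\<^sup>2) * (norm (x - a))\<^sup>2", OF this sm]
  have "partial i (bump a R) x
      = exp_inverse_deriv 1 t * partial i (\<lambda>x. 1 - (1 / R\<^sup>2) * (norm (x - a))\<^sup>2) x"
    by (simp add: bump_def[abs_def])
  also have "partial i (\<lambda>x. 1 - (1 / R\<^sup>2) * (norm (x - a))\<^sup>2) x = - (1 / R\<^sup>2) * (2 * (x $ i - a $ i))"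
  proof -
    have "partial i (\<lambda>x. 1 - c * (norm (x - a))\<^sup>2) x = - c * (2 * (x $ i - a $ i))" for c
    proof -
      have 1: "partial i (\<lambda>x. 1 - c * (norm (x - a))\<^sup>2) x
          = partial i (\<lambda>_. 1) x - partial i (\<lambda>x. c * (norm (x - a))\<^sup>2) x"
        by (intro partial_diff smooth_differentiable smooth_const smooth_mult smooth_norm_power2)
      have 2: "partial i (\<lambda>x. c * (norm (x - a))\<^sup>2) x
          = c * partial i (\<lambda>x. (norm (x - a))\<^sup>2) x + partial i (\<lambda>_. c) x * (norm (x - a))\<^sup>2"
        by (intro partial_mult smooth_differentiable smooth_const smooth_norm_power2)
      show ?thesis
        unfolding 1 2 by (simp add: partial_norm_power2)
    qed
    then show ?thesis .
  qed
  finally have eq: "partial i (bump a R) x = exp_inverse_deriv 1 t * (- (1 / R\<^sup>2) * (2 * (x $ i - a $ i)))" .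
  show ?thesis
  proof (cases "t > 0")
    case True
    have "(norm (x - a))\<^sup>2 < R\<^sup>2"
      using True assms by (simp add: t_def field_simps)
    then have "norm (x - a) < R"
      using assms by (simp add: power_less_imp_less_base)
    then have xR: "\<bar>x $ i - a $ i\<bar> \<le> R"
      using component_le_norm_cart[of "x - a" i] by simp
    have t: "\<bar>exp_inverse_deriv 1 t\<bar> \<le> bump_grad_bound / 2"
      using True by (intro exp_inverse_deriv_1_bound) (simp add: t_def)
    have "\<bar>partial i (bump a R) x\<bar> = \<bar>exp_inverse_deriv 1 t\<bar> * (2 * \<bar>x $ i - a $ i\<bar> / R\<^sup>2)"
      unfolding eq abs_mult using assms by simp
    also have "\<dots> \<le> (bump_grad_bound / 2) * (2 * R / R\<^sup>2)"
      using assms xR t by (intro mult_mono divide_right_mono) auto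
    finally show ?thesis
      using assms by (simp add: power2_eq_square)
  next
    case False
    then show ?thesis
      using assms bump_grad_bound_nonneg by (simp add: eq exp_inverse_deriv_def)
  qed
qed

section \<open>Compactly supported smooth functions and parameter integrals\<close>

lemma compactly_supported_inI:
  assumes "compact K" "K \<subseteq> E" "\<And>x. x \<notin> K \<Longrightarrow> f x = 0"
  shows "compactly_supported_in E f"
proof -
  have "closure {x. f x \<noteq> 0} \<subseteq> K"
    using assms by (intro closure_minimal compact_imp_closed) auto
  moreover have "bounded {x. f x \<noteq> 0}"
    using assms by (intro bounded_subset[OF compact_imp_bounded[of K]]) auto
  ultimately show ?thesis
    using assms(2) by (auto simp: compactly_supported_in_def)
qed

lemma compactly_supported_in_eq_0: "compactly_supported_in E f \<Longrightarrow> x \<notin> E \<Longrightarrow> f x = 0"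
  using closure_subset[of "{x. f x \<noteq> 0}"] by (auto simp: compactly_supported_in_def)

lemma compactly_supported_in_mult_left:
  fixes f :: "real^3 \<Rightarrow> real"
  assumes "compactly_supported_in E f"
  shows "compactly_supported_in E (\<lambda>x. g x * f x)"
proof -
  have K: "compact (closure {x. f x \<noteq> 0})" "closure {x. f x \<noteq> 0} \<subseteq> E"
    using assms by (simp_all only: compactly_supported_in_def)
  show ?thesis
  proof (rule compactly_supported_inI[OF K])
    fix x assume "x \<notin> closure {x. f x \<noteq> 0}"
    then show "g x * f x = 0"
      using closure_subset[of "{x. f x \<noteq> 0}"] by auto
  qed
qed

lemma compactly_supported_in_partial:
  assumes "compactly_supported_in E f"
  shows "compactly_supported_in E (partial i f)"
proof (rule compactly_supported_inI[where K = "closure {x. f x \<noteq> 0}"])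
  fix x assume x: "x \<notin> closure {x. f x \<noteq> 0}"
  have "(f has_derivative (\<lambda>_. 0)) (at x)"
  proof (rule has_derivative_transform_within_open[where f = "\<lambda>_. 0"])
    show "open (- closure {x. f x \<noteq> 0})" "x \<in> - closure {x. f x \<noteq> 0}"
      using x by auto
    show "\<And>y. y \<in> - closure {x. f x \<noteq> 0} \<Longrightarrow> 0 = f y"
      using closure_subset[of "{x. f x \<noteq> 0}"] by auto
  qed simp
  then show "partial i f x = 0"
    by (rule partial_eq)
qed (use assms in \<open>simp_all add: compactly_supported_in_def\<close>)

lemma compactly_supported_bump:
  assumes "0 < R" "cball a R \<subseteq> E"
  shows "compactly_supported_in E (bump a R)"
  using assms bump_eq_0 by (intro compactly_supported_inI[of "cball a R"]) auto

text \<open>The compact ball is taken one unit larger than a ball containing the support: two points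
  closer than 1 are then either both in it or both outside the support.\<close>

lemma compactly_supported_uniformly_continuous:
  fixes f :: "real^3 \<Rightarrow> real"
  assumes "continuous_on UNIV f" "compactly_supported_in UNIV f"
  shows "uniformly_continuous_on UNIV f"
proof -
  have "bounded (closure {x. f x \<noteq> 0})"
    using assms(2) unfolding compactly_supported_in_def by (blast intro: compact_imp_bounded)
  then obtain R where R: "closure {x. f x \<noteq> 0} \<subseteq> ball 0 R"
    using bounded_subset_ballD by metis
  have f0: "f x = 0" if "x \<notin> cball 0 R" for x
  proof (rule ccontr)
    assume "f x \<noteq> 0"
    then have "x \<in> closure {x. f x \<noteq> 0}"
      by (intro closure_subset[THEN subsetD]) simp
    with R that show False
      by auto
  qed
  have uc: "uniformly_continuous_on (cball 0 (R + 1)) f"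
    by (rule compact_uniformly_continuous[OF continuous_on_subset[OF assms(1)]]) auto
  show ?thesis
    unfolding uniformly_continuous_on_def
  proof (intro allI impI)
    fix e :: real assume "e > 0"
    then obtain d where d: "d > 0" "\<And>x x'. x \<in> cball 0 (R + 1) \<Longrightarrow> x' \<in> cball 0 (R + 1) \<Longrightarrow>
        dist x' x < d \<Longrightarrow> dist (f x') (f x) < e"
      using uc unfolding uniformly_continuous_on_def by meson
    have "dist (f x') (f x) < e" if "dist x' x < min d 1" for x x'
    proof (cases "x \<in> cball 0 R \<or> x' \<in> cball 0 R")
      case True
      then have "x \<in> cball 0 (R + 1)" "x' \<in> cball 0 (R + 1)"
        using that norm_triangle_ineq3[of x x'] norm_minus_commute[of x x']
        by (auto simp: dist_norm abs_le_iff)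
      then show ?thesis
        using d that by simp
    next
      case False
      then show ?thesis
        using f0[of x] f0[of x'] \<open>e > 0\<close> by simp
    qed
    then show "\<exists>d>0. \<forall>x\<in>UNIV. \<forall>x'\<in>UNIV. dist x' x < d \<longrightarrow> dist (f x') (f x) < e"
      using d(1) by (intro exI[of _ "min d 1"]) auto
  qed
qed

lemma compactly_supported_bounded:
  fixes f :: "real^3 \<Rightarrow> real"
  assumes "continuous_on UNIV f" "compactly_supported_in UNIV f"
  shows "\<exists>B\<ge>0. \<forall>x. \<bar>f x\<bar> \<le> B"
proof -
  have "compact (f ` closure {x. f x \<noteq> 0})"
    using assms by (intro compact_continuous_image)
      (auto simp: compactly_supported_in_def intro: continuous_on_subset)
  then obtain B where B: "\<And>y. y \<in> f ` closure {x. f x \<noteq> 0} \<Longrightarrow> \<bar>y\<bar> \<le> B"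
    using compact_imp_bounded bounded_iff by (metis real_norm_def)
  have "\<bar>f x\<bar> \<le> max B 0" for x
  proof (cases "f x = 0")
    case False
    then have "f x \<in> f ` closure {x. f x \<noteq> 0}"
      using closure_subset[of "{x. f x \<noteq> 0}"] by blast
    then show ?thesis
      using B by fastforce
  qed simp
  then show ?thesis
    by (intro exI[of _ "max B 0"]) simp
qed

text \<open>The radius d does not depend on the base point; only so can the linearization error be
  integrated against an arbitrary integrable weight. It comes from uniform continuity of the
  gradient and the mean value inequality on a segment.\<close>

lemma smooth_uniform_linearization:
  assumes f: "smooth f" and supp: "compactly_supported_in UNIV f" and "0 < e"
  shows "\<exists>d>0. \<forall>y h. norm h < d \<longrightarrow> \<bar>f (y + h) - f y - grad f y \<bullet> h\<bar> \<le> e * norm h"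
proof -
  have "\<exists>d>0. \<forall>x x'. dist x' x < d \<longrightarrow> \<bar>partial i f x' - partial i f x\<bar> < e / 3" for i
    using compactly_supported_uniformly_continuous[OF smooth_continuous[OF smooth_partial[OF f]]
        compactly_supported_in_partial[OF supp], of i] \<open>0 < e\<close>
    unfolding uniformly_continuous_on_def dist_real_def
    by (metis UNIV_I divide_pos_pos zero_less_numeral)
  then obtain d where d: "\<And>i. d i > 0"
      "\<And>i x x'. dist x' x < d i \<Longrightarrow> \<bar>partial i f x' - partial i f x\<bar> < e / 3"
    by metis
  define \<delta> where "\<delta> = Min (range d)"
  have "\<delta> > 0"
    using d(1) by (auto simp: \<delta>_def)
  have g: "norm (grad f x' - grad f x) \<le> e" if "dist x' x < \<delta>" for x x'
  proof -
    have "norm (grad f x' - grad f x) \<le> (\<Sum>i\<in>UNIV. \<bar>(grad f x' - grad f x) $ i\<bar>)"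
      by (rule norm_le_l1_cart)
    also have "\<dots> \<le> (\<Sum>i\<in>(UNIV :: 3 set). e / 3)"
    proof (rule sum_mono)
      fix i :: 3
      have "\<delta> \<le> d i"
        by (simp add: \<delta>_def)
      then show "\<bar>(grad f x' - grad f x) $ i\<bar> \<le> e / 3"
        using d(2)[of x' x i] that by (simp add: grad_def)
    qed
    finally show ?thesis
      by simp
  qed
  have "\<bar>f (y + h) - f y - grad f y \<bullet> h\<bar> \<le> e * norm h" if h: "norm h < \<delta>" for y h
  proof -
    define g where "g z = f z - grad f y \<bullet> z" for z
    have "norm (g (y + h) - g y) \<le> e * norm (y + h - y)"
    proof (rule differentiable_bound)
      show "convex (closed_segment y (y + h))"
        by simp
      show "(g has_derivative (\<lambda>h. (grad f x - grad f y) \<bullet> h)) (at x within closed_segment y (y + h))" for x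
        unfolding g_def inner_diff_left
        by (intro has_derivative_diff has_derivative_at_withinI[OF smooth_has_derivative_grad[OF f]]
            has_derivative_inner_right has_derivative_ident)
      show "onorm (\<lambda>h. (grad f x - grad f y) \<bullet> h) \<le> e" if "x \<in> closed_segment y (y + h)" for x
      proof (rule onorm_le)
        have "dist x y \<le> norm h"
          using that segment_bound(1)[of x y "y + h"] by (simp add: dist_norm)
        then have "norm (grad f x - grad f y) \<le> e"
          using g h by simp
        then show "norm ((grad f x - grad f y) \<bullet> v) \<le> e * norm v" for v
          using Cauchy_Schwarz_ineq2[of "grad f x - grad f y" v]
          by (smt (verit) mult_right_mono norm_ge_zero real_norm_def)
      qed
    qed auto
    then show ?thesis
      by (simp add: g_def inner_add_right algebra_simps)
  qed
  then show ?thesis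
    using \<open>\<delta> > 0\<close> by blast
qed

text \<open>Setting for differentiating the integral of w(\<omega>) \<zeta>(A \<omega> + B \<omega>
  x) with respect to x. One affine form serves translations (B = 1), mollification after a
  contraction (B = -l) and line integrals of a mollified field (B = -l t). As |B| is at most 1, an
  increment of x is never enlarged inside \<zeta>.\<close>

locale kernel_integral =
  fixes M :: "'a measure" and A :: "'a \<Rightarrow> real^3" and B :: "'a \<Rightarrow> real"
  assumes A_measurable [measurable]: "A \<in> borel_measurable M"
    and B_measurable [measurable]: "B \<in> borel_measurable M"
    and B_bound: "\<And>\<omega>. \<omega> \<in> space M \<Longrightarrow> \<bar>B \<omega>\<bar> \<le> 1"
begin

lemma integrable_kernel:
  assumes w: "integrable M w" and \<zeta>: "continuous_on UNIV \<zeta>" "compactly_supported_in UNIV \<zeta>"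
  shows "integrable M (\<lambda>\<omega>. w \<omega> * (\<zeta> (A \<omega> + B \<omega> *\<^sub>R x) :: real))"
proof -
  obtain K where K: "\<And>x. \<bar>\<zeta> x\<bar> \<le> K"
    using compactly_supported_bounded[OF \<zeta>] by blast
  have [measurable]: "\<zeta> \<in> borel_measurable borel" "w \<in> borel_measurable M"
    using \<zeta>(1) w by (auto intro: borel_measurable_continuous_onI)
  show ?thesis
  proof (rule Bochner_Integration.integrable_bound)
    show "integrable M (\<lambda>\<omega>. K * w \<omega>)"
      using w by simp
    show "AE \<omega> in M. norm (w \<omega> * \<zeta> (A \<omega> + B \<omega> *\<^sub>R x)) \<le> norm (K * w \<omega>)"
    proof (rule AE_I2)
      fix \<omega>
      have "\<bar>\<zeta> (A \<omega> + B \<omega> *\<^sub>R x)\<bar> \<le> \<bar>K\<bar>"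
        using K[of "A \<omega> + B \<omega> *\<^sub>R x"] by linarith
      then show "norm (w \<omega> * \<zeta> (A \<omega> + B \<omega> *\<^sub>R x)) \<le> norm (K * w \<omega>)"
        by (simp add: abs_mult mult.commute[of "\<bar>K\<bar>"] mult_left_mono)
    qed
  qed measurable
qed

lemma integrable_weight_B: "integrable M w \<Longrightarrow> integrable M (\<lambda>\<omega>. w \<omega> * B \<omega>)" for w :: "'a \<Rightarrow> real"
proof (rule Bochner_Integration.integrable_bound[where f = w])
  assume "integrable M w"
  then have [measurable]: "w \<in> borel_measurable M"
    by auto
  show "(\<lambda>\<omega>. w \<omega> * B \<omega>) \<in> borel_measurable M"
    by measurable
  show "AE \<omega> in M. norm (w \<omega> * B \<omega>) \<le> norm (w \<omega>)"
    using B_bound by (intro AE_I2) (simp add: abs_mult mult_left_le)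
qed

lemma has_derivative_kernel:
  assumes w: "integrable M w" and \<zeta>: "smooth \<zeta>" "compactly_supported_in UNIV \<zeta>"
  shows "((\<lambda>x. LINT \<omega>|M. w \<omega> * \<zeta> (A \<omega> + B \<omega> *\<^sub>R x)) has_derivative
    (\<lambda>h. (\<chi> i. LINT \<omega>|M. w \<omega> * B \<omega> * partial i \<zeta> (A \<omega> + B \<omega> *\<^sub>R x)) \<bullet> h)) (at x)"
    (is "(?F has_derivative (\<lambda>h. ?G \<bullet> h)) (at x)")
  unfolding has_derivative_at_alt
proof (intro conjI allI impI)
  show "bounded_linear (\<lambda>h. ?G \<bullet> h)"
    by (rule bounded_linear_inner_right)
next
  fix e :: real assume "e > 0"
  define W where "W = (LINT \<omega>|M. \<bar>w \<omega>\<bar>)"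
  have W: "0 \<le> W"
    by (simp add: W_def)
  \<comment> \<open>\<open>W\<close> is the mass of the weight; the added 1 covers W = 0. The same
    device recurs in the later approximation arguments.\<close>
  define e' where "e' = e / (W + 1)"
  have e': "0 < e'" "W * e' \<le> e"
    using \<open>e > 0\<close> W by (auto simp: e'_def field_simps)
  obtain d where d: "d > 0"
      "\<And>y h. norm h < d \<Longrightarrow> \<bar>\<zeta> (y + h) - \<zeta> y - grad \<zeta> y \<bullet> h\<bar> \<le> e' * norm h"
    using smooth_uniform_linearization[OF \<zeta> e'(1)] by blast
  have "norm (?F y - ?F x - ?G \<bullet> (y - x)) \<le> e * norm (y - x)" if y: "norm (y - x) < d" for y
  proof -
    define k where "k = y - x"
    define P where "P i \<omega> = w \<omega> * B \<omega> * partial i \<zeta> (A \<omega> + B \<omega> *\<^sub>R x)" for i \<omega>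
    define Q where "Q y \<omega> = w \<omega> * \<zeta> (A \<omega> + B \<omega> *\<^sub>R y)" for y \<omega>
    have P: "integrable M (P i)" for i
      unfolding P_def
      using integrable_kernel[OF integrable_weight_B[OF w] smooth_continuous[OF smooth_partial[OF \<zeta>(1)]]
          compactly_supported_in_partial[OF \<zeta>(2)]] .
    have Q: "integrable M (Q y)" for y
      unfolding Q_def using integrable_kernel[OF w smooth_continuous[OF \<zeta>(1)] \<zeta>(2)] .
    define R where "R \<omega> = Q y \<omega> - Q x \<omega> - (\<Sum>i\<in>UNIV. P i \<omega> * k $ i)" for \<omega>
    have R: "integrable M R"
      unfolding R_def
      by (intro Bochner_Integration.integrable_diff Bochner_Integration.integrable_sum
          integrable_mult_left P Q)
    have "?F y - ?F x - ?G \<bullet> (y - x) = integral\<^sup>L M (Q y) - integral\<^sup>L M (Q x) - (\<Sum>i\<in>UNIV. integral\<^sup>L M (P i) * k $ i)"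
      by (simp add: Q_def[abs_def] P_def[abs_def] inner_vec_def k_def)
    also have "\<dots> = integral\<^sup>L M R"
      using P Q by (simp add: R_def[abs_def])
    finally have eq: "?F y - ?F x - ?G \<bullet> (y - x) = integral\<^sup>L M R" .
    have "norm (R \<omega>) \<le> \<bar>w \<omega>\<bar> * (e' * norm k)" if "\<omega> \<in> space M" for \<omega>
    proof -
      define z where "z = A \<omega> + B \<omega> *\<^sub>R x"
      have nk: "norm (B \<omega> *\<^sub>R k) \<le> norm k"
        using mult_right_mono[OF B_bound[OF that] norm_ge_zero[of k]] by simp
      have "R \<omega> = w \<omega> * (\<zeta> (z + B \<omega> *\<^sub>R k) - \<zeta> z - grad \<zeta> z \<bullet> (B \<omega> *\<^sub>R k))"
      proof -
        have "A \<omega> + B \<omega> *\<^sub>R y = z + B \<omega> *\<^sub>R k"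
          by (simp add: z_def k_def scaleR_diff_right)
        moreover have "(\<Sum>i\<in>UNIV. P i \<omega> * k $ i) = w \<omega> * (grad \<zeta> z \<bullet> (B \<omega> *\<^sub>R k))"
          by (simp add: P_def inner_vec_def grad_def z_def sum_distrib_left mult_ac)
        ultimately show ?thesis
          by (simp add: R_def Q_def z_def algebra_simps)
      qed
      moreover have "\<bar>\<zeta> (z + B \<omega> *\<^sub>R k) - \<zeta> z - grad \<zeta> z \<bullet> (B \<omega> *\<^sub>R k)\<bar> \<le> e' * norm (B \<omega> *\<^sub>R k)"
        using nk y by (intro d) (simp add: k_def)
      moreover have "e' * norm (B \<omega> *\<^sub>R k) \<le> e' * norm k"
        using nk e' by (intro mult_left_mono) auto
      ultimately show ?thesis
        by (simp only: real_norm_def abs_mult) (meson abs_ge_zero mult_left_mono order_trans)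
    qed
    then have "norm (integral\<^sup>L M R) \<le> (LINT \<omega>|M. \<bar>w \<omega>\<bar> * (e' * norm k))"
      using R w by (intro integral_norm_bound[THEN order_trans] integral_mono) auto
    also have "\<dots> = W * e' * norm k"
      by (simp add: W_def)
    also have "\<dots> \<le> e * norm k"
      using e' by (intro mult_right_mono) auto
    finally show ?thesis
      using eq by (simp add: k_def)
  qed
  then show "\<exists>d>0. \<forall>y. norm (y - x) < d \<longrightarrow> norm (?F y - ?F x - ?G \<bullet> (y - x)) \<le> e * norm (y - x)"
    using d(1) by blast
qed

lemma partial_kernel:
  assumes "integrable M w" "smooth \<zeta>" "compactly_supported_in UNIV \<zeta>"
  shows "partial i (\<lambda>x. LINT \<omega>|M. w \<omega> * \<zeta> (A \<omega> + B \<omega> *\<^sub>R x)) x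
    = (LINT \<omega>|M. w \<omega> * B \<omega> * partial i \<zeta> (A \<omega> + B \<omega> *\<^sub>R x))"
  using partial_eq[OF has_derivative_kernel[OF assms]] by (simp add: inner_axis)

text \<open>A partial derivative of such an integral is again one, with weight w B and kernel
  \<open>partial i \<zeta>\<close>, so the coinduction principle applies.\<close>

lemma smooth_kernel:
  assumes "integrable M w" "smooth \<zeta>" "compactly_supported_in UNIV \<zeta>"
  shows "smooth (\<lambda>x. LINT \<omega>|M. w \<omega> * \<zeta> (A \<omega> + B \<omega> *\<^sub>R x))"
proof (rule smooth_coinduct[where X = "{f. \<exists>w \<zeta>. integrable M w \<and> smooth \<zeta> \<and>
    compactly_supported_in UNIV \<zeta> \<and> f = (\<lambda>x. LINT \<omega>|M. w \<omega> * \<zeta> (A \<omega> + B \<omega> *\<^sub>R x))}"])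
  show "(\<lambda>x. LINT \<omega>|M. w \<omega> * \<zeta> (A \<omega> + B \<omega> *\<^sub>R x)) \<in> {f. \<exists>w \<zeta>. integrable M w \<and> smooth \<zeta> \<and>
    compactly_supported_in UNIV \<zeta> \<and> f = (\<lambda>x. LINT \<omega>|M. w \<omega> * \<zeta> (A \<omega> + B \<omega> *\<^sub>R x))}"
    using assms by blast
next
  fix f :: "real^3 \<Rightarrow> real" and x
  assume "f \<in> {f. \<exists>w \<zeta>. integrable M w \<and> smooth \<zeta> \<and>
    compactly_supported_in UNIV \<zeta> \<and> f = (\<lambda>x. LINT \<omega>|M. w \<omega> * \<zeta> (A \<omega> + B \<omega> *\<^sub>R x))}"
  then obtain w \<zeta> where *: "integrable M w" "smooth \<zeta>" "compactly_supported_in UNIV \<zeta>"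
    "f = (\<lambda>x. LINT \<omega>|M. w \<omega> * \<zeta> (A \<omega> + B \<omega> *\<^sub>R x))"
    by blast
  show "f differentiable at x"
    unfolding *(4) using has_derivative_kernel[OF *(1-3)] differentiable_def by blast
next
  fix f :: "real^3 \<Rightarrow> real" and i
  assume "f \<in> {f. \<exists>w \<zeta>. integrable M w \<and> smooth \<zeta> \<and>
    compactly_supported_in UNIV \<zeta> \<and> f = (\<lambda>x. LINT \<omega>|M. w \<omega> * \<zeta> (A \<omega> + B \<omega> *\<^sub>R x))}"
  then obtain w \<zeta> where *: "integrable M w" "smooth \<zeta>" "compactly_supported_in UNIV \<zeta>"
    "f = (\<lambda>x. LINT \<omega>|M. w \<omega> * \<zeta> (A \<omega> + B \<omega> *\<^sub>R x))"
    by blast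
  have "partial i f = (\<lambda>x. LINT \<omega>|M. w \<omega> * B \<omega> * partial i \<zeta> (A \<omega> + B \<omega> *\<^sub>R x))"
    unfolding *(4) using partial_kernel[OF *(1-3)] by blast
  moreover note integrable_weight_B[OF *(1)] smooth_partial[OF *(2)] compactly_supported_in_partial[OF *(3)]
  ultimately show "partial i f \<in> {f. \<exists>w \<zeta>. integrable M w \<and> smooth \<zeta> \<and>
    compactly_supported_in UNIV \<zeta> \<and> f = (\<lambda>x. LINT \<omega>|M. w \<omega> * \<zeta> (A \<omega> + B \<omega> *\<^sub>R x))}"
    by blast
qed

end

section \<open>Integration by parts\<close>

lemma integral_lebesgue_on_eq_lborel:
  fixes f :: "'a::euclidean_space \<Rightarrow> real"
  assumes "f \<in> borel_measurable borel" "S \<in> sets lebesgue" "\<And>x. x \<notin> S \<Longrightarrow> f x = 0"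
  shows "integral\<^sup>L (lebesgue_on S) f = integral\<^sup>L lborel f"
proof -
  have "integral\<^sup>L (lebesgue_on S) f = (LINT x|lebesgue. indicator S x *\<^sub>R f x)"
    using assms(2) by (intro integral_restrict_space) auto
  also have "\<dots> = integral\<^sup>L lebesgue f"
    using assms(3) by (intro Bochner_Integration.integral_cong) (auto simp: indicator_def)
  also have "\<dots> = integral\<^sup>L lborel f"
    using assms(1) by (intro integral_completion) auto
  finally show ?thesis .
qed

lemma compactly_supported_integrable:
  fixes f :: "real^3 \<Rightarrow> real"
  assumes "continuous_on UNIV f" "compactly_supported_in UNIV f"
  shows "integrable lborel f"
proof -
  interpret kernel_integral lborel "\<lambda>x. x" "\<lambda>_. 0"
    by unfold_locales auto
  have K: "compact (closure {x. f x \<noteq> 0})"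
    using assms(2) by (simp only: compactly_supported_in_def)
  then have "integrable lborel (indicat_real (closure {x. f x \<noteq> 0}))"
    using emeasure_bounded_finite[OF compact_imp_bounded[OF K]] by (simp add: integrable_indicator_iff)
  from integrable_kernel[OF this assms, of 0] show ?thesis
  proof (rule Bochner_Integration.integrable_cong[THEN iffD1, rotated 2])
    fix x :: "real^3"
    show "indicator (closure {x. f x \<noteq> 0}) x * f (x + 0 *\<^sub>R 0) = f x"
      using closure_subset[of "{x. f x \<noteq> 0}"] by (cases "f x = 0") (auto simp: indicator_def)
  qed simp
qed

text \<open>The integral of a translate of \<zeta> does not depend on the translation, so its
  derivative at 0 vanishes; differentiation under the integral sign identifies this derivative with
  the integral of the partial derivative.\<close>

lemma integral_partial_eq_0:
  assumes \<zeta>: "smooth \<zeta>" "compactly_supported_in UNIV \<zeta>"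
  shows "(LINT x|lborel. partial i \<zeta> x) = 0"
proof -
  interpret kernel_integral lborel "\<lambda>x. x" "\<lambda>_. 1"
    by unfold_locales auto
  have "bounded (closure {x. \<zeta> x \<noteq> 0})"
    using \<zeta>(2) unfolding compactly_supported_in_def by (blast intro: compact_imp_bounded)
  then obtain R where R: "closure {x. \<zeta> x \<noteq> 0} \<subseteq> ball 0 R"
    using bounded_subset_ballD by metis
  have R0: "x \<in> ball 0 R" if "\<zeta> x \<noteq> 0" for x
    using that R closure_subset[of "{x. \<zeta> x \<noteq> 0}"] by auto
  have ind: "integrable lborel (indicat_real (ball (0 :: real^3) (R + 1)))"
    using emeasure_bounded_finite[of "ball (0 :: real^3) (R + 1)"] by (simp add: integrable_indicator_iff)
  \<comment> \<open>The indicator plays the part of the integrable weight. The radius R + 1 keeps it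
    equal to 1 on the translated support as long as |x| < 1.\<close>
  define F where "F x = (LINT y|lborel. indicat_real (ball 0 (R + 1)) y * \<zeta> (y + 1 *\<^sub>R x))" for x
  have F: "F x = integral\<^sup>L lborel \<zeta>" if "x \<in> ball 0 1" for x
  proof -
    have "F x = (LINT y|lborel. \<zeta> (x + y))"
      unfolding F_def
    proof (intro Bochner_Integration.integral_cong refl)
      fix y
      show "indicat_real (ball 0 (R + 1)) y * \<zeta> (y + 1 *\<^sub>R x) = \<zeta> (x + y)"
      proof (cases "\<zeta> (x + y) = 0")
        case False
        then have "norm y < R + 1"
          using R0[OF False] that norm_triangle_ineq4[of "x + y" x] by simp
        then show ?thesis
          by (simp add: add.commute)
      qed (simp add: add.commute)
    qed
    also have "\<dots> = integral\<^sup>L (distr lborel borel ((+) x)) \<zeta>"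
      using smooth_continuous[OF \<zeta>(1)]
      by (intro integral_distr[symmetric] borel_measurable_continuous_onI) auto
    also have "\<dots> = integral\<^sup>L lborel \<zeta>"
      by (simp only: lborel_distr_plus)
    finally show ?thesis .
  qed
  have "(F has_derivative (\<lambda>_. 0)) (at 0)"
    by (rule has_derivative_transform_within_open[of "\<lambda>_. integral\<^sup>L lborel \<zeta>" _ _ _ "ball 0 1"])
       (use F in auto)
  then have "partial i F 0 = 0"
    by (rule partial_eq)
  moreover have "partial i F 0 = (LINT y|lborel. indicat_real (ball 0 (R + 1)) y * 1 * partial i \<zeta> (y + 1 *\<^sub>R 0))"
    unfolding F_def by (rule partial_kernel[OF ind \<zeta>])
  moreover have "\<dots> = (LINT y|lborel. partial i \<zeta> y)"
  proof (intro Bochner_Integration.integral_cong refl)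
    fix y
    have "partial i \<zeta> y = 0" if "y \<notin> ball 0 (R + 1)"
    proof (rule compactly_supported_in_eq_0[of "ball 0 R"])
      show "compactly_supported_in (ball 0 R) (partial i \<zeta>)"
        using \<zeta>(2) R by (intro compactly_supported_in_partial) (simp only: compactly_supported_in_def)
    qed (use that in auto)
    then show "indicat_real (ball 0 (R + 1)) y * 1 * partial i \<zeta> (y + 1 *\<^sub>R 0) = partial i \<zeta> y"
      by (auto simp: indicator_def)
  qed
  ultimately show ?thesis
    by simp
qed

lemma compactly_supported_in_UNIV: "compactly_supported_in E f \<Longrightarrow> compactly_supported_in UNIV f"
  by (simp only: compactly_supported_in_def) simp

text \<open>Only \<phi> has compact support, but the product f \<phi> inherits it, and the integral
  of the derivative of this product vanishes.\<close>

lemma integration_by_parts: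
  assumes E: "E \<in> sets lebesgue" and f: "smooth f"
    and \<phi>: "smooth \<phi>" "compactly_supported_in E \<phi>"
  shows "(LINT x|lebesgue_on E. f x * partial i \<phi> x) = - (LINT x|lebesgue_on E. partial i f x * \<phi> x)"
proof -
  have int: "integrable lborel (\<lambda>x. g x * \<psi> x)"
    and eq: "(LINT x|lebesgue_on E. g x * \<psi> x) = (LINT x|lborel. g x * \<psi> x)"
    if "smooth g" "smooth \<psi>" "compactly_supported_in E \<psi>" for g \<psi>
  proof -
    have c: "continuous_on UNIV (\<lambda>x. g x * \<psi> x)"
      using that by (intro smooth_continuous smooth_mult)
    have s: "compactly_supported_in E (\<lambda>x. g x * \<psi> x)"
      using that(3) by (rule compactly_supported_in_mult_left)
    show "integrable lborel (\<lambda>x. g x * \<psi> x)"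
      using compactly_supported_integrable[OF c compactly_supported_in_UNIV[OF s]] .
    show "(LINT x|lebesgue_on E. g x * \<psi> x) = (LINT x|lborel. g x * \<psi> x)"
      using c E compactly_supported_in_eq_0[OF s]
      by (intro integral_lebesgue_on_eq_lborel borel_measurable_continuous_onI) auto
  qed
  have "0 = (LINT x|lborel. partial i (\<lambda>x. f x * \<phi> x) x)"
    using integral_partial_eq_0[OF smooth_mult[OF f \<phi>(1)]
        compactly_supported_in_UNIV[OF compactly_supported_in_mult_left[OF \<phi>(2)]]] by simp
  also have "\<dots> = (LINT x|lborel. f x * partial i \<phi> x + partial i f x * \<phi> x)"
    using f \<phi> by (simp add: partial_mult smooth_differentiable)
  also have "\<dots> = (LINT x|lborel. f x * partial i \<phi> x) + (LINT x|lborel. partial i f x * \<phi> x)"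
    using f \<phi> compactly_supported_in_partial[OF \<phi>(2)]
    by (intro Bochner_Integration.integral_add int smooth_partial)
  finally show ?thesis
    using f \<phi> compactly_supported_in_partial[OF \<phi>(2)]
    by (simp add: eq smooth_partial)
qed

section \<open>Polynomials of bounded degree\<close>

lemma polys_add [intro]: "p \<in> polys m \<Longrightarrow> q \<in> polys m \<Longrightarrow> (\<lambda>x. p x + q x) \<in> polys m"
proof -
  assume "p \<in> polys m" "q \<in> polys m"
  then obtain c d where
    "\<And>x. p x = (\<Sum>\<alpha> | (\<Sum>i\<in>UNIV. \<alpha> i) \<le> m. c \<alpha> * (\<Prod>i\<in>UNIV. (x $ i) ^ \<alpha> i))"
    "\<And>x. q x = (\<Sum>\<alpha> | (\<Sum>i\<in>UNIV. \<alpha> i) \<le> m. d \<alpha> * (\<Prod>i\<in>UNIV. (x $ i) ^ \<alpha> i))"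
    unfolding polys_def by blast
  then show ?thesis
    unfolding polys_def
    by (auto simp: distrib_right sum.distrib intro!: exI[of _ "\<lambda>\<alpha>. c \<alpha> + d \<alpha>"])
qed

lemma polys_cmult [intro]: "p \<in> polys m \<Longrightarrow> (\<lambda>x. a * p x) \<in> polys m"
proof -
  assume "p \<in> polys m"
  then obtain c where
    "\<And>x. p x = (\<Sum>\<alpha> | (\<Sum>i\<in>UNIV. \<alpha> i) \<le> m. c \<alpha> * (\<Prod>i\<in>UNIV. (x $ i) ^ \<alpha> i))"
    unfolding polys_def by blast
  then show ?thesis
    unfolding polys_def
    by (auto simp: sum_distrib_left mult.assoc intro!: exI[of _ "\<lambda>\<alpha>. a * c \<alpha>"])
qed

lemma polys_monomial:
  assumes "(\<Sum>i\<in>UNIV. \<alpha> i) \<le> m"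
  shows "(\<lambda>x. \<Prod>i\<in>UNIV. (x $ i) ^ \<alpha> i) \<in> polys m"
proof -
  have "(\<Sum>\<beta> | (\<Sum>i\<in>UNIV. \<beta> i) \<le> m. (if \<beta> = \<alpha> then 1 else 0) * (\<Prod>i\<in>UNIV. (x $ i) ^ \<beta> i))
      = (\<Prod>i\<in>UNIV. (x $ i) ^ \<alpha> i)" for x :: "real^3"
    using assms finite_multi_indices[of m]
    by (simp add: if_distrib[of "\<lambda>y. y * _"] cong: if_cong)
  then show ?thesis
    unfolding polys_def by (auto intro!: exI[of _ "\<lambda>\<beta>. if \<beta> = \<alpha> then 1 else 0"])
qed

lemma polys_const [intro]: "(\<lambda>_. c) \<in> polys m"
  using polys_cmult[OF polys_monomial[of "\<lambda>_. 0" m], of c] by simp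

lemma polys_sum [intro]: "(\<And>i. i \<in> I \<Longrightarrow> f i \<in> polys m) \<Longrightarrow> (\<lambda>x. \<Sum>i\<in>I. f i x) \<in> polys m"
  by (induction I rule: infinite_finite_induct) auto

lemma polys_diff [intro]: "p \<in> polys m \<Longrightarrow> q \<in> polys m \<Longrightarrow> (\<lambda>x. p x - q x) \<in> polys m"
  using polys_add[of p m "\<lambda>x. (-1) * q x"] polys_cmult[of q m "-1"] by simp

lemma polys_expansion:
  assumes "p \<in> polys m"
  obtains c where "p = (\<lambda>x. \<Sum>\<alpha> | (\<Sum>i\<in>UNIV. \<alpha> i) \<le> m. c \<alpha> * (\<Prod>i\<in>UNIV. (x $ i) ^ \<alpha> i))"
  using assms unfolding polys_def by blast

lemma polys_mono: "m \<le> n \<Longrightarrow> p \<in> polys m \<Longrightarrow> p \<in> polys n"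
  by (elim polys_expansion) (auto intro!: polys_sum polys_cmult polys_monomial)

lemma polys_mult [intro]:
  assumes "p \<in> polys m" "q \<in> polys n"
  shows "(\<lambda>x. p x * q x) \<in> polys (m + n)"
proof -
  obtain c where p: "p = (\<lambda>x. \<Sum>\<alpha> | (\<Sum>i\<in>UNIV. \<alpha> i) \<le> m. c \<alpha> * (\<Prod>i\<in>UNIV. (x $ i) ^ \<alpha> i))"
    using assms(1) by (rule polys_expansion)
  obtain d where q: "q = (\<lambda>x. \<Sum>\<alpha> | (\<Sum>i\<in>UNIV. \<alpha> i) \<le> n. d \<alpha> * (\<Prod>i\<in>UNIV. (x $ i) ^ \<alpha> i))"
    using assms(2) by (rule polys_expansion)
  have eq: "p x * q x = (\<Sum>\<alpha> | (\<Sum>i\<in>UNIV. \<alpha> i) \<le> m. \<Sum>\<beta> | (\<Sum>i\<in>UNIV. \<beta> i) \<le> n.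
      (c \<alpha> * d \<beta>) * (\<Prod>i\<in>UNIV. (x $ i) ^ (\<alpha> i + \<beta> i)))" for x
    by (simp add: p q sum_product prod.distrib power_add mult_ac)
  show ?thesis
    unfolding eq
    by (intro polys_sum polys_cmult polys_monomial) (auto simp: sum.distrib intro: add_mono)
qed

lemma polys_component [intro]: "(\<lambda>x. x $ i) \<in> polys 1"
proof -
  have "(\<lambda>x. \<Prod>j\<in>UNIV. (x $ j) ^ (if j = i then 1 else 0)) \<in> polys 1"
    by (rule polys_monomial) simp
  moreover have "(\<Prod>j\<in>UNIV. (x $ j) ^ (if j = i then 1 else 0)) = x $ i" for x :: "real^3"
    by (simp add: if_distrib[of "\<lambda>n. _ ^ n"] cong: if_cong)
  ultimately show ?thesis
    by simp
qed

text \<open>The predicate carries the degree bound as an argument, so products add bounds. Monomials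
  arise as products of components, and the final sum is formed at the common bound m.\<close>

lemma polys_induct [consumes 1, case_names const component add mult mono]:
  assumes "p \<in> polys m"
    and const: "\<And>c. Q 0 (\<lambda>_. c)"
    and component: "\<And>i. Q 1 (\<lambda>x. x $ i)"
    and add: "\<And>n f g. Q n f \<Longrightarrow> Q n g \<Longrightarrow> Q n (\<lambda>x. f x + g x)"
    and mult: "\<And>n k f g. Q n f \<Longrightarrow> Q k g \<Longrightarrow> Q (n + k) (\<lambda>x. f x * g x)"
    and mono: "\<And>n k f. Q n f \<Longrightarrow> n \<le> k \<Longrightarrow> Q k f"
  shows "Q m p"
proof -
  have pow: "Q n (\<lambda>x. (x $ i) ^ n)" for n i
  proof (induction n)
    case (Suc n)
    then show ?case
      using mult[OF component Suc, of i] by simp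
  qed (simp add: const)
  have prod: "Q (\<Sum>i\<in>I. \<alpha> i) (\<lambda>x. \<Prod>i\<in>I. (x $ i) ^ \<alpha> i)" for I :: "3 set" and \<alpha>
    by (induction I rule: infinite_finite_induct) (auto intro: const mult pow)
  obtain c where p: "p = (\<lambda>x. \<Sum>\<alpha> | (\<Sum>i\<in>UNIV. \<alpha> i) \<le> m. c \<alpha> * (\<Prod>i\<in>UNIV. (x $ i) ^ \<alpha> i))"
    using assms(1) by (rule polys_expansion)
  have monom: "Q m (\<lambda>x. c \<alpha> * (\<Prod>i\<in>UNIV. (x $ i) ^ \<alpha> i))" if "(\<Sum>i\<in>UNIV. \<alpha> i) \<le> m" for \<alpha>
    using mono[OF mult[OF const prod]] that by simp
  have "Q m (\<lambda>x. \<Sum>\<alpha>\<in>J. c \<alpha> * (\<Prod>i\<in>UNIV. (x $ i) ^ \<alpha> i))"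
    if "J \<subseteq> {\<alpha>. (\<Sum>i\<in>UNIV. \<alpha> i) \<le> m}" for J
    using finite_subset[OF that finite_multi_indices] that
  proof (induction J rule: finite_induct)
    case empty
    show ?case
      using mono[OF const[of 0], of m] by simp
  next
    case (insert \<alpha> J)
    then show ?case
      using add[OF monom[of \<alpha>] insert.IH] by simp
  qed
  then show ?thesis
    unfolding p by blast
qed

lemma smooth_polys [intro]: "p \<in> polys m \<Longrightarrow> smooth p"
  by (induction rule: polys_induct) auto

lemma polys_linear:
  assumes "linear (L :: real^3 \<Rightarrow> real)"
  shows "L \<in> polys 1"
proof -
  interpret L: linear L by fact
  have "L x = (\<Sum>i\<in>UNIV. L (axis i 1) * x $ i)" for x
  proof -
    have "x = (\<Sum>i\<in>UNIV. x $ i *\<^sub>R axis i 1)"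
      by (simp add: vec_eq_iff axis_def if_distrib[of "\<lambda>y. _ * y"] cong: if_cong)
    then have "L x = L (\<Sum>i\<in>UNIV. x $ i *\<^sub>R axis i 1)"
      by simp
    then show ?thesis
      by (simp add: L.sum L.scale mult.commute)
  qed
  then have "L = (\<lambda>x. \<Sum>i\<in>UNIV. L (axis i 1) * x $ i)"
    by blast
  then show ?thesis
    using polys_sum[of UNIV "\<lambda>i x. L (axis i 1) * x $ i" 1] by (metis polys_cmult polys_component)
qed

lemma polys_affine_compose:
  assumes "p \<in> polys m" "linear (L :: real^3 \<Rightarrow> real^3)"
  shows "(\<lambda>x. p (a + L x)) \<in> polys m"
  using assms(1)
proof (induction rule: polys_induct)
  case (component i)
  have "linear (\<lambda>x. L x $ i)"
    using linear_compose[OF assms(2) bounded_linear.linear[OF bounded_linear_vec_nth[of i]]]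
    by (simp add: o_def)
  then have "(\<lambda>x. L x $ i) \<in> polys 1"
    by (rule polys_linear)
  then show ?case
    using polys_add[OF polys_const[of "a $ i"]] by simp
next
  case (mono n k f)
  then show ?case
    by (blast intro: polys_mono)
qed auto

text \<open>Bridge to one variable: on a line, root counting and Lagrange interpolation become
  available for polynomials in three variables, with the same degree bound.\<close>

lemma polys_on_line:
  assumes "p \<in> polys m"
  shows "\<exists>q :: real poly. degree q \<le> m \<and> (\<forall>t. p (a + t *\<^sub>R b) = poly q t)"
  using assms
proof (induction rule: polys_induct)
  case (const c)
  show ?case
    by (intro exI[of _ "[:c:]"]) simp
next
  case (component i)
  show ?case
    by (intro exI[of _ "[:a $ i, b $ i:]"]) simp
next
  case (add n f g)
  then obtain q r where "degree q \<le> n" "degree r \<le> n"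
    "\<And>t. f (a + t *\<^sub>R b) = poly q t" "\<And>t. g (a + t *\<^sub>R b) = poly r t"
    by blast
  then show ?case
    by (intro exI[of _ "q + r"]) (auto simp: degree_add_le)
next
  case (mult n k f g)
  then obtain q r where "degree q \<le> n" "degree r \<le> k"
    "\<And>t. f (a + t *\<^sub>R b) = poly q t" "\<And>t. g (a + t *\<^sub>R b) = poly r t"
    by blast
  then show ?case
    using degree_mult_le[of q r] by (intro exI[of _ "q * r"]) auto
next
  case (mono n k f)
  then show ?case
    by (meson le_trans)
qed

lemma polys_partial:
  assumes "p \<in> polys m"
  shows "partial i p \<in> polys m"
proof -
  have "p \<in> polys m \<and> partial i p \<in> polys m"
    using assms
  proof (induction rule: polys_induct)
    case (component j)
    have "partial i (\<lambda>x. x $ j) = (\<lambda>_. if i = j then 1 else 0)"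
      using partial_component by blast
    then show ?case
      using polys_component[of j] polys_const[of "if i = j then 1 else 0" 1] by simp
  next
    case (add n f g)
    have "partial i (\<lambda>x. f x + g x) = (\<lambda>x. partial i f x + partial i g x)"
      using add smooth_polys by (intro ext partial_add smooth_differentiable) auto
    then show ?case
      using add by auto
  next
    case (mult n k f g)
    have "partial i (\<lambda>x. f x * g x) = (\<lambda>x. f x * partial i g x + partial i f x * g x)"
      using mult smooth_polys by (intro ext partial_mult smooth_differentiable) auto
    then show ?case
      using mult by auto
  next
    case (mono n k f)
    then show ?case
      by (blast intro: polys_mono)
  qed auto
  then show ?thesis ..
qed

text \<open>On the line from a through x the restriction vanishes for all small t > 0, thus has
  infinitely many roots and is zero at t = 1 as well.\<close>

lemma polys_eq_0_if_zero_on_ball: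
  assumes "p \<in> polys m" "R > 0" "\<And>x. x \<in> ball a R \<Longrightarrow> p x = 0"
  shows "p = (\<lambda>_. 0)"
proof
  fix x
  obtain q :: "real poly" where q: "\<And>t. p (a + t *\<^sub>R (x - a)) = poly q t"
    using polys_on_line[OF assms(1)] by blast
  define d where "d = R / (norm (x - a) + 1)"
  have d: "d > 0"
    using assms(2) by (simp add: d_def add_nonneg_pos)
  have "poly q t = 0" if "t \<in> {0<..<d}" for t
  proof -
    have "t * norm (x - a) \<le> d * norm (x - a)"
      using that by (intro mult_right_mono) auto
    also have "\<dots> < R"
      using assms(2) by (simp add: d_def pos_divide_less_eq add_nonneg_pos)
    finally have "a + t *\<^sub>R (x - a) \<in> ball a R"
      using that by (simp add: dist_norm)
    then show ?thesis
      using assms(3) q by metis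
  qed
  then have "infinite {t. poly q t = 0}"
    using infinite_Ioo[OF d] finite_subset[of "{0<..<d}" "{t. poly q t = 0}"] by blast
  then have "q = 0"
    using poly_roots_finite by blast
  then show "p x = 0"
    using q[of 1] by simp
qed

lemma vpolys_component: "q \<in> vpolys m \<Longrightarrow> (\<lambda>x. q x $ i) \<in> polys m"
  by (simp add: vpolys_def)

section \<open>Norm equivalence for polynomials on balls\<close>

lemma lagrange_expansion:
  fixes t :: "nat \<Rightarrow> real"
  assumes t: "inj_on t {..m}"
  obtains l :: "nat \<Rightarrow> real poly"
  where "\<And>q. degree q \<le> m \<Longrightarrow> q = (\<Sum>j\<le>m. smult (poly q (t j)) (l j))"
proof -
  define l where "l j = smult (inverse (\<Prod>i\<in>{..m} - {j}. t j - t i)) (\<Prod>i\<in>{..m} - {j}. [:- t i, 1:])" for j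
  have eval: "poly (l j) (t i) = (if i = j then 1 else 0)" if "i \<le> m" "j \<le> m" for i j
  proof (cases "i = j")
    case True
    have "(\<Prod>i\<in>{..m} - {j}. t j - t i) \<noteq> 0"
      using that t by (auto simp: inj_on_def)
    then show ?thesis
      using True by (simp add: l_def poly_prod)
  next
    case False
    then have "(\<Prod>k\<in>{..m} - {j}. t i - t k) = 0"
      using that by (intro prod_zero) auto
    then show ?thesis
      using False by (simp add: l_def poly_prod)
  qed
  have deg: "degree (l j) \<le> m" if "j \<le> m" for j
  proof -
    have "degree (\<Prod>i\<in>{..m} - {j}. [:- t i, 1:]) = (\<Sum>i\<in>{..m} - {j}. degree [:- t i, 1:])"
      by (rule degree_prod_eq_sum_degree) simp
    also have "\<dots> = m"
      using that by simp
    finally show ?thesis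
      unfolding l_def using degree_smult_le by metis
  qed
  have "q = (\<Sum>j\<le>m. smult (poly q (t j)) (l j))" if q: "degree q \<le> m" for q
  proof (rule poly_eqI_degree[of "t ` {..m}"])
    fix x assume "x \<in> t ` {..m}"
    then obtain i where i: "i \<le> m" "x = t i"
      by auto
    have "poly (\<Sum>j\<le>m. smult (poly q (t j)) (l j)) x = (\<Sum>j\<le>m. poly q (t j) * (if i = j then 1 else 0))"
      using i eval by (simp add: poly_sum)
    also have "\<dots> = poly q x"
      using i by (simp add: if_distrib[of "\<lambda>y. _ * y"] cong: if_cong)
    finally show "poly q x = poly (\<Sum>j\<le>m. smult (poly q (t j)) (l j)) x" ..
  next
    have c: "card (t ` {..m}) = Suc m"
      using t by (simp add: card_image)
    show "degree q < card (t ` {..m})"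
      using q c by simp
    have "degree (\<Sum>j\<le>m. smult (poly q (t j)) (l j)) \<le> m"
      using deg by (intro degree_sum_le) (auto intro: order_trans[OF degree_smult_le])
    then show "degree (\<Sum>j\<le>m. smult (poly q (t j)) (l j)) < card (t ` {..m})"
      using c by simp
  qed
  then show thesis
    using that by blast
qed

text \<open>By Lagrange interpolation at 0, \<delta>, ..., m \<delta>, the value at 1 and the slope
  at 0 are fixed linear combinations of the node values. \<open>C\<close> depends on m and \<delta>
  alone; the shape-independent polynomial bounds rest on this.\<close>

lemma poly_value_derivative_bound:
  assumes "\<delta> > 0"
  obtains C :: real where "C > 0"
    and "\<And>q :: real poly. degree q \<le> m \<Longrightarrow> \<bar>poly q 1\<bar> \<le> C * (\<Sum>j\<le>m. \<bar>poly q (\<delta> * real j)\<bar>)"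
    and "\<And>q :: real poly. degree q \<le> m \<Longrightarrow> \<bar>poly (pderiv q) 0\<bar> \<le> C * (\<Sum>j\<le>m. \<bar>poly q (\<delta> * real j)\<bar>)"
proof -
  have "inj_on (\<lambda>j. \<delta> * real j) {..m}"
    using assms by (auto simp: inj_on_def)
  then obtain l :: "nat \<Rightarrow> real poly"
    where l: "\<And>q. degree q \<le> m \<Longrightarrow> q = (\<Sum>j\<le>m. smult (poly q (\<delta> * real j)) (l j))"
    by (rule lagrange_expansion[of "\<lambda>j. \<delta> * real j" m]) blast
  define C where "C = 1 + (\<Sum>j\<le>m. \<bar>poly (l j) 1\<bar> + \<bar>poly (pderiv (l j)) 0\<bar>)"
  have C: "\<bar>poly (l j) 1\<bar> \<le> C" "\<bar>poly (pderiv (l j)) 0\<bar> \<le> C" "0 < C" if "j \<le> m" for j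
  proof -
    have "\<bar>poly (l j) 1\<bar> + \<bar>poly (pderiv (l j)) 0\<bar> \<le> (\<Sum>j\<le>m. \<bar>poly (l j) 1\<bar> + \<bar>poly (pderiv (l j)) 0\<bar>)"
      using that by (intro member_le_sum) auto
    then show "\<bar>poly (l j) 1\<bar> \<le> C" "\<bar>poly (pderiv (l j)) 0\<bar> \<le> C" "0 < C"
      unfolding C_def by (auto simp: abs_ge_zero add_pos_nonneg)
  qed
  have bound: "\<bar>\<Sum>j\<le>m. a j * b j\<bar> \<le> C * (\<Sum>j\<le>m. \<bar>a j\<bar>)" if "\<And>j. j \<le> m \<Longrightarrow> \<bar>b j\<bar> \<le> C" for a b :: "nat \<Rightarrow> real"
  proof -
    have "\<bar>\<Sum>j\<le>m. a j * b j\<bar> \<le> (\<Sum>j\<le>m. \<bar>a j\<bar> * C)"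
      using that by (intro order_trans[OF sum_abs] sum_mono) (auto simp: abs_mult mult_left_mono)
    then show ?thesis
      by (simp add: sum_distrib_left mult.commute)
  qed
  show thesis
  proof (rule that[OF C(3)[of 0]])
    fix q :: "real poly" assume q: "degree q \<le> m"
    have "poly q 1 = (\<Sum>j\<le>m. poly q (\<delta> * real j) * poly (l j) 1)"
      by (subst l[OF q]) (simp add: poly_sum)
    then show "\<bar>poly q 1\<bar> \<le> C * (\<Sum>j\<le>m. \<bar>poly q (\<delta> * real j)\<bar>)"
      using bound C(1) by presburger
    have "pderiv q = (\<Sum>j\<le>m. smult (poly q (\<delta> * real j)) (pderiv (l j)))"
      by (subst l[OF q]) (simp add: higher_pderiv_sum[of 1, simplified] pderiv_smult)
    then have "poly (pderiv q) 0 = (\<Sum>j\<le>m. poly q (\<delta> * real j) * poly (pderiv (l j)) 0)"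
      by (simp add: poly_sum)
    then show "\<bar>poly (pderiv q) 0\<bar> \<le> C * (\<Sum>j\<le>m. \<bar>poly q (\<delta> * real j)\<bar>)"
      using bound C(2) by presburger
  qed simp
qed

section \<open>Lebesgue integrals over open sets\<close>

lemma nn_integral_lebesgue_on:
  fixes f :: "'a::euclidean_space \<Rightarrow> ennreal"
  assumes "S \<in> sets borel"
  shows "(\<integral>\<^sup>+x. f x \<partial>lebesgue_on S) = (\<integral>\<^sup>+x. f x * indicator S x \<partial>lborel)"
proof -
  have "(\<integral>\<^sup>+x. f x \<partial>lebesgue_on S) = (\<integral>\<^sup>+x. f x * indicator S x \<partial>lebesgue)"
    using assms by (subst nn_integral_restrict_space) auto
  also have "\<dots> = (\<integral>\<^sup>+x. f x * indicator S x \<partial>lborel)"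
    by (rule nn_integral_completion)
  finally show ?thesis .
qed

lemma nn_integral_lborel_affine:
  fixes f :: "'a::euclidean_space \<Rightarrow> ennreal" and t :: 'a
  assumes [measurable]: "f \<in> borel_measurable borel" and "s \<noteq> 0"
  shows "(\<integral>\<^sup>+x. f x \<partial>lborel) = ennreal (\<bar>s\<bar> ^ DIM('a)) * (\<integral>\<^sup>+x. f (t + s *\<^sub>R x) \<partial>lborel)"
  by (subst lborel_affine[OF assms(2), of t])
     (simp add: nn_integral_density nn_integral_distr nn_integral_cmult)

text \<open>The Jacobian of the substitution is at least (1/2)^3, whence the factor 8.\<close>

lemma nn_integral_lborel_affine_le:
  fixes f :: "real^3 \<Rightarrow> ennreal"
  assumes f: "f \<in> borel_measurable borel" and s: "1 / 2 \<le> \<bar>s\<bar>"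
  shows "(\<integral>\<^sup>+x. f (t + s *\<^sub>R x) \<partial>lborel) \<le> 8 * (\<integral>\<^sup>+x. f x \<partial>lborel)"
proof -
  have "(1 / 2) ^ 3 \<le> \<bar>s\<bar> ^ 3"
    using s by (intro power_mono) auto
  then have "1 \<le> 8 * \<bar>s\<bar> ^ 3"
    by (simp add: power3_eq_cube)
  then have "ennreal 1 \<le> ennreal (8 * \<bar>s\<bar> ^ 3)"
    by (rule ennreal_leI)
  then have "1 * (\<integral>\<^sup>+x. f (t + s *\<^sub>R x) \<partial>lborel) \<le> ennreal (8 * \<bar>s\<bar> ^ 3) * (\<integral>\<^sup>+x. f (t + s *\<^sub>R x) \<partial>lborel)"
    by (intro mult_right_mono) auto
  also have "\<dots> = 8 * (\<integral>\<^sup>+x. f x \<partial>lborel)"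
  proof -
    have "s \<noteq> 0"
      using s by auto
    then show ?thesis
      using nn_integral_lborel_affine[OF f, of s t]
      by (simp add: ennreal_mult mult.assoc flip: ennreal_numeral)
  qed
  finally show ?thesis
    by simp
qed

lemma finite_measure_lebesgue_on_bounded:
  fixes S :: "'a::euclidean_space set"
  assumes "bounded S" "S \<in> sets lebesgue"
  shows "finite_measure (lebesgue_on S)"
  using assms by (intro finite_measure_lebesgue_on bounded_set_imp_lmeasurable)

lemma continuous_lebesgue_on_measurable:
  fixes f :: "'a::euclidean_space \<Rightarrow> 'b::euclidean_space"
  assumes "continuous_on UNIV f"
  shows "f \<in> borel_measurable (lebesgue_on S)"
  using assms by (intro measurable_restrict_space1 measurable_completion)
    (simp add: borel_measurable_continuous_onI)

lemma continuous_L2: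
  fixes f :: "'a::euclidean_space \<Rightarrow> 'b::euclidean_space"
  assumes S: "bounded S" "S \<in> sets lebesgue" and f: "continuous_on UNIV f"
  shows "f \<in> L2 (lebesgue_on S)"
proof -
  have "bounded (f ` closure S)"
    using S f by (intro compact_imp_bounded compact_continuous_image)
      (auto intro: continuous_on_subset simp: compact_closure)
  then obtain B where "\<And>x. x \<in> closure S \<Longrightarrow> norm (f x) \<le> B"
    by (auto simp: bounded_iff)
  then have "\<And>x. x \<in> S \<Longrightarrow> norm (f x) \<le> B"
    using closure_subset by blast
  then show ?thesis
    using S f by (intro L2_bounded[where B = B] finite_measure_lebesgue_on_bounded
        continuous_lebesgue_on_measurable) auto
qed

lemma l2_norm_eq_nn_integral:
  fixes f :: "'a::euclidean_space \<Rightarrow> 'b::euclidean_space"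
  assumes "f \<in> L2 (lebesgue_on S)" "S \<in> sets borel"
  shows "ennreal ((l2_norm (lebesgue_on S) f)\<^sup>2) = (\<integral>\<^sup>+x. ennreal ((norm (f x))\<^sup>2) * indicator S x \<partial>lborel)"
proof -
  have "ennreal ((l2_norm (lebesgue_on S) f)\<^sup>2) = (\<integral>\<^sup>+x. ennreal ((norm (f x))\<^sup>2) \<partial>lebesgue_on S)"
    unfolding l2_norm_power2_eq_integral
    using assms(1) by (intro nn_integral_eq_integral[symmetric]) (auto simp: L2_def)
  also have "\<dots> = (\<integral>\<^sup>+x. ennreal ((norm (f x))\<^sup>2) * indicator S x \<partial>lborel)"
    using assms by (intro nn_integral_lebesgue_on)
  finally show ?thesis .
qed

lemma l2_norm_subset:
  fixes f :: "'a::euclidean_space \<Rightarrow> 'b::euclidean_space"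
  assumes "f \<in> L2 (lebesgue_on T)" "S \<subseteq> T" "S \<in> sets lebesgue" "T \<in> sets lebesgue"
  shows "f \<in> L2 (lebesgue_on S)" "l2_norm (lebesgue_on S) f \<le> l2_norm (lebesgue_on T) f"
proof -
  have T: "integrable lebesgue (\<lambda>x. indicator T x *\<^sub>R (norm (f x))\<^sup>2)"
    using L2_integrable_norm2[OF assms(1)] assms(4)
    by (subst (asm) integrable_restrict_space) auto
  have "set_integrable lebesgue S (\<lambda>x. (norm (f x))\<^sup>2)"
    by (rule set_integrable_subset[OF T[folded set_integrable_def] assms(3,2)])
  then have S: "integrable lebesgue (\<lambda>x. indicator S x *\<^sub>R (norm (f x))\<^sup>2)"
    by (simp add: set_integrable_def)
  have "f \<in> borel_measurable (lebesgue_on S)"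
    using L2_measurable[OF assms(1)] assms(2) by (rule measurable_restrict_mono)
  then show "f \<in> L2 (lebesgue_on S)"
    unfolding L2_def using S assms(3) by (subst integrable_restrict_space) auto
  have "(l2_norm (lebesgue_on S) f)\<^sup>2 \<le> (l2_norm (lebesgue_on T) f)\<^sup>2"
  proof -
    have "(l2_norm (lebesgue_on S) f)\<^sup>2 = (LINT x|lebesgue. indicator S x *\<^sub>R (norm (f x))\<^sup>2)"
      unfolding l2_norm_power2_eq_integral using assms(3) by (intro integral_restrict_space) auto
    also have "\<dots> \<le> (LINT x|lebesgue. indicator T x *\<^sub>R (norm (f x))\<^sup>2)"
      using assms(2) by (intro integral_mono[OF S T]) (auto simp: indicator_def)
    also have "\<dots> = (l2_norm (lebesgue_on T) f)\<^sup>2"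
      unfolding l2_norm_power2_eq_integral
      using assms(4) by (intro integral_restrict_space[symmetric]) auto
    finally show ?thesis .
  qed
  then show "l2_norm (lebesgue_on S) f \<le> l2_norm (lebesgue_on T) f"
    by (rule power2_le_imp_le) (rule l2_norm_nonneg)
qed

text \<open>Each y in the half ball is joined to x by a segment; p(x) is extrapolated from nodes on
  that segment which are so close to y that they stay in the ball of radius R. Averaging over y
  turns node values into the integral of p^2, even for x far outside the ball.\<close>

lemma poly_sup_bound:
  fixes m :: nat and \<kappa> :: real
  assumes "\<kappa> \<ge> 1"
  obtains C where "C > 0"
    "\<And>p (a :: real^3) R x. p \<in> polys m \<Longrightarrow> R > 0 \<Longrightarrow> x \<in> cball a (\<kappa> * R) \<Longrightarrow>
      (p x)\<^sup>2 \<le> C / R ^ 3 * (l2_norm (lebesgue_on (ball a R)) p)\<^sup>2"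
proof -
  \<comment> \<open>Since |x - y| is at most (\<kappa> + 1) R, this bound on the node parameters
    keeps every node within R / 4 of y.\<close>
  define \<delta> where "\<delta> = 1 / (4 * (\<kappa> + 1) * (real m + 1))"
  have \<delta>: "\<delta> > 0"
    using assms by (simp add: \<delta>_def)
  have \<delta>j: "0 \<le> \<delta> * real j" "\<delta> * real j \<le> 1 / (4 * (\<kappa> + 1))" if "j \<le> m" for j
  proof -
    have "\<delta> * real j \<le> \<delta> * (real m + 1)"
      using that \<delta> by (intro mult_left_mono) auto
    also have "\<dots> = 1 / (4 * (\<kappa> + 1))"
      by (simp add: \<delta>_def)
    finally show "\<delta> * real j \<le> 1 / (4 * (\<kappa> + 1))" .
  qed (use \<delta> in auto)
  obtain C0 :: real where C0: "C0 > 0"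
    "\<And>q :: real poly. degree q \<le> m \<Longrightarrow> \<bar>poly q 1\<bar> \<le> C0 * (\<Sum>j\<le>m. \<bar>poly q (\<delta> * real j)\<bar>)"
    using poly_value_derivative_bound[OF \<delta>, of m] by metis
  define K where "K = C0\<^sup>2 * (real m + 1)"
  have K: "K > 0"
    using C0(1) by (simp add: K_def)
  define vol where "vol = unit_ball_vol 3 / 8"
  have vol: "vol > 0"
    by (simp add: vol_def unit_ball_vol_pos)
  define C where "C = K * (8 * (real m + 1)) / vol"
  show thesis
  proof (rule that[of C])
    show "C > 0"
      using K vol by (simp add: C_def)
  next
    fix p and a x :: "real^3" and R :: real
    assume p: "p \<in> polys m" and R: "R > 0" and x: "x \<in> cball a (\<kappa> * R)"
    have cont: "continuous_on UNIV p"
      using p by (intro smooth_continuous smooth_polys)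
    have pm [measurable]: "p \<in> borel_measurable borel"
      using cont by (rule borel_measurable_continuous_onI)
    have pL2: "p \<in> L2 (lebesgue_on (ball a R))"
      using cont by (intro continuous_L2) auto
    define I where "I = (l2_norm (lebesgue_on (ball a R)) p)\<^sup>2"
    define z where "z j y = (\<delta> * real j) *\<^sub>R x + (1 - \<delta> * real j) *\<^sub>R y" for j :: nat and y
    have z: "z j y \<in> ball a R" if "j \<le> m" "y \<in> ball a (R / 2)" for j y
    proof -
      have "norm (y - a) < R / 2"
        using that by (simp add: dist_norm norm_minus_commute)
      moreover have "norm (x - a) \<le> \<kappa> * R"
        using x by (simp add: dist_norm norm_minus_commute)
      ultimately have "norm (x - y) \<le> (\<kappa> + 1) * R"
        using norm_triangle_ineq4[of "x - a" "y - a"] R by (simp add: algebra_simps)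
      then have "(\<delta> * real j) * norm (x - y) \<le> 1 / (4 * (\<kappa> + 1)) * ((\<kappa> + 1) * R)"
        using \<delta>j[OF that(1)] assms by (intro mult_mono) auto
      also have "\<dots> = R / 4"
        using assms by (simp add: field_simps)
      finally have 1: "norm ((\<delta> * real j) *\<^sub>R (x - y)) \<le> R / 4"
        using \<delta>j[OF that(1)] by simp
      have 2: "z j y - a = (y - a) + (\<delta> * real j) *\<^sub>R (x - y)"
        by (simp add: z_def algebra_simps)
      have "norm (z j y - a) \<le> norm (y - a) + R / 4"
        unfolding 2 by (rule order_trans[OF norm_triangle_ineq add_left_mono[OF 1]])
      with \<open>norm (y - a) < R / 2\<close> R have "norm (z j y - a) < R"
        by linarith
      then show ?thesis
        by (simp add: dist_norm norm_minus_commute)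
    qed
    \<comment> \<open>x sits at parameter 1 of the line from y. Squaring by Cauchy-Schwarz costs the
      number m + 1 of nodes.\<close>
    have pointwise: "(p x)\<^sup>2 \<le> K * (\<Sum>j\<le>m. (p (z j y))\<^sup>2)" for y
    proof -
      obtain q :: "real poly" where q: "degree q \<le> m" "\<And>t. p (y + t *\<^sub>R (x - y)) = poly q t"
        using polys_on_line[OF p] by blast
      have zq: "poly q (\<delta> * real j) = p (z j y)" for j
        unfolding q(2)[symmetric] z_def by (simp add: algebra_simps)
      have "\<bar>p x\<bar> \<le> C0 * (\<Sum>j\<le>m. \<bar>p (z j y)\<bar>)"
        using C0(2)[OF q(1)] q(2)[of 1] by (simp add: zq)
      then have "\<bar>p x\<bar>\<^sup>2 \<le> (C0 * (\<Sum>j\<le>m. \<bar>p (z j y)\<bar>))\<^sup>2"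
        by (intro power_mono) auto
      also have "\<dots> \<le> C0\<^sup>2 * ((\<Sum>j\<le>m. \<bar>p (z j y)\<bar>\<^sup>2) * (\<Sum>j\<le>m. 1\<^sup>2))"
        unfolding power_mult_distrib
        using Cauchy_Schwarz_ineq_sum[of "\<lambda>j. \<bar>p (z j y)\<bar>" "\<lambda>_. 1" "{..m}"]
        by (intro mult_left_mono) auto
      finally show ?thesis
        by (simp add: K_def algebra_simps)
    qed
    define f where "f w = ennreal ((p w)\<^sup>2) * indicator (ball a R) w" for w
    have [measurable]: "ball a R \<in> sets borel"
      by simp
    have f [measurable]: "f \<in> borel_measurable borel"
      unfolding f_def by measurable
    have If: "ennreal I = (\<integral>\<^sup>+w. f w \<partial>lborel)"
      unfolding I_def f_def using l2_norm_eq_nn_integral[OF pL2] by simp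
    \<comment> \<open>Integration of the pointwise bound over all y in the half ball; the left side
      does not depend on y.\<close>
    have "ennreal ((p x)\<^sup>2) * emeasure lborel (ball a (R / 2))
        = (\<integral>\<^sup>+y. ennreal ((p x)\<^sup>2) * indicator (ball a (R / 2)) y \<partial>lborel)"
      by (simp add: nn_integral_cmult_indicator)
    also have "\<dots> \<le> (\<integral>\<^sup>+y. ennreal K * (\<Sum>j\<le>m. f (z j y)) \<partial>lborel)"
    proof (rule nn_integral_mono)
      fix y
      show "ennreal ((p x)\<^sup>2) * indicator (ball a (R / 2)) y \<le> ennreal K * (\<Sum>j\<le>m. f (z j y))"
      proof (cases "y \<in> ball a (R / 2)")
        case True
        then have "ennreal K * (\<Sum>j\<le>m. f (z j y)) = ennreal (K * (\<Sum>j\<le>m. (p (z j y))\<^sup>2))"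
          using z[OF _ True] K by (simp add: f_def ennreal_mult sum_nonneg flip: sum_ennreal)
        then show ?thesis
          using True pointwise[of y] by (simp add: ennreal_leI)
      qed simp
    qed
    also have "\<dots> = ennreal K * (\<Sum>j\<le>m. \<integral>\<^sup>+y. f (z j y) \<partial>lborel)"
      unfolding z_def by (simp add: nn_integral_cmult nn_integral_sum)
    \<comment> \<open>The j-th node depends on y through a contraction by the factor 1 - \<delta> j,
      which is at least 1/2, so the substitution costs at most 8.\<close>
    also have "\<dots> \<le> ennreal K * (\<Sum>j\<le>m. 8 * ennreal I)"
    proof (intro mult_left_mono sum_mono)
      fix j assume "j \<in> {..m}"
      then have "\<delta> * real j \<le> 1 / (4 * (\<kappa> + 1))"
        using \<delta>j by simp
      also have "\<dots> \<le> 1 / 2"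
        using assms by (simp add: field_simps)
      finally show "(\<integral>\<^sup>+y. f (z j y) \<partial>lborel) \<le> 8 * ennreal I"
        unfolding z_def If by (intro nn_integral_lborel_affine_le f) simp
    qed simp
    also have "\<dots> = ennreal (K * (8 * (real m + 1)) * I)"
    proof -
      have I0: "0 \<le> I"
        by (simp add: I_def)
      have "(\<Sum>j\<le>m. 8 * ennreal I) = (\<Sum>j\<le>m. ennreal (8 * I))"
        using I0 by (simp add: ennreal_mult)
      also have "\<dots> = ennreal (\<Sum>j\<le>m. 8 * I)"
        using I0 by (intro sum_ennreal) simp
      also have "ennreal K * \<dots> = ennreal (K * (\<Sum>j\<le>m. 8 * I))"
        using K I0 by (intro ennreal_mult[symmetric]) (auto intro: sum_nonneg)
      finally show ?thesis
        by (simp add: algebra_simps)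
    qed
    finally have "ennreal ((p x)\<^sup>2) * emeasure lborel (ball a (R / 2)) \<le> ennreal (K * (8 * (real m + 1)) * I)" .
    moreover have "emeasure lborel (ball a (R / 2)) = ennreal (vol * R ^ 3)"
      using R by (simp add: emeasure_ball vol_def power_divide)
    ultimately have "ennreal ((p x)\<^sup>2 * (vol * R ^ 3)) \<le> ennreal (K * (8 * (real m + 1)) * I)"
      using R vol by (simp add: ennreal_mult)
    then have "(p x)\<^sup>2 * (vol * R ^ 3) \<le> K * (8 * (real m + 1)) * I"
      using K by (subst (asm) ennreal_le_iff) (auto simp: I_def)
    then show "(p x)\<^sup>2 \<le> C / R ^ 3 * (l2_norm (lebesgue_on (ball a R)) p)\<^sup>2"
      using R vol by (simp add: C_def I_def field_simps)
  qed
qed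

text \<open>R times the partial derivative at x is the slope at 0 of the restriction to an
  axis-parallel line traversed with speed R. The interpolation nodes have parameters in [0, 1], so
  the sample points lie in the ball of radius (\<kappa> + 1) R, where the sup bound applies.\<close>

lemma poly_partial_sup_bound:
  fixes m :: nat and \<kappa> :: real
  assumes "\<kappa> \<ge> 1"
  obtains C where "C > 0"
    "\<And>p (a :: real^3) R x i. p \<in> polys m \<Longrightarrow> R > 0 \<Longrightarrow> x \<in> cball a (\<kappa> * R) \<Longrightarrow>
      (R * partial i p x)\<^sup>2 \<le> C / R ^ 3 * (l2_norm (lebesgue_on (ball a R)) p)\<^sup>2"
proof -
  obtain C1 where C1: "C1 > 0"
    "\<And>p (a :: real^3) R x. p \<in> polys m \<Longrightarrow> R > 0 \<Longrightarrow> x \<in> cball a ((\<kappa> + 1) * R) \<Longrightarrow>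
      (p x)\<^sup>2 \<le> C1 / R ^ 3 * (l2_norm (lebesgue_on (ball a R)) p)\<^sup>2"
    using poly_sup_bound[of "\<kappa> + 1" m] assms by auto
  define \<delta> where "\<delta> = 1 / (real m + 1)"
  have \<delta>: "\<delta> > 0"
    by (simp add: \<delta>_def)
  obtain C0 :: real where C0: "C0 > 0"
    "\<And>q :: real poly. degree q \<le> m \<Longrightarrow> \<bar>poly (pderiv q) 0\<bar> \<le> C0 * (\<Sum>j\<le>m. \<bar>poly q (\<delta> * real j)\<bar>)"
    using poly_value_derivative_bound[OF \<delta>, of m] by metis
  show thesis
  proof (rule that[of "(C0 * (real m + 1))\<^sup>2 * C1"])
    show "(C0 * (real m + 1))\<^sup>2 * C1 > 0"
      using C0(1) C1(1) by (simp add: zero_less_mult_iff)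
  next
    fix p and a x :: "real^3" and R :: real and i :: 3
    assume p: "p \<in> polys m" and R: "R > 0" and x: "x \<in> cball a (\<kappa> * R)"
    define S where "S = sqrt (C1 / R ^ 3 * (l2_norm (lebesgue_on (ball a R)) p)\<^sup>2)"
    have S: "\<bar>p y\<bar> \<le> S" if "y \<in> cball a ((\<kappa> + 1) * R)" for y
      using real_sqrt_le_mono[OF C1(2)[OF p R that]] by (simp add: S_def)
    obtain q :: "real poly" where q: "degree q \<le> m" "\<And>t. p (x + t *\<^sub>R (R *\<^sub>R axis i 1)) = poly q t"
      using polys_on_line[OF p] by blast
    have "((\<lambda>t. p (x + t *\<^sub>R (R *\<^sub>R axis i 1))) has_derivative (\<lambda>t. grad p x \<bullet> (t *\<^sub>R (R *\<^sub>R axis i 1)))) (at 0)"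
    proof (rule has_derivative_compose[where f = "\<lambda>t. x + t *\<^sub>R (R *\<^sub>R axis i 1)"])
      show "((\<lambda>t. x + t *\<^sub>R (R *\<^sub>R axis i 1)) has_derivative (\<lambda>t. t *\<^sub>R (R *\<^sub>R axis i 1))) (at 0)"
        by (auto intro!: derivative_eq_intros)
      show "(p has_derivative (\<lambda>h. grad p x \<bullet> h)) (at (x + 0 *\<^sub>R (R *\<^sub>R axis i 1)))"
        using smooth_has_derivative_grad[OF smooth_polys[OF p]] by simp
    qed
    then have "(poly q has_derivative (\<lambda>t. grad p x \<bullet> (t *\<^sub>R (R *\<^sub>R axis i 1)))) (at 0)"
      unfolding q(2) .
    then have "(poly q has_real_derivative R * partial i p x) (at 0)"
      by (simp add: has_field_derivative_def inner_axis grad_def mult_commute_abs mult.assoc)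
    then have "R * partial i p x = poly (pderiv q) 0"
      using poly_DERIV DERIV_unique by blast
    also have "\<bar>\<dots>\<bar> \<le> C0 * (\<Sum>j\<le>m. \<bar>poly q (\<delta> * real j)\<bar>)"
      by (rule C0(2)[OF q(1)])
    also have "\<dots> \<le> C0 * (\<Sum>j\<le>m. S)"
    proof (intro mult_left_mono sum_mono)
      fix j assume j: "j \<in> {..m}"
      have "\<delta> * real j \<le> 1"
        using j by (simp add: \<delta>_def)
      then have "\<delta> * real j * R \<le> 1 * R"
        using R by (intro mult_right_mono) auto
      then have "norm ((\<delta> * real j) *\<^sub>R (R *\<^sub>R axis i (1::real))) \<le> R"
        using \<delta> R by (simp add: abs_mult)
      moreover have "norm (x - a) \<le> \<kappa> * R"
        using x by (simp add: dist_norm norm_minus_commute)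
      ultimately have "norm (x + (\<delta> * real j) *\<^sub>R (R *\<^sub>R axis i 1) - a) \<le> (\<kappa> + 1) * R"
        using norm_triangle_ineq[of "x - a" "(\<delta> * real j) *\<^sub>R (R *\<^sub>R axis i 1)"]
        by (simp add: algebra_simps)
      then show "\<bar>poly q (\<delta> * real j)\<bar> \<le> S"
        unfolding q(2)[symmetric] by (intro S) (simp add: dist_norm norm_minus_commute)
    qed (use C0 in auto)
    finally have "\<bar>R * partial i p x\<bar> \<le> C0 * (real m + 1) * S"
      by (simp add: algebra_simps)
    then have "\<bar>R * partial i p x\<bar>\<^sup>2 \<le> (C0 * (real m + 1) * S)\<^sup>2"
      by (intro power_mono) auto
    also have "\<dots> = (C0 * (real m + 1))\<^sup>2 * (C1 / R ^ 3 * (l2_norm (lebesgue_on (ball a R)) p)\<^sup>2)"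
    proof -
      have "0 \<le> C1 / R ^ 3 * (l2_norm (lebesgue_on (ball a R)) p)\<^sup>2"
        using C1(1) R by simp
      then show ?thesis
        unfolding power_mult_distrib S_def by simp
    qed
    finally show "(R * partial i p x)\<^sup>2 \<le> (C0 * (real m + 1))\<^sup>2 * C1 / R ^ 3 * (l2_norm (lebesgue_on (ball a R)) p)\<^sup>2"
      by simp
  qed
qed

section \<open>Density of continuous functions and the fundamental lemma\<close>

lemma borel_measurable_continuous_limit:
  fixes f :: "'a::euclidean_space \<Rightarrow> real"
  assumes "f \<in> borel_measurable (lebesgue_on S)" "S \<in> sets lebesgue"
  obtains g where "\<And>n :: nat. continuous_on UNIV (g n)"
    "AE x in lebesgue_on S. (\<lambda>n. g n x) \<longlonglongrightarrow> f x"
proof -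
  have "f measurable_on S"
    using assms by (simp add: measurable_on_iff_borel_measurable)
  then obtain N g where N: "negligible N" and g: "\<And>n. continuous_on UNIV (g n)"
    "\<And>x. x \<notin> N \<Longrightarrow> (\<lambda>n. g n x) \<longlonglongrightarrow> (if x \<in> S then f x else 0)"
    unfolding measurable_on_def by blast
  have "AE x in lebesgue. x \<notin> N"
    using N by (intro AE_not_in) (simp add: negligible_iff_null_sets)
  then have "AE x in lebesgue. x \<in> S \<longrightarrow> (\<lambda>n. g n x) \<longlonglongrightarrow> f x"
  proof eventually_elim
    case (elim x)
    then show ?case
      using g(2)[of x] by auto
  qed
  then have "AE x in lebesgue_on S. (\<lambda>n. g n x) \<longlonglongrightarrow> f x"
    using assms(2) by (subst AE_restrict_space_iff) auto
  with g(1) show thesis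
    by (rule that)
qed

definition clamp :: "real \<Rightarrow> real \<Rightarrow> real" where
  "clamp K t = max (- K) (min K t)"

lemma clamp_le: "0 \<le> K \<Longrightarrow> \<bar>clamp K t\<bar> \<le> K"
  by (auto simp: clamp_def)

lemma clamp_id: "\<bar>t\<bar> \<le> K \<Longrightarrow> clamp K t = t"
  by (auto simp: clamp_def)

lemma clamp_diff_le: "0 \<le> K \<Longrightarrow> \<bar>t - clamp K t\<bar> \<le> \<bar>t\<bar>"
  by (auto simp: clamp_def)

lemma continuous_on_clamp [continuous_intros]:
  "continuous_on S f \<Longrightarrow> continuous_on S (\<lambda>x. clamp K (f x))"
  unfolding clamp_def by (intro continuous_intros)

lemma tendsto_clamp: "(f \<longlongrightarrow> a) F \<Longrightarrow> ((\<lambda>x. clamp K (f x)) \<longlongrightarrow> clamp K a) F"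
  unfolding clamp_def by (intro tendsto_intros)

lemma borel_measurable_clamp [measurable]: "clamp K \<in> borel_measurable borel"
  unfolding clamp_def by measurable

text \<open>Continuous functions converge almost everywhere to sgn f. Clamped to [-1, 1] they are
  admissible test functions, and dominated convergence makes the integral of |f| vanish.\<close>

lemma AE_zero_if_orthogonal_to_continuous:
  fixes f :: "'a::euclidean_space \<Rightarrow> real"
  assumes f: "integrable (lebesgue_on S) f" and S: "S \<in> sets lebesgue"
    and zero: "\<And>g. continuous_on UNIV g \<Longrightarrow> (\<And>x. \<bar>g x\<bar> \<le> 1) \<Longrightarrow> (LINT x|lebesgue_on S. f x * g x) = 0"
  shows "AE x in lebesgue_on S. f x = 0"
proof -
  have fm [measurable]: "f \<in> borel_measurable (lebesgue_on S)"
    using f by auto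
  have "(\<lambda>x. sgn (f x)) \<in> borel_measurable (lebesgue_on S)"
    by measurable
  then obtain g where g: "\<And>n :: nat. continuous_on UNIV (g n)"
    "AE x in lebesgue_on S. (\<lambda>n. g n x) \<longlonglongrightarrow> sgn (f x)"
    using borel_measurable_continuous_limit S by blast
  define h where "h n x = clamp 1 (g n x)" for n x
  have hc: "continuous_on UNIV (h n)" for n
    unfolding h_def by (intro continuous_intros g)
  have h1: "\<bar>h n x\<bar> \<le> 1" for n x
    unfolding h_def by (intro clamp_le) simp
  have "(\<lambda>n. LINT x|lebesgue_on S. f x * h n x) \<longlonglongrightarrow> (LINT x|lebesgue_on S. f x * sgn (f x))"
  proof (rule integral_dominated_convergence[where w = "\<lambda>x. \<bar>f x\<bar>"])
    show "AE x in lebesgue_on S. (\<lambda>n. f x * h n x) \<longlonglongrightarrow> f x * sgn (f x)"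
      using g(2)
    proof eventually_elim
      case (elim x)
      have "clamp 1 (sgn (f x)) = sgn (f x)"
        by (intro clamp_id) (simp add: sgn_if)
      then show ?case
        using tendsto_mult[OF tendsto_const tendsto_clamp[OF elim, of 1], of "f x"] by (simp add: h_def)
    qed
    show "AE x in lebesgue_on S. norm (f x * h n x) \<le> \<bar>f x\<bar>" for n
      using h1[of n] by (auto simp: abs_mult mult_left_le)
    show "(\<lambda>x. f x * h n x) \<in> borel_measurable (lebesgue_on S)" for n
      using continuous_lebesgue_on_measurable[OF hc] by measurable
  qed (use f in auto)
  moreover have "(LINT x|lebesgue_on S. f x * h n x) = 0" for n
    using hc h1 by (rule zero)
  ultimately have "(LINT x|lebesgue_on S. f x * sgn (f x)) = 0"
    by (simp only: LIMSEQ_const_iff)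
  moreover have "f x * sgn (f x) = \<bar>f x\<bar>" for x
    by (simp add: abs_sgn)
  ultimately have "(LINT x|lebesgue_on S. \<bar>f x\<bar>) = 0"
    by simp
  then show ?thesis
    using f by (subst (asm) integral_nonneg_eq_0_iff_AE) auto
qed

text \<open>f is truncated at a level k, and continuous functions converging to f almost everywhere
  are clamped at the same level. They are then dominated by a constant, which is integrable over a
  bounded set.\<close>

lemma L2_continuous_approximation:
  fixes f :: "'a::euclidean_space \<Rightarrow> real"
  assumes S: "bounded S" "S \<in> sets lebesgue" and f: "f \<in> L2 (lebesgue_on S)" and "e > 0"
  obtains g where "continuous_on UNIV g" "l2_norm (lebesgue_on S) (\<lambda>x. f x - g x) < e"
proof -
  interpret finite_measure "lebesgue_on S"
    using S by (rule finite_measure_lebesgue_on_bounded)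
  have fm [measurable]: "f \<in> borel_measurable (lebesgue_on S)"
    using f by (rule L2_measurable)
  obtain g where g: "\<And>n :: nat. continuous_on UNIV (g n)"
    "AE x in lebesgue_on S. (\<lambda>n. g n x) \<longlonglongrightarrow> f x"
    using borel_measurable_continuous_limit[OF fm S(2)] by blast
  have "(\<lambda>k. LINT x|lebesgue_on S. (f x - clamp (real k) (f x))\<^sup>2) \<longlonglongrightarrow> (LINT x|lebesgue_on S. 0)"
  proof (rule integral_dominated_convergence[where w = "\<lambda>x. (norm (f x))\<^sup>2"])
    show "AE x in lebesgue_on S. (\<lambda>k. (f x - clamp (real k) (f x))\<^sup>2) \<longlonglongrightarrow> 0"
    proof (rule AE_I2)
      fix x
      obtain N where N: "\<bar>f x\<bar> \<le> real N"
        using real_arch_simple by blast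
      have "\<forall>\<^sub>F k in sequentially. (f x - clamp (real k) (f x))\<^sup>2 = 0"
        using eventually_ge_at_top[of N]
      proof eventually_elim
        case (elim k)
        then have "clamp (real k) (f x) = f x"
          using N by (intro clamp_id) simp
        then show ?case
          by simp
      qed
      then show "(\<lambda>k. (f x - clamp (real k) (f x))\<^sup>2) \<longlonglongrightarrow> 0"
        by (rule tendsto_eventually)
    qed
    show "AE x in lebesgue_on S. norm ((f x - clamp (real k) (f x))\<^sup>2) \<le> (norm (f x))\<^sup>2" for k
    proof (rule AE_I2)
      fix x
      have "\<bar>f x - clamp (real k) (f x)\<bar>\<^sup>2 \<le> \<bar>f x\<bar>\<^sup>2"
        by (intro power_mono clamp_diff_le) auto
      then show "norm ((f x - clamp (real k) (f x))\<^sup>2) \<le> (norm (f x))\<^sup>2"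
        by simp
    qed
    show "integrable (lebesgue_on S) (\<lambda>x. (norm (f x))\<^sup>2)"
      using f by (rule L2_integrable_norm2)
  qed auto
  then have "\<forall>\<^sub>F k in sequentially. (LINT x|lebesgue_on S. (f x - clamp (real k) (f x))\<^sup>2) < (e / 2)\<^sup>2"
    using \<open>e > 0\<close> by (intro order_tendstoD) auto
  then obtain k where k: "(LINT x|lebesgue_on S. (f x - clamp (real k) (f x))\<^sup>2) < (e / 2)\<^sup>2"
    by (auto simp: eventually_sequentially)
  define F where "F x = clamp (real k) (f x)" for x
  define h where "h n x = clamp (real k) (g n x)" for n x
  have Fm [measurable]: "F \<in> borel_measurable (lebesgue_on S)"
    unfolding F_def by measurable
  have hc: "continuous_on UNIV (h n)" for n
    unfolding h_def by (intro continuous_intros g)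
  have hm [measurable]: "h n \<in> borel_measurable (lebesgue_on S)" for n
    using hc by (rule continuous_lebesgue_on_measurable)
  have "(\<lambda>n. LINT x|lebesgue_on S. (F x - h n x)\<^sup>2) \<longlonglongrightarrow> (LINT x|lebesgue_on S. 0)"
  proof (rule integral_dominated_convergence[where w = "\<lambda>x. (2 * real k)\<^sup>2"])
    show "AE x in lebesgue_on S. (\<lambda>n. (F x - h n x)\<^sup>2) \<longlonglongrightarrow> 0"
      using g(2)
    proof eventually_elim
      case (elim x)
      have "(\<lambda>n. (F x - h n x)\<^sup>2) \<longlonglongrightarrow> (F x - clamp (real k) (f x))\<^sup>2"
        unfolding h_def by (intro tendsto_intros tendsto_clamp elim)
      then show ?case
        by (simp add: F_def)
    qed
    show "AE x in lebesgue_on S. norm ((F x - h n x)\<^sup>2) \<le> (2 * real k)\<^sup>2" for n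
    proof (rule AE_I2)
      fix x
      have "\<bar>F x - h n x\<bar> \<le> 2 * real k"
        using clamp_le[of "real k" "f x"] clamp_le[of "real k" "g n x"] by (simp add: F_def h_def)
      then have "\<bar>F x - h n x\<bar>\<^sup>2 \<le> (2 * real k)\<^sup>2"
        by (intro power_mono) auto
      then show "norm ((F x - h n x)\<^sup>2) \<le> (2 * real k)\<^sup>2"
        by simp
    qed
  qed auto
  then have "\<forall>\<^sub>F n in sequentially. (LINT x|lebesgue_on S. (F x - h n x)\<^sup>2) < (e / 2)\<^sup>2"
    using \<open>e > 0\<close> by (intro order_tendstoD) auto
  then obtain n where n: "(LINT x|lebesgue_on S. (F x - h n x)\<^sup>2) < (e / 2)\<^sup>2"
    by (auto simp: eventually_sequentially)
  have norm: "l2_norm (lebesgue_on S) u < e / 2" if "(LINT x|lebesgue_on S. (u x)\<^sup>2) < (e / 2)\<^sup>2" for u :: "'a \<Rightarrow> real"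
  proof (rule power2_less_imp_less)
    show "(l2_norm (lebesgue_on S) u)\<^sup>2 < (e / 2)\<^sup>2"
      using that by (simp add: l2_norm_power2_eq_integral)
  qed (use \<open>e > 0\<close> in simp)
  have FL2: "F \<in> L2 (lebesgue_on S)"
    unfolding F_def by (rule L2_bounded[where B = "real k"]) (auto intro: clamp_le finite_measure_axioms)
  have hL2: "h n \<in> L2 (lebesgue_on S)"
    using S hc by (rule continuous_L2)
  have "l2_norm (lebesgue_on S) (\<lambda>x. (f x - F x) + (F x - h n x))
      \<le> l2_norm (lebesgue_on S) (\<lambda>x. f x - F x) + l2_norm (lebesgue_on S) (\<lambda>x. F x - h n x)"
    by (intro l2_norm_triangle L2_diff f FL2 hL2)
  also have "\<dots> < e / 2 + e / 2"
    using norm[OF n] norm[of "\<lambda>x. f x - F x"] k by (intro add_strict_mono) (auto simp: F_def)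
  finally show thesis
    using that[of "h n"] hc by simp
qed

text \<open>A polynomial times a bump is a test function, and polynomials are uniformly dense in the
  continuous functions on the closure of \<open>E\<close>. So d times the bump is orthogonal to
  every continuous function and vanishes almost everywhere; on the ball the bump is
  positive.\<close>

lemma negligible_if_bump_orthogonal:
  fixes d :: "real^3 \<Rightarrow> real"
  assumes E: "open E" "bounded E" and d: "d \<in> L2 (lebesgue_on E)"
    and orth: "\<And>\<phi>. smooth \<phi> \<Longrightarrow> compactly_supported_in E \<phi> \<Longrightarrow> l2_inner (lebesgue_on E) d \<phi> = 0"
    and R: "R > 0" "cball a R \<subseteq> E"
  shows "negligible ({x \<in> E. d x \<noteq> 0} \<inter> ball a R)"
proof -
  have El: "E \<in> sets lebesgue"
    using E(1) by (intro sets_completionI_sets) simp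
  define f where "f x = d x * bump a R x" for x
  have bc: "continuous_on UNIV (bump a R)"
    by (intro smooth_continuous smooth_bump)
  have fL2: "f \<in> L2 (lebesgue_on E)"
    unfolding f_def
  proof (rule L2_mult_bounded[OF d, where B = 1])
    show "\<bar>bump a R x\<bar> \<le> 1" for x
      using bump_nonneg[of a R x] bump_le_1[of a R x] by simp
  qed (rule continuous_lebesgue_on_measurable[OF bc])
  have f: "integrable (lebesgue_on E) f"
    using finite_measure_lebesgue_on_bounded[OF E(2) El] fL2 by (rule L2_integrable)
  have "AE x in lebesgue_on E. f x = 0"
  proof (rule AE_zero_if_orthogonal_to_continuous[OF f El])
    fix g :: "real^3 \<Rightarrow> real"
    assume g: "continuous_on UNIV g"
    define W where "W = (LINT x|lebesgue_on E. \<bar>f x\<bar>)"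
    have gL2: "g \<in> L2 (lebesgue_on E)"
      using E(2) El g by (rule continuous_L2)
    have "\<bar>LINT x|lebesgue_on E. f x * g x\<bar> \<le> 0 + e" if "e > 0" for e
    proof -
      define e' where "e' = e / (W + 1)"
      have W: "W \<ge> 0"
        by (simp add: W_def)
      then have e': "e' > 0" "W * e' \<le> e"
        using that by (auto simp: e'_def field_simps)
      have "compact (closure E)"
        using E(2) by (simp add: compact_closure)
      then obtain p where p: "real_polynomial_function p" "\<And>x. x \<in> closure E \<Longrightarrow> \<bar>g x - p x\<bar> < e'"
        using Stone_Weierstrass_real_polynomial_function[OF _ continuous_on_subset[OF g subset_UNIV] e'(1)]
        by metis
      have ps: "smooth p"
        using p(1) by (rule smooth_real_polynomial_function)
      have pL2: "p \<in> L2 (lebesgue_on E)"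
        using E(2) El smooth_continuous[OF ps] by (rule continuous_L2)
      have "l2_inner (lebesgue_on E) d (\<lambda>x. p x * bump a R x) = 0"
        using R by (intro orth smooth_mult ps smooth_bump compactly_supported_in_mult_left compactly_supported_bump)
      then have fp: "(LINT x|lebesgue_on E. f x * p x) = 0"
        by (simp add: l2_inner_def f_def mult_ac)
      have ig: "integrable (lebesgue_on E) (\<lambda>x. f x * g x)" and ip: "integrable (lebesgue_on E) (\<lambda>x. f x * p x)"
        using L2_integrable_inner[OF fL2 gL2] L2_integrable_inner[OF fL2 pL2] by simp_all
      have "(LINT x|lebesgue_on E. f x * g x) = (LINT x|lebesgue_on E. f x * g x - f x * p x)"
        using ig ip fp by simp
      also have "\<bar>\<dots>\<bar> \<le> (LINT x|lebesgue_on E. \<bar>f x * g x - f x * p x\<bar>)"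
        by (rule integral_abs_bound)
      also have "\<dots> \<le> (LINT x|lebesgue_on E. \<bar>f x\<bar> * e')"
      proof (rule integral_mono)
        show "\<bar>f x * g x - f x * p x\<bar> \<le> \<bar>f x\<bar> * e'" if "x \<in> space (lebesgue_on E)" for x
        proof -
          have "x \<in> closure E"
            using that closure_subset by auto
          then have "\<bar>f x\<bar> * \<bar>g x - p x\<bar> \<le> \<bar>f x\<bar> * e'"
            using p(2) by (intro mult_left_mono) (auto simp: less_imp_le)
          then show ?thesis
            by (simp add: abs_mult flip: right_diff_distrib)
        qed
      qed (use ig ip f in auto)
      also have "\<dots> \<le> e"
        using e' by (simp add: W_def)
      finally show ?thesis
        by simp
    qed
    then show "(LINT x|lebesgue_on E. f x * g x) = 0"
      using field_le_epsilon[of "\<bar>LINT x|lebesgue_on E. f x * g x\<bar>" 0] by simp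
  qed
  then have "AE x in lebesgue. x \<in> E \<longrightarrow> f x = 0"
    using El by (subst (asm) AE_restrict_space_iff) auto
  then have "AE x in lebesgue. x \<notin> {x \<in> E. d x \<noteq> 0} \<inter> ball a R"
    by eventually_elim (use bump_pos[OF R(1)] in \<open>force simp: f_def\<close>)
  then obtain N where N: "N \<in> null_sets lebesgue"
    "{x \<in> space lebesgue. \<not> x \<notin> {x \<in> E. d x \<noteq> 0} \<inter> ball a R} \<subseteq> N"
    unfolding eventually_ae_filter by blast
  then have "{x \<in> E. d x \<noteq> 0} \<inter> ball a R \<subseteq> N"
    by auto
  then show ?thesis
    using N(1) negligible_subset negligible_iff_null_sets by metis
qed

text \<open>From local to global: around each of its points the set where d is nonzero is
  negligible, and local negligibility implies negligibility.\<close>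

lemma AE_zero_if_orthogonal_to_test_functions:
  fixes d :: "real^3 \<Rightarrow> real"
  assumes E: "open E" "bounded E" and d: "d \<in> L2 (lebesgue_on E)"
    and orth: "\<And>\<phi>. smooth \<phi> \<Longrightarrow> compactly_supported_in E \<phi> \<Longrightarrow> l2_inner (lebesgue_on E) d \<phi> = 0"
  shows "AE x in lebesgue_on E. d x = 0"
proof -
  define Z where "Z = {x \<in> E. d x \<noteq> 0}"
  have "negligible Z"
  proof (rule locally_negligible_alt[THEN iffD2], rule ballI)
    fix x assume x: "x \<in> Z"
    then obtain R where R: "R > 0" "cball x R \<subseteq> E"
      using E(1) by (auto simp: Z_def open_contains_cball)
    have "negligible (Z \<inter> ball x R)"
      unfolding Z_def using negligible_if_bump_orthogonal[OF E d orth R] .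
    moreover have "openin (top_of_set Z) (Z \<inter> ball x R)"
      by (simp add: openin_open_Int)
    moreover have "x \<in> Z \<inter> ball x R"
      using x R by simp
    ultimately show "\<exists>U. openin (top_of_set Z) U \<and> x \<in> U \<and> negligible U"
      by blast
  qed
  then have "AE x in lebesgue. x \<notin> Z"
    by (intro AE_not_in) (simp add: negligible_iff_null_sets)
  then have "AE x in lebesgue. x \<in> E \<longrightarrow> d x = 0"
    by eventually_elim (auto simp: Z_def)
  then show ?thesis
    using E(1) by (subst AE_restrict_space_iff) auto
qed

text \<open>Two square integrable weak divergences have the same pairing with every test function.
  Hence the choice made in \<open>weak_div\<close> may be exchanged for the polynomial divergence
  under integrals.\<close>

lemma weak_div_AE_eq:
  assumes E: "open E" "bounded E" and d: "d \<in> L2 (lebesgue_on E)" "has_weak_div E v d"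
  shows "weak_div E v \<in> L2 (lebesgue_on E)" "AE x in lebesgue_on E. weak_div E v x = d x"
proof -
  have *: "weak_div E v \<in> L2 (lebesgue_on E) \<and> has_weak_div E v (weak_div E v)"
    unfolding weak_div_def by (rule someI[of _ d]) (use d in blast)
  then show wL2: "weak_div E v \<in> L2 (lebesgue_on E)"
    by blast
  have "AE x in lebesgue_on E. weak_div E v x - d x = 0"
  proof (rule AE_zero_if_orthogonal_to_test_functions[OF E L2_diff[OF wL2 d(1)]])
    fix \<phi> assume \<phi>: "smooth \<phi>" "compactly_supported_in E \<phi>"
    have "\<phi> \<in> L2 (lebesgue_on E)"
      using E \<phi>(1) by (intro continuous_L2 smooth_continuous) auto
    moreover have "l2_inner (lebesgue_on E) (weak_div E v) \<phi> = l2_inner (lebesgue_on E) d \<phi>"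
      using * d(2) \<phi> unfolding has_weak_div_def by (metis neg_equal_iff_equal)
    ultimately show "l2_inner (lebesgue_on E) (\<lambda>x. weak_div E v x - d x) \<phi> = 0"
      using wL2 d(1) by (simp add: l2_inner_diff_left)
  qed
  then show "AE x in lebesgue_on E. weak_div E v x = d x"
    by simp
qed

section \<open>Orthonormal coordinates adapted to a plane\<close>

text \<open>Lebesgue measure is characterized by its values on boxes, and the preimage of a box is
  its image under the inverse orthogonal map, which preserves volume.\<close>

lemma lborel_distr_orthogonal_transformation:
  fixes Q :: "real^3 \<Rightarrow> real^3"
  assumes Q: "orthogonal_transformation Q"
  shows "distr lborel borel Q = lborel"
proof (rule lborel_eqI[symmetric])
  obtain P where P: "orthogonal_transformation P" "\<And>x. P (Q x) = x" "\<And>x. Q (P x) = x"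
    using Q orthogonal_transformation_inv orthogonal_transformation_bij
    by (metis bij_inv_eq_iff)
  have Qm: "Q \<in> borel_measurable borel"
    using Q by (intro borel_measurable_continuous_onI linear_continuous_on
        linear_conv_bounded_linear[THEN iffD1] orthogonal_transformation_linear)
  fix l u :: "real^3"
  assume lu: "\<And>b. b \<in> Basis \<Longrightarrow> l \<bullet> b \<le> u \<bullet> b"
  have vim: "Q -` box l u = P ` box l u"
  proof (intro equalityI subsetI)
    fix x assume "x \<in> Q -` box l u"
    then show "x \<in> P ` box l u"
      using P(2)[of x] by (metis imageI vimageE)
  next
    fix x assume "x \<in> P ` box l u"
    then show "x \<in> Q -` box l u"
      using P(3) by auto
  qed
  have "emeasure (distr lborel borel Q) (box l u) = emeasure lborel (Q -` box l u)"
    using Qm by (subst emeasure_distr) auto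
  also have "Q -` box l u \<in> sets borel"
    using measurable_sets[OF Qm, of "box l u"] by simp
  then have "emeasure lborel (Q -` box l u) = emeasure lebesgue (P ` box l u)"
    by (simp add: vim)
  also have "\<dots> = ennreal (measure lebesgue (P ` box l u))"
    using measurable_orthogonal_image[OF P(1) lmeasurable_box, of l u]
    by (intro emeasure_eq_measure2)
  also have "\<dots> = ennreal (measure lebesgue (box l u))"
    using measure_orthogonal_image[OF P(1) lmeasurable_box, of l u] by simp
  also have "\<dots> = ennreal (\<Prod>b\<in>Basis. (u - l) \<bullet> b)"
    using lu by (simp add: measure_lborel_box_eq)
  finally show "emeasure (distr lborel borel Q) (box l u) = ennreal (\<Prod>b\<in>Basis. (u - l) \<bullet> b)" .
qed simp

locale plane_chart =
  fixes a :: "real^3" and L :: "real^2 \<Rightarrow> real^3"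
  assumes L_linear: "linear L" and L_norm: "\<And>y. norm (L y) = norm y"
begin

definition T :: "real^2 \<Rightarrow> real^3" where "T y = a + L y"

lemma L_inner: "L x \<bullet> L y = x \<bullet> y"
proof -
  have "(norm (L (x + y)))\<^sup>2 = (norm (x + y))\<^sup>2"
    by (simp add: L_norm)
  then have "(norm (L x + L y))\<^sup>2 = (norm (x + y))\<^sup>2"
    using linear_add[OF L_linear] by simp
  then have "(norm (L x))\<^sup>2 + 2 * (L x \<bullet> L y) + (norm (L y))\<^sup>2 = (norm x)\<^sup>2 + 2 * (x \<bullet> y) + (norm y)\<^sup>2"
    unfolding power2_norm_eq_inner by (simp add: algebra_simps inner_commute)
  then show ?thesis
    by (simp add: L_norm)
qed

lemma L_continuous: "continuous_on S L"
  using L_linear by (simp add: linear_continuous_on linear_conv_bounded_linear)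

lemma T_continuous: "continuous_on S T"
  unfolding T_def by (intro continuous_intros L_continuous)

lemma T_measurable [measurable]: "T \<in> borel_measurable borel"
  by (intro borel_measurable_continuous_onI T_continuous)

lemma L_measurable [measurable]: "L \<in> borel_measurable borel"
  by (intro borel_measurable_continuous_onI L_continuous)

lemma dist_T: "dist (T x) (T y) = dist x y"
  using L_norm[of "x - y"] linear_diff[OF L_linear] by (simp add: T_def dist_norm)

lemma inj_T: "inj T"
  by (metis dist_T dist_eq_0_iff injI)

definition normal :: "real^3" where "normal = cross3 (L (axis 1 1)) (L (axis 2 1))"

lemma norm_normal: "norm normal = 1"
proof -
  have "(norm normal)\<^sup>2 = 1"
    unfolding normal_def norm_cross
    by (simp add: L_norm L_inner inner_axis_axis)
  then show ?thesis
    by (simp add: power2_eq_1_iff) (smt (verit) norm_ge_zero)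
qed

lemma L_expand: "L w = w $ 1 *\<^sub>R L (axis 1 1) + w $ 2 *\<^sub>R L (axis 2 1)"
proof -
  have "w = w $ 1 *\<^sub>R axis 1 1 + w $ 2 *\<^sub>R axis 2 1"
    by (simp add: vec_eq_iff axis_def forall_2)
  then have "L w = L (w $ 1 *\<^sub>R axis 1 1 + w $ 2 *\<^sub>R axis 2 1)"
    by simp
  then show ?thesis
    using linear_add[OF L_linear] linear_scale[OF L_linear] by simp
qed

lemma normal_inner_L: "normal \<bullet> L w = 0"
  by (subst L_expand) (simp add: inner_add_right normal_def dot_cross_self)

text \<open>Completes the isometry \<open>L\<close> of the plane to an orthogonal map of space,
  sending the third axis to the unit normal.\<close>

definition Q :: "real^3 \<Rightarrow> real^3" where
  "Q x = x $ 1 *\<^sub>R L (axis 1 1) + x $ 2 *\<^sub>R L (axis 2 1) + x $ 3 *\<^sub>R normal"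

lemma orthogonal_transformation_Q: "orthogonal_transformation Q"
  unfolding orthogonal_transformation
proof
  show "linear Q"
    unfolding Q_def by (rule linearI) (simp_all add: algebra_simps)
  have n: "normal \<bullet> normal = 1"
    using norm_normal by (simp add: norm_eq_sqrt_inner)
  show "\<forall>x. norm (Q x) = norm x"
  proof
    fix x
    define e d where "e = L (axis 1 1)" and "d = L (axis 2 1)"
    have ed: "e \<bullet> e = 1" "d \<bullet> d = 1" "e \<bullet> d = 0" "d \<bullet> e = 0"
      "normal \<bullet> e = 0" "normal \<bullet> d = 0" "e \<bullet> normal = 0" "d \<bullet> normal = 0"
      using normal_inner_L by (simp_all add: e_def d_def L_inner inner_axis_axis inner_commute[of _ normal])
    have "Q x \<bullet> Q x = (x $ 1)\<^sup>2 + (x $ 2)\<^sup>2 + (x $ 3)\<^sup>2"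
      unfolding Q_def e_def[symmetric] d_def[symmetric]
      by (simp add: inner_add_left inner_add_right ed n power2_eq_square)
    then have "Q x \<bullet> Q x = x \<bullet> x"
      by (simp add: inner_vec_def sum_3 power2_eq_square)
    then show "norm (Q x) = norm x"
      by (simp add: norm_eq_sqrt_inner)
  qed
qed

lemma decompose:
  obtains w where "z = L w + (normal \<bullet> z) *\<^sub>R normal"
proof -
  obtain x where x: "z = Q x"
    using orthogonal_transformation_surj[OF orthogonal_transformation_Q] by (metis surjD)
  define w :: "real^2" where "w = vector [x $ 1, x $ 2]"
  have z: "z = L w + x $ 3 *\<^sub>R normal"
    by (subst L_expand) (simp add: x Q_def w_def)
  have "normal \<bullet> normal = 1"
    using norm_normal by (simp add: norm_eq_sqrt_inner)
  then have "normal \<bullet> z = x $ 3"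
    by (simp add: z inner_add_right normal_inner_L)
  then show thesis
    using that z by metis
qed

end

lemma prod_UNIV_3: "(\<Prod>i\<in>UNIV. f i) = f 1 * f 2 * f (3 :: 3)"
  unfolding UNIV_3 by (simp add: mult.assoc)

definition vector_of_pair :: "(real^2) \<times> real \<Rightarrow> real^3" where
  "vector_of_pair x = vector [fst x $ 1, fst x $ 2, snd x]"

lemma vector_of_pair_measurable [measurable]: "vector_of_pair \<in> borel_measurable (lborel \<Otimes>\<^sub>M lborel)"
proof -
  have "vector_of_pair = (\<lambda>x. (fst x $ 1) *\<^sub>R axis 1 1 + (fst x $ 2) *\<^sub>R axis 2 1 + snd x *\<^sub>R axis 3 1)"
    by (simp add: vector_of_pair_def fun_eq_iff vec_eq_iff forall_3 axis_def)
  moreover have "continuous_on UNIV (\<lambda>x :: (real^2) \<times> real.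
      (fst x $ 1) *\<^sub>R axis 1 1 + (fst x $ 2) *\<^sub>R axis 2 1 + snd x *\<^sub>R (axis 3 1 :: real^3))"
    by (intro continuous_intros)
  ultimately have "continuous_on UNIV vector_of_pair"
    by (simp only:)
  then have "vector_of_pair \<in> borel_measurable borel"
    by (rule borel_measurable_continuous_onI)
  then show ?thesis
    by (simp add: lborel_prod)
qed

lemma lborel_distr_vector_of_pair: "distr (lborel \<Otimes>\<^sub>M lborel) borel vector_of_pair = lborel"
proof (rule lborel_eqI[symmetric])
  fix l u :: "real^3"
  assume lu: "\<And>b. b \<in> Basis \<Longrightarrow> l \<bullet> b \<le> u \<bullet> b"
  then have lu': "l $ i \<le> u $ i" for i
    using lu[of "axis i 1"] by (simp add: inner_axis)
  define B where "B = box (vector [l $ 1, l $ 2] :: real^2) (vector [u $ 1, u $ 2])"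
  have "vector_of_pair -` box l u = B \<times> box (l $ 3) (u $ 3)"
    by (auto simp: vector_of_pair_def B_def mem_box_cart forall_3 forall_2)
  then have "emeasure (distr (lborel \<Otimes>\<^sub>M lborel) borel vector_of_pair) (box l u)
      = emeasure (lborel \<Otimes>\<^sub>M lborel) (B \<times> box (l $ 3) (u $ 3))"
    by (subst emeasure_distr) (auto simp: space_pair_measure)
  also have "\<dots> = emeasure lborel B * emeasure lborel (box (l $ 3) (u $ 3))"
    unfolding B_def by (rule lborel.emeasure_pair_measure_Times) auto
  also have "emeasure lborel B = ennreal ((u $ 1 - l $ 1) * (u $ 2 - l $ 2))"
    unfolding B_def using lu' by (subst emeasure_lborel_box_eq)
      (auto simp: Basis_vec_def UNIV_2 inner_axis forall_2 axis_eq_axis)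
  also have "emeasure lborel (box (l $ 3) (u $ 3)) = ennreal (u $ 3 - l $ 3)"
    using lu' by simp
  also have "ennreal ((u $ 1 - l $ 1) * (u $ 2 - l $ 2)) * ennreal (u $ 3 - l $ 3)
      = ennreal (\<Prod>b\<in>Basis. (u - l) \<bullet> b)"
  proof -
    have B: "Basis = (\<lambda>i. axis i 1 :: real^3) ` UNIV"
      by (auto simp: Basis_vec_def)
    have "inj (\<lambda>i. axis i 1 :: real^3)"
      by (auto simp: inj_def axis_eq_axis)
    then have "(\<Prod>b\<in>Basis. (u - l) \<bullet> b) = (\<Prod>i\<in>UNIV. u $ i - l $ i)"
      unfolding B by (simp add: prod.reindex inner_axis)
    also have "\<dots> = (u $ 1 - l $ 1) * (u $ 2 - l $ 2) * (u $ 3 - l $ 3)"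
      unfolding prod_UNIV_3 ..
    finally show ?thesis
      using lu' by (simp add: ennreal_mult)
  qed
  finally show "emeasure (distr (lborel \<Otimes>\<^sub>M lborel) borel vector_of_pair) (box l u)
      = ennreal (\<Prod>b\<in>Basis. (u - l) \<bullet> b)" .
qed simp

context plane_chart
begin

text \<open>Translations and the orthogonal map \<open>Q\<close> preserve volume, so Fubini slices
  space parallel to the plane. The origin b of the slicing is free; it is a point of the plane in
  one application and the apex of a cone in another.\<close>

lemma nn_integral_coordinates:
  assumes [measurable]: "f \<in> borel_measurable borel"
  shows "(\<integral>\<^sup>+z. f z \<partial>lborel) = (\<integral>\<^sup>+t. \<integral>\<^sup>+w. f (b + L w + t *\<^sub>R normal) \<partial>lborel \<partial>lborel)"
proof -
  have Qm [measurable]: "Q \<in> borel_measurable borel"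
    using orthogonal_transformation_Q by (intro borel_measurable_continuous_onI linear_continuous_on
        linear_conv_bounded_linear[THEN iffD1] orthogonal_transformation_linear)
  have QV: "Q (vector_of_pair x) = L (fst x) + snd x *\<^sub>R normal" for x
    by (subst L_expand) (simp add: Q_def vector_of_pair_def)
  have "(\<integral>\<^sup>+z. f z \<partial>lborel) = (\<integral>\<^sup>+z. f (b + z) \<partial>lborel)"
    by (subst lborel_distr_plus[of b, symmetric]) (simp add: nn_integral_distr)
  also have "\<dots> = (\<integral>\<^sup>+z. f (b + Q z) \<partial>lborel)"
    by (subst lborel_distr_orthogonal_transformation[OF orthogonal_transformation_Q, symmetric])
       (simp add: nn_integral_distr)
  also have "\<dots> = (\<integral>\<^sup>+x. f (b + Q (vector_of_pair x)) \<partial>(lborel \<Otimes>\<^sub>M lborel))"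
    by (subst lborel_distr_vector_of_pair[symmetric], subst nn_integral_distr) simp_all
  also have "\<dots> = (\<integral>\<^sup>+x. f (b + L (fst x) + snd x *\<^sub>R normal) \<partial>(lborel \<Otimes>\<^sub>M lborel))"
    by (intro nn_integral_cong) (auto simp: QV add.assoc)
  also have "\<dots> = (\<integral>\<^sup>+t. \<integral>\<^sup>+w. f (b + L w + t *\<^sub>R normal) \<partial>lborel \<partial>lborel)"
    by (subst lborel_pair.nn_integral_snd[symmetric]) simp_all
  finally show ?thesis .
qed

text \<open>Polar-type coordinates with apex c, in which t = 1 is the plane. In the Jacobian, |H|
  comes from the height t H above c and t^2 from scaling the two-dimensional slice.\<close>

lemma nn_integral_cone:
  assumes f [measurable]: "f \<in> borel_measurable borel" and H: "H = normal \<bullet> (a - c)" "H \<noteq> 0"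
  shows "(\<integral>\<^sup>+z. f z \<partial>lborel)
    = (\<integral>\<^sup>+t. \<integral>\<^sup>+w. ennreal (\<bar>H\<bar> * t\<^sup>2) * f (c + t *\<^sub>R (T w - c)) \<partial>lborel \<partial>lborel)"
proof -
  \<comment> \<open>w0 is the tangential part of a - c. Substituting t (w0 + w) for the slice
    variable matches the slice at height t H with the plane contracted by t towards c.\<close>
  obtain w0 where w0: "a - c = L w0 + H *\<^sub>R normal"
    using decompose[of "a - c"] H(1) by metis
  have inner: "(\<integral>\<^sup>+w. f (c + L w + (t * H) *\<^sub>R normal) \<partial>lborel)
      = (\<integral>\<^sup>+w. ennreal (t\<^sup>2) * f (c + t *\<^sub>R (T w - c)) \<partial>lborel)" if "t \<noteq> 0" for t
  proof -
    have "(\<integral>\<^sup>+w. f (c + L w + (t * H) *\<^sub>R normal) \<partial>lborel)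
        = ennreal (\<bar>t\<bar> ^ DIM(real^2)) * (\<integral>\<^sup>+w. f (c + L (t *\<^sub>R w0 + t *\<^sub>R w) + (t * H) *\<^sub>R normal) \<partial>lborel)"
      using that by (intro nn_integral_lborel_affine) auto
    also have "\<dots> = (\<integral>\<^sup>+w. ennreal (t\<^sup>2) * f (c + L (t *\<^sub>R w0 + t *\<^sub>R w) + (t * H) *\<^sub>R normal) \<partial>lborel)"
      by (simp add: nn_integral_cmult)
    also have "\<dots> = (\<integral>\<^sup>+w. ennreal (t\<^sup>2) * f (c + t *\<^sub>R (T w - c)) \<partial>lborel)"
    proof (intro nn_integral_cong)
      fix w
      have "T w - c = (a - c) + L w"
        by (simp add: T_def)
      then have "T w - c = L w0 + H *\<^sub>R normal + L w"
        unfolding w0 .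
      then have "c + t *\<^sub>R (T w - c) = c + L (t *\<^sub>R w0 + t *\<^sub>R w) + (t * H) *\<^sub>R normal"
        using linear_add[OF L_linear] linear_scale[OF L_linear] by (simp add: algebra_simps)
      then have eq: "f (c + L (t *\<^sub>R w0 + t *\<^sub>R w) + (t * H) *\<^sub>R normal) = f (c + t *\<^sub>R (T w - c))"
        by (rule arg_cong[symmetric])
      show "ennreal (t\<^sup>2) * f (c + L (t *\<^sub>R w0 + t *\<^sub>R w) + (t * H) *\<^sub>R normal)
          = ennreal (t\<^sup>2) * f (c + t *\<^sub>R (T w - c))"
        by (simp only: eq)
    qed
    finally show ?thesis .
  qed
  have "(\<integral>\<^sup>+z. f z \<partial>lborel) = (\<integral>\<^sup>+t. \<integral>\<^sup>+w. f (c + L w + t *\<^sub>R normal) \<partial>lborel \<partial>lborel)"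
    by (rule nn_integral_coordinates[OF f])
  also have "\<dots> = ennreal (\<bar>H\<bar> ^ DIM(real)) *
      (\<integral>\<^sup>+t. \<integral>\<^sup>+w. f (c + L w + (0 + H *\<^sub>R t) *\<^sub>R normal) \<partial>lborel \<partial>lborel)"
    using H(2) by (intro nn_integral_lborel_affine) measurable
  also have "\<dots> = (\<integral>\<^sup>+t. ennreal \<bar>H\<bar> * (\<integral>\<^sup>+w. f (c + L w + (t * H) *\<^sub>R normal) \<partial>lborel) \<partial>lborel)"
    by (subst nn_integral_cmult) (simp_all add: mult.commute)
  also have "\<dots> = (\<integral>\<^sup>+t. \<integral>\<^sup>+w. ennreal (\<bar>H\<bar> * t\<^sup>2) * f (c + t *\<^sub>R (T w - c)) \<partial>lborel \<partial>lborel)"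
  proof (rule nn_integral_cong_AE)
    have "AE t in lborel. t \<noteq> (0 :: real)"
      by (rule AE_lborel_singleton)
    then show "AE t in lborel. ennreal \<bar>H\<bar> * (\<integral>\<^sup>+w. f (c + L w + (t * H) *\<^sub>R normal) \<partial>lborel)
        = (\<integral>\<^sup>+w. ennreal (\<bar>H\<bar> * t\<^sup>2) * f (c + t *\<^sub>R (T w - c)) \<partial>lborel)"
    proof eventually_elim
      case (elim t)
      show ?case
        unfolding inner[OF elim] by (subst nn_integral_cmult[symmetric]) (simp_all add: ennreal_mult mult.assoc)
    qed
  qed
  finally show ?thesis .
qed

end

section \<open>Area measure on a face\<close>

lemma isometric_chart_exists:
  assumes "affine P" "aff_dim P = 2"
  shows "\<exists>T. isometric_chart T P"
proof -
  have "P \<noteq> {}"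
    using assms(2) by auto
  then obtain a where a: "a \<in> P"
    by blast
  define S where "S = (\<lambda>x. x - a) ` P"
  have S: "subspace S"
    using affine_diffs_subspace_subtract[OF assms(1) a] by (simp add: S_def)
  have "dim S = 2"
  proof -
    have "aff_dim P = int (dim ((+) (- a) ` P))"
      using aff_dim_eq_dim_subtract[of a P] a hull_inc[of a P affine] by (simp add: image_def)
    moreover have "(+) (- a) ` P = S"
      by (auto simp: S_def)
    ultimately show ?thesis
      using assms(2) by simp
  qed
  then have "dim (UNIV :: (real^2) set) = dim S"
    by simp
  then obtain L :: "real^2 \<Rightarrow> real^3" where L: "linear L" "L ` UNIV = S" "\<And>x. norm (L x) = norm x"
    using isometry_subspaces[OF subspace_UNIV S] by (metis UNIV_I)
  have "range (\<lambda>y. a + L y) = P"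
  proof -
    have "range (\<lambda>y. a + L y) = (+) a ` S"
      using L(2) by (auto simp: image_iff)
    also have "\<dots> = P"
      by (auto simp: S_def image_iff)
    finally show ?thesis .
  qed
  then show ?thesis
    unfolding isometric_chart_def using L(1,3) by blast
qed

text \<open>The chart fixed here is the very one that \<open>SOME\<close> selects inside
  \<open>area_on\<close>, so that area integrals are plane integrals by definition.\<close>

locale face_chart = plane_chart +
  fixes F :: "(real^3) set"
  assumes F_compact: "compact F"
    and range_T: "range T = affine hull F"
    and area_on_eq: "area_on F = embed_measure (lebesgue_on (T -` F)) T"
begin

lemma F_range: "F \<subseteq> range T"
  using range_T hull_subset[of F affine] by blast

lemma closed_vimage: "closed (T -` F)"
proof (rule continuous_closed_vimage[OF compact_imp_closed[OF F_compact]])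
  show "isCont T x" for x
    using T_continuous[of UNIV] by (simp add: continuous_on_eq_continuous_at)
qed

lemma bounded_vimage: "bounded (T -` F)"
proof (cases "T -` F = {}")
  case False
  then obtain w where w: "T w \<in> F"
    by blast
  obtain K where K: "\<And>x. x \<in> F \<Longrightarrow> dist (T w) x \<le> K"
    using compact_imp_bounded[OF F_compact] unfolding bounded_any_center[of F "T w"] by blast
  have "T -` F \<subseteq> cball w K"
  proof
    fix x assume "x \<in> T -` F"
    then show "x \<in> cball w K"
      using K[of "T x"] dist_T[of w x] by simp
  qed
  then show ?thesis
    using bounded_subset bounded_cball by metis
qed simp

lemma vimage_lebesgue: "T -` F \<in> sets lebesgue"
  using closed_vimage by (intro sets_completionI_sets) simp

lemma vimage_borel: "T -` F \<in> sets borel"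
  using closed_vimage by simp

lemma finite_measure_vimage: "finite_measure (lebesgue_on (T -` F))"
  using bounded_vimage vimage_lebesgue by (rule finite_measure_lebesgue_on_bounded)

lemma measurable_area_iff:
  fixes f :: "real^3 \<Rightarrow> 'b::euclidean_space"
  shows "f \<in> borel_measurable (area_on F) \<longleftrightarrow> (\<lambda>w. f (T w)) \<in> borel_measurable (lebesgue_on (T -` F))"
  unfolding area_on_eq
  using measurable_compose[OF measurable_embed_measure2[OF inj_T]] measurable_embed_measure1 by blast

lemma integral_area:
  fixes f :: "real^3 \<Rightarrow> real"
  assumes "f \<in> borel_measurable (area_on F)"
  shows "(LINT x|area_on F. f x) = (LINT w|lebesgue_on (T -` F). f (T w))"
  using assms unfolding area_on_eq
  by (subst embed_measure_eq_distr[OF inj_T])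
     (simp add: integral_distr[OF measurable_embed_measure2[OF inj_T]])

lemma integrable_area_iff:
  fixes f :: "real^3 \<Rightarrow> real"
  assumes "f \<in> borel_measurable (area_on F)"
  shows "integrable (area_on F) f \<longleftrightarrow> integrable (lebesgue_on (T -` F)) (\<lambda>w. f (T w))"
  using assms unfolding area_on_eq
  by (subst embed_measure_eq_distr[OF inj_T])
     (simp add: integrable_distr_eq[OF measurable_embed_measure2[OF inj_T]])

lemma AE_area_iff: "(AE x in area_on F. P x) \<longleftrightarrow> (AE w in lebesgue_on (T -` F). P (T w))"
  unfolding area_on_eq by (rule AE_embed_measure[OF inj_T])

lemma space_area: "space (area_on F) = F"
  unfolding area_on_eq space_embed_measure using F_range by auto

lemma L2_area_iff:
  fixes f :: "real^3 \<Rightarrow> real"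
  shows "f \<in> L2 (area_on F) \<longleftrightarrow> (\<lambda>w. f (T w)) \<in> L2 (lebesgue_on (T -` F))"
proof (cases "f \<in> borel_measurable (area_on F)")
  case True
  then have "(\<lambda>x. (norm (f x))\<^sup>2) \<in> borel_measurable (area_on F)"
    by measurable
  then show ?thesis
    using True integrable_area_iff measurable_area_iff[of f] by (simp add: L2_def)
next
  case False
  then show ?thesis
    using measurable_area_iff[of f] by (simp add: L2_def)
qed

lemma l2_inner_area:
  fixes f g :: "real^3 \<Rightarrow> real"
  assumes "f \<in> borel_measurable (area_on F)" "g \<in> borel_measurable (area_on F)"
  shows "l2_inner (area_on F) f g = l2_inner (lebesgue_on (T -` F)) (\<lambda>w. f (T w)) (\<lambda>w. g (T w))"
  unfolding l2_inner_def using assms by (intro integral_area) measurable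

lemma continuous_L2_area:
  fixes f :: "real^3 \<Rightarrow> real"
  assumes "continuous_on UNIV f"
  shows "f \<in> L2 (area_on F)"
  unfolding L2_area_iff
  by (intro continuous_L2 bounded_vimage vimage_lebesgue continuous_on_compose2[OF assms T_continuous]) auto

lemma finite_measure_area: "finite_measure (area_on F)"
proof -
  interpret finite_measure "lebesgue_on (T -` F)"
    by (rule finite_measure_vimage)
  have "T \<in> measurable (lebesgue_on (T -` F)) (embed_measure (lebesgue_on (T -` F)) T)"
    by (rule measurable_embed_measure2[OF inj_T])
  then show ?thesis
    unfolding area_on_eq by (subst embed_measure_eq_distr[OF inj_T]) (rule finite_measure_distr)
qed

end

lemma face_chart_exists:
  assumes "compact F" "aff_dim F = 2"
  obtains a L where "face_chart a L F"
proof -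
  define U where "U = (SOME T. isometric_chart T (affine hull F))"
  have "isometric_chart U (affine hull F)"
  proof -
    have "aff_dim (affine hull F) = 2"
      using assms(2) by simp
    from someI_ex[OF isometric_chart_exists[OF affine_affine_hull this]] show ?thesis
      unfolding U_def .
  qed
  then obtain a L where L: "linear L" "\<And>y. norm (L y) = norm y" "U = (\<lambda>y. a + L y)" "range U = affine hull F"
    unfolding isometric_chart_def by blast
  have "plane_chart L"
    by (rule plane_chart.intro) (use L in auto)
  then interpret plane_chart a L .
  have U: "U = T"
    by (simp add: L(3) T_def fun_eq_iff)
  have "area_on F = embed_measure (lebesgue_on (U -` F)) U"
    by (simp add: area_on_def U_def Let_def)
  then have "face_chart a L F"
    using L(4) assms(1) \<open>plane_chart L\<close> unfolding U
    by (intro face_chart.intro face_chart_axioms.intro)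
  then show thesis
    by (rule that)
qed

section \<open>Geometry of star-shaped polyhedra\<close>

text \<open>x is only a limit point of \<open>E\<close>. It is replaced by a nearby x' in
  \<open>E\<close>, and the apex b is shifted to b' so that the same intermediate point lies on the
  segment from b' to x'; the ball leaves room for the shift.\<close>

lemma star_shaped_open_segment:
  fixes E :: "'a::real_normed_vector set"
  assumes star: "star_shaped_wrt E (ball c r)" and b: "b \<in> ball c r"
    and x: "x \<in> closure E" and t: "0 \<le> t" "t < 1"
  shows "b + t *\<^sub>R (x - b) \<in> E"
proof -
  define y where "y = b + t *\<^sub>R (x - b)"
  obtain e where e: "e > 0" "ball b e \<subseteq> ball c r"
    using b open_ball open_contains_ball by metis
  \<comment> \<open>The apex moves by t / (1 - t) times |x - x'|, which this choice keeps at most e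
    t / (t + 1) and hence below e.\<close>
  define d where "d = e * (1 - t) / (t + 1)"
  have d: "d > 0"
    using e t by (simp add: d_def)
  obtain x' where x': "x' \<in> E" "dist x' x < d"
    using x d closure_approachable by blast
  define b' where "b' = (1 / (1 - t)) *\<^sub>R (y - t *\<^sub>R x')"
  have y: "y = b' + t *\<^sub>R (x' - b')"
  proof -
    have "b' + t *\<^sub>R (x' - b') = (1 - t) *\<^sub>R b' + t *\<^sub>R x'"
      by (simp add: algebra_simps)
    then show ?thesis
      using t by (simp add: b'_def)
  qed
  have "b' - b = (t / (1 - t)) *\<^sub>R (x - x')"
  proof -
    have "(1 - t) *\<^sub>R b' = y - t *\<^sub>R x'"
      using t by (simp add: b'_def)
    then have "(1 - t) *\<^sub>R (b' - b) = t *\<^sub>R (x - x')"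
      by (simp add: y_def algebra_simps)
    then have "(1 / (1 - t)) *\<^sub>R ((1 - t) *\<^sub>R (b' - b)) = (1 / (1 - t)) *\<^sub>R (t *\<^sub>R (x - x'))"
      by simp
    then show ?thesis
      using t by simp
  qed
  then have "norm (b' - b) = t / (1 - t) * norm (x' - x)"
    using t by (simp add: norm_minus_commute)
  also have "\<dots> \<le> t / (1 - t) * d"
    using x'(2) t by (intro mult_left_mono) (auto simp: dist_norm)
  also have "\<dots> = e * (t / (t + 1))"
    using t by (simp add: d_def)
  also have "\<dots> < e * 1"
    using t e by (intro mult_strict_left_mono) auto
  finally have "b' \<in> ball c r"
    using e by (auto simp: dist_norm norm_minus_commute)
  then have "closed_segment b' x' \<subseteq> E"
    using star x'(1) by (auto simp: star_shaped_wrt_def)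
  moreover have "y \<in> closed_segment b' x'"
    using t y by (auto simp: closed_segment_def algebra_simps intro!: exI[of _ t])
  ultimately show ?thesis
    by (auto simp: y_def)
qed

text \<open>A ray from c meets the frontier only once: everything strictly before a frontier point
  lies in the open set \<open>E\<close>. Both the description of the frontier near a face and the
  disjointness of cones over faces depend on this.\<close>

lemma star_shaped_frontier_unique:
  fixes E :: "'a::real_normed_vector set"
  assumes "open E" and star: "star_shaped_wrt E (ball c r)" and "r > 0"
    and x: "x \<in> frontier E" and y: "c + t *\<^sub>R (x - c) \<in> frontier E" and t: "t \<ge> 0"
  shows "t = 1"
proof -
  have notE: "z \<notin> E" "z \<in> closure E" if "z \<in> frontier E" for z
    using that assms(1) by (auto simp: frontier_def interior_open)
  have c: "c \<in> ball c r"
    using assms(3) by simp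
  show ?thesis
  proof (rule linorder_cases[of t 1])
    assume "t < 1"
    then show ?thesis
      using star_shaped_open_segment[OF star c notE(2)[OF x] t] notE(1)[OF y] by blast
  next
    assume "t > 1"
    then have "c + (1 / t) *\<^sub>R (c + t *\<^sub>R (x - c) - c) \<in> E"
      by (intro star_shaped_open_segment[OF star c notE(2)[OF y]]) auto
    then show ?thesis
      using \<open>t > 1\<close> notE(1)[OF x] by simp
  qed
qed

locale star_polyhedron =
  fixes E :: "(real^3) set" and Fs :: "(real^3) set set" and edges :: "(real^3) set \<Rightarrow> (real^3) set set"
    and c :: "real^3" and r :: real
  assumes polyhedral: "polyhedral_domain E Fs edges"
    and star: "star_shaped_wrt E (ball c r)" and r_pos: "r > 0"
begin

lemma E_open: "open E" and E_bounded: "bounded E" and E_nonempty: "E \<noteq> {}"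
  and Fs_finite: "finite Fs" and Fs_Union: "\<Union>Fs = frontier E"
  using polyhedral by (auto simp: polyhedral_domain_def)

lemma E_lebesgue: "E \<in> sets lebesgue"
  using E_open by (intro sets_completionI_sets) simp

lemma face_polygon: "F \<in> Fs \<Longrightarrow> polygon_with_edges F (edges F)"
  using polyhedral by (auto simp: polyhedral_domain_def)

lemma face_compact: "F \<in> Fs \<Longrightarrow> compact F" and face_aff_dim: "F \<in> Fs \<Longrightarrow> aff_dim F = 2"
  and face_edges: "F \<in> Fs \<Longrightarrow> \<Union>(edges F) = rel_frontier F"
  using face_polygon by (auto simp: polygon_with_edges_def)

lemma face_disjoint: "F \<in> Fs \<Longrightarrow> F' \<in> Fs \<Longrightarrow> F \<noteq> F' \<Longrightarrow> rel_interior F \<inter> F' = {}"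
  using polyhedral by (auto simp: polyhedral_domain_def)

lemma face_subset_frontier: "F \<in> Fs \<Longrightarrow> F \<subseteq> frontier E"
  using Fs_Union by blast

lemma center_ball_subset: "ball c r \<subseteq> E"
  using star by (simp add: star_shaped_wrt_def)

lemma frontier_not_in_E: "z \<in> frontier E \<Longrightarrow> z \<notin> E" and frontier_in_closure: "z \<in> frontier E \<Longrightarrow> z \<in> closure E"
  using E_open by (auto simp: frontier_def interior_open)

text \<open>If the plane contained a point b of the ball, a point of the disk moved slightly from x
  towards b would still belong to the face, hence to the frontier. It also lies strictly between b
  and a point of the closure, hence in \<open>E\<close>.\<close>

lemma plane_avoids_ball:
  assumes F: "F \<in> Fs" and disk: "x \<in> F" "s > 0" "ball x s \<inter> affine hull F \<subseteq> F"
  shows "affine hull F \<inter> ball c r = {}"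
proof (rule ccontr)
  assume "affine hull F \<inter> ball c r \<noteq> {}"
  then obtain b where b: "b \<in> affine hull F" "b \<in> ball c r"
    by blast
  define t where "t = min (1 / 2) (s / (2 * (norm (b - x) + 1)))"
  have t: "0 < t" "t < 1"
    using disk(2) by (auto simp: t_def add_nonneg_pos)
  define y where "y = x + t *\<^sub>R (b - x)"
  have "t * norm (b - x) \<le> s / (2 * (norm (b - x) + 1)) * norm (b - x)"
    by (intro mult_right_mono) (auto simp: t_def)
  also have "\<dots> = (s / 2) * (norm (b - x) / (norm (b - x) + 1))"
    by simp
  also have "\<dots> \<le> (s / 2) * 1"
    using disk(2) by (intro mult_left_mono) (auto simp: divide_le_eq add_nonneg_pos)
  finally have "y \<in> ball x s"
    using t disk(2) by (simp add: y_def dist_norm)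
  moreover have "y \<in> affine hull F"
  proof -
    have "(1 - t) *\<^sub>R x + t *\<^sub>R b \<in> affine hull F"
      using b(1) hull_inc[OF disk(1)] affine_affine_hull[of F] unfolding affine_alt by blast
    then show ?thesis
      by (simp add: y_def algebra_simps)
  qed
  ultimately have "y \<in> frontier E"
    using disk(3) face_subset_frontier[OF F] by blast
  moreover have "b + (1 - t) *\<^sub>R (x - b) \<in> E"
    using t disk(1) face_subset_frontier[OF F] frontier_in_closure
    by (intro star_shaped_open_segment[OF star b(2)]) auto
  moreover have "b + (1 - t) *\<^sub>R (x - b) = y"
    by (simp add: y_def algebra_simps)
  ultimately show False
    using frontier_not_in_E by simp
qed

lemma rel_interior_if_near:
  assumes "x \<in> F" "ball x s \<inter> affine hull F \<subseteq> F" "y \<in> ball x s" "y \<in> affine hull F"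
  shows "y \<in> rel_interior F"
  unfolding mem_rel_interior
  using assms by (intro exI[of _ "ball x s"]) auto

end

context plane_chart
begin

lemma adjoint_L: "adjoint L (L y) = y"
proof -
  have "x \<bullet> adjoint L (L y) = x \<bullet> y" for x
    using adjoint_works[OF L_linear, of x "L y"] by (simp add: L_inner)
  then show ?thesis
    by (metis inner_commute vector_eq_rdot)
qed

lemma adjoint_L_continuous: "continuous_on S (adjoint L)"
  using adjoint_linear[OF L_linear] by (simp add: linear_continuous_on linear_conv_bounded_linear)

text \<open>The adjoint of \<open>L\<close> inverts the chart after a translation, so the preimage
  is contained in an affine image of the segment, which is again a segment and is null in the
  plane.\<close>

lemma negligible_vimage_segment: "negligible (T -` closed_segment u v)"
proof -
  have "T -` closed_segment u v \<subseteq> (\<lambda>x. adjoint L (x - a)) ` closed_segment u v"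
  proof
    fix w assume "w \<in> T -` closed_segment u v"
    then show "w \<in> (\<lambda>x. adjoint L (x - a)) ` closed_segment u v"
      by (intro image_eqI[of _ _ "T w"]) (auto simp: T_def adjoint_L)
  qed
  also have "\<dots> = adjoint L ` ((\<lambda>x. x - a) ` closed_segment u v)"
    by (simp add: image_image)
  also have "(\<lambda>x. x - a) ` closed_segment u v = closed_segment (u - a) (v - a)"
    using closed_segment_translation[of "- a" u v] by simp
  also have "adjoint L ` closed_segment (u - a) (v - a) = closed_segment (adjoint L (u - a)) (adjoint L (v - a))"
    by (rule closed_segment_linear_image[OF adjoint_linear[OF L_linear], symmetric])
  finally have sub: "T -` closed_segment u v \<subseteq> closed_segment (adjoint L (u - a)) (adjoint L (v - a))" .
  have "interior (closed_segment (adjoint L (u - a)) (adjoint L (v - a))) = {}"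
    by (rule interior_closed_segment_ge2) simp
  then have "negligible (closed_segment (adjoint L (u - a)) (adjoint L (v - a)))"
    using negligible_convex_interior[OF convex_closed_segment] by blast
  then show ?thesis
    using sub negligible_subset by blast
qed

lemma range_T_iff: "z \<in> range T \<longleftrightarrow> normal \<bullet> (z - a) = 0"
proof
  assume "z \<in> range T"
  then show "normal \<bullet> (z - a) = 0"
    by (auto simp: T_def normal_inner_L)
next
  assume *: "normal \<bullet> (z - a) = 0"
  obtain w where "z - a = L w + (normal \<bullet> (z - a)) *\<^sub>R normal"
    by (rule decompose)
  with * have "z = T w"
    by (simp add: T_def algebra_simps)
  then show "z \<in> range T"
    by simp
qed

end

section \<open>Almost everywhere uniqueness of the normal trace\<close>

context star_polyhedron
begin

text \<open>The other faces avoid the relative interior of \<open>F\<close>, so they meet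
  \<open>F\<close> only in its relative frontier, a finite union of segments.\<close>

lemma face_AE_not_in_other_faces:
  assumes "face_chart a L F" and F: "F \<in> Fs"
  shows "AE w in lebesgue_on (plane_chart.T a L -` F). plane_chart.T a L w \<notin> \<Union>(Fs - {F})"
proof -
  interpret face_chart a L F by fact
  have "negligible (T -` e)" if "e \<in> edges F" for e
  proof -
    have "\<forall>e\<in>edges F. \<exists>u v. u \<noteq> v \<and> e = closed_segment u v"
      using face_polygon[OF F] unfolding polygon_with_edges_def by (elim conjE)
    then have "\<exists>u v. e = closed_segment u v"
      using that by blast
    then obtain u v where "e = closed_segment u v"
      by blast
    then show ?thesis
      using negligible_vimage_segment by simp
  qed
  moreover have "finite (edges F)"
    using face_polygon[OF F] by (simp add: polygon_with_edges_def)
  ultimately have "negligible (\<Union>e\<in>edges F. T -` e)"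
    by (intro negligible_Union) auto
  then have "AE w in lebesgue. w \<notin> (\<Union>e\<in>edges F. T -` e)"
    by (intro AE_not_in) (simp add: negligible_iff_null_sets)
  then have "AE w in lebesgue. w \<in> T -` F \<longrightarrow> T w \<notin> \<Union>(Fs - {F})"
  proof eventually_elim
    case (elim w)
    show ?case
    proof (intro impI notI)
      assume w: "w \<in> T -` F" and "T w \<in> \<Union>(Fs - {F})"
      then have "T w \<notin> rel_interior F"
        using face_disjoint[OF F] by blast
      then have "T w \<in> rel_frontier F"
        using w closure_subset[of F] by (auto simp: rel_frontier_def)
      then show False
        using elim face_edges[OF F] by blast
    qed
  qed
  then show ?thesis
    using vimage_lebesgue by (subst AE_restrict_space_iff) auto
qed

lemma continuous_L2_face:
  assumes F: "F \<in> Fs" and f: "continuous_on UNIV (f :: real^3 \<Rightarrow> real)"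
  shows "f \<in> L2 (area_on F)"
proof -
  obtain a L where "face_chart a L F"
    using face_chart_exists[OF face_compact[OF F] face_aff_dim[OF F]] .
  then interpret face_chart a L F .
  show ?thesis
    using f by (rule continuous_L2_area)
qed

lemma assumes F: "F \<in> Fs"
  shows finite_measure_face: "finite_measure (area_on F)" and space_face: "space (area_on F) = F"
proof -
  obtain a L where "face_chart a L F"
    using face_chart_exists[OF face_compact[OF F] face_aff_dim[OF F]] .
  then interpret face_chart a L F .
  show "finite_measure (area_on F)" "space (area_on F) = F"
    by (rule finite_measure_area space_area)+
qed

text \<open>Polynomials are smooth and uniformly dense in the continuous functions on the compact
  frontier, and the functional is controlled by the sup norm with the L1 norms of the densities as
  factor.\<close>

lemma boundary_functional_zero_on_continuous:
  fixes e :: "(real^3) set \<Rightarrow> real^3 \<Rightarrow> real"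
  assumes e: "\<And>F. F \<in> Fs \<Longrightarrow> e F \<in> L2 (area_on F)"
    and zero: "\<And>\<phi>. smooth \<phi> \<Longrightarrow> (\<Sum>F\<in>Fs. l2_inner (area_on F) (e F) \<phi>) = 0"
    and \<psi>: "continuous_on UNIV \<psi>"
  shows "(\<Sum>F\<in>Fs. l2_inner (area_on F) (e F) \<psi>) = 0"
proof -
  have eint: "integrable (area_on F) (e F)" if "F \<in> Fs" for F
    using finite_measure_face[OF that] e[OF that] by (rule L2_integrable)
  define W where "W = (\<Sum>F\<in>Fs. LINT x|area_on F. \<bar>e F x\<bar>)"
  have W: "W \<ge> 0"
    unfolding W_def by (intro sum_nonneg) simp
  have "\<bar>\<Sum>F\<in>Fs. l2_inner (area_on F) (e F) \<psi>\<bar> \<le> 0 + \<epsilon>" if "\<epsilon> > 0" for \<epsilon>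
  proof -
    define \<epsilon>' where "\<epsilon>' = \<epsilon> / (W + 1)"
    have \<epsilon>': "\<epsilon>' > 0" "\<epsilon>' * W \<le> \<epsilon>"
      using that W by (auto simp: \<epsilon>'_def field_simps)
    have "compact (frontier E)"
      using E_bounded by (rule compact_frontier_bounded)
    then obtain p where p: "real_polynomial_function p" "\<And>x. x \<in> frontier E \<Longrightarrow> \<bar>\<psi> x - p x\<bar> < \<epsilon>'"
      using Stone_Weierstrass_real_polynomial_function[OF _ continuous_on_subset[OF \<psi> subset_UNIV] \<epsilon>'(1)]
      by metis
    have ps: "smooth p"
      using p(1) by (rule smooth_real_polynomial_function)
    have "(\<Sum>F\<in>Fs. l2_inner (area_on F) (e F) \<psi>)
        = (\<Sum>F\<in>Fs. l2_inner (area_on F) (e F) \<psi>) - (\<Sum>F\<in>Fs. l2_inner (area_on F) (e F) p)"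
      using zero[OF ps] by simp
    also have "\<dots> = (\<Sum>F\<in>Fs. l2_inner (area_on F) (e F) (\<lambda>x. \<psi> x - p x))"
      using e continuous_L2_face \<psi> smooth_continuous[OF ps]
      by (simp add: l2_inner_diff_right sum_subtractf)
    also have "\<bar>\<dots>\<bar> \<le> (\<Sum>F\<in>Fs. \<bar>l2_inner (area_on F) (e F) (\<lambda>x. \<psi> x - p x)\<bar>)"
      by (rule sum_abs)
    also have "\<dots> \<le> (\<Sum>F\<in>Fs. \<epsilon>' * (LINT x|area_on F. \<bar>e F x\<bar>))"
    proof (rule sum_mono)
      fix F assume F: "F \<in> Fs"
      have d: "(\<lambda>x. \<psi> x - p x) \<in> L2 (area_on F)"
        using F \<psi> smooth_continuous[OF ps] by (intro continuous_L2_face continuous_intros)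
      have i: "integrable (area_on F) (\<lambda>x. e F x \<bullet> (\<psi> x - p x))"
        using e[OF F] d by (rule L2_integrable_inner)
      have "\<bar>l2_inner (area_on F) (e F) (\<lambda>x. \<psi> x - p x)\<bar> \<le> (LINT x|area_on F. \<bar>e F x \<bullet> (\<psi> x - p x)\<bar>)"
        unfolding l2_inner_def by (rule integral_abs_bound)
      also have "\<dots> \<le> (LINT x|area_on F. \<epsilon>' * \<bar>e F x\<bar>)"
      proof (rule integral_mono)
        fix x assume "x \<in> space (area_on F)"
        then have "x \<in> frontier E"
          using space_face[OF F] face_subset_frontier[OF F] by blast
        then show "\<bar>e F x \<bullet> (\<psi> x - p x)\<bar> \<le> \<epsilon>' * \<bar>e F x\<bar>"
          using p(2)[of x] by (simp add: abs_mult mult.commute[of \<epsilon>'] mult_left_mono)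
      qed (use i eint[OF F] in auto)
      finally show "\<bar>l2_inner (area_on F) (e F) (\<lambda>x. \<psi> x - p x)\<bar> \<le> \<epsilon>' * (LINT x|area_on F. \<bar>e F x\<bar>)"
        by simp
    qed
    also have "\<dots> = \<epsilon>' * W"
      by (simp add: W_def sum_distrib_left)
    finally show ?thesis
      using \<epsilon>'(2) by simp
  qed
  then show ?thesis
    using field_le_epsilon[of "\<bar>\<Sum>F\<in>Fs. l2_inner (area_on F) (e F) \<psi>\<bar>" 0] by simp
qed

text \<open>One face is isolated from the sum by continuous cutoffs that vanish on all other faces
  and converge to 1 almost everywhere on \<open>F\<close>. They are merely continuous, which is why
  the functional had to be extended to continuous functions.\<close>

lemma boundary_functional_zero_AE:
  fixes e :: "(real^3) set \<Rightarrow> real^3 \<Rightarrow> real"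
  assumes e: "\<And>F. F \<in> Fs \<Longrightarrow> e F \<in> L2 (area_on F)"
    and zero: "\<And>\<phi>. smooth \<phi> \<Longrightarrow> (\<Sum>F\<in>Fs. l2_inner (area_on F) (e F) \<phi>) = 0"
    and F: "F \<in> Fs"
  shows "AE x in area_on F. e F x = 0"
proof -
  obtain a L where fc: "face_chart a L F"
    using face_chart_exists[OF face_compact[OF F] face_aff_dim[OF F]] .
  then interpret face_chart a L F .
  define M where "M = lebesgue_on (T -` F)"
  define f where "f w = e F (T w)" for w
  have fL2: "f \<in> L2 M"
    using e[OF F] unfolding L2_area_iff M_def f_def .
  have fint: "integrable M f"
    using finite_measure_vimage fL2 unfolding M_def by (rule L2_integrable)
  \<comment> \<open>The point p keeps the set \<open>D\<close> nonempty even if \<open>F\<close> is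
    the only face: \<open>infdist\<close> to the empty set is 0 by convention, and the cutoffs would
    then vanish identically.\<close>
  obtain p where p: "p \<notin> F"
    using F_compact compact_imp_bounded not_bounded_UNIV by (metis UNIV_eq_I)
  define D where "D = insert p (\<Union>(Fs - {F}))"
  have "closed (\<Union>(Fs - {F}))"
    using Fs_finite face_compact by (intro closed_Union ballI compact_imp_closed) auto
  then have D: "closed D" "D \<noteq> {}"
    unfolding D_def by (auto intro: closed_insert)
  have AED: "AE w in M. T w \<notin> D"
  proof -
    have "AE w in M. w \<in> T -` F"
      unfolding M_def by (rule AE_I2) simp
    moreover have "AE w in M. T w \<notin> \<Union>(Fs - {F})"
      unfolding M_def using face_AE_not_in_other_faces[OF fc F] .
    ultimately show ?thesis
      by eventually_elim (use p in \<open>auto simp: D_def\<close>)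
  qed
  have "AE w in M. f w = 0"
    unfolding M_def
  proof (rule AE_zero_if_orthogonal_to_continuous[OF fint[unfolded M_def] vimage_lebesgue])
    fix k :: "real^2 \<Rightarrow> real"
    assume k: "continuous_on UNIV k" "\<And>w. \<bar>k w\<bar> \<le> 1"
    define \<eta> where "\<eta> n x = min 1 (real n * infdist x D)" for n x
    have \<eta>: "0 \<le> \<eta> n x" "\<eta> n x \<le> 1" for n x
      by (auto simp: \<eta>_def infdist_nonneg)
    have \<eta>c: "continuous_on UNIV (\<eta> n)" for n
      unfolding \<eta>_def by (intro continuous_intros)
    \<comment> \<open>The plane function k is extended to space constantly along the normal; the
      adjoint of \<open>L\<close> recovers the plane coordinate.\<close>
    define \<psi> where "\<psi> n x = \<eta> n x * k (adjoint L (x - a))" for n x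
    have \<psi>c: "continuous_on UNIV (\<psi> n)" for n
      unfolding \<psi>_def
      by (intro continuous_intros \<eta>c continuous_on_compose2[OF k(1)]
          continuous_on_compose2[OF adjoint_L_continuous[of UNIV]]) auto
    have "l2_inner (area_on G) (e G) (\<psi> n) = 0" if "G \<in> Fs - {F}" for G n
    proof -
      have "e G x \<bullet> \<psi> n x = 0" if "x \<in> space (area_on G)" for x
      proof -
        have "x \<in> D"
          using that space_face[of G] \<open>G \<in> Fs - {F}\<close> by (auto simp: D_def)
        then show ?thesis
          by (simp add: \<psi>_def \<eta>_def)
      qed
      then have "l2_inner (area_on G) (e G) (\<psi> n) = (LINT x|area_on G. 0)"
        unfolding l2_inner_def by (intro Bochner_Integration.integral_cong) auto
      then show ?thesis
        by simp
    qed
    then have "l2_inner (area_on F) (e F) (\<psi> n) = 0" for n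
      using boundary_functional_zero_on_continuous[OF e zero \<psi>c[of n]] Fs_finite F
      by (simp add: sum.remove)
    moreover have "l2_inner (area_on F) (e F) (\<psi> n) = (LINT w|M. f w * (\<eta> n (T w) * k w))" for n
      using l2_inner_area[OF L2_measurable[OF e[OF F]] L2_measurable[OF continuous_L2_face[OF F \<psi>c[of n]]]]
      by (simp add: l2_inner_def M_def f_def \<psi>_def T_def adjoint_L)
    ultimately have zero_n: "(LINT w|M. f w * (\<eta> n (T w) * k w)) = 0" for n
      by simp
    have "(\<lambda>n. LINT w|M. f w * (\<eta> n (T w) * k w)) \<longlonglongrightarrow> (LINT w|M. f w * k w)"
    proof (rule integral_dominated_convergence[where w = "\<lambda>w. \<bar>f w\<bar>"])
      have km: "k \<in> borel_measurable M"
        unfolding M_def by (rule continuous_lebesgue_on_measurable[OF k(1)])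
      have \<eta>m: "(\<lambda>w. \<eta> n (T w)) \<in> borel_measurable M" for n
        unfolding M_def
        by (intro continuous_lebesgue_on_measurable continuous_on_compose2[OF \<eta>c T_continuous]) auto
      show "(\<lambda>w. f w * k w) \<in> borel_measurable M" "(\<lambda>w. f w * (\<eta> n (T w) * k w)) \<in> borel_measurable M" for n
        using km \<eta>m[of n] L2_measurable[OF fL2] by simp_all
      show "integrable M (\<lambda>w. \<bar>f w\<bar>)"
        using fint by simp
      show "AE w in M. (\<lambda>n. f w * (\<eta> n (T w) * k w)) \<longlonglongrightarrow> f w * k w"
        using AED
      proof eventually_elim
        case (elim w)
        then have i: "infdist (T w) D > 0"
          using D infdist_pos_not_in_closed by blast
        obtain N :: nat where N: "1 < real N * infdist (T w) D"
          using i reals_Archimedean3 by blast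
        have "\<forall>\<^sub>F n in sequentially. f w * (\<eta> n (T w) * k w) = f w * k w"
          using eventually_ge_at_top[of N]
        proof eventually_elim
          case (elim n)
          then have "real N * infdist (T w) D \<le> real n * infdist (T w) D"
            using i by (intro mult_right_mono) auto
          then show ?case
            using N by (simp add: \<eta>_def)
        qed
        then show ?case
          by (rule tendsto_eventually)
      qed
      show "AE w in M. norm (f w * (\<eta> n (T w) * k w)) \<le> \<bar>f w\<bar>" for n
      proof (rule AE_I2)
        fix w
        have "\<bar>\<eta> n (T w)\<bar> * \<bar>k w\<bar> \<le> 1 * 1"
          using \<eta>[of n "T w"] k(2)[of w] by (intro mult_mono) auto
        then show "norm (f w * (\<eta> n (T w) * k w)) \<le> \<bar>f w\<bar>"
          by (simp add: abs_mult mult_left_le)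
      qed
    qed
    then have "0 = (LINT w|M. f w * k w)"
      unfolding zero_n LIMSEQ_const_iff .
    then show "(LINT w|lebesgue_on (T -` F). f w * k w) = 0"
      unfolding M_def by (rule sym)
  qed
  then show ?thesis
    unfolding AE_area_iff M_def f_def .
qed

text \<open>Green's formula fixes the whole boundary functional, and by localization each face
  density. So the choice in \<open>normal_trace\<close> agrees with the polynomial trace almost
  everywhere on each face.\<close>

lemma normal_trace_unique:
  assumes g: "has_normal_trace E Fs v g" and g': "has_normal_trace E Fs v g'" and F: "F \<in> Fs"
  shows "AE x in area_on F. g F x = g' F x"
proof -
  define e where "e G x = g G x - g' G x" for G x
  have gL2: "g G \<in> L2 (area_on G)" "g' G \<in> L2 (area_on G)" if "G \<in> Fs" for G
    using g g' that by (auto simp: has_normal_trace_def)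
  have "AE x in area_on F. e F x = 0"
  proof (rule boundary_functional_zero_AE[OF _ _ F])
    show "e G \<in> L2 (area_on G)" if "G \<in> Fs" for G
      unfolding e_def using gL2[OF that] by (rule L2_diff)
    fix \<phi> assume \<phi>: "smooth \<phi>"
    have "(\<Sum>G\<in>Fs. l2_inner (area_on G) (e G) \<phi>)
        = (\<Sum>G\<in>Fs. l2_inner (area_on G) (g G) \<phi>) - (\<Sum>G\<in>Fs. l2_inner (area_on G) (g' G) \<phi>)"
      unfolding e_def using gL2 continuous_L2_face[OF _ smooth_continuous[OF \<phi>]]
      by (simp add: l2_inner_diff_left sum_subtractf)
    also have "\<dots> = 0"
      using g g' \<phi> by (auto simp: has_normal_trace_def)
    finally show "(\<Sum>G\<in>Fs. l2_inner (area_on G) (e G) \<phi>) = 0" .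
  qed
  then show ?thesis
    by (simp add: e_def)
qed

lemma normal_trace_AE_eq:
  assumes g: "has_normal_trace E Fs v g" and F: "F \<in> Fs"
  shows "normal_trace E Fs v F \<in> L2 (area_on F)" "AE x in area_on F. normal_trace E Fs v F x = g F x"
proof -
  have *: "has_normal_trace E Fs v (normal_trace E Fs v)"
    unfolding normal_trace_def using someI[of "has_normal_trace E Fs v" g] g by simp
  then show "normal_trace E Fs v F \<in> L2 (area_on F)"
    using F by (simp add: has_normal_trace_def)
  show "AE x in area_on F. normal_trace E Fs v F x = g F x"
    using * g F by (rule normal_trace_unique)
qed

end

section \<open>Inverse estimates\<close>

lemma norm_vec_power2: "(norm x)\<^sup>2 = (\<Sum>i\<in>UNIV. (x $ i)\<^sup>2)" for x :: "real^'n::finite"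
  unfolding power2_norm_eq_inner inner_vec_def by (simp add: power2_eq_square)

lemma l2_norm_supported_ball:
  fixes f :: "real^3 \<Rightarrow> 'b::euclidean_space"
  assumes f: "continuous_on UNIV f" and S: "S \<in> sets lebesgue"
    and bound: "\<And>x. (norm (f x))\<^sup>2 \<le> B" and supp: "\<And>x. x \<notin> cball a R \<Longrightarrow> f x = 0" and R: "R \<ge> 0"
  shows "(l2_norm (lebesgue_on S) f)\<^sup>2 \<le> B * (unit_ball_vol 3 * R ^ 3)"
proof -
  have B: "B \<ge> 0"
    using bound[of 0] zero_le_power2 order_trans by blast
  have i: "integrable lebesgue (\<lambda>x. indicator (cball a R) x * B)"
    using emeasure_bounded_finite[of "cball a R"]
    by (intro integrable_mult_left integrable_real_indicator) auto
  have "(l2_norm (lebesgue_on S) f)\<^sup>2 = (LINT x|lebesgue. indicator S x *\<^sub>R (norm (f x))\<^sup>2)"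
    unfolding l2_norm_power2_eq_integral using S by (intro integral_restrict_space) auto
  also have "\<dots> \<le> (LINT x|lebesgue. indicator (cball a R) x * B)"
  proof (rule integral_mono_AE')
    show "AE x in lebesgue. indicator S x *\<^sub>R (norm (f x))\<^sup>2 \<le> indicator (cball a R) x * B"
    proof (rule AE_I2)
      fix x
      show "indicator S x *\<^sub>R (norm (f x))\<^sup>2 \<le> indicator (cball a R) x * B"
        using bound[of x] supp[of x] B by (cases "x \<in> cball a R") (auto simp: indicator_def)
    qed
    show "AE x in lebesgue. 0 \<le> indicator (cball a R) x * B"
      using B by simp
  qed (rule i)
  also have "\<dots> = B * (unit_ball_vol 3 * R ^ 3)"
    using R by (simp add: content_cball)
  finally show ?thesis .
qed

text \<open>The left sides are bounded at every point of space, as the bump vanishes outside its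
  ball; the right sides see p only on the half ball, where the bump is bounded below. This match is
  what the inverse estimates exploit.\<close>

lemma bubble_bounds:
  obtains C :: real where "C > 0"
    "\<And>p (a :: real^3) R x. p \<in> polys m \<Longrightarrow> R > 0 \<Longrightarrow>
      (p x * bump a R x)\<^sup>2 \<le> C / R ^ 3 * (l2_norm (lebesgue_on (ball a (R / 2))) p)\<^sup>2"
    "\<And>p (a :: real^3) R x i. p \<in> polys m \<Longrightarrow> R > 0 \<Longrightarrow>
      (R * partial i (\<lambda>x. p x * bump a R x) x)\<^sup>2 \<le> C / R ^ 3 * (l2_norm (lebesgue_on (ball a (R / 2))) p)\<^sup>2"
proof -
  obtain C1 where C1: "C1 > 0"
    "\<And>p (a :: real^3) R x. p \<in> polys m \<Longrightarrow> R > 0 \<Longrightarrow> x \<in> cball a (2 * R) \<Longrightarrow>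
      (p x)\<^sup>2 \<le> C1 / R ^ 3 * (l2_norm (lebesgue_on (ball a R)) p)\<^sup>2"
    using poly_sup_bound[of 2 m] by auto
  obtain C2 where C2: "C2 > 0"
    "\<And>p (a :: real^3) R x i. p \<in> polys m \<Longrightarrow> R > 0 \<Longrightarrow> x \<in> cball a (2 * R) \<Longrightarrow>
      (R * partial i p x)\<^sup>2 \<le> C2 / R ^ 3 * (l2_norm (lebesgue_on (ball a R)) p)\<^sup>2"
    using poly_partial_sup_bound[of 2 m] by auto
  define K where "K = bump_grad_bound"
  \<comment> \<open>The sup bounds are used for radius R / 2, which gives 8 for values and 8 * 4 =
    32 for R times a derivative. The two terms of the product rule bring another factor 2
    each.\<close>
  define C where "C = 8 * C1 + 16 * C1 * K\<^sup>2 + 64 * C2"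
  have C: "C > 0"
    unfolding C_def using C1(1) C2(1) by (intro add_pos_pos add_pos_nonneg) auto
  show thesis
  proof (rule that[OF C])
    fix p and a x :: "real^3" and R :: real
    assume p: "p \<in> polys m" and R: "R > 0"
    define A where "A = (l2_norm (lebesgue_on (ball a (R / 2))) p)\<^sup>2 / R ^ 3"
    have A: "A \<ge> 0"
      using R by (simp add: A_def)
    have pb: "(p x)\<^sup>2 \<le> 8 * C1 * A" if "x \<in> cball a R" for x
      using C1(2)[OF p, of "R / 2" x a] R that by (simp add: A_def power_divide mult_ac)
    have dpb: "(R * partial i p x)\<^sup>2 \<le> 32 * C2 * A" if "x \<in> cball a R" for x i
      using C2(2)[OF p, of "R / 2" x a i] R that
      by (simp add: A_def power_divide power_mult_distrib field_simps)
    have sp: "smooth p"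
      using p by (rule smooth_polys)
    show "(p x * bump a R x)\<^sup>2 \<le> C / R ^ 3 * (l2_norm (lebesgue_on (ball a (R / 2))) p)\<^sup>2"
    proof (cases "x \<in> cball a R")
      case True
      have "(bump a R x)\<^sup>2 \<le> 1"
        using bump_nonneg[of a R x] bump_le_1[of a R x] by (simp add: power_le_one)
      then have "(p x * bump a R x)\<^sup>2 \<le> (p x)\<^sup>2"
        by (simp add: power_mult_distrib mult_left_le)
      also have "\<dots> \<le> 8 * C1 * A"
        using True by (rule pb)
      also have "\<dots> \<le> C * A"
        unfolding C_def using A C1(1) C2(1) by (intro mult_right_mono) auto
      finally show ?thesis
        by (simp add: A_def)
    next
      case False
      then have "bump a R x = 0"
        using R by (intro bump_eq_0) auto
      then show ?thesis
        using C R by simp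
    qed
    fix i :: 3
    have "partial i (\<lambda>x. p x * bump a R x) x = p x * partial i (bump a R) x + partial i p x * bump a R x"
      using sp by (intro partial_mult smooth_differentiable smooth_bump)
    then have eq: "R * partial i (\<lambda>x. p x * bump a R x) x
        = p x * (R * partial i (bump a R) x) + (R * partial i p x) * bump a R x"
      by (simp add: algebra_simps)
    show "(R * partial i (\<lambda>x. p x * bump a R x) x)\<^sup>2 \<le> C / R ^ 3 * (l2_norm (lebesgue_on (ball a (R / 2))) p)\<^sup>2"
    proof (cases "x \<in> cball a R")
      case True
      have "\<bar>R * partial i (bump a R) x\<bar> \<le> K"
        using partial_bump_bound[OF R, of i a x] R by (simp add: K_def abs_mult pos_le_divide_eq mult.commute)
      then have "\<bar>R * partial i (bump a R) x\<bar>\<^sup>2 \<le> K\<^sup>2"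
        by (intro power_mono) auto
      then have "(p x)\<^sup>2 * (R * partial i (bump a R) x)\<^sup>2 \<le> (8 * C1 * A) * K\<^sup>2"
        using pb[OF True] A C1(1) by (intro mult_mono) auto
      then have 1: "(p x * (R * partial i (bump a R) x))\<^sup>2 \<le> 8 * C1 * A * K\<^sup>2"
        by (simp only: power_mult_distrib)
      have "(bump a R x)\<^sup>2 \<le> 1"
        using bump_nonneg[of a R x] bump_le_1[of a R x] by (simp add: power_le_one)
      then have "(R * partial i p x)\<^sup>2 * (bump a R x)\<^sup>2 \<le> (32 * C2 * A) * 1"
        using dpb[OF True, of i] A C2(1) by (intro mult_mono) auto
      then have 2: "((R * partial i p x) * bump a R x)\<^sup>2 \<le> 32 * C2 * A"
        by (simp only: power_mult_distrib mult_1_right)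
      have "(R * partial i (\<lambda>x. p x * bump a R x) x)\<^sup>2
          \<le> 2 * (p x * (R * partial i (bump a R) x))\<^sup>2 + 2 * ((R * partial i p x) * bump a R x)\<^sup>2"
        unfolding eq using sum_squares_bound[of "p x * (R * partial i (bump a R) x)" "(R * partial i p x) * bump a R x"]
        by (simp only: power2_sum)
      also have "\<dots> \<le> 2 * (8 * C1 * A * K\<^sup>2) + 2 * (32 * C2 * A)"
        using 1 2 by (intro add_mono mult_left_mono) auto
      also have "\<dots> \<le> C * A"
        unfolding C_def using A C1(1) by (simp add: algebra_simps)
      finally show ?thesis
        by (simp add: A_def)
    next
      case False
      have "compactly_supported_in (cball a R) (\<lambda>x. p x * bump a R x)"
        using R by (intro compactly_supported_in_mult_left compactly_supported_bump) auto
      then have "partial i (\<lambda>x. p x * bump a R x) x = 0"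
        using compactly_supported_in_eq_0[OF compactly_supported_in_partial False] by blast
      then show ?thesis
        using C R by simp
    qed
  qed
qed

text \<open>Closing step of the inverse estimates: testing with a multiple of the polynomial itself
  leaves its norm \<open>N\<close> squared on the left and once on the right, so one power
  cancels.\<close>

lemma absorb_square:
  fixes e N K V :: real
  assumes "e > 0" "N \<ge> 0" "K \<ge> 0" "V \<ge> 0" "e * N\<^sup>2 \<le> K * N * V"
  shows "N\<^sup>2 \<le> (K / e)\<^sup>2 * V\<^sup>2"
proof (cases "N = 0")
  case False
  then have "e * N \<le> K * V"
    using assms by (simp add: power2_eq_square)
  then have "N \<le> K / e * V"
    using assms(1) by (simp add: field_simps)
  then have "N\<^sup>2 \<le> (K / e * V)\<^sup>2"
    using assms(2) by (intro power_mono) auto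
  then show ?thesis
    by (simp only: power_mult_distrib)
qed (use assms in simp)

lemma l2_norm_power2_vec:
  fixes f :: "'a \<Rightarrow> real^'n::finite"
  assumes "f \<in> L2 M"
  shows "(l2_norm M f)\<^sup>2 = (\<Sum>i\<in>UNIV. (l2_norm M (\<lambda>x. f x $ i))\<^sup>2)"
proof -
  have "integrable M (\<lambda>x. f x $ i * f x $ i)" for i
    using L2_integrable_inner[OF L2_vec_nth[OF assms] L2_vec_nth[OF assms], of i i] by simp
  then show ?thesis
    by (simp add: l2_norm_power2 l2_inner_def inner_vec_def)
qed

text \<open>On the half ball the bump exceeds exp(-2), and the rest of \<open>E\<close> contributes
  a nonnegative amount.\<close>

lemma bump_inner_ge:
  fixes p :: "real^3 \<Rightarrow> 'b::euclidean_space"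
  assumes E: "bounded E" "E \<in> sets lebesgue" and R: "R > 0" "ball a (R / 2) \<subseteq> E" and p: "continuous_on UNIV p"
  shows "exp (-2) * (l2_norm (lebesgue_on (ball a (R / 2))) p)\<^sup>2
    \<le> l2_inner (lebesgue_on E) p (\<lambda>x. bump a R x *\<^sub>R p x)"
proof -
  have pL2: "p \<in> L2 (lebesgue_on E)"
    using E p by (rule continuous_L2)
  have bL2: "(\<lambda>x. bump a R x *\<^sub>R p x) \<in> L2 (lebesgue_on E)"
    using E p smooth_continuous[OF smooth_bump] by (intro continuous_L2 continuous_intros) auto
  have "(l2_norm (lebesgue_on (ball a (R / 2))) p)\<^sup>2 = (LINT x|lebesgue. indicator (ball a (R / 2)) x *\<^sub>R (norm (p x))\<^sup>2)"
    unfolding l2_norm_power2_eq_integral by (intro integral_restrict_space) auto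
  also have "exp (-2) * \<dots> = (LINT x|lebesgue. exp (-2) * (indicator (ball a (R / 2)) x *\<^sub>R (norm (p x))\<^sup>2))"
    by simp
  also have "\<dots> \<le> (LINT x|lebesgue. indicator E x *\<^sub>R (p x \<bullet> (bump a R x *\<^sub>R p x)))"
  proof (rule integral_mono_AE')
    show "integrable lebesgue (\<lambda>x. indicator E x *\<^sub>R (p x \<bullet> (bump a R x *\<^sub>R p x)))"
      using L2_integrable_inner[OF pL2 bL2] E(2) by (subst (asm) integrable_restrict_space) auto
    show "AE x in lebesgue. exp (-2) * (indicator (ball a (R / 2)) x *\<^sub>R (norm (p x))\<^sup>2)
        \<le> indicator E x *\<^sub>R (p x \<bullet> (bump a R x *\<^sub>R p x))"
    proof (rule AE_I2)
      fix x
      show "exp (-2) * (indicator (ball a (R / 2)) x *\<^sub>R (norm (p x))\<^sup>2)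
        \<le> indicator E x *\<^sub>R (p x \<bullet> (bump a R x *\<^sub>R p x))"
      proof (cases "x \<in> ball a (R / 2)")
        case True
        then have "exp (-2) * (norm (p x))\<^sup>2 \<le> bump a R x * (norm (p x))\<^sup>2"
          using R by (intro mult_right_mono bump_ge) auto
        then show ?thesis
          using True R by (auto simp: indicator_def power2_norm_eq_inner)
      next
        case False
        have "0 \<le> bump a R x * (p x \<bullet> p x)"
          by (intro mult_nonneg_nonneg bump_nonneg inner_ge_zero)
        then show ?thesis
          using False by (simp add: indicator_def)
      qed
    qed
    show "AE x in lebesgue. 0 \<le> indicator E x *\<^sub>R (p x \<bullet> (bump a R x *\<^sub>R p x))"
      using bump_nonneg[of a R] by simp
  qed
  also have "\<dots> = l2_inner (lebesgue_on E) p (\<lambda>x. bump a R x *\<^sub>R p x)"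
    unfolding l2_inner_def using E(2) by (intro integral_restrict_space[symmetric]) auto
  finally show ?thesis .
qed

text \<open>The weak divergence is tested with d times a bump. The pairing with d dominates exp(-2)
  N^2, whereas the gradient of the test function has norm at most K N / R. The constant is
  quantified before the domain, so it cannot depend on the mesh.\<close>

lemma weak_div_inverse_estimate:
  obtains C :: real where "C > 0"
    "\<And>E v d a R. bounded E \<Longrightarrow> E \<in> sets lebesgue \<Longrightarrow> R > 0 \<Longrightarrow> cball a R \<subseteq> E \<Longrightarrow> v \<in> L2 (lebesgue_on E) \<Longrightarrow>
      d \<in> polys m \<Longrightarrow> has_weak_div E v d \<Longrightarrow>
      (R * l2_norm (lebesgue_on (ball a (R / 2))) d)\<^sup>2 \<le> C * (l2_norm (lebesgue_on E) v)\<^sup>2"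
proof -
  obtain C :: real where C: "C > 0"
    "\<And>p (a :: real^3) R x i. p \<in> polys m \<Longrightarrow> R > 0 \<Longrightarrow>
      (R * partial i (\<lambda>x. p x * bump a R x) x)\<^sup>2 \<le> C / R ^ 3 * (l2_norm (lebesgue_on (ball a (R / 2))) p)\<^sup>2"
    by (rule bubble_bounds[of m]) (rule that)
  \<comment> \<open>Three components of the gradient, each with square at most C N^2 / R^5, on a
    ball of volume \<open>unit_ball_vol 3 * R ^ 3\<close>.\<close>
  define K where "K = sqrt (3 * C * unit_ball_vol 3)"
  have "3 * C * unit_ball_vol 3 > 0"
    using C(1) unit_ball_vol_pos[of 3] by simp
  then have K: "K > 0" "K\<^sup>2 = 3 * C * unit_ball_vol 3"
    by (simp_all add: K_def)
  show thesis
  proof (rule that[of "(K / exp (-2))\<^sup>2"])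
    show "(K / exp (-2))\<^sup>2 > 0"
      using K(1) by simp
  next
    fix E v d and a :: "real^3" and R :: real
    assume E: "bounded E" "E \<in> sets lebesgue" and R: "R > 0" "cball a R \<subseteq> E" and v: "v \<in> L2 (lebesgue_on E)"
      and d: "d \<in> polys m" and wd: "has_weak_div E v d"
    define N where "N = l2_norm (lebesgue_on (ball a (R / 2))) d"
    have N: "N \<ge> 0"
      by (simp add: N_def l2_norm_nonneg)
    define V where "V = l2_norm (lebesgue_on E) v"
    have V: "V \<ge> 0"
      by (simp add: V_def l2_norm_nonneg)
    define \<phi> where "\<phi> x = d x * bump a R x" for x
    have sd: "smooth d"
      using d by (rule smooth_polys)
    have \<phi>: "smooth \<phi>" "compactly_supported_in E \<phi>"
      unfolding \<phi>_def using sd R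
      by (auto intro!: smooth_mult compactly_supported_in_mult_left compactly_supported_bump)
    have gc: "continuous_on UNIV (grad \<phi>)"
      unfolding grad_def[abs_def] using \<phi>(1)
      by (intro continuous_on_vec_lambda smooth_continuous smooth_partial)
    have gL2: "grad \<phi> \<in> L2 (lebesgue_on E)"
      using E gc by (rule continuous_L2)
    have ball: "ball a (R / 2) \<subseteq> E"
      using R by (intro order_trans[OF _ R(2)]) auto
    have "exp (-2) * N\<^sup>2 \<le> l2_inner (lebesgue_on E) d (\<lambda>x. bump a R x *\<^sub>R d x)"
      unfolding N_def using E R(1) ball smooth_continuous[OF sd] by (rule bump_inner_ge)
    also have "\<dots> = l2_inner (lebesgue_on E) d \<phi>"
      by (simp add: \<phi>_def[abs_def] mult.commute)
    also have "\<dots> = - l2_inner (lebesgue_on E) v (grad \<phi>)"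
      using wd \<phi> unfolding has_weak_div_def by (metis minus_minus)
    also have "\<dots> \<le> V * l2_norm (lebesgue_on E) (grad \<phi>)"
      using l2_Cauchy_Schwarz[OF v gL2] by (simp add: V_def)
    also have "\<dots> \<le> V * (K * N / R)"
    proof (rule mult_left_mono[OF _ V], rule power2_le_imp_le)
      have "(l2_norm (lebesgue_on E) (grad \<phi>))\<^sup>2 \<le> (3 * (C / R ^ 5 * N\<^sup>2)) * (unit_ball_vol 3 * R ^ 3)"
      proof (rule l2_norm_supported_ball[OF gc E(2)])
        fix x
        have "(partial i \<phi> x)\<^sup>2 \<le> C / R ^ 5 * N\<^sup>2" for i
        proof -
          have "R\<^sup>2 * (partial i \<phi> x)\<^sup>2 \<le> C / R ^ 3 * N\<^sup>2"
            using C(2)[OF d R(1), of i a x] by (simp add: \<phi>_def[abs_def] N_def power_mult_distrib)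
          then have "(partial i \<phi> x)\<^sup>2 \<le> C / R ^ 3 * N\<^sup>2 / R\<^sup>2"
            using R(1) by (simp add: pos_le_divide_eq mult.commute)
          also have "\<dots> = C / R ^ 5 * N\<^sup>2"
            by (simp add: power_add[of R 3 2, simplified] mult.commute)
          finally show ?thesis .
        qed
        then have "(\<Sum>i\<in>UNIV. (partial i \<phi> x)\<^sup>2) \<le> (\<Sum>i\<in>(UNIV :: 3 set). C / R ^ 5 * N\<^sup>2)"
          by (intro sum_mono)
        then show "(norm (grad \<phi> x))\<^sup>2 \<le> 3 * (C / R ^ 5 * N\<^sup>2)"
          unfolding norm_vec_power2 by (simp add: grad_def)
      next
        fix x assume "x \<notin> cball a R"
        moreover have "compactly_supported_in (cball a R) \<phi>"
          unfolding \<phi>_def using R(1) by (intro compactly_supported_in_mult_left compactly_supported_bump) auto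
        ultimately have "partial i \<phi> x = 0" for i
          using compactly_supported_in_eq_0[OF compactly_supported_in_partial] by blast
        then show "grad \<phi> x = 0"
          by (simp add: grad_def vec_eq_iff)
      qed (use R in simp)
      also have "\<dots> = (K * N / R)\<^sup>2"
      proof -
        have "R ^ 5 = R ^ 3 * R\<^sup>2"
          by (simp flip: power_add)
        then show ?thesis
          unfolding power_mult_distrib power_divide K(2) using R(1) by (simp add: field_simps)
      qed
      finally show "(l2_norm (lebesgue_on E) (grad \<phi>))\<^sup>2 \<le> (K * N / R)\<^sup>2" .
      show "0 \<le> K * N / R"
        using K(1) N R(1) by simp
    qed
    finally have "exp (-2) * N\<^sup>2 \<le> (K / R) * N * V"
      by (simp add: mult_ac)
    then have "N\<^sup>2 \<le> (K / R / exp (-2))\<^sup>2 * V\<^sup>2"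
      using K(1) R(1) N V by (intro absorb_square) auto
    then have "R\<^sup>2 * N\<^sup>2 \<le> R\<^sup>2 * ((K / R / exp (-2))\<^sup>2 * V\<^sup>2)"
      by (intro mult_left_mono) auto
    then show "(R * l2_norm (lebesgue_on (ball a (R / 2))) d)\<^sup>2 \<le> (K / exp (-2))\<^sup>2 * (l2_norm (lebesgue_on E) v)\<^sup>2"
      using R(1) by (simp add: N_def V_def power_mult_distrib power_divide)
  qed
qed

lemma norm_curl_bound:
  assumes "\<And>i j. (partial i (\<lambda>y. u y $ j) x)\<^sup>2 \<le> B"
  shows "(norm (curl u x))\<^sup>2 \<le> 12 * B"
proof -
  have sq: "(p - q)\<^sup>2 \<le> 4 * B" if "p\<^sup>2 \<le> B" "q\<^sup>2 \<le> B" for p q :: real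
  proof -
    have "(p - q)\<^sup>2 + (p + q)\<^sup>2 = 2 * p\<^sup>2 + 2 * q\<^sup>2"
      by (simp add: power2_eq_square algebra_simps)
    then show ?thesis
      using that zero_le_power2[of "p + q"] by linarith
  qed
  have "(norm (curl u x))\<^sup>2 = (curl u x $ 1)\<^sup>2 + (curl u x $ 2)\<^sup>2 + (curl u x $ 3)\<^sup>2"
    unfolding norm_vec_power2 sum_3 ..
  also have "\<dots> \<le> 4 * B + 4 * B + 4 * B"
    unfolding curl_def vector_3 by (intro add_mono sq assms)
  finally show ?thesis
    by simp
qed

lemma continuous_curl:
  assumes "\<And>i. smooth (\<lambda>x. u x $ i)"
  shows "continuous_on UNIV (curl u)"
proof -
  have "continuous_on UNIV (\<lambda>x. curl u x $ 1)" "continuous_on UNIV (\<lambda>x. curl u x $ 2)"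
    "continuous_on UNIV (\<lambda>x. curl u x $ 3)"
    unfolding curl_def vector_3
    by (intro continuous_on_diff smooth_continuous smooth_partial assms)+
  then have "continuous_on UNIV (\<lambda>x. curl u x $ i)" for i
    using exhaust_3[of i] by metis
  then have "continuous_on UNIV (\<lambda>x. \<chi> i. curl u x $ i)"
    by (rule continuous_on_vec_lambda)
  then show ?thesis
    by simp
qed

lemma l2_norm_component_le:
  fixes f :: "'a \<Rightarrow> real^'n::finite"
  assumes "f \<in> L2 M"
  shows "l2_norm M (\<lambda>x. f x $ i) \<le> l2_norm M f"
proof (rule l2_norm_mono[OF assms])
  show "(\<lambda>x. f x $ i) \<in> borel_measurable M"
    using L2_vec_nth[OF assms] by (rule L2_measurable)
qed (simp add: component_le_norm_cart)

lemma vpolys_continuous: "q \<in> vpolys m \<Longrightarrow> continuous_on S q"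
proof -
  assume "q \<in> vpolys m"
  then have "continuous_on S (\<lambda>x. \<chi> i. q x $ i)"
    by (intro continuous_on_vec_lambda smooth_continuous smooth_polys[OF vpolys_component])
  then show ?thesis
    by simp
qed

text \<open>The test of the divergence estimate again, now with the vector field d times a bump; the
  bubble bounds are applied to each component, whose norm is at most that of d.\<close>

lemma weak_curl_inverse_estimate:
  obtains C :: real where "C > 0"
    "\<And>E v d a R. bounded E \<Longrightarrow> E \<in> sets lebesgue \<Longrightarrow> R > 0 \<Longrightarrow> cball a R \<subseteq> E \<Longrightarrow> v \<in> L2 (lebesgue_on E) \<Longrightarrow>
      d \<in> vpolys m \<Longrightarrow> has_weak_curl E v d \<Longrightarrow>
      (R * l2_norm (lebesgue_on (ball a (R / 2))) d)\<^sup>2 \<le> C * (l2_norm (lebesgue_on E) v)\<^sup>2"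
proof -
  obtain C :: real where C: "C > 0"
    "\<And>p (a :: real^3) R x i. p \<in> polys m \<Longrightarrow> R > 0 \<Longrightarrow>
      (R * partial i (\<lambda>x. p x * bump a R x) x)\<^sup>2 \<le> C / R ^ 3 * (l2_norm (lebesgue_on (ball a (R / 2))) p)\<^sup>2"
    by (rule bubble_bounds[of m]) (rule that)
  \<comment> \<open>The curl has three components, each a difference of two partial derivatives, and
    the square of such a difference is at most four times the common bound.\<close>
  define K where "K = sqrt (12 * C * unit_ball_vol 3)"
  have "12 * C * unit_ball_vol 3 > 0"
    using C(1) unit_ball_vol_pos[of 3] by simp
  then have K: "K > 0" "K\<^sup>2 = 12 * C * unit_ball_vol 3"
    by (simp_all add: K_def)
  show thesis
  proof (rule that[of "(K / exp (-2))\<^sup>2"])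
    show "(K / exp (-2))\<^sup>2 > 0"
      using K(1) by simp
  next
    fix E v d and a :: "real^3" and R :: real
    assume E: "bounded E" "E \<in> sets lebesgue" and R: "R > 0" "cball a R \<subseteq> E" and v: "v \<in> L2 (lebesgue_on E)"
      and d: "d \<in> vpolys m" and wd: "has_weak_curl E v d"
    define N where "N = l2_norm (lebesgue_on (ball a (R / 2))) d"
    have N: "N \<ge> 0"
      by (simp add: N_def l2_norm_nonneg)
    define V where "V = l2_norm (lebesgue_on E) v"
    have V: "V \<ge> 0"
      by (simp add: V_def l2_norm_nonneg)
    define \<psi> where "\<psi> x = bump a R x *\<^sub>R d x" for x
    have di: "(\<lambda>x. d x $ i) \<in> polys m" for i
      using d by (rule vpolys_component)
    have \<psi>i: "(\<lambda>x. \<psi> x $ i) = (\<lambda>x. d x $ i * bump a R x)" for i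
      by (simp add: \<psi>_def mult.commute)
    have \<psi>s: "smooth (\<lambda>x. \<psi> x $ i)" for i
      unfolding \<psi>i using di by (intro smooth_mult smooth_bump smooth_polys)
    have \<psi>supp: "compactly_supported_in E \<psi>"
      using R bump_eq_0[OF R(1)] by (intro compactly_supported_inI[of "cball a R"]) (auto simp: \<psi>_def)
    have gc: "continuous_on UNIV (curl \<psi>)"
      using \<psi>s by (rule continuous_curl)
    have gL2: "curl \<psi> \<in> L2 (lebesgue_on E)"
      using E gc by (rule continuous_L2)
    have ball: "ball a (R / 2) \<subseteq> E"
      using R by (intro order_trans[OF _ R(2)]) auto
    have "exp (-2) * N\<^sup>2 \<le> l2_inner (lebesgue_on E) d (\<lambda>x. bump a R x *\<^sub>R d x)"
      unfolding N_def using E R(1) ball vpolys_continuous[OF d] by (rule bump_inner_ge)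
    also have "\<dots> = l2_inner (lebesgue_on E) d \<psi>"
      by (simp add: \<psi>_def[abs_def])
    also have "\<dots> = l2_inner (lebesgue_on E) v (curl \<psi>)"
      using wd \<psi>s \<psi>supp unfolding has_weak_curl_def by simp
    also have "\<dots> \<le> V * l2_norm (lebesgue_on E) (curl \<psi>)"
      using l2_Cauchy_Schwarz[OF v gL2] by (simp add: V_def)
    also have "\<dots> \<le> V * (K * N / R)"
    proof (rule mult_left_mono[OF _ V], rule power2_le_imp_le)
      have "(l2_norm (lebesgue_on E) (curl \<psi>))\<^sup>2 \<le> (12 * (C / R ^ 5 * N\<^sup>2)) * (unit_ball_vol 3 * R ^ 3)"
      proof (rule l2_norm_supported_ball[OF gc E(2)])
        fix x
        have "(partial i (\<lambda>y. \<psi> y $ j) x)\<^sup>2 \<le> C / R ^ 5 * N\<^sup>2" for i j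
        proof -
          have "(l2_norm (lebesgue_on (ball a (R / 2))) (\<lambda>x. d x $ j))\<^sup>2 \<le> N\<^sup>2"
            unfolding N_def
            by (intro power_mono l2_norm_component_le continuous_L2 l2_norm_nonneg vpolys_continuous[OF d]) auto
          then have "C / R ^ 3 * (l2_norm (lebesgue_on (ball a (R / 2))) (\<lambda>x. d x $ j))\<^sup>2 \<le> C / R ^ 3 * N\<^sup>2"
            using C(1) R(1) by (intro mult_left_mono) auto
          with C(2)[OF di[of j] R(1), where a = a and x = x and i = i] have "R\<^sup>2 * (partial i (\<lambda>y. \<psi> y $ j) x)\<^sup>2 \<le> C / R ^ 3 * N\<^sup>2"
            unfolding \<psi>i by (simp only: power_mult_distrib)
          then have "(partial i (\<lambda>y. \<psi> y $ j) x)\<^sup>2 \<le> C / R ^ 3 * N\<^sup>2 / R\<^sup>2"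
            using R(1) by (simp add: pos_le_divide_eq mult.commute)
          also have "\<dots> = C / R ^ 5 * N\<^sup>2"
            by (simp add: power_add[of R 3 2, simplified] mult.commute)
          finally show ?thesis .
        qed
        then show "(norm (curl \<psi> x))\<^sup>2 \<le> 12 * (C / R ^ 5 * N\<^sup>2)"
          by (rule norm_curl_bound)
      next
        fix x assume x: "x \<notin> cball a R"
        have "compactly_supported_in (cball a R) (\<lambda>x. \<psi> x $ i)" for i
          unfolding \<psi>i using R(1) by (intro compactly_supported_in_mult_left compactly_supported_bump) auto
        then have "partial i (\<lambda>x. \<psi> x $ j) x = 0" for i j
          using compactly_supported_in_eq_0[OF compactly_supported_in_partial x] by blast
        then show "curl \<psi> x = 0"
          by (simp add: curl_def vec_eq_iff forall_3)
      qed (use R in simp)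
      also have "\<dots> = (K * N / R)\<^sup>2"
      proof -
        have "R ^ 5 = R ^ 3 * R\<^sup>2"
          by (simp flip: power_add)
        then show ?thesis
          unfolding power_mult_distrib power_divide K(2) using R(1) by (simp add: field_simps)
      qed
      finally show "(l2_norm (lebesgue_on E) (curl \<psi>))\<^sup>2 \<le> (K * N / R)\<^sup>2" .
      show "0 \<le> K * N / R"
        using K(1) N R(1) by simp
    qed
    finally have "exp (-2) * N\<^sup>2 \<le> (K / R) * N * V"
      by (simp add: mult_ac)
    then have "N\<^sup>2 \<le> (K / R / exp (-2))\<^sup>2 * V\<^sup>2"
      using K(1) R(1) N V by (intro absorb_square) auto
    then have "R\<^sup>2 * N\<^sup>2 \<le> R\<^sup>2 * ((K / R / exp (-2))\<^sup>2 * V\<^sup>2)"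
      by (intro mult_left_mono) auto
    then show "(R * l2_norm (lebesgue_on (ball a (R / 2))) d)\<^sup>2 \<le> (K / exp (-2))\<^sup>2 * (l2_norm (lebesgue_on E) v)\<^sup>2"
      using R(1) by (simp add: N_def V_def power_mult_distrib power_divide)
  qed
qed

section \<open>Shape-regular elements\<close>

text \<open>Normal form of mesh regularity: a star center of radius exactly \<rho> h, and in every
  face a disk of the common radius \<rho>^2 h, which is a lower bound for \<rho> times the face
  diameter.\<close>

locale mesh_element = star_polyhedron +
  fixes \<rho> h :: real
  assumes h_eq: "h = diameter E" and rho_pos: "0 < \<rho>" and rho_le_1: "\<rho> \<le> 1" and r_eq: "r = \<rho> * h"
    and face_disk: "\<And>F. F \<in> Fs \<Longrightarrow> \<exists>x\<in>affine hull F. ball x (\<rho>\<^sup>2 * h) \<inter> affine hull F \<subseteq> F"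
begin

lemma h_pos: "h > 0"
  using r_pos r_eq rho_pos by (simp add: zero_less_mult_iff)

lemma r_le_h: "r \<le> h"
  using r_eq rho_le_1 h_pos by (simp add: mult_le_cancel_right1)

lemma dist_le_h: "x \<in> closure E \<Longrightarrow> y \<in> closure E \<Longrightarrow> dist x y \<le> h"
  using diameter_bounded_bound[of "closure E" x y] E_bounded by (simp add: h_eq diameter_closure bounded_closure)

lemma center_in_E: "c \<in> E"
  using center_ball_subset r_pos by auto

lemma closure_subset_cball: "closure E \<subseteq> cball c h"
proof
  fix x assume x: "x \<in> closure E"
  have "c \<in> closure E"
    using center_in_E closure_subset by blast
  then show "x \<in> cball c h"
    using dist_le_h[OF _ x] by simp
qed

lemma E_subset_cball: "E \<subseteq> cball c h"
  using closure_subset_cball closure_subset by blast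

definition face_center :: "(real^3) set \<Rightarrow> real^3" where
  "face_center F = (SOME x. x \<in> affine hull F \<and> ball x (\<rho>\<^sup>2 * h) \<inter> affine hull F \<subseteq> F)"

lemma face_center:
  assumes "F \<in> Fs"
  shows "face_center F \<in> affine hull F" "ball (face_center F) (\<rho>\<^sup>2 * h) \<inter> affine hull F \<subseteq> F"
    "face_center F \<in> F"
proof -
  have "\<exists>x. x \<in> affine hull F \<and> ball x (\<rho>\<^sup>2 * h) \<inter> affine hull F \<subseteq> F"
    using face_disk[OF assms] by blast
  from someI_ex[OF this]
  have *: "face_center F \<in> affine hull F \<and> ball (face_center F) (\<rho>\<^sup>2 * h) \<inter> affine hull F \<subseteq> F"
    unfolding face_center_def .
  then show "face_center F \<in> affine hull F" "ball (face_center F) (\<rho>\<^sup>2 * h) \<inter> affine hull F \<subseteq> F"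
    by blast+
  show "face_center F \<in> F"
    using * rho_pos h_pos by auto
qed

text \<open>A radius around face centers within which the frontier consists of that face alone.
  Projecting a point from c onto the plane of the face displaces it by less than \<delta> * 2 h / r;
  the denominator 10 keeps \<delta> (1 + 2 h / r) below the disk radius \<rho>^2 h.\<close>

definition \<delta> :: real where "\<delta> = \<rho> ^ 3 * h / 10"

lemma \<delta>_pos: "\<delta> > 0"
  using rho_pos h_pos by (simp add: \<delta>_def)

lemma \<delta>_less: "\<delta> < \<rho>\<^sup>2 * h" "\<delta> \<le> r / 2" "\<delta> * (1 + 2 * h / r) < \<rho>\<^sup>2 * h"
proof -
  have "\<rho> ^ 3 * h \<le> \<rho>\<^sup>2 * h * 1"
    using rho_pos rho_le_1 h_pos by (simp add: power3_eq_cube power2_eq_square mult_le_cancel_left1)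
  moreover have "0 < \<rho>\<^sup>2 * h"
    using rho_pos h_pos by simp
  ultimately show "\<delta> < \<rho>\<^sup>2 * h"
    by (simp add: \<delta>_def)
  have "\<rho>\<^sup>2 \<le> 1"
    using rho_pos rho_le_1 by (simp add: power_le_one)
  then have "\<rho> ^ 3 * h \<le> \<rho> * h"
    using rho_pos h_pos by (simp add: power3_eq_cube power2_eq_square mult_le_cancel_left1)
  then show "\<delta> \<le> r / 2"
    using rho_pos h_pos by (simp add: \<delta>_def r_eq)
  have "\<delta> * (1 + 2 * h / r) = (\<rho>\<^sup>2 * h) * ((\<rho> + 2) / 10)"
    using rho_pos h_pos by (simp add: \<delta>_def r_eq field_simps power3_eq_cube power2_eq_square)
  also have "\<dots> < (\<rho>\<^sup>2 * h) * 1"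
    using rho_pos rho_le_1 h_pos by (intro mult_strict_left_mono) auto
  finally show "\<delta> * (1 + 2 * h / r) < \<rho>\<^sup>2 * h"
    by simp
qed

text \<open>The foot of the perpendicular from c lies in the plane of the face, hence outside the
  star center ball. Geometrically, this is the lower bound for the height of the cone from c over
  the face.\<close>

lemma face_plane_distance:
  assumes "face_chart a L F" and F: "F \<in> Fs"
  shows "r \<le> \<bar>plane_chart.normal L \<bullet> (a - c)\<bar>"
proof -
  interpret face_chart a L F by fact
  define H where "H = normal \<bullet> (a - c)"
  have nn: "normal \<bullet> normal = 1"
    using norm_normal by (simp add: norm_eq_sqrt_inner)
  have "c + H *\<^sub>R normal \<in> range T"
    unfolding range_T_iff by (simp add: H_def inner_diff_right inner_add_right nn)
  then have "c + H *\<^sub>R normal \<notin> ball c r"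
    using plane_avoids_ball[OF F face_center(3)[OF F] _ face_center(2)[OF F]] rho_pos h_pos range_T by auto
  then show ?thesis
    using norm_normal by (simp add: dist_norm H_def)
qed

text \<open>The frontier point z is projected from c onto the plane of \<open>F\<close>. The
  projection y is still in the disk, hence on the frontier; as a ray from c meets the frontier only
  once, y = z.\<close>

lemma near_face_center:
  assumes F: "F \<in> Fs" and z: "z \<in> frontier E" "z \<in> ball (face_center F) \<delta>"
  shows "z \<in> rel_interior F"
proof -
  obtain a L where fc: "face_chart a L F"
    using face_chart_exists[OF face_compact[OF F] face_aff_dim[OF F]] .
  then interpret face_chart a L F .
  define x where "x = face_center F"
  define H where "H = normal \<bullet> (a - c)"
  define s where "s = normal \<bullet> (z - c)"
  have Hr: "r \<le> \<bar>H\<bar>"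
    unfolding H_def using face_plane_distance[OF fc F] .
  have "x \<in> range T"
    using face_center(1)[OF F] range_T by (simp add: x_def)
  then have xH: "normal \<bullet> (x - c) = H"
    using range_T_iff[of x] by (simp add: H_def inner_diff_right)
  have zx: "norm (z - x) < \<delta>"
    using z(2) by (simp add: x_def dist_norm norm_minus_commute)
  have "\<bar>s - H\<bar> = \<bar>normal \<bullet> (z - x)\<bar>"
    by (simp add: s_def inner_diff_right flip: xH)
  also have "\<dots> \<le> norm (z - x)"
    using Cauchy_Schwarz_ineq2[of normal "z - x"] norm_normal by simp
  finally have sH: "\<bar>s - H\<bar> \<le> norm (z - x)" .
  \<comment> \<open>z is less than r / 2 away from the plane, which has distance at least r from c.
    So z is on the same side of c as the plane, and its ray hits the plane at a positive parameter
    k.\<close>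
  have s2: "r / 2 \<le> \<bar>s\<bar>" and sgn: "0 < H * s"
  proof -
    have "\<bar>s - H\<bar> < r / 2"
      using sH zx \<delta>_less(2) by linarith
    then show "r / 2 \<le> \<bar>s\<bar>" "0 < H * s"
      using Hr r_pos by (auto simp: zero_less_mult_iff abs_if split: if_splits)
  qed
  define k where "k = H / s"
  have k: "k > 0" "k * s = H"
    using sgn by (auto simp: k_def zero_less_divide_iff zero_less_mult_iff)
  define y where "y = c + k *\<^sub>R (z - c)"
  have "y \<in> range T"
    unfolding range_T_iff
  proof -
    have "normal \<bullet> (y - a) = k * s - H"
      by (simp add: y_def s_def H_def inner_diff_right inner_add_right algebra_simps)
    then show "normal \<bullet> (y - a) = 0"
      using k by simp
  qed
  moreover have "norm (y - x) < \<rho>\<^sup>2 * h"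
  proof -
    have "\<bar>k - 1\<bar> = \<bar>H - s\<bar> / \<bar>s\<bar>"
    proof -
      have "k - 1 = (H - s) / s"
        using s2 r_pos by (simp add: k_def diff_divide_distrib)
      then show ?thesis
        by (simp add: abs_divide)
    qed
    also have "\<dots> \<le> \<delta> / (r / 2)"
      using sH zx s2 r_pos by (intro frac_le) auto
    finally have k1: "\<bar>k - 1\<bar> \<le> 2 * \<delta> / r"
      by (simp add: mult.commute)
    have "norm (z - c) \<le> h"
      using closure_subset_cball frontier_in_closure[OF z(1)] by (auto simp: dist_norm norm_minus_commute)
    then have 1: "norm ((k - 1) *\<^sub>R (z - c)) \<le> 2 * \<delta> / r * h"
      using k1 r_pos \<delta>_pos by (simp del: times_divide_eq_left times_divide_eq_right) (intro mult_mono, auto)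
    have 2: "y - x = (z - x) + (k - 1) *\<^sub>R (z - c)"
      by (simp add: y_def algebra_simps)
    have "norm (y - x) \<le> norm (z - x) + 2 * \<delta> / r * h"
      unfolding 2 by (rule order_trans[OF norm_triangle_ineq add_left_mono[OF 1]])
    also have "\<dots> < \<delta> * (1 + 2 * h / r)"
      using zx by (simp add: algebra_simps)
    also have "\<dots> < \<rho>\<^sup>2 * h"
      by (rule \<delta>_less(3))
    finally show ?thesis .
  qed
  ultimately have yF: "y \<in> ball x (\<rho>\<^sup>2 * h)" "y \<in> affine hull F"
    using range_T by (auto simp: dist_norm norm_minus_commute)
  then have "y \<in> F"
    using face_center(2)[OF F] by (auto simp: x_def)
  then have "c + k *\<^sub>R (z - c) \<in> frontier E"
    using face_subset_frontier[OF F] by (auto simp: y_def)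
  then have "k = 1"
    using star_shaped_frontier_unique[OF E_open star r_pos z(1)] k(1) by simp
  then have "y = z"
    by (simp add: y_def)
  then show ?thesis
    using rel_interior_if_near[OF face_center(3)[OF F] face_center(2)[OF F]] yF by (simp add: x_def)
qed

lemma near_face_center_other:
  assumes "F \<in> Fs" "F' \<in> Fs" "F \<noteq> F'"
  shows "F' \<inter> ball (face_center F) \<delta> = {}"
  using near_face_center[OF assms(1)] face_subset_frontier[OF assms(2)] face_disjoint[OF assms] by blast

text \<open>Bumps at different faces therefore do not interact, and norms over the faces add up as
  orthogonal sums with no factor for the number of faces.\<close>

lemma face_balls_disjoint:
  assumes "F \<in> Fs" "F' \<in> Fs" "F \<noteq> F'"
  shows "ball (face_center F) (\<delta> / 2) \<inter> ball (face_center F') (\<delta> / 2) = {}"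
proof -
  have "face_center F' \<notin> ball (face_center F) \<delta>"
    using near_face_center_other[OF assms] face_center(3)[OF assms(2)] by blast
  then have "\<delta> \<le> dist (face_center F) (face_center F')"
    by simp
  then show ?thesis
    by (intro disjoint_ballI) simp
qed

end

lemma l2_norm_power2_sum_orthogonal:
  assumes "finite I" "\<And>i. i \<in> I \<Longrightarrow> f i \<in> L2 M"
    and "\<And>i j x. i \<in> I \<Longrightarrow> j \<in> I \<Longrightarrow> i \<noteq> j \<Longrightarrow> f i x \<bullet> f j x = 0"
  shows "(l2_norm M (\<lambda>x. \<Sum>i\<in>I. f i x))\<^sup>2 = (\<Sum>i\<in>I. (l2_norm M (f i))\<^sup>2)"
proof -
  have sL2: "(\<lambda>x. \<Sum>i\<in>I. f i x) \<in> L2 M"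
    using assms(2) by (rule L2_sum)
  have "(l2_norm M (\<lambda>x. \<Sum>i\<in>I. f i x))\<^sup>2 = (\<Sum>i\<in>I. l2_inner M (\<lambda>x. \<Sum>i\<in>I. f i x) (f i))"
    unfolding l2_norm_power2 using sL2 assms(2) by (rule l2_inner_sum_right)
  also have "\<dots> = (\<Sum>i\<in>I. (l2_norm M (f i))\<^sup>2)"
  proof (rule sum.cong[OF refl])
    fix i assume i: "i \<in> I"
    have "(\<Sum>j\<in>I. f j x) \<bullet> f i x = f i x \<bullet> f i x" for x
    proof -
      have "(\<Sum>j\<in>I. f j x) \<bullet> f i x = (\<Sum>j\<in>I. if j = i then f i x \<bullet> f i x else 0)"
        unfolding inner_sum_left using assms(3) i by (intro sum.cong) auto
      then show ?thesis
        using i assms(1) by simp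
    qed
    then show "l2_inner M (\<lambda>x. \<Sum>i\<in>I. f i x) (f i) = (l2_norm M (f i))\<^sup>2"
      by (simp add: l2_inner_def l2_norm_power2)
  qed
  finally show ?thesis .
qed

section \<open>Inverse estimate for the normal trace\<close>

context mesh_element
begin

lemma face_subset_cball: "F \<in> Fs \<Longrightarrow> F \<subseteq> cball (face_center F) h"
  using dist_le_h frontier_in_closure face_subset_frontier face_center(3) by (meson mem_cball subsetD subsetI)

text \<open>g is extended constantly along the normal of the face. Seen in slices, the ball is
  contained in a slab of thickness 2 R over the piece of the plane inside the ball, whence the
  factor 2 R.\<close>

lemma face_polynomial_extension:
  assumes F: "F \<in> Fs" and g: "g \<in> polys m" and R: "0 < R" "R \<le> \<rho>\<^sup>2 * h"
  obtains p where "p \<in> polys m" "\<And>x. x \<in> F \<Longrightarrow> p x = g x"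
    "(l2_norm (lebesgue_on (ball (face_center F) R)) p)\<^sup>2
      \<le> 2 * R * (LINT x|area_on F. indicator (ball (face_center F) R) x * (g x)\<^sup>2)"
proof -
  obtain a L where fc: "face_chart a L F"
    using face_chart_exists[OF face_compact[OF F] face_aff_dim[OF F]] .
  then interpret face_chart a L F .
  define x0 where "x0 = face_center F"
  define B where "B = ball x0 R"
  have [measurable]: "B \<in> sets borel"
    by (simp add: B_def)
  \<comment> \<open>\<open>L\<close> after its adjoint is the orthogonal projection onto the
    direction of the plane, so this is g at the foot of the perpendicular from x.\<close>
  define p where "p x = g ((a - L (adjoint L a)) + L (adjoint L x))" for x
  have lin: "linear (\<lambda>x. L (adjoint L x))"
    using linear_compose[OF adjoint_linear[OF L_linear] L_linear] by (simp add: o_def)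
  have p: "p \<in> polys m"
    unfolding p_def using g lin by (rule polys_affine_compose)
  have adj_n: "adjoint L normal = 0"
  proof -
    have "y \<bullet> adjoint L normal = 0" for y
      using adjoint_works[OF L_linear, of y normal] normal_inner_L[of y] by (simp add: inner_commute)
    then show ?thesis
      by (metis inner_eq_zero_iff)
  qed
  have pT: "p (a + L w + t *\<^sub>R normal) = g (T w)" for w t
  proof -
    have "L (adjoint L (a + L w + t *\<^sub>R normal)) = L (adjoint L a) + L w"
      using linear_add[OF adjoint_linear[OF L_linear]] linear_scale[OF adjoint_linear[OF L_linear]]
      by (simp add: adjoint_L adj_n linear_add[OF L_linear])
    then show ?thesis
      by (simp add: p_def T_def)
  qed
  have pF: "p x = g x" if x: "x \<in> F" for x
  proof -
    obtain w where "x = T w"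
      using F_range x by blast
    then show ?thesis
      using pT[of w 0] by (simp add: T_def)
  qed
  have pc: "continuous_on UNIV p"
    using p by (intro smooth_continuous smooth_polys)
  have gc: "continuous_on UNIV g"
    using g by (intro smooth_continuous smooth_polys)
  have [measurable]: "p \<in> borel_measurable borel" "g \<in> borel_measurable borel"
    using pc gc by (auto intro: borel_measurable_continuous_onI)
  define J where "J = (LINT x|area_on F. indicator B x * (g x)\<^sup>2)"
  define f where "f z = ennreal ((p z)\<^sup>2) * indicator B z" for z
  have f [measurable]: "f \<in> borel_measurable borel"
    unfolding f_def by measurable
  obtain w0 where w0: "x0 = T w0"
    using face_center(1)[OF F] range_T by (auto simp: x0_def)
  have nn: "normal \<bullet> normal = 1"
    using norm_normal by (simp add: norm_eq_sqrt_inner)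
  have pyth: "(norm (a + L w + t *\<^sub>R normal - x0))\<^sup>2 = (norm (T w - x0))\<^sup>2 + t\<^sup>2" for w t
  proof -
    have Tw: "T w - x0 = L (w - w0)"
      using linear_diff[OF L_linear] by (simp add: w0 T_def)
    have "a + L w + t *\<^sub>R normal - x0 = (T w - x0) + t *\<^sub>R normal"
      by (simp add: T_def)
    then have z: "a + L w + t *\<^sub>R normal - x0 = L (w - w0) + t *\<^sub>R normal"
      unfolding Tw .
    have orth: "normal \<bullet> L (w - w0) = 0" "L (w - w0) \<bullet> normal = 0"
      using normal_inner_L[of "w - w0"] by (simp_all add: inner_commute)
    show ?thesis
      unfolding z Tw power2_norm_eq_inner
      by (simp add: inner_add_left inner_add_right nn orth power2_eq_square)
  qed
  have ind: "f (a + L w + t *\<^sub>R normal)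
      \<le> indicator {-R<..<R} t * (ennreal ((g (T w))\<^sup>2) * indicator B (T w))" for w t
  proof (cases "a + L w + t *\<^sub>R normal \<in> B")
    case True
    then have "norm (a + L w + t *\<^sub>R normal - x0) < R"
      by (simp add: B_def dist_norm norm_minus_commute)
    then have lt: "(norm (T w - x0))\<^sup>2 + t\<^sup>2 < R\<^sup>2"
      using R by (subst pyth[symmetric]) (intro power_strict_mono, auto)
    have "(norm (T w - x0))\<^sup>2 < R\<^sup>2"
      using lt zero_le_power2[of t] by linarith
    moreover have "\<bar>t\<bar>\<^sup>2 < R\<^sup>2"
      unfolding power2_abs using lt zero_le_power2[of "norm (T w - x0)"] by linarith
    ultimately have "norm (T w - x0) < R" "\<bar>t\<bar> < R"
      using R(1) power_less_imp_less_base less_imp_le by blast+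
    then have "T w \<in> B" "t \<in> {-R<..<R}"
      by (auto simp: B_def dist_norm norm_minus_commute)
    then show ?thesis
      by (simp add: f_def pT indicator_def)
  qed (simp add: f_def)
  have Jint: "integrable (lebesgue_on (T -` F)) (\<lambda>w. indicator B (T w) * (g (T w))\<^sup>2)"
  proof (rule Bochner_Integration.integrable_bound)
    show "integrable (lebesgue_on (T -` F)) (\<lambda>w. (norm (g (T w)))\<^sup>2)"
      using continuous_L2_area[OF gc] unfolding L2_area_iff by (rule L2_integrable_norm2)
    show "(\<lambda>w. indicator B (T w) * (g (T w))\<^sup>2) \<in> borel_measurable (lebesgue_on (T -` F))"
      by (intro measurable_restrict_space1 measurable_completion) measurable
    show "AE w in lebesgue_on (T -` F). norm (indicator B (T w) * (g (T w))\<^sup>2) \<le> norm ((norm (g (T w)))\<^sup>2)"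
      by (intro AE_I2) (simp add: indicator_def)
  qed
  have J: "J = (LINT w|lebesgue_on (T -` F). indicator B (T w) * (g (T w))\<^sup>2)"
    unfolding J_def
  proof (rule integral_area)
    show "(\<lambda>x. indicator B x * (g x)\<^sup>2) \<in> borel_measurable (area_on F)"
      unfolding measurable_area_iff using Jint by (rule borel_measurable_integrable)
  qed
  have J0: "0 \<le> J"
    unfolding J_def by simp
  have "(\<integral>\<^sup>+w. ennreal ((g (T w))\<^sup>2) * indicator B (T w) \<partial>lborel) = ennreal J"
  proof -
    have "T w \<in> F" if "T w \<in> B" for w
    proof -
      have "ball x0 R \<subseteq> ball x0 (\<rho>\<^sup>2 * h)"
        using R(2) by (rule subset_ball)
      moreover have "T w \<in> affine hull F"
        using range_T by blast
      ultimately show ?thesis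
        using that face_center(2)[OF F] by (auto simp: B_def x0_def)
    qed
    then have "(\<integral>\<^sup>+w. ennreal ((g (T w))\<^sup>2) * indicator B (T w) \<partial>lborel)
        = (\<integral>\<^sup>+w. ennreal (indicator B (T w) * (g (T w))\<^sup>2) * indicator (T -` F) w \<partial>lborel)"
      by (intro nn_integral_cong) (auto simp: indicator_def)
    also have "\<dots> = (\<integral>\<^sup>+w. ennreal (indicator B (T w) * (g (T w))\<^sup>2) \<partial>lebesgue_on (T -` F))"
      by (rule nn_integral_lebesgue_on[OF vimage_borel, symmetric])
    also have "\<dots> = ennreal J"
      unfolding J by (intro nn_integral_eq_integral[OF Jint]) auto
    finally show ?thesis .
  qed
  note nnJ = this
  have "ennreal ((l2_norm (lebesgue_on B) p)\<^sup>2) = (\<integral>\<^sup>+z. f z \<partial>lborel)"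
    unfolding f_def
    using l2_norm_eq_nn_integral[OF continuous_L2[OF _ _ pc], of B] by (simp add: B_def)
  also have "\<dots> = (\<integral>\<^sup>+t. \<integral>\<^sup>+w. f (a + L w + t *\<^sub>R normal) \<partial>lborel \<partial>lborel)"
    by (rule nn_integral_coordinates[OF f])
  also have "\<dots> \<le> (\<integral>\<^sup>+t. \<integral>\<^sup>+w. indicator {-R<..<R} t * (ennreal ((g (T w))\<^sup>2) * indicator B (T w)) \<partial>lborel \<partial>lborel)"
    by (intro nn_integral_mono ind)
  also have "\<dots> = (\<integral>\<^sup>+t. indicator {-R<..<R} t * ennreal J \<partial>lborel)"
    by (subst nn_integral_cmult) (simp_all add: nnJ)
  also have "\<dots> = ennreal (2 * R) * ennreal J"
    using R by (simp add: nn_integral_multc)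
  also have "\<dots> = ennreal (2 * R * J)"
    using R J0 by (simp add: ennreal_mult)
  finally have "(l2_norm (lebesgue_on B) p)\<^sup>2 \<le> 2 * R * J"
    using R J0 by (subst (asm) ennreal_le_iff) auto
  then show thesis
    using that[OF p pF] by (simp add: B_def J_def x0_def)
qed

lemma l2_norm_face_bound:
  assumes F: "F \<in> Fs" and g: "continuous_on UNIV g" and bound: "\<And>x. x \<in> F \<Longrightarrow> (g x)\<^sup>2 \<le> B"
  shows "(l2_norm (area_on F) g)\<^sup>2 \<le> B * (pi * h\<^sup>2)"
proof -
  obtain a L where fc: "face_chart a L F"
    using face_chart_exists[OF face_compact[OF F] face_aff_dim[OF F]] .
  then interpret face_chart a L F .
  have B: "B \<ge> 0"
    using bound[OF face_center(3)[OF F]] zero_le_power2 order_trans by blast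
  obtain w0 where w0: "face_center F = T w0"
    using face_center(1)[OF F] range_T by auto
  have sub: "T -` F \<subseteq> cball w0 h"
  proof
    fix w assume "w \<in> T -` F"
    then have "T w \<in> cball (T w0) h"
      using face_subset_cball[OF F] w0 by auto
    then show "w \<in> cball w0 h"
      by (simp add: dist_T)
  qed
  have gL2: "g \<in> L2 (area_on F)"
    using g by (rule continuous_L2_area)
  have "(l2_norm (area_on F) g)\<^sup>2 = (l2_norm (lebesgue_on (T -` F)) (\<lambda>w. g (T w)))\<^sup>2"
    unfolding l2_norm_power2 using L2_measurable[OF gL2] by (intro l2_inner_area)
  also have "\<dots> \<le> (sqrt B)\<^sup>2 * measure (lebesgue_on (T -` F)) (space (lebesgue_on (T -` F)))"
  proof (rule l2_norm_bounded[OF finite_measure_vimage])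
    show "(\<lambda>w. g (T w)) \<in> borel_measurable (lebesgue_on (T -` F))"
      using gL2 unfolding L2_area_iff by (rule L2_measurable)
    fix w assume "w \<in> space (lebesgue_on (T -` F))"
    then have "(g (T w))\<^sup>2 \<le> B"
      using bound by simp
    then show "norm (g (T w)) \<le> sqrt B"
      using real_le_rsqrt[of "\<bar>g (T w)\<bar>" B] by simp
  qed
  also have "\<dots> = B * measure lebesgue (T -` F)"
    using B vimage_lebesgue by (simp add: measure_restrict_space)
  also have "\<dots> \<le> B * measure lebesgue (cball w0 h)"
    using sub B vimage_lebesgue by (intro mult_left_mono measure_mono_fmeasurable) auto
  also have "measure lebesgue (cball w0 h) = pi * h\<^sup>2"
    using h_pos by (simp add: content_cball unit_ball_vol_2)
  finally show ?thesis .
qed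

text \<open>The polynomial constants appear as hypotheses because they are to be fixed before the
  element. Green's formula is tested with the sum, over all faces, of an extended trace times a bump
  at the face center: the boundary side bounds the trace near the centers from below, the volume
  side splits orthogonally.\<close>

lemma trace_inverse_estimate:
  assumes C1: "C1 > 0"
    "\<And>p (a :: real^3) R x. p \<in> polys m \<Longrightarrow> R > 0 \<Longrightarrow>
      (p x * bump a R x)\<^sup>2 \<le> C1 / R ^ 3 * (l2_norm (lebesgue_on (ball a (R / 2))) p)\<^sup>2"
    "\<And>p (a :: real^3) R x i. p \<in> polys m \<Longrightarrow> R > 0 \<Longrightarrow>
      (R * partial i (\<lambda>x. p x * bump a R x) x)\<^sup>2 \<le> C1 / R ^ 3 * (l2_norm (lebesgue_on (ball a (R / 2))) p)\<^sup>2"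
    and C3: "C3 > 0"
    "\<And>p (a :: real^3) R x. p \<in> polys m \<Longrightarrow> R > 0 \<Longrightarrow> x \<in> cball a (80 / \<rho> ^ 3 * R) \<Longrightarrow>
      (p x)\<^sup>2 \<le> C3 / R ^ 3 * (l2_norm (lebesgue_on (ball a R)) p)\<^sup>2"
    and v: "v \<in> L2 (lebesgue_on E)" and d: "d \<in> L2 (lebesgue_on E)"
    and g: "\<And>F. F \<in> Fs \<Longrightarrow> g F \<in> polys m"
    and green: "\<And>\<phi>. smooth \<phi> \<Longrightarrow> l2_inner (lebesgue_on E) v (grad \<phi>) + l2_inner (lebesgue_on E) d \<phi>
      = (\<Sum>F\<in>Fs. l2_inner (area_on F) (g F) \<phi>)"
  shows "h * (\<Sum>F\<in>Fs. (l2_norm (area_on F) (g F))\<^sup>2)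
    \<le> (48 * pi * exp 4 * C1 * C3 * unit_ball_vol 3 * (40 / \<rho> ^ 3) ^ 3)
      * ((l2_norm (lebesgue_on E) v)\<^sup>2 + h\<^sup>2 * (l2_norm (lebesgue_on E) d)\<^sup>2)"
proof -
  define u :: real where "u = unit_ball_vol 3"
  have u: "u > 0"
    by (simp add: u_def unit_ball_vol_pos)
  \<comment> \<open>The closed balls of radius R then lie in the pairwise disjoint open balls of
    radius \<delta> / 2.\<close>
  define R where "R = \<delta> / 4"
  have R: "R > 0" "R / 2 \<le> \<rho>\<^sup>2 * h"
    using \<delta>_pos \<delta>_less(1) by (auto simp: R_def)
  \<comment> \<open>In units of R / 2 the ball of radius h about a face center, which contains the
    face, has radius 80 / \<rho>^3; this is the dilation in the hypothesis on
    \<open>C3\<close>.\<close>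
  have hR: "h = 40 / \<rho> ^ 3 * R"
    using rho_pos by (simp add: R_def \<delta>_def)
  have Rh: "R \<le> h"
    using \<delta>_less(2) r_le_h r_pos by (simp add: R_def)
  define J where "J F = (LINT x|area_on F. indicator (ball (face_center F) (R / 2)) x * (g F x)\<^sup>2)" for F
  have J0: "0 \<le> J F" for F
    unfolding J_def by simp
  have "\<exists>p. p \<in> polys m \<and> (\<forall>x\<in>F. p x = g F x)
      \<and> (l2_norm (lebesgue_on (ball (face_center F) (R / 2))) p)\<^sup>2 \<le> 2 * (R / 2) * J F" if "F \<in> Fs" for F
  proof -
    have "0 < R / 2"
      using R by simp
    then show ?thesis
    proof (rule face_polynomial_extension[OF that g[OF that] _ R(2)])
      fix p assume p: "p \<in> polys m" "\<And>x. x \<in> F \<Longrightarrow> p x = g F x"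
        "(l2_norm (lebesgue_on (ball (face_center F) (R / 2))) p)\<^sup>2
          \<le> 2 * (R / 2) * (LINT x|area_on F. indicator (ball (face_center F) (R / 2)) x * (g F x)\<^sup>2)"
      show ?thesis
        by (intro exI[of _ p] conjI ballI) (use p in \<open>simp_all only: J_def\<close>)
    qed
  qed
  then obtain p where p: "\<And>F. F \<in> Fs \<Longrightarrow> p F \<in> polys m" "\<And>F x. F \<in> Fs \<Longrightarrow> x \<in> F \<Longrightarrow> p F x = g F x"
    "\<And>F. F \<in> Fs \<Longrightarrow> (l2_norm (lebesgue_on (ball (face_center F) (R / 2))) (p F))\<^sup>2 \<le> 2 * (R / 2) * J F"
    by metis
  define A where "A F = (l2_norm (lebesgue_on (ball (face_center F) (R / 2))) (p F))\<^sup>2" for F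
  have A: "0 \<le> A F" "F \<in> Fs \<Longrightarrow> A F \<le> R * J F" for F
    using p(3)[of F] by (auto simp: A_def)
  define G where "G = (\<Sum>F\<in>Fs. J F)"
  have G: "G \<ge> 0"
    unfolding G_def using J0 by (intro sum_nonneg)
  define \<phi> where "\<phi> F x = p F x * bump (face_center F) R x" for F x
  have \<phi>s: "smooth (\<phi> F)" if "F \<in> Fs" for F
    unfolding \<phi>_def using p(1)[OF that] by (intro smooth_mult smooth_polys smooth_bump)
  have \<phi>supp: "compactly_supported_in (cball (face_center F) R) (\<phi> F)" for F
    unfolding \<phi>_def using R by (intro compactly_supported_in_mult_left compactly_supported_bump) auto
  have \<phi>0: "\<phi> F x = 0" "grad (\<phi> F) x = 0" if "x \<notin> cball (face_center F) R" for F x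
    using compactly_supported_in_eq_0[OF \<phi>supp that]
      compactly_supported_in_eq_0[OF compactly_supported_in_partial[OF \<phi>supp] that]
    by (simp_all add: grad_def vec_eq_iff)
  have disj: "x \<notin> cball (face_center F) R \<or> x \<notin> cball (face_center F') R"
    if "F \<in> Fs" "F' \<in> Fs" "F \<noteq> F'" for F F' x
  proof -
    have "cball (face_center G) R \<subseteq> ball (face_center G) (\<delta> / 2)" for G
      using \<delta>_pos by (simp add: R_def cball_subset_ball_iff)
    then show ?thesis
      using face_balls_disjoint[OF that] by blast
  qed
  have orth: "\<phi> F x \<bullet> \<phi> F' x = 0" "grad (\<phi> F) x \<bullet> grad (\<phi> F') x = 0"
    if "F \<in> Fs" "F' \<in> Fs" "F \<noteq> F'" for F F' x
    using disj[OF that, of x] \<phi>0[of x F] \<phi>0[of x F'] by auto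
  define \<Phi> where "\<Phi> x = (\<Sum>F\<in>Fs. \<phi> F x)" for x
  have \<Phi>s: "smooth \<Phi>"
    unfolding \<Phi>_def using \<phi>s by (rule smooth_sum)
  have grad\<Phi>: "grad \<Phi> = (\<lambda>x. \<Sum>F\<in>Fs. grad (\<phi> F) x)"
  proof (intro ext vec_eq_iff[THEN iffD2] allI)
    fix x and i :: 3
    show "grad \<Phi> x $ i = (\<Sum>F\<in>Fs. grad (\<phi> F) x) $ i"
      unfolding \<Phi>_def grad_def using \<phi>s by (simp add: partial_sum smooth_differentiable)
  qed
  have gc: "continuous_on UNIV (grad f)" if "smooth f" for f
    unfolding grad_def[abs_def] using that by (intro continuous_on_vec_lambda smooth_continuous smooth_partial)
  have \<phi>L2: "\<phi> F \<in> L2 (lebesgue_on E)" "grad (\<phi> F) \<in> L2 (lebesgue_on E)" if "F \<in> Fs" for F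
    using gc[OF \<phi>s[OF that]] smooth_continuous[OF \<phi>s[OF that]]
    by (auto intro: continuous_L2[OF E_bounded E_lebesgue])
  have \<Phi>L2: "\<Phi> \<in> L2 (lebesgue_on E)" "grad \<Phi> \<in> L2 (lebesgue_on E)"
    using gc[OF \<Phi>s] smooth_continuous[OF \<Phi>s] by (auto intro: continuous_L2[OF E_bounded E_lebesgue])
  have \<phi>_norm: "(l2_norm (lebesgue_on E) (\<phi> F))\<^sup>2 \<le> C1 * u * (R * J F)"
    "(l2_norm (lebesgue_on E) (grad (\<phi> F)))\<^sup>2 \<le> 3 * C1 * u / R\<^sup>2 * (R * J F)" if F: "F \<in> Fs" for F
  proof -
    have "(l2_norm (lebesgue_on E) (\<phi> F))\<^sup>2 \<le> (C1 / R ^ 3 * A F) * (unit_ball_vol 3 * R ^ 3)"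
    proof (rule l2_norm_supported_ball[OF smooth_continuous[OF \<phi>s[OF F]] E_lebesgue])
      show "(norm (\<phi> F x))\<^sup>2 \<le> C1 / R ^ 3 * A F" for x
        using C1(2)[OF p(1)[OF F] R(1)] by (simp add: \<phi>_def A_def)
    qed (use R \<phi>0 in auto)
    also have "\<dots> = C1 * u * A F"
      using R by (simp add: u_def)
    also have "\<dots> \<le> C1 * u * (R * J F)"
      using A(2)[OF F] C1(1) u by (intro mult_left_mono) auto
    finally show "(l2_norm (lebesgue_on E) (\<phi> F))\<^sup>2 \<le> C1 * u * (R * J F)" .
    have "(l2_norm (lebesgue_on E) (grad (\<phi> F)))\<^sup>2 \<le> (3 * (C1 / R ^ 3 * A F / R\<^sup>2)) * (unit_ball_vol 3 * R ^ 3)"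
    proof (rule l2_norm_supported_ball[OF gc[OF \<phi>s[OF F]] E_lebesgue])
      fix x
      have "(partial i (\<phi> F) x)\<^sup>2 \<le> C1 / R ^ 3 * A F / R\<^sup>2" for i
      proof -
        have "R\<^sup>2 * (partial i (\<phi> F) x)\<^sup>2 \<le> C1 / R ^ 3 * A F"
          using C1(3)[OF p(1)[OF F] R(1)] unfolding \<phi>_def A_def power_mult_distrib by blast
        then show ?thesis
          using R(1) by (simp add: pos_le_divide_eq mult.commute)
      qed
      then have "(\<Sum>i\<in>UNIV. (partial i (\<phi> F) x)\<^sup>2) \<le> (\<Sum>i\<in>(UNIV :: 3 set). C1 / R ^ 3 * A F / R\<^sup>2)"
        by (intro sum_mono)
      then show "(norm (grad (\<phi> F) x))\<^sup>2 \<le> 3 * (C1 / R ^ 3 * A F / R\<^sup>2)"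
        unfolding norm_vec_power2 by (simp add: grad_def)
    qed (use R \<phi>0 in auto)
    also have "\<dots> = 3 * C1 * u / R\<^sup>2 * A F"
      using R by (simp add: u_def field_simps)
    also have "\<dots> \<le> 3 * C1 * u / R\<^sup>2 * (R * J F)"
      using A(2)[OF F] C1(1) u by (intro mult_left_mono) auto
    finally show "(l2_norm (lebesgue_on E) (grad (\<phi> F)))\<^sup>2 \<le> 3 * C1 * u / R\<^sup>2 * (R * J F)" .
  qed
  \<comment> \<open>Chosen so that (K N)^2 is the sum of the gradient bounds; the norm of \<Phi>
    itself carries one more factor R.\<close>
  define K where "K = sqrt (3 * C1 * u / R)"
  have K: "K \<ge> 0" "K\<^sup>2 = 3 * C1 * u / R"
    using C1(1) u R by (auto simp: K_def)
  define N where "N = sqrt G"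
  have N: "N \<ge> 0" "N\<^sup>2 = G"
    using G by (auto simp: N_def)
  have norm_grad: "l2_norm (lebesgue_on E) (grad \<Phi>) \<le> K * N"
  proof (rule power2_le_imp_le)
    have "(l2_norm (lebesgue_on E) (grad \<Phi>))\<^sup>2 = (\<Sum>F\<in>Fs. (l2_norm (lebesgue_on E) (grad (\<phi> F)))\<^sup>2)"
      unfolding grad\<Phi> by (intro l2_norm_power2_sum_orthogonal Fs_finite \<phi>L2 orth)
    also have "\<dots> \<le> (\<Sum>F\<in>Fs. 3 * C1 * u / R\<^sup>2 * (R * J F))"
      by (intro sum_mono \<phi>_norm)
    also have "\<dots> = (K * N)\<^sup>2"
    proof -
      have "3 * C1 * u / R\<^sup>2 * (R * J F) = 3 * C1 * u / R * J F" for F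
        using R by (simp add: power2_eq_square)
      then show ?thesis
        unfolding power_mult_distrib K(2) N(2) G_def by (simp add: sum_distrib_left)
    qed
    finally show "(l2_norm (lebesgue_on E) (grad \<Phi>))\<^sup>2 \<le> (K * N)\<^sup>2" .
  qed (use K N in simp)
  have norm_\<Phi>: "l2_norm (lebesgue_on E) \<Phi> \<le> R * K * N"
  proof (rule power2_le_imp_le)
    have "(l2_norm (lebesgue_on E) \<Phi>)\<^sup>2 = (\<Sum>F\<in>Fs. (l2_norm (lebesgue_on E) (\<phi> F))\<^sup>2)"
      unfolding \<Phi>_def by (intro l2_norm_power2_sum_orthogonal Fs_finite \<phi>L2 orth)
    also have "\<dots> \<le> (\<Sum>F\<in>Fs. C1 * u * (R * J F))"
      by (intro sum_mono \<phi>_norm)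
    also have "\<dots> = C1 * u * R * G"
      unfolding G_def by (simp add: sum_distrib_left mult_ac)
    also have "\<dots> \<le> 3 * (C1 * u * R * G)"
      using C1(1) u R G by simp
    also have "\<dots> = (R * K * N)\<^sup>2"
      unfolding power_mult_distrib K(2) N(2) using R by (simp add: power2_eq_square)
    finally show "(l2_norm (lebesgue_on E) \<Phi>)\<^sup>2 \<le> (R * K * N)\<^sup>2" .
  qed (use K N R in simp)
  \<comment> \<open>On \<open>F\<close> only the summand belonging to \<open>F\<close> survives,
    since \<open>F\<close> avoids the balls of radius \<delta> about the other face centers.\<close>
  have lower: "exp (-2) * J F \<le> l2_inner (area_on F) (g F) \<Phi>" if F: "F \<in> Fs" for F
  proof -
    have sp: "space (area_on F) = F"
      using F by (rule space_face)
    have gcont: "continuous_on UNIV (g F)"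
      using g[OF F] by (intro smooth_continuous smooth_polys)
    have gL2: "g F \<in> L2 (area_on F)" and \<Phi>A: "\<Phi> \<in> L2 (area_on F)"
      using gcont smooth_continuous[OF \<Phi>s] by (auto intro: continuous_L2_face[OF F])
    have "exp (-2) * J F = (LINT x|area_on F. exp (-2) * (indicator (ball (face_center F) (R / 2)) x * (g F x)\<^sup>2))"
      by (simp add: J_def)
    also have "\<dots> \<le> (LINT x|area_on F. g F x \<bullet> \<Phi> x)"
    proof (rule integral_mono_AE')
      show "integrable (area_on F) (\<lambda>x. g F x \<bullet> \<Phi> x)"
        using gL2 \<Phi>A by (rule L2_integrable_inner)
      have \<Phi>_eq: "g F x \<bullet> \<Phi> x = (g F x)\<^sup>2 * bump (face_center F) R x" if "x \<in> F" for x
      proof -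
        have "\<phi> F' x = 0" if "F' \<in> Fs - {F}" for F'
        proof -
          have "x \<notin> ball (face_center F') \<delta>"
            using near_face_center_other[of F' F] F \<open>x \<in> F\<close> that by blast
          then have "x \<notin> cball (face_center F') R"
            using \<delta>_pos by (auto simp: R_def)
          then show ?thesis
            by (rule \<phi>0)
        qed
        then have "\<Phi> x = \<phi> F x"
          unfolding \<Phi>_def using Fs_finite F by (simp add: sum.remove)
        then show ?thesis
          using p(2)[OF F that] by (simp add: \<phi>_def power2_eq_square)
      qed
      show "AE x in area_on F. exp (-2) * (indicator (ball (face_center F) (R / 2)) x * (g F x)\<^sup>2) \<le> g F x \<bullet> \<Phi> x"
      proof (rule AE_I2)
        fix x assume "x \<in> space (area_on F)"
        then have x: "x \<in> F"
          using sp by simp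
        show "exp (-2) * (indicator (ball (face_center F) (R / 2)) x * (g F x)\<^sup>2) \<le> g F x \<bullet> \<Phi> x"
        proof (cases "x \<in> ball (face_center F) (R / 2)")
          case True
          then have "exp (-2) \<le> bump (face_center F) R x"
            using R by (intro bump_ge) auto
          then have "exp (-2) * (g F x)\<^sup>2 \<le> bump (face_center F) R x * (g F x)\<^sup>2"
            by (intro mult_right_mono) auto
          then show ?thesis
            unfolding \<Phi>_eq[OF x] using True by (simp add: mult.commute)
        next
          case False
          then show ?thesis
            unfolding \<Phi>_eq[OF x] using bump_nonneg by simp
        qed
      qed
      show "AE x in area_on F. 0 \<le> g F x \<bullet> \<Phi> x"
        using \<Phi>_eq bump_nonneg sp by (intro AE_I2) simp
    qed
    finally show ?thesis
      by (simp add: l2_inner_def)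
  qed
  define V where "V = l2_norm (lebesgue_on E) v"
  define D where "D = l2_norm (lebesgue_on E) d"
  have VD: "V \<ge> 0" "D \<ge> 0"
    by (simp_all add: V_def D_def l2_norm_nonneg)
  have "exp (-2) * G \<le> (\<Sum>F\<in>Fs. l2_inner (area_on F) (g F) \<Phi>)"
    unfolding G_def sum_distrib_left by (intro sum_mono lower)
  also have "\<dots> = l2_inner (lebesgue_on E) v (grad \<Phi>) + l2_inner (lebesgue_on E) d \<Phi>"
    using green[OF \<Phi>s] by simp
  also have "\<dots> \<le> V * (K * N) + D * (R * K * N)"
  proof (rule add_mono)
    have "l2_inner (lebesgue_on E) v (grad \<Phi>) \<le> V * l2_norm (lebesgue_on E) (grad \<Phi>)"
      using l2_Cauchy_Schwarz[OF v \<Phi>L2(2)] by (simp add: V_def)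
    also have "\<dots> \<le> V * (K * N)"
      using norm_grad VD by (intro mult_left_mono)
    finally show "l2_inner (lebesgue_on E) v (grad \<Phi>) \<le> V * (K * N)" .
    have "l2_inner (lebesgue_on E) d \<Phi> \<le> D * l2_norm (lebesgue_on E) \<Phi>"
      using l2_Cauchy_Schwarz[OF d \<Phi>L2(1)] by (simp add: D_def)
    also have "\<dots> \<le> D * (R * K * N)"
      using norm_\<Phi> VD by (intro mult_left_mono)
    finally show "l2_inner (lebesgue_on E) d \<Phi> \<le> D * (R * K * N)" .
  qed
  finally have "exp (-2) * N\<^sup>2 \<le> K * N * (V + R * D)"
    unfolding N(2) by (simp add: algebra_simps)
  then have GV1: "G \<le> (K / exp (-2))\<^sup>2 * (V + R * D)\<^sup>2"
    unfolding N(2)[symmetric] using K N VD R by (intro absorb_square) auto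
  have K_exp: "(K / exp (-2))\<^sup>2 = exp 4 * (3 * C1 * u / R)"
    unfolding power_divide K(2) by (simp add: exp_minus power2_eq_square field_simps flip: exp_add)
  have VD2: "(V + R * D)\<^sup>2 \<le> 2 * (V\<^sup>2 + h\<^sup>2 * D\<^sup>2)"
  proof -
    have "(V + R * D)\<^sup>2 \<le> 2 * V\<^sup>2 + 2 * (R * D)\<^sup>2"
      using sum_squares_bound[of V "R * D"] by (simp add: power2_sum)
    also have "(R * D)\<^sup>2 \<le> (h * D)\<^sup>2"
      using Rh R VD by (intro power_mono mult_right_mono) auto
    finally show ?thesis
      by (simp add: power_mult_distrib)
  qed
  have "exp 4 * (3 * C1 * u / R) * (V + R * D)\<^sup>2 \<le> exp 4 * (3 * C1 * u / R) * (2 * (V\<^sup>2 + h\<^sup>2 * D\<^sup>2))"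
    using C1(1) u R by (intro mult_left_mono VD2) auto
  then have GV: "G \<le> exp 4 * (3 * C1 * u / R) * (2 * (V\<^sup>2 + h\<^sup>2 * D\<^sup>2))"
    using GV1 unfolding K_exp by (rule order_trans[rotated])
  \<comment> \<open>From the part of the face near its center to the whole face: the extension p
    agrees with g on the face and is bounded on the large ball by its norm on the small one.\<close>
  have gF: "(l2_norm (area_on F) (g F))\<^sup>2 \<le> 8 * pi * C3 * h\<^sup>2 / R\<^sup>2 * J F" if F: "F \<in> Fs" for F
  proof -
    have "(l2_norm (area_on F) (g F))\<^sup>2 \<le> (C3 / (R / 2) ^ 3 * A F) * (pi * h\<^sup>2)"
    proof (rule l2_norm_face_bound[OF F])
      show "continuous_on UNIV (g F)"
        using g[OF F] by (intro smooth_continuous smooth_polys)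
      fix x assume x: "x \<in> F"
      then have "x \<in> cball (face_center F) (80 / \<rho> ^ 3 * (R / 2))"
        using face_subset_cball[OF F] by (auto simp: hR)
      from C3(2)[OF p(1)[OF F] _ this] show "(g F x)\<^sup>2 \<le> C3 / (R / 2) ^ 3 * A F"
        unfolding A_def p(2)[OF F x] using R by simp
    qed
    also have "\<dots> \<le> (C3 / (R / 2) ^ 3 * (R * J F)) * (pi * h\<^sup>2)"
      using A(2)[OF F] C3(1) R by (intro mult_right_mono mult_left_mono) auto
    also have "\<dots> = 8 * pi * C3 * h\<^sup>2 / R\<^sup>2 * J F"
      using R by (simp add: power_divide power3_eq_cube power2_eq_square)
    finally show ?thesis .
  qed
  have "(\<Sum>F\<in>Fs. (l2_norm (area_on F) (g F))\<^sup>2) \<le> (\<Sum>F\<in>Fs. 8 * pi * C3 * h\<^sup>2 / R\<^sup>2 * J F)"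
    by (intro sum_mono gF)
  also have "\<dots> = 8 * pi * C3 * h\<^sup>2 / R\<^sup>2 * G"
    by (simp add: G_def sum_distrib_left)
  also have "\<dots> \<le> 8 * pi * C3 * h\<^sup>2 / R\<^sup>2 * (exp 4 * (3 * C1 * u / R) * (2 * (V\<^sup>2 + h\<^sup>2 * D\<^sup>2)))"
    using GV C3(1) by (intro mult_left_mono) auto
  finally have "h * (\<Sum>F\<in>Fs. (l2_norm (area_on F) (g F))\<^sup>2)
      \<le> h * (8 * pi * C3 * h\<^sup>2 / R\<^sup>2 * (exp 4 * (3 * C1 * u / R) * (2 * (V\<^sup>2 + h\<^sup>2 * D\<^sup>2))))"
    using h_pos by (intro mult_left_mono) auto
  also have "\<dots> = (48 * pi * exp 4 * C1 * C3 * u * (h / R) ^ 3) * (V\<^sup>2 + h\<^sup>2 * D\<^sup>2)"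
    using R by (simp add: power_divide power3_eq_cube power2_eq_square)
  also have "h / R = 40 / \<rho> ^ 3"
    using R by (simp add: hR)
  finally show ?thesis
    by (simp add: V_def D_def u_def)
qed

end

section \<open>Poincare and trace inequalities on star-shaped elements\<close>

lemma nn_integral_indicator_mult: "A \<in> sets M \<Longrightarrow> (\<integral>\<^sup>+x. indicator A x * c \<partial>M) = c * emeasure M A"
  by (simp add: mult.commute[of _ c] nn_integral_cmult_indicator)

text \<open>Cauchy-Schwarz on the unit interval, obtained from nonnegativity of the variance of f'.
  Extended nonnegative values let the bound be integrated over further variables by Tonelli.\<close>

lemma ennreal_square_increment_le:
  fixes f f' :: "real \<Rightarrow> real"
  assumes f: "\<And>t. (f has_real_derivative f' t) (at t)" and f': "continuous_on UNIV f'"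
  shows "ennreal ((f 1 - f 0)\<^sup>2) \<le> (\<integral>\<^sup>+t. indicator {0..1} t * ennreal ((f' t)\<^sup>2) \<partial>lborel)"
proof -
  define \<Delta> where "\<Delta> = f 1 - f 0"
  have c: "isCont f' t" for t
    using f' by (simp add: continuous_on_eq_continuous_at)
  have i: "integrable lborel (\<lambda>t. g t * indicator {0..1} t)" if "\<And>t. isCont g t" for g :: "real \<Rightarrow> real"
    using that by (intro borel_integrable_atLeastAtMost) auto
  have 1: "(LINT t|lborel. f' t * indicator {0..1} t) = \<Delta>"
    unfolding \<Delta>_def using f c by (intro integral_FTC_Icc_real) auto
  have "0 \<le> (LINT t|lborel. (f' t - \<Delta>)\<^sup>2 * indicator {0..1} t)"
    by (intro integral_nonneg_AE AE_I2) (simp add: indicator_def)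
  also have "\<dots> = (LINT t|lborel. (f' t)\<^sup>2 * indicator {0..1} t - 2 * \<Delta> * (f' t * indicator {0..1} t)
      + \<Delta>\<^sup>2 * indicator {0..1} t)"
    by (intro Bochner_Integration.integral_cong) (auto simp: power2_eq_square algebra_simps)
  also have "\<dots> = (LINT t|lborel. (f' t)\<^sup>2 * indicator {0..1} t) - 2 * \<Delta> * \<Delta> + \<Delta>\<^sup>2"
    using i[of "\<lambda>t. (f' t)\<^sup>2"] i[of f'] c i[of "\<lambda>t. 1"] by (simp add: 1)
  finally have "\<Delta>\<^sup>2 \<le> (LINT t|lborel. (f' t)\<^sup>2 * indicator {0..1} t)"
    by (simp add: power2_eq_square)
  then have "ennreal (\<Delta>\<^sup>2) \<le> ennreal (LINT t|lborel. (f' t)\<^sup>2 * indicator {0..1} t)"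
    by (rule ennreal_leI)
  also have "\<dots> = (\<integral>\<^sup>+t. ennreal ((f' t)\<^sup>2 * indicator {0..1} t) \<partial>lborel)"
    using i[of "\<lambda>t. (f' t)\<^sup>2"] c by (intro nn_integral_eq_integral[symmetric]) auto
  also have "\<dots> = (\<integral>\<^sup>+t. indicator {0..1} t * ennreal ((f' t)\<^sup>2) \<partial>lborel)"
    by (intro nn_integral_cong) (simp add: indicator_def)
  finally show ?thesis
    by (simp add: \<Delta>_def)
qed

text \<open>The interval on the right is open because the cones to which this is applied contain
  neither their apex nor their base.\<close>

lemma ennreal_increment_le:
  fixes f f' q :: "real \<Rightarrow> real"
  assumes f: "\<And>t. (f has_real_derivative f' t) (at t)" and f': "continuous_on UNIV f'"
    and q: "\<And>t. 0 \<le> t \<Longrightarrow> t \<le> 1 \<Longrightarrow> f' t \<le> q t"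
  shows "ennreal (f 1 - f 0) \<le> (\<integral>\<^sup>+t. indicator {0<..<1} t * ennreal (q t) \<partial>lborel)"
proof -
  have c: "isCont f' t" for t
    using f' by (simp add: continuous_on_eq_continuous_at)
  have i: "integrable lborel (\<lambda>t. f' t * indicator {0..1} t)"
    using c by (intro borel_integrable_atLeastAtMost) auto
  have "f 1 - f 0 = (LINT t|lborel. f' t * indicator {0..1} t)"
    using f c by (intro integral_FTC_Icc_real[symmetric]) auto
  also have "\<dots> \<le> (LINT t|lborel. max 0 (f' t * indicator {0..1} t))"
    using i by (intro integral_mono) auto
  finally have "ennreal (f 1 - f 0) \<le> ennreal (LINT t|lborel. max 0 (f' t * indicator {0..1} t))"
    by (rule ennreal_leI)
  also have "\<dots> = (\<integral>\<^sup>+t. ennreal (max 0 (f' t * indicator {0..1} t)) \<partial>lborel)"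
    using i by (intro nn_integral_eq_integral[symmetric]) auto
  also have "\<dots> = (\<integral>\<^sup>+t. ennreal (f' t * indicator {0..1} t) \<partial>lborel)"
    by (intro nn_integral_cong) (auto simp: max_def ennreal_neg)
  finally have "ennreal (f 1 - f 0) \<le> (\<integral>\<^sup>+t. ennreal (f' t * indicator {0..1} t) \<partial>lborel)" .
  also have "\<dots> \<le> (\<integral>\<^sup>+t. indicator {0<..<1} t * ennreal (q t) \<partial>lborel)"
  proof (rule nn_integral_mono_AE)
    have "AE t in lborel. t \<noteq> (0 :: real)" "AE t in lborel. t \<noteq> (1 :: real)"
      by (rule AE_lborel_singleton)+
    then show "AE t in lborel. ennreal (f' t * indicator {0..1} t) \<le> indicator {0<..<1} t * ennreal (q t)"
      by eventually_elim (auto simp: indicator_def intro!: ennreal_leI q)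
  qed
  finally show ?thesis .
qed

lemma line_derivative:
  assumes "smooth \<psi>"
  shows "((\<lambda>t. \<psi> (y + t *\<^sub>R b)) has_real_derivative grad \<psi> (y + t *\<^sub>R b) \<bullet> b) (at t)"
proof -
  have "((\<lambda>t. \<psi> (y + t *\<^sub>R b)) has_derivative (\<lambda>s. grad \<psi> (y + t *\<^sub>R b) \<bullet> (s *\<^sub>R b))) (at t)"
    using assms
    by (intro has_derivative_compose[where f = "\<lambda>t. y + t *\<^sub>R b", OF _ smooth_has_derivative_grad])
       (auto intro!: derivative_eq_intros)
  then show ?thesis
    by (simp add: has_field_derivative_def mult_commute_abs)
qed

lemma continuous_grad: "smooth \<psi> \<Longrightarrow> continuous_on S (grad \<psi>)"
  unfolding grad_def[abs_def] by (intro continuous_on_vec_lambda smooth_continuous smooth_partial)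

context mesh_element
begin

lemma segment_in_E:
  assumes "y \<in> ball c r" "x \<in> E" "0 \<le> t" "t \<le> 1"
  shows "y + t *\<^sub>R (x - y) \<in> E"
proof -
  have "closed_segment y x \<subseteq> E"
    using star assms by (simp add: star_shaped_wrt_def)
  moreover have "y + t *\<^sub>R (x - y) \<in> closed_segment y x"
    using assms by (auto simp: closed_segment_def algebra_simps intro!: exI[of _ t])
  ultimately show ?thesis
    by blast
qed

lemma emeasure_E_le: "emeasure lborel E \<le> ennreal (unit_ball_vol 3 * h ^ 3)"
proof -
  have "emeasure lborel E \<le> emeasure lborel (cball c h)"
    using E_subset_cball by (intro emeasure_mono) auto
  also have "\<dots> = ennreal (unit_ball_vol 3 * h ^ 3)"
    using h_pos by (simp add: emeasure_cball)
  finally show ?thesis .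
qed

lemma emeasure_center_ball: "emeasure lborel (ball c r) = ennreal (unit_ball_vol 3 * r ^ 3)"
  using r_pos by (simp add: emeasure_ball)

lemma E_borel [measurable]: "E \<in> sets borel"
  using E_open by simp

text \<open>The increment from y to x is a line integral over a segment that stays in
  \<open>E\<close> because y belongs to the star center. What remains is to exchange the three
  integrations and to substitute the intermediate point for one of the endpoints.\<close>

lemma increments_bound:
  assumes \<psi>: "smooth \<psi>"
  shows "(\<integral>\<^sup>+y. indicator (ball c r) y * (\<integral>\<^sup>+x. indicator E x * ennreal ((\<psi> x - \<psi> y)\<^sup>2) \<partial>lborel) \<partial>lborel)
    \<le> ennreal (8 * h\<^sup>2 * (unit_ball_vol 3 * r ^ 3 + unit_ball_vol 3 * h ^ 3) * (l2_norm (lebesgue_on E) (grad \<psi>))\<^sup>2)"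
proof -
  define B where "B = ball c r"
  have Bm [measurable]: "B \<in> sets borel"
    by (simp add: B_def)
  define W where "W z = ennreal ((norm (grad \<psi> z))\<^sup>2) * indicator E z" for z
  have [measurable]: "grad \<psi> \<in> borel_measurable borel" "\<psi> \<in> borel_measurable borel"
    using continuous_grad[OF \<psi>] smooth_continuous[OF \<psi>] by (auto intro: borel_measurable_continuous_onI)
  have Wm [measurable]: "W \<in> borel_measurable borel"
    unfolding W_def by measurable
  define I where "I = (l2_norm (lebesgue_on E) (grad \<psi>))\<^sup>2"
  have I: "ennreal I = (\<integral>\<^sup>+z. W z \<partial>lborel)"
    unfolding I_def W_def
    by (rule l2_norm_eq_nn_integral[OF continuous_L2[OF E_bounded E_lebesgue continuous_grad[OF \<psi>]] E_borel])
  define k where "k t x y = indicator B y * (indicator E x * W (t *\<^sub>R x + (1 - t) *\<^sub>R y))" for t :: real and x y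
  have pointwise: "indicator B y * (indicator E x * ennreal ((\<psi> x - \<psi> y)\<^sup>2))
      \<le> ennreal (h\<^sup>2) * (\<integral>\<^sup>+t. indicator {0..1} t * k t x y \<partial>lborel)" for x y
  proof (cases "y \<in> B \<and> x \<in> E")
    case True
    define f where "f t = \<psi> (y + t *\<^sub>R (x - y))" for t
    define f' where "f' t = grad \<psi> (y + t *\<^sub>R (x - y)) \<bullet> (x - y)" for t
    have df: "(f has_real_derivative f' t) (at t)" for t
      unfolding f_def f'_def by (rule line_derivative[OF \<psi>])
    have "continuous_on UNIV f'"
      unfolding f'_def by (intro continuous_intros continuous_on_compose2[OF continuous_grad[OF \<psi>, of UNIV]]) auto
    then have "ennreal ((f 1 - f 0)\<^sup>2) \<le> (\<integral>\<^sup>+t. indicator {0..1} t * ennreal ((f' t)\<^sup>2) \<partial>lborel)"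
      by (rule ennreal_square_increment_le[OF df])
    also have "\<dots> \<le> (\<integral>\<^sup>+t. ennreal (h\<^sup>2) * (indicator {0..1} t * k t x y) \<partial>lborel)"
    proof (rule nn_integral_mono)
      fix t :: real
      show "indicator {0..1} t * ennreal ((f' t)\<^sup>2) \<le> ennreal (h\<^sup>2) * (indicator {0..1} t * k t x y)"
      proof (cases "t \<in> {0..1}")
        case t: True
        define z where "z = y + t *\<^sub>R (x - y)"
        have z: "z = t *\<^sub>R x + (1 - t) *\<^sub>R y"
          by (simp add: z_def algebra_simps)
        have zE: "z \<in> E"
          unfolding z_def using True t by (intro segment_in_E) (auto simp: B_def)
        have "y \<in> E"
          using True center_ball_subset by (auto simp: B_def)
        then have "norm (x - y) \<le> h"
          using dist_le_h[of x y] True closure_subset[of E] by (auto simp: dist_norm)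
        then have "norm (grad \<psi> z) * norm (x - y) \<le> norm (grad \<psi> z) * h"
          by (intro mult_left_mono) auto
        then have "\<bar>f' t\<bar> \<le> h * norm (grad \<psi> z)"
          using Cauchy_Schwarz_ineq2[of "grad \<psi> z" "x - y"] by (simp add: f'_def z_def mult.commute)
        then have "\<bar>f' t\<bar>\<^sup>2 \<le> (h * norm (grad \<psi> z))\<^sup>2"
          by (intro power_mono) auto
        then have "ennreal ((f' t)\<^sup>2) \<le> ennreal (h\<^sup>2 * (norm (grad \<psi> z))\<^sup>2)"
          by (intro ennreal_leI) (simp add: power_mult_distrib)
        then show ?thesis
          using t zE True by (simp add: k_def W_def ennreal_mult flip: z)
      qed simp
    qed
    also have "\<dots> = ennreal (h\<^sup>2) * (\<integral>\<^sup>+t. indicator {0..1} t * k t x y \<partial>lborel)"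
      unfolding k_def by (intro nn_integral_cmult) measurable
    finally show ?thesis
      using True by (simp add: f_def)
  qed auto
  \<comment> \<open>For t at least 1/2 the intermediate point replaces x, otherwise it replaces y.
    So the contraction factor is never below 1/2, and the singular Jacobians at t = 0 and t = 1 are
    avoided.\<close>
  have slice: "(\<integral>\<^sup>+y. \<integral>\<^sup>+x. k t x y \<partial>lborel \<partial>lborel) \<le> 8 * (emeasure lborel B + emeasure lborel E) * ennreal I"
    if t: "t \<in> {0..1}" for t
  proof (cases "1 / 2 \<le> t")
    case True
    have "(\<integral>\<^sup>+y. \<integral>\<^sup>+x. k t x y \<partial>lborel \<partial>lborel)
        \<le> (\<integral>\<^sup>+y. indicator B y * (\<integral>\<^sup>+x. W ((1 - t) *\<^sub>R y + t *\<^sub>R x) \<partial>lborel) \<partial>lborel)"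
      unfolding k_def by (subst nn_integral_cmult[symmetric], measurable)
        (intro nn_integral_mono, auto simp: indicator_def add.commute)
    also have "\<dots> \<le> (\<integral>\<^sup>+y. indicator B y * (8 * ennreal I) \<partial>lborel)"
      unfolding I using True by (intro nn_integral_mono mult_left_mono nn_integral_lborel_affine_le Wm) auto
    also have "\<dots> = 8 * emeasure lborel B * ennreal I"
      by (subst nn_integral_indicator_mult) (simp_all add: mult_ac)
    also have "\<dots> \<le> 8 * (emeasure lborel B + emeasure lborel E) * ennreal I"
      by (intro mult_right_mono mult_left_mono) auto
    finally show ?thesis .
  next
    case False
    have "(\<integral>\<^sup>+y. \<integral>\<^sup>+x. k t x y \<partial>lborel \<partial>lborel) = (\<integral>\<^sup>+x. \<integral>\<^sup>+y. k t x y \<partial>lborel \<partial>lborel)"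
      unfolding k_def by (rule lborel_pair.Fubini') measurable
    also have "\<dots> \<le> (\<integral>\<^sup>+x. indicator E x * (\<integral>\<^sup>+y. W (t *\<^sub>R x + (1 - t) *\<^sub>R y) \<partial>lborel) \<partial>lborel)"
      unfolding k_def by (subst nn_integral_cmult[symmetric], measurable)
        (intro nn_integral_mono, auto simp: indicator_def)
    also have "\<dots> \<le> (\<integral>\<^sup>+x. indicator E x * (8 * ennreal I) \<partial>lborel)"
      unfolding I using False by (intro nn_integral_mono mult_left_mono nn_integral_lborel_affine_le Wm) auto
    also have "\<dots> = 8 * emeasure lborel E * ennreal I"
      by (subst nn_integral_indicator_mult) (simp_all add: mult_ac)
    also have "\<dots> \<le> 8 * (emeasure lborel B + emeasure lborel E) * ennreal I"
      by (intro mult_right_mono mult_left_mono) auto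
    finally show ?thesis .
  qed
  have "(\<integral>\<^sup>+y. indicator B y * (\<integral>\<^sup>+x. indicator E x * ennreal ((\<psi> x - \<psi> y)\<^sup>2) \<partial>lborel) \<partial>lborel)
      = (\<integral>\<^sup>+y. \<integral>\<^sup>+x. indicator B y * (indicator E x * ennreal ((\<psi> x - \<psi> y)\<^sup>2)) \<partial>lborel \<partial>lborel)"
    by (simp add: nn_integral_cmult)
  also have "\<dots> \<le> (\<integral>\<^sup>+y. \<integral>\<^sup>+x. ennreal (h\<^sup>2) * (\<integral>\<^sup>+t. indicator {0..1} t * k t x y \<partial>lborel) \<partial>lborel \<partial>lborel)"
    by (intro nn_integral_mono pointwise)
  also have "\<dots> = ennreal (h\<^sup>2) * (\<integral>\<^sup>+y. \<integral>\<^sup>+x. \<integral>\<^sup>+t. indicator {0..1} t * k t x y \<partial>lborel \<partial>lborel \<partial>lborel)"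
    unfolding k_def by (simp add: nn_integral_cmult)
  also have "(\<integral>\<^sup>+y. \<integral>\<^sup>+x. \<integral>\<^sup>+t. indicator {0..1} t * k t x y \<partial>lborel \<partial>lborel \<partial>lborel)
      = (\<integral>\<^sup>+y. \<integral>\<^sup>+t. \<integral>\<^sup>+x. indicator {0..1} t * k t x y \<partial>lborel \<partial>lborel \<partial>lborel)"
    unfolding k_def by (intro nn_integral_cong lborel_pair.Fubini') measurable
  also have "\<dots> = (\<integral>\<^sup>+t. \<integral>\<^sup>+y. \<integral>\<^sup>+x. indicator {0..1} t * k t x y \<partial>lborel \<partial>lborel \<partial>lborel)"
    unfolding k_def by (rule lborel_pair.Fubini') measurable
  also have "\<dots> = (\<integral>\<^sup>+t. indicator {0..1} t * (\<integral>\<^sup>+y. \<integral>\<^sup>+x. k t x y \<partial>lborel \<partial>lborel) \<partial>lborel)"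
    unfolding k_def by (simp add: nn_integral_cmult)
  also have "\<dots> \<le> (\<integral>\<^sup>+t. indicator {0..1 :: real} t * (8 * (emeasure lborel B + emeasure lborel E) * ennreal I) \<partial>lborel)"
    by (rule nn_integral_mono) (use slice in \<open>auto simp: indicator_def\<close>)
  also have "\<dots> = 8 * (emeasure lborel B + emeasure lborel E) * ennreal I"
    by (subst nn_integral_indicator_mult) simp_all
  also have "\<dots> \<le> 8 * (ennreal (unit_ball_vol 3 * r ^ 3) + ennreal (unit_ball_vol 3 * h ^ 3)) * ennreal I"
    unfolding B_def emeasure_center_ball using emeasure_E_le by (intro mult_right_mono mult_left_mono add_left_mono) auto
  also have "\<dots> = ennreal (8 * (unit_ball_vol 3 * r ^ 3 + unit_ball_vol 3 * h ^ 3) * I)"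
  proof -
    have "8 * (ennreal a + ennreal b) * ennreal I = ennreal (8 * (a + b) * I)" if "0 \<le> a" "0 \<le> b" for a b
      using that by (simp add: ennreal_mult ennreal_plus I_def)
    then show ?thesis
      using r_pos h_pos unit_ball_vol_pos[of 3] by simp
  qed
  finally have "(\<integral>\<^sup>+y. indicator B y * (\<integral>\<^sup>+x. indicator E x * ennreal ((\<psi> x - \<psi> y)\<^sup>2) \<partial>lborel) \<partial>lborel)
      \<le> ennreal (h\<^sup>2) * ennreal (8 * (unit_ball_vol 3 * r ^ 3 + unit_ball_vol 3 * h ^ 3) * I)"
    by (simp add: mult_left_mono)
  also have "\<dots> = ennreal (8 * h\<^sup>2 * (unit_ball_vol 3 * r ^ 3 + unit_ball_vol 3 * h ^ 3) * I)"
    using r_pos h_pos unit_ball_vol_pos[of 3] by (simp add: I_def mult_ac flip: ennreal_mult)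
  finally show ?thesis
    by (simp add: B_def I_def)
qed

text \<open>Mean value argument: the average over y in the ball of the integral of (\<psi> x -
  \<psi> y)^2 is at most \<open>K\<close>, so some y does at least as well, and its value \<psi> y
  serves as the constant.\<close>

lemma poincare:
  assumes \<psi>: "smooth \<psi>"
  obtains a where "(l2_norm (lebesgue_on E) (\<lambda>x. \<psi> x - a))\<^sup>2
    \<le> 8 * (1 + 1 / \<rho> ^ 3) * h\<^sup>2 * (l2_norm (lebesgue_on E) (grad \<psi>))\<^sup>2"
proof -
  define u :: real where "u = unit_ball_vol 3"
  have u: "u > 0"
    by (simp add: u_def unit_ball_vol_pos)
  define I where "I = (l2_norm (lebesgue_on E) (grad \<psi>))\<^sup>2"
  have I: "I \<ge> 0"
    by (simp add: I_def)
  define K where "K = 8 * (1 + 1 / \<rho> ^ 3) * h\<^sup>2 * I"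
  have K: "K \<ge> 0"
    using rho_pos I by (simp add: K_def)
  define J where "J y = (\<integral>\<^sup>+x. indicator E x * ennreal ((\<psi> x - \<psi> y)\<^sup>2) \<partial>lborel)" for y
  have [measurable]: "\<psi> \<in> borel_measurable borel"
    using smooth_continuous[OF \<psi>] by (auto intro: borel_measurable_continuous_onI)
  have [measurable]: "ball c r \<in> sets borel"
    by simp
  have Jm [measurable]: "J \<in> borel_measurable borel"
    unfolding J_def by measurable
  \<comment> \<open>Dividing the bound on the double integral by the volume u r^3 of the ball leaves
    1 + h^3 / r^3 = 1 + 1 / \<rho>^3.\<close>
  have KI: "K * (u * r ^ 3) = 8 * h\<^sup>2 * (u * r ^ 3 + u * h ^ 3) * I"
    using rho_pos by (simp add: K_def r_eq power_mult_distrib field_simps)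
  have "\<exists>y\<in>ball c r. J y \<le> ennreal K"
  proof (rule ccontr)
    assume "\<not> (\<exists>y\<in>ball c r. J y \<le> ennreal K)"
    then have lt: "ennreal K < J y" if "y \<in> ball c r" for y
      using that by (meson not_le)
    have "(\<integral>\<^sup>+y. indicator (ball c r) y * ennreal K \<partial>lborel) < (\<integral>\<^sup>+y. indicator (ball c r) y * J y \<partial>lborel)"
    proof (rule nn_integral_less)
      show "(\<integral>\<^sup>+y. indicator (ball c r) y * ennreal K \<partial>lborel) \<noteq> \<infinity>"
        by (simp add: nn_integral_indicator_mult emeasure_center_ball ennreal_mult_eq_top_iff)
      show "AE y in lborel. indicator (ball c r) y * ennreal K \<le> indicator (ball c r) y * J y"
        using lt by (intro AE_I2) (auto simp: indicator_def less_imp_le)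
      show "\<not> (AE y in lborel. indicator (ball c r) y * J y \<le> indicator (ball c r) y * ennreal K)"
      proof
        assume "AE y in lborel. indicator (ball c r) y * J y \<le> indicator (ball c r) y * ennreal K"
        then have "AE y in lborel. y \<notin> ball c r"
        proof eventually_elim
          case (elim y)
          show ?case
          proof
            assume "y \<in> ball c r"
            then show False
              using elim lt[of y] by simp
          qed
        qed
        then have "emeasure lborel (ball c r) = 0"
          by (subst (asm) AE_iff_measurable[of "ball c r"]) auto
        then show False
          using u r_pos unfolding emeasure_center_ball by (simp add: u_def)
      qed
    qed measurable
    also have "\<dots> \<le> ennreal (8 * h\<^sup>2 * (u * r ^ 3 + u * h ^ 3) * I)"
      unfolding J_def u_def I_def by (rule increments_bound[OF \<psi>])
    also have "\<dots> = (\<integral>\<^sup>+y. indicator (ball c r) y * ennreal K \<partial>lborel)"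
      using K u r_pos
      by (simp add: nn_integral_indicator_mult emeasure_center_ball ennreal_mult flip: KI u_def)
    finally show False
      by simp
  qed
  then obtain y where y: "J y \<le> ennreal K"
    by blast
  have "(\<lambda>x. \<psi> x - \<psi> y) \<in> L2 (lebesgue_on E)"
    using smooth_continuous[OF \<psi>] by (intro continuous_L2[OF E_bounded E_lebesgue] continuous_intros)
  then have "ennreal ((l2_norm (lebesgue_on E) (\<lambda>x. \<psi> x - \<psi> y))\<^sup>2) = J y"
    by (subst l2_norm_eq_nn_integral) (simp_all add: J_def mult.commute)
  then have "ennreal ((l2_norm (lebesgue_on E) (\<lambda>x. \<psi> x - \<psi> y))\<^sup>2) \<le> ennreal K"
    using y by simp
  then have "(l2_norm (lebesgue_on E) (\<lambda>x. \<psi> x - \<psi> y))\<^sup>2 \<le> K"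
    using K by (subst (asm) ennreal_le_iff)
  then show thesis
    using that by (simp add: K_def I_def)
qed

end

lemma l2_norm_norm: "l2_norm M (\<lambda>z. norm (f z)) = l2_norm M f"
  by (simp add: l2_norm_def l2_inner_def power2_norm_eq_inner flip: power2_eq_square)

section \<open>Trace inequality by cones from the center\<close>

context mesh_element
begin

text \<open>A boundary value is the integral of the derivative of t^3 \<phi>^2 along the ray from c,
  and this derivative carries the factor t^2 that the cone coordinates need as Jacobian. The
  remaining factor |H| is at least r.\<close>

lemma face_trace_le_cone_integral:
  assumes F: "F \<in> Fs" and \<phi>: "smooth \<phi>"
  obtains C where "C \<in> sets borel"
    "\<And>z. z \<in> C \<Longrightarrow> \<exists>t y. 0 < t \<and> t < 1 \<and> y \<in> F - \<Union>(Fs - {F}) \<and> z = c + t *\<^sub>R (y - c)"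
    "ennreal (r * (l2_norm (area_on F) \<phi>)\<^sup>2)
      \<le> (\<integral>\<^sup>+z. ennreal (3 * (\<phi> z)\<^sup>2 + 2 * h * (\<bar>\<phi> z\<bar> * norm (grad \<phi> z))) * indicator C z \<partial>lborel)"
proof -
  obtain a L where fc: "face_chart a L F"
    using face_chart_exists[OF face_compact[OF F] face_aff_dim[OF F]] .
  then interpret face_chart a L F .
  define H where "H = normal \<bullet> (a - c)"
  have Hr: "r \<le> \<bar>H\<bar>"
    unfolding H_def using face_plane_distance[OF fc F] .
  have H0: "H \<noteq> 0"
    using Hr r_pos by auto
  \<comment> \<open>Points shared with other faces form a null set in the face; without them the
    cones over different faces are disjoint.\<close>
  define G where "G = F - \<Union>(Fs - {F})"
  have "closed (\<Union>(Fs - {F}))"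
    using Fs_finite face_compact by (intro closed_Union ballI compact_imp_closed) auto
  then have Gm [measurable]: "G \<in> sets borel"
    using compact_imp_closed[OF F_compact] unfolding G_def by (intro sets.Diff) auto
  \<comment> \<open>The cone parameter t recovered from the point: the height of z above c relative
    to that of the plane. It makes the cone a Borel set by an explicit formula.\<close>
  define s where "s z = (normal \<bullet> (z - c)) / H" for z
  define C where "C = {z. 0 < s z \<and> s z < 1 \<and> c + (1 / s z) *\<^sub>R (z - c) \<in> G}"
  have [measurable]: "s \<in> borel_measurable borel"
    unfolding s_def by measurable
  have Cm [measurable]: "C \<in> sets borel"
    unfolding C_def by measurable
  have C_elim: "\<exists>t y. 0 < t \<and> t < 1 \<and> y \<in> F - \<Union>(Fs - {F}) \<and> z = c + t *\<^sub>R (y - c)" if "z \<in> C" for z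
  proof (intro exI conjI)
    show "0 < s z" "s z < 1" "c + (1 / s z) *\<^sub>R (z - c) \<in> F - \<Union>(Fs - {F})"
      using that by (auto simp: C_def G_def)
    then show "z = c + s z *\<^sub>R (c + (1 / s z) *\<^sub>R (z - c) - c)"
      by simp
  qed
  have s_T: "s (c + t *\<^sub>R (T w - c)) = t" for t w
  proof -
    have "normal \<bullet> (T w - c) = H"
      by (simp add: T_def H_def inner_add_right inner_diff_right normal_inner_L)
    then show ?thesis
      using H0 by (simp add: s_def)
  qed
  have C_intro: "c + t *\<^sub>R (T w - c) \<in> C" if "0 < t" "t < 1" "T w \<in> G" for t w
    using that by (simp add: C_def s_T)
  define q where "q z = 3 * (\<phi> z)\<^sup>2 + 2 * h * (\<bar>\<phi> z\<bar> * norm (grad \<phi> z))" for z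
  have q0: "0 \<le> q z" for z
    unfolding q_def using h_pos by simp
  have [measurable]: "\<phi> \<in> borel_measurable borel" "grad \<phi> \<in> borel_measurable borel"
    using smooth_continuous[OF \<phi>] continuous_grad[OF \<phi>] by (auto intro: borel_measurable_continuous_onI)
  have qm [measurable]: "q \<in> borel_measurable borel"
    unfolding q_def by measurable
  define f where "f z = ennreal (q z) * indicator C z" for z
  have fm [measurable]: "f \<in> borel_measurable borel"
    unfolding f_def by measurable
  have pointwise: "ennreal ((\<phi> (T w))\<^sup>2) * indicator (T -` G) w
      \<le> (\<integral>\<^sup>+t. ennreal (t\<^sup>2) * f (c + t *\<^sub>R (T w - c)) \<partial>lborel)" for w
  proof (cases "T w \<in> G")
    case True
    define b where "b = T w - c"
    \<comment> \<open>It vanishes at the apex, so its increment is the boundary value alone, and its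
      derivative is divisible by t^2.\<close>
    define k where "k t = t ^ 3 * (\<phi> (c + t *\<^sub>R b))\<^sup>2" for t
    define k' where "k' t = 3 * t\<^sup>2 * (\<phi> (c + t *\<^sub>R b))\<^sup>2
      + t ^ 3 * (2 * \<phi> (c + t *\<^sub>R b) * (grad \<phi> (c + t *\<^sub>R b) \<bullet> b))" for t
    have dk: "(k has_real_derivative k' t) (at t)" for t
      unfolding k_def k'_def
      by (rule derivative_eq_intros line_derivative[OF \<phi>] refl | simp)+
    have ck: "continuous_on UNIV k'"
      unfolding k'_def
      by (intro continuous_intros continuous_on_compose2[OF continuous_grad[OF \<phi>, of UNIV]]
          continuous_on_compose2[OF smooth_continuous[OF \<phi>, of UNIV]]) auto
    have "norm b \<le> h"
    proof -
      have "T w \<in> closure E"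
        using True F face_subset_frontier frontier_in_closure by (auto simp: G_def)
      then show ?thesis
        using closure_subset_cball by (auto simp: b_def dist_norm norm_minus_commute)
    qed
    have bound: "k' t \<le> t\<^sup>2 * q (c + t *\<^sub>R b)" if "0 \<le> t" "t \<le> 1" for t
    proof -
      define z where "z = c + t *\<^sub>R b"
      have "grad \<phi> z \<bullet> b \<le> norm (grad \<phi> z) * h"
        using Cauchy_Schwarz_ineq2[of "grad \<phi> z" b] mult_left_mono[OF \<open>norm b \<le> h\<close> norm_ge_zero[of "grad \<phi> z"]]
        by linarith
      moreover have "- (norm (grad \<phi> z) * h) \<le> grad \<phi> z \<bullet> b"
        using Cauchy_Schwarz_ineq2[of "grad \<phi> z" b] mult_left_mono[OF \<open>norm b \<le> h\<close> norm_ge_zero[of "grad \<phi> z"]]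
        by linarith
      ultimately have "\<bar>grad \<phi> z \<bullet> b\<bar> \<le> norm (grad \<phi> z) * h"
        by linarith
      then have "\<bar>\<phi> z\<bar> * \<bar>grad \<phi> z \<bullet> b\<bar> \<le> \<bar>\<phi> z\<bar> * (norm (grad \<phi> z) * h)"
        by (intro mult_left_mono) auto
      then have "\<phi> z * (grad \<phi> z \<bullet> b) \<le> h * (\<bar>\<phi> z\<bar> * norm (grad \<phi> z))"
        using abs_ge_self[of "\<phi> z * (grad \<phi> z \<bullet> b)"] by (simp add: abs_mult mult_ac)
      then have "t ^ 3 * (2 * (\<phi> z * (grad \<phi> z \<bullet> b))) \<le> t ^ 3 * (2 * (h * (\<bar>\<phi> z\<bar> * norm (grad \<phi> z))))"
        using that by (intro mult_left_mono) auto
      also have "\<dots> \<le> t\<^sup>2 * (2 * (h * (\<bar>\<phi> z\<bar> * norm (grad \<phi> z))))"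
        using that h_pos by (intro mult_right_mono) (auto simp: power3_eq_cube power2_eq_square mult_left_le)
      finally show ?thesis
        by (simp add: k'_def q_def algebra_simps flip: z_def)
    qed
    have "ennreal ((\<phi> (T w))\<^sup>2) = ennreal (k 1 - k 0)"
      by (simp add: k_def b_def)
    also have "\<dots> \<le> (\<integral>\<^sup>+t. indicator {0<..<1} t * ennreal (t\<^sup>2 * q (c + t *\<^sub>R b)) \<partial>lborel)"
      using dk ck bound by (rule ennreal_increment_le)
    also have "\<dots> \<le> (\<integral>\<^sup>+t. ennreal (t\<^sup>2) * f (c + t *\<^sub>R (T w - c)) \<partial>lborel)"
    proof (rule nn_integral_mono)
      fix t :: real
      show "indicator {0<..<1} t * ennreal (t\<^sup>2 * q (c + t *\<^sub>R b)) \<le> ennreal (t\<^sup>2) * f (c + t *\<^sub>R (T w - c))"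
        using C_intro[of t w] True q0 by (auto simp: indicator_def f_def b_def ennreal_mult)
    qed
    finally show ?thesis
      using True by simp
  qed simp
  have \<phi>L2: "\<phi> \<in> L2 (area_on F)"
    using smooth_continuous[OF \<phi>] by (rule continuous_L2_area)
  have Tw: "(\<lambda>w. \<phi> (T w)) \<in> L2 (lebesgue_on (T -` F))"
    using \<phi>L2 by (simp add: L2_area_iff)
  have "ennreal ((l2_norm (area_on F) \<phi>)\<^sup>2) = ennreal ((l2_norm (lebesgue_on (T -` F)) (\<lambda>w. \<phi> (T w)))\<^sup>2)"
    unfolding l2_norm_power2 using L2_measurable[OF \<phi>L2] by (subst l2_inner_area) auto
  also have "\<dots> = (\<integral>\<^sup>+w. ennreal ((\<phi> (T w))\<^sup>2) * indicator (T -` F) w \<partial>lborel)"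
    using l2_norm_eq_nn_integral[OF Tw vimage_borel] by simp
  also have "\<dots> = (\<integral>\<^sup>+w. ennreal ((\<phi> (T w))\<^sup>2) * indicator (T -` F) w \<partial>lebesgue)"
    by (simp add: nn_integral_completion)
  also have "\<dots> = (\<integral>\<^sup>+w. ennreal ((\<phi> (T w))\<^sup>2) * indicator (T -` G) w \<partial>lebesgue)"
  proof (rule nn_integral_cong_AE)
    have "AE w in lebesgue. w \<in> T -` F \<longrightarrow> T w \<notin> \<Union>(Fs - {F})"
      using face_AE_not_in_other_faces[OF fc F] vimage_lebesgue by (subst (asm) AE_restrict_space_iff) auto
    then show "AE w in lebesgue. ennreal ((\<phi> (T w))\<^sup>2) * indicator (T -` F) w
        = ennreal ((\<phi> (T w))\<^sup>2) * indicator (T -` G) w"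
      by eventually_elim (auto simp: indicator_def G_def)
  qed
  also have "\<dots> = (\<integral>\<^sup>+w. ennreal ((\<phi> (T w))\<^sup>2) * indicator (T -` G) w \<partial>lborel)"
    by (simp add: nn_integral_completion)
  also have "\<dots> \<le> (\<integral>\<^sup>+w. \<integral>\<^sup>+t. ennreal (t\<^sup>2) * f (c + t *\<^sub>R (T w - c)) \<partial>lborel \<partial>lborel)"
    by (intro nn_integral_mono pointwise)
  also have "\<dots> = (\<integral>\<^sup>+t. \<integral>\<^sup>+w. ennreal (t\<^sup>2) * f (c + t *\<^sub>R (T w - c)) \<partial>lborel \<partial>lborel)"
    by (rule lborel_pair.Fubini') measurable
  finally have "ennreal \<bar>H\<bar> * ennreal ((l2_norm (area_on F) \<phi>)\<^sup>2)
      \<le> ennreal \<bar>H\<bar> * (\<integral>\<^sup>+t. \<integral>\<^sup>+w. ennreal (t\<^sup>2) * f (c + t *\<^sub>R (T w - c)) \<partial>lborel \<partial>lborel)"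
    by (rule mult_left_mono) simp
  also have "\<dots> = (\<integral>\<^sup>+t. \<integral>\<^sup>+w. ennreal (\<bar>H\<bar> * t\<^sup>2) * f (c + t *\<^sub>R (T w - c)) \<partial>lborel \<partial>lborel)"
    by (simp add: ennreal_mult mult.assoc nn_integral_cmult)
  also have "\<dots> = (\<integral>\<^sup>+z. f z \<partial>lborel)"
    by (rule nn_integral_cone[OF fm H_def H0, symmetric])
  finally have "ennreal (\<bar>H\<bar> * (l2_norm (area_on F) \<phi>)\<^sup>2) \<le> (\<integral>\<^sup>+z. f z \<partial>lborel)"
    by (simp add: ennreal_mult)
  moreover have "ennreal (r * (l2_norm (area_on F) \<phi>)\<^sup>2) \<le> ennreal (\<bar>H\<bar> * (l2_norm (area_on F) \<phi>)\<^sup>2)"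
    using Hr by (intro ennreal_leI mult_right_mono) auto
  ultimately have "ennreal (r * (l2_norm (area_on F) \<phi>)\<^sup>2) \<le> (\<integral>\<^sup>+z. f z \<partial>lborel)"
    by (rule order_trans[rotated])
  then show thesis
    using that[OF Cm C_elim] by (simp add: f_def q_def)
qed

text \<open>The cones over different faces are disjoint subsets of \<open>E\<close>: a common point
  would place two different frontier points on one ray from c. Hence the face estimates add up to a
  single integral over \<open>E\<close>.\<close>

lemma trace_inequality:
  assumes \<phi>: "smooth \<phi>"
  shows "r * (\<Sum>F\<in>Fs. (l2_norm (area_on F) \<phi>)\<^sup>2)
    \<le> 3 * (l2_norm (lebesgue_on E) \<phi>)\<^sup>2
      + 2 * h * (l2_norm (lebesgue_on E) \<phi> * l2_norm (lebesgue_on E) (grad \<phi>))"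
proof -
  define q where "q z = 3 * (\<phi> z)\<^sup>2 + 2 * h * (\<bar>\<phi> z\<bar> * norm (grad \<phi> z))" for z
  have q0: "0 \<le> q z" for z
    unfolding q_def using h_pos by simp
  have [measurable]: "\<phi> \<in> borel_measurable borel" "grad \<phi> \<in> borel_measurable borel"
    using smooth_continuous[OF \<phi>] continuous_grad[OF \<phi>] by (auto intro: borel_measurable_continuous_onI)
  have qm [measurable]: "q \<in> borel_measurable borel"
    unfolding q_def by measurable
  have "\<exists>C. C \<in> sets borel \<and>
      (\<forall>z\<in>C. \<exists>t y. 0 < t \<and> t < 1 \<and> y \<in> F - \<Union>(Fs - {F}) \<and> z = c + t *\<^sub>R (y - c)) \<and>
      ennreal (r * (l2_norm (area_on F) \<phi>)\<^sup>2) \<le> (\<integral>\<^sup>+z. ennreal (q z) * indicator C z \<partial>lborel)"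
    if F: "F \<in> Fs" for F
    by (rule face_trace_le_cone_integral[OF F \<phi>]) (unfold q_def, blast)
  then have "\<exists>C. \<forall>F\<in>Fs. C F \<in> sets borel \<and>
      (\<forall>z\<in>C F. \<exists>t y. 0 < t \<and> t < 1 \<and> y \<in> F - \<Union>(Fs - {F}) \<and> z = c + t *\<^sub>R (y - c)) \<and>
      ennreal (r * (l2_norm (area_on F) \<phi>)\<^sup>2) \<le> (\<integral>\<^sup>+z. ennreal (q z) * indicator (C F) z \<partial>lborel)"
    by (intro bchoice ballI)
  then obtain C where C': "\<forall>F\<in>Fs. C F \<in> sets borel \<and>
      (\<forall>z\<in>C F. \<exists>t y. 0 < t \<and> t < 1 \<and> y \<in> F - \<Union>(Fs - {F}) \<and> z = c + t *\<^sub>R (y - c)) \<and>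
      ennreal (r * (l2_norm (area_on F) \<phi>)\<^sup>2) \<le> (\<integral>\<^sup>+z. ennreal (q z) * indicator (C F) z \<partial>lborel)" ..
  have C1: "C F \<in> sets borel" if "F \<in> Fs" for F
    using bspec[OF C' that] by (rule conjunct1)
  have C2: "\<exists>t y. 0 < t \<and> t < 1 \<and> y \<in> F - \<Union>(Fs - {F}) \<and> z = c + t *\<^sub>R (y - c)"
    if "F \<in> Fs" "z \<in> C F" for F z
    using bspec[OF C' that(1), THEN conjunct2, THEN conjunct1] that(2) by (rule bspec)
  have C3: "ennreal (r * (l2_norm (area_on F) \<phi>)\<^sup>2) \<le> (\<integral>\<^sup>+z. ennreal (q z) * indicator (C F) z \<partial>lborel)"
    if "F \<in> Fs" for F
    using bspec[OF C' that, THEN conjunct2, THEN conjunct2] .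
  note C = C1 C2 C3
  have CE: "C F \<subseteq> E" if F: "F \<in> Fs" for F
  proof
    fix z assume "z \<in> C F"
    then obtain t y where ty: "0 < t" "t < 1" "y \<in> F" "z = c + t *\<^sub>R (y - c)"
      using C(2)[OF F] by blast
    have "y \<in> closure E"
      using ty(3) face_subset_frontier[OF F] frontier_in_closure by blast
    then show "z \<in> E"
      using star_shaped_open_segment[OF star, of c y t] ty r_pos by simp
  qed
  have disj: "C F \<inter> C F' = {}" if F: "F \<in> Fs" "F' \<in> Fs" "F \<noteq> F'" for F F'
  proof (rule ccontr)
    assume "C F \<inter> C F' \<noteq> {}"
    then obtain z where z: "z \<in> C F" "z \<in> C F'"
      by blast
    obtain t y where ty: "0 < t" "t < 1" "y \<in> F - \<Union>(Fs - {F})" "z = c + t *\<^sub>R (y - c)"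
      using C(2)[OF F(1) z(1)] by blast
    obtain t' y' where ty': "0 < t'" "t' < 1" "y' \<in> F' - \<Union>(Fs - {F'})" "z = c + t' *\<^sub>R (y' - c)"
      using C(2)[OF F(2) z(2)] by blast
    have eq: "t *\<^sub>R (y - c) = t' *\<^sub>R (y' - c)"
      using ty(4) ty'(4) by simp
    have "(1 / t') *\<^sub>R (t *\<^sub>R (y - c)) = (1 / t') *\<^sub>R (t' *\<^sub>R (y' - c))"
      unfolding eq ..
    then have y': "y' = c + (t / t') *\<^sub>R (y - c)"
      using ty'(1) by simp
    have "y \<in> frontier E" "y' \<in> frontier E"
      using ty(3) ty'(3) face_subset_frontier F by blast+
    then have "t / t' = 1"
      using star_shaped_frontier_unique[OF E_open star r_pos, of y "t / t'"] y' ty(1) ty'(1) by simp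
    then have "y' = y"
      using y' by simp
    then show False
      using ty(3) ty'(3) F by blast
  qed
  have \<phi>L2: "\<phi> \<in> L2 (lebesgue_on E)" "grad \<phi> \<in> L2 (lebesgue_on E)"
    using smooth_continuous[OF \<phi>] continuous_grad[OF \<phi>] by (auto intro: continuous_L2[OF E_bounded E_lebesgue])
  have qi: "integrable (lebesgue_on E) q" and q_int: "(LINT z|lebesgue_on E. q z)
      = 3 * (l2_norm (lebesgue_on E) \<phi>)\<^sup>2 + 2 * h * (LINT z|lebesgue_on E. norm (\<phi> z) * norm (grad \<phi> z))"
    unfolding q_def l2_norm_power2_eq_integral
    using L2_integrable_norm2[OF \<phi>L2(1)] L2_integrable_norm_mult[OF \<phi>L2] by simp_all
  have "ennreal (r * (\<Sum>F\<in>Fs. (l2_norm (area_on F) \<phi>)\<^sup>2)) = (\<Sum>F\<in>Fs. ennreal (r * (l2_norm (area_on F) \<phi>)\<^sup>2))"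
    unfolding sum_distrib_left using r_pos by (intro sum_ennreal[symmetric]) simp
  also have "\<dots> \<le> (\<Sum>F\<in>Fs. \<integral>\<^sup>+z. ennreal (q z) * indicator (C F) z \<partial>lborel)"
    by (intro sum_mono C(3))
  also have "\<dots> = (\<integral>\<^sup>+z. (\<Sum>F\<in>Fs. ennreal (q z) * indicator (C F) z) \<partial>lborel)"
    using C(1) by (intro nn_integral_sum[symmetric]) simp
  also have "\<dots> \<le> (\<integral>\<^sup>+z. ennreal (q z) * indicator E z \<partial>lborel)"
  proof (rule nn_integral_mono)
    fix z
    show "(\<Sum>F\<in>Fs. ennreal (q z) * indicator (C F) z) \<le> ennreal (q z) * indicator E z"
    proof (cases "\<exists>F\<in>Fs. z \<in> C F")
      case True
      then obtain F where F: "F \<in> Fs" "z \<in> C F"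
        by blast
      have "ennreal (q z) * indicator (C F') z = 0" if "F' \<in> Fs - {F}" for F'
        using disj[of F F'] F that by (auto simp: indicator_def)
      then have "(\<Sum>F'\<in>Fs - {F}. ennreal (q z) * indicator (C F') z) = 0"
        by (intro sum.neutral ballI)
      then have "(\<Sum>F\<in>Fs. ennreal (q z) * indicator (C F) z) = ennreal (q z) * indicator (C F) z"
        using sum.remove[OF Fs_finite F(1), of "\<lambda>F. ennreal (q z) * indicator (C F) z"] by simp
      moreover have "z \<in> E"
        using CE F by blast
      ultimately show ?thesis
        using F(2) by simp
    qed simp
  qed
  also have "\<dots> = (\<integral>\<^sup>+z. ennreal (q z) \<partial>lebesgue_on E)"
    by (rule nn_integral_lebesgue_on[OF E_borel, symmetric])
  also have "\<dots> = ennreal (LINT z|lebesgue_on E. q z)"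
    using qi q0 by (intro nn_integral_eq_integral) auto
  finally have "r * (\<Sum>F\<in>Fs. (l2_norm (area_on F) \<phi>)\<^sup>2) \<le> (LINT z|lebesgue_on E. q z)"
    using q0 by (subst (asm) ennreal_le_iff) auto
  moreover have "(LINT z|lebesgue_on E. norm (\<phi> z) * norm (grad \<phi> z))
      \<le> l2_norm (lebesgue_on E) \<phi> * l2_norm (lebesgue_on E) (grad \<phi>)"
  proof -
    have n: "(\<lambda>z. norm (\<phi> z)) \<in> L2 (lebesgue_on E)" "(\<lambda>z. norm (grad \<phi> z)) \<in> L2 (lebesgue_on E)"
      using smooth_continuous[OF \<phi>] continuous_grad[OF \<phi>]
      by (auto intro!: continuous_L2[OF E_bounded E_lebesgue] continuous_intros)
    have "l2_inner (lebesgue_on E) (\<lambda>z. norm (\<phi> z)) (\<lambda>z. norm (grad \<phi> z))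
        \<le> l2_norm (lebesgue_on E) (\<lambda>z. norm (\<phi> z)) * l2_norm (lebesgue_on E) (\<lambda>z. norm (grad \<phi> z))"
      using l2_Cauchy_Schwarz[OF n] by linarith
    then show ?thesis
      by (simp only: l2_inner_def inner_real_def l2_norm_norm)
  qed
  ultimately show ?thesis
    unfolding q_int using h_pos by (smt (verit) mult_left_mono)
qed

end

text \<open>The Poincare inequality bounds the norm by \<open>poincare_const \<rho>\<close> times h
  times the norm of the gradient.\<close>

definition poincare_const :: "real \<Rightarrow> real" where
  "poincare_const \<rho> = sqrt (8 * (1 + 1 / \<rho> ^ 3))"

text \<open>The first summand comes from pairing with the divergence. The second is the constant of
  the trace inequality after the Poincare inequality has been inserted; it belongs to the pairing
  with the normal trace.\<close>

definition pairing_const :: "real \<Rightarrow> real" where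
  "pairing_const \<rho> = poincare_const \<rho> + sqrt ((3 * (poincare_const \<rho>)\<^sup>2 + 2 * poincare_const \<rho>) / \<rho>)"

context mesh_element
begin

text \<open>Only the gradient of \<psi> matters on the left, so the Poincare constant may be
  subtracted from \<psi>; Green's formula then leaves the divergence and the trace against a
  function small in terms of its gradient.\<close>

lemma gradient_pairing_bound:
  assumes v: "v \<in> L2 (lebesgue_on E)" and d: "d \<in> L2 (lebesgue_on E)"
    and g: "\<And>F. F \<in> Fs \<Longrightarrow> g F \<in> L2 (area_on F)"
    and green: "\<And>\<phi>. smooth \<phi> \<Longrightarrow> l2_inner (lebesgue_on E) v (grad \<phi>) + l2_inner (lebesgue_on E) d \<phi>
      = (\<Sum>F\<in>Fs. l2_inner (area_on F) (g F) \<phi>)"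
    and \<psi>: "smooth \<psi>"
  shows "\<bar>l2_inner (lebesgue_on E) v (grad \<psi>)\<bar>
    \<le> pairing_const \<rho> * (h * l2_norm (lebesgue_on E) d + sqrt (h * (\<Sum>F\<in>Fs. (l2_norm (area_on F) (g F))\<^sup>2)))
      * l2_norm (lebesgue_on E) (grad \<psi>)"
proof -
  define P where "P = poincare_const \<rho>"
  have P: "P \<ge> 0" "P\<^sup>2 = 8 * (1 + 1 / \<rho> ^ 3)"
    using rho_pos by (auto simp: P_def poincare_const_def add_nonneg_nonneg)
  obtain a where a: "(l2_norm (lebesgue_on E) (\<lambda>x. \<psi> x - a))\<^sup>2
      \<le> 8 * (1 + 1 / \<rho> ^ 3) * h\<^sup>2 * (l2_norm (lebesgue_on E) (grad \<psi>))\<^sup>2"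
    using poincare[OF \<psi>] .
  define \<phi> where "\<phi> x = \<psi> x - a" for x
  have \<phi>: "smooth \<phi>"
    unfolding \<phi>_def using \<psi> by (intro smooth_diff smooth_const)
  have grad_eq: "grad \<phi> = grad \<psi>"
    unfolding \<phi>_def grad_def[abs_def] using \<psi>
    by (simp add: partial_diff smooth_differentiable smooth_const)
  define N where "N = l2_norm (lebesgue_on E) (grad \<psi>)"
  have N: "N \<ge> 0"
    by (simp add: N_def l2_norm_nonneg)
  have \<phi>N: "l2_norm (lebesgue_on E) \<phi> \<le> P * h * N"
  proof (rule power2_le_imp_le)
    show "(l2_norm (lebesgue_on E) \<phi>)\<^sup>2 \<le> (P * h * N)\<^sup>2"
      using a unfolding power_mult_distrib P(2) by (simp add: \<phi>_def[abs_def] N_def)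
  qed (use P h_pos N in simp)
  define X where "X = (\<Sum>F\<in>Fs. (l2_norm (area_on F) \<phi>)\<^sup>2)"
  define Y where "Y = (\<Sum>F\<in>Fs. (l2_norm (area_on F) (g F))\<^sup>2)"
  have XY: "X \<ge> 0" "Y \<ge> 0"
    by (auto simp: X_def Y_def intro: sum_nonneg)
  \<comment> \<open>With the norm of \<phi> at most P h N, the trace inequality reads r X \<le> (3
    P^2 + 2 P) h^2 N^2, and r = \<rho> h.\<close>
  define Q where "Q = (3 * P\<^sup>2 + 2 * P) / \<rho>"
  have Q: "Q \<ge> 0"
    using P rho_pos by (simp add: Q_def)
  have "r * X \<le> 3 * (P * h * N)\<^sup>2 + 2 * h * ((P * h * N) * N)"
  proof -
    have "3 * (l2_norm (lebesgue_on E) \<phi>)\<^sup>2 \<le> 3 * (P * h * N)\<^sup>2"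
      using \<phi>N by (intro mult_left_mono power_mono l2_norm_nonneg) auto
    moreover have "2 * h * (l2_norm (lebesgue_on E) \<phi> * N) \<le> 2 * h * ((P * h * N) * N)"
      using \<phi>N N h_pos by (intro mult_left_mono mult_right_mono) auto
    ultimately show ?thesis
      using trace_inequality[OF \<phi>] unfolding grad_eq X_def N_def by linarith
  qed
  also have "\<dots> = r * (Q * h * N\<^sup>2)"
  proof -
    have "\<rho> * Q = 3 * P\<^sup>2 + 2 * P"
      using rho_pos by (simp add: Q_def)
    moreover have "r * (Q * h * N\<^sup>2) = (\<rho> * Q) * (h\<^sup>2 * N\<^sup>2)"
      by (simp add: r_eq power2_eq_square)
    ultimately show ?thesis
      by (simp add: power_mult_distrib power2_eq_square algebra_simps)
  qed
  finally have XQ: "X \<le> Q * h * N\<^sup>2"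
    using r_pos by simp
  have gF: "\<bar>\<Sum>F\<in>Fs. l2_inner (area_on F) (g F) \<phi>\<bar> \<le> sqrt Y * sqrt X"
  proof -
    have "\<bar>\<Sum>F\<in>Fs. l2_inner (area_on F) (g F) \<phi>\<bar> \<le> (\<Sum>F\<in>Fs. l2_norm (area_on F) (g F) * l2_norm (area_on F) \<phi>)"
      using g continuous_L2_face[OF _ smooth_continuous[OF \<phi>]]
      by (intro order_trans[OF sum_abs] sum_mono l2_Cauchy_Schwarz) auto
    also have "\<dots> \<le> sqrt (Y * X)"
      using Cauchy_Schwarz_ineq_sum[of "\<lambda>F. l2_norm (area_on F) (g F)" "\<lambda>F. l2_norm (area_on F) \<phi>" Fs]
      unfolding X_def Y_def by (intro real_le_rsqrt)
    finally show ?thesis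
      by (simp add: real_sqrt_mult)
  qed
  have \<phi>L2: "\<phi> \<in> L2 (lebesgue_on E)"
    using smooth_continuous[OF \<phi>] by (rule continuous_L2[OF E_bounded E_lebesgue])
  have "\<bar>l2_inner (lebesgue_on E) v (grad \<psi>)\<bar> \<le> \<bar>l2_inner (lebesgue_on E) d \<phi>\<bar> + \<bar>\<Sum>F\<in>Fs. l2_inner (area_on F) (g F) \<phi>\<bar>"
    using green[OF \<phi>] unfolding grad_eq by linarith
  also have "\<dots> \<le> l2_norm (lebesgue_on E) d * (P * h * N) + sqrt Y * sqrt (Q * h * N\<^sup>2)"
  proof (rule add_mono)
    show "\<bar>l2_inner (lebesgue_on E) d \<phi>\<bar> \<le> l2_norm (lebesgue_on E) d * (P * h * N)"
      using l2_Cauchy_Schwarz[OF d \<phi>L2] \<phi>N l2_norm_nonneg[of "lebesgue_on E" d]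
      by (meson mult_left_mono order_trans)
    have "sqrt X \<le> sqrt (Q * h * N\<^sup>2)"
      using XQ by simp
    then show "\<bar>\<Sum>F\<in>Fs. l2_inner (area_on F) (g F) \<phi>\<bar> \<le> sqrt Y * sqrt (Q * h * N\<^sup>2)"
      using gF XY by (meson mult_left_mono order_trans real_sqrt_ge_zero)
  qed
  also have "sqrt Y * sqrt (Q * h * N\<^sup>2) = sqrt Q * sqrt (h * Y) * N"
    using N by (simp add: real_sqrt_mult)
  also have "l2_norm (lebesgue_on E) d * (P * h * N) + sqrt Q * sqrt (h * Y) * N
      \<le> (P + sqrt Q) * (h * l2_norm (lebesgue_on E) d + sqrt (h * Y)) * N"
  proof -
    have "0 \<le> P * sqrt (h * Y) * N" "0 \<le> sqrt Q * (h * l2_norm (lebesgue_on E) d) * N"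
      using P Q N XY h_pos l2_norm_nonneg[of "lebesgue_on E" d] by (simp_all add: mult_nonneg_nonneg)
    then show ?thesis
      by (simp add: algebra_simps)
  qed
  finally show ?thesis
    by (simp add: pairing_const_def P_def Q_def Y_def N_def)
qed

end

section \<open>Approximation of curl-free fields by gradients\<close>

definition mollifier :: "real \<Rightarrow> real^3 \<Rightarrow> real" where
  "mollifier \<epsilon> x = bump 0 \<epsilon> x / (LINT y|lborel. bump 0 \<epsilon> y)"

lemma smooth_mollifier: "smooth (mollifier \<epsilon>)"
proof -
  have "smooth (\<lambda>x. (1 / (LINT y|lborel. bump 0 \<epsilon> y)) * bump 0 \<epsilon> x)"
    by (intro smooth_mult smooth_const smooth_bump)
  then show ?thesis
    by (simp add: mollifier_def[abs_def])
qed

lemma mollifier_nonneg: "0 \<le> mollifier \<epsilon> x"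
  unfolding mollifier_def by (intro divide_nonneg_nonneg integral_nonneg_AE AE_I2 bump_nonneg)

lemma mollifier_eq_0: "\<epsilon> > 0 \<Longrightarrow> x \<notin> cball 0 \<epsilon> \<Longrightarrow> mollifier \<epsilon> x = 0"
  by (simp add: mollifier_def bump_eq_0)

lemma mollifier_supported: "\<epsilon> > 0 \<Longrightarrow> compactly_supported_in UNIV (mollifier \<epsilon>)"
  by (rule compactly_supported_inI[of "cball 0 \<epsilon>"]) (auto intro: mollifier_eq_0)

lemma bump_integral_pos:
  assumes "\<epsilon> > 0"
  shows "(LINT y|lborel. bump a \<epsilon> y) > 0"
proof -
  have s: "compactly_supported_in UNIV (bump a \<epsilon>)"
    using assms by (intro compactly_supported_bump) auto
  have "0 < exp (-2) * (unit_ball_vol 3 * (\<epsilon> / 2) ^ 3)"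
    using assms unit_ball_vol_pos[of 3] by simp
  also have "\<dots> = (LINT y|lborel. indicator (cball a (\<epsilon> / 2)) y * exp (-2))"
    using assms by (simp add: content_cball)
  also have "\<dots> \<le> (LINT y|lborel. bump a \<epsilon> y)"
  proof (rule integral_mono)
    show "integrable lborel (\<lambda>y. indicator (cball a (\<epsilon> / 2)) y * exp (-2) :: real)"
      using emeasure_bounded_finite[of "cball a (\<epsilon> / 2)"]
      by (intro integrable_mult_left integrable_real_indicator) auto
    show "integrable lborel (bump a \<epsilon>)"
      using s by (intro compactly_supported_integrable smooth_continuous smooth_bump)
    show "indicator (cball a (\<epsilon> / 2)) y * exp (-2) \<le> bump a \<epsilon> y" for y
      using bump_ge[OF assms, of y a] bump_nonneg[of a \<epsilon> y] by (auto simp: indicator_def)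
  qed
  finally show ?thesis .
qed

lemma integrable_mollifier: "\<epsilon> > 0 \<Longrightarrow> integrable lborel (mollifier \<epsilon>)"
  by (intro compactly_supported_integrable smooth_continuous smooth_mollifier mollifier_supported)

lemma integral_mollifier: "\<epsilon> > 0 \<Longrightarrow> (LINT x|lborel. mollifier \<epsilon> x) = 1"
  unfolding mollifier_def using bump_integral_pos[of \<epsilon> 0] by simp

lemma smooth_translate: "smooth \<zeta> \<Longrightarrow> smooth (\<lambda>z. \<zeta> (z - s))"
  using smooth_affine[of \<zeta> "- s" 1] by simp

lemma partial_translate: "smooth \<zeta> \<Longrightarrow> partial i (\<lambda>z. \<zeta> (z - s)) z = partial i \<zeta> (z - s)"
  using partial_affine[of \<zeta> i "- s" 1 z] by simp

text \<open>Test fields \<phi> times a unit vector extract single components of the curl: vanishing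
  weak curl means a symmetric weak Jacobian.\<close>

lemma weak_curl_zero_symmetric:
  assumes E: "bounded E" "E \<in> sets lebesgue" and u: "u \<in> L2 (lebesgue_on E)" "has_weak_curl E u (\<lambda>_. 0)"
    and \<phi>: "smooth \<phi>" "compactly_supported_in E \<phi>"
  shows "(LINT z|lebesgue_on E. u z $ i * partial j \<phi> z) = (LINT z|lebesgue_on E. u z $ j * partial i \<phi> z)"
proof -
  have int: "integrable (lebesgue_on E) (\<lambda>z. u z $ i * partial j \<phi> z)" for i j
    using L2_integrable_inner[OF L2_vec_nth[OF u(1)] continuous_L2[OF E smooth_continuous[OF smooth_partial[OF \<phi>(1)]]], of i j]
    by simp
  have zero: "(LINT z|lebesgue_on E. u z \<bullet> curl (\<lambda>x. \<phi> x *\<^sub>R axis k 1) z) = 0" for k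
  proof -
    have s: "smooth (\<lambda>x. (\<phi> x *\<^sub>R axis k 1) $ i)" for i
      using smooth_mult[OF \<phi>(1) smooth_const[of "axis k 1 $ i"]] by simp
    have K: "compact (closure {x. \<phi> x \<noteq> 0})" "closure {x. \<phi> x \<noteq> 0} \<subseteq> E"
      using \<phi>(2) by (simp_all only: compactly_supported_in_def)
    have "compactly_supported_in E (\<lambda>x. \<phi> x *\<^sub>R axis k (1 :: real))"
    proof (rule compactly_supported_inI[OF K])
      fix x assume "x \<notin> closure {x. \<phi> x \<noteq> 0}"
      then have "\<phi> x = 0"
        using closure_subset[of "{x. \<phi> x \<noteq> 0}"] by auto
      then show "\<phi> x *\<^sub>R axis k 1 = 0"
        by simp
    qed
    from u(2)[unfolded has_weak_curl_def, THEN spec, THEN mp, OF conjI, OF allI[OF s] this] show ?thesis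
      by (simp add: l2_inner_def)
  qed
  have p: "partial m (\<lambda>y. \<phi> y * axis k (1 :: real) $ l) z = (if l = k then partial m \<phi> z else 0)" for m k l z
    by (cases "l = k") (simp_all add: axis_def)
  have 1: "(LINT z|lebesgue_on E. u z $ 2 * partial 3 \<phi> z) = (LINT z|lebesgue_on E. u z $ 3 * partial 2 \<phi> z)"
    using zero[of 1] int[of 2 3] int[of 3 2] by (simp add: curl_def p inner_vec_def sum_3)
  have 2: "(LINT z|lebesgue_on E. u z $ 3 * partial 1 \<phi> z) = (LINT z|lebesgue_on E. u z $ 1 * partial 3 \<phi> z)"
    using zero[of 2] int[of 3 1] int[of 1 3] by (simp add: curl_def p inner_vec_def sum_3)
  have 3: "(LINT z|lebesgue_on E. u z $ 1 * partial 2 \<phi> z) = (LINT z|lebesgue_on E. u z $ 2 * partial 1 \<phi> z)"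
    using zero[of 3] int[of 1 2] int[of 2 1] by (simp add: curl_def p inner_vec_def sum_3)
  show ?thesis
    using exhaust_3[of i] exhaust_3[of j] 1 2 3 by (elim disjE) simp_all
qed

section \<open>Potentials of mollified curl-free fields\<close>

context mesh_element
begin

text \<open>A displacement w at the contracted point is absorbed by moving the apex from c to c + w
  / (1 - l), at most r / 2 away. The star shape with respect to the ball thus leaves room of size (1
  - l) r / 2 around the contracted element.\<close>

lemma shrunk_ball_subset:
  assumes "0 \<le> l" "l < 1" "0 \<le> t" "t \<le> 1" "x \<in> E"
  shows "cball (c + (l * t) *\<^sub>R (x - c)) ((1 - l) * r / 2) \<subseteq> E"
proof
  fix z assume z: "z \<in> cball (c + (l * t) *\<^sub>R (x - c)) ((1 - l) * r / 2)"
  define w where "w = z - (c + (l * t) *\<^sub>R (x - c))"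
  define b where "b = c + (1 / (1 - l)) *\<^sub>R w"
  have x': "c + t *\<^sub>R (x - c) \<in> E"
    using assms r_pos by (intro segment_in_E) auto
  have "norm w \<le> (1 - l) * r / 2"
    using z by (simp add: w_def dist_norm norm_minus_commute)
  then have "norm w / (1 - l) \<le> r / 2"
    using assms by (simp add: field_simps)
  moreover have "norm (b - c) = norm w / (1 - l)"
    using assms by (simp add: b_def)
  ultimately have "norm (b - c) < r"
    using r_pos by linarith
  then have b: "b \<in> ball c r"
    by (simp add: dist_norm norm_minus_commute)
  have "(1 - l) *\<^sub>R b = (1 - l) *\<^sub>R c + w"
    using assms by (simp add: b_def scaleR_add_right)
  moreover have "b + l *\<^sub>R (c + t *\<^sub>R (x - c) - b) = (1 - l) *\<^sub>R b + l *\<^sub>R c + (l * t) *\<^sub>R (x - c)"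
    by (simp add: algebra_simps)
  ultimately have "b + l *\<^sub>R (c + t *\<^sub>R (x - c) - b) = z"
    by (simp add: w_def algebra_simps)
  then show "z \<in> E"
    using segment_in_E[OF b x', of l] assms by simp
qed

text \<open>Poincare lemma for the field x -> (mollified u)(c + l (x - c)), which is smooth and
  curl-free on \<open>E\<close>. Its potential is the line integral from c; the integral over the
  line and the convolution are merged into one integral over a product space.\<close>

lemma smooth_potential_of_mollification:
  assumes u: "u \<in> L2 (lebesgue_on E)" "has_weak_curl E u (\<lambda>_. 0)" and l: "0 < l" "l < 1"
  shows "\<exists>\<psi>. smooth \<psi> \<and> (\<forall>x\<in>E. \<forall>i. grad \<psi> x $ i
    = (LINT z|lebesgue_on E. u z $ i * mollifier ((1 - l) * r / 2) (z - (c + l *\<^sub>R (x - c)))))"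
proof -
  define \<zeta> where "\<zeta> = mollifier ((1 - l) * r / 2)"
  have \<epsilon>: "(1 - l) * r / 2 > 0"
    using l r_pos by simp
  have \<zeta>: "smooth \<zeta>" "compactly_supported_in UNIV \<zeta>"
    unfolding \<zeta>_def using \<epsilon> by (simp_all add: smooth_mollifier mollifier_supported)
  define M1 where "M1 = lebesgue_on E"
  define M2 where "M2 = lebesgue_on {0..1 :: real}"
  have fin: "finite_measure M1" "finite_measure M2"
    unfolding M1_def M2_def using E_bounded E_lebesgue
    by (auto intro!: finite_measure_lebesgue_on_bounded)
  interpret M1: finite_measure M1
    by (rule fin)
  interpret M2: finite_measure M2
    by (rule fin)
  interpret P: pair_sigma_finite M1 M2 ..
  define M where "M = M1 \<Otimes>\<^sub>M M2"
  have sp: "space M1 = E" "space M2 = {0..1}"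
    by (simp_all add: M1_def M2_def)
  \<comment> \<open>For \<omega> = (z, t) the affine argument A + B x equals z - (c + l t (x - c)),
    so the pair integral convolves and runs along the segment at once.\<close>
  define A where "A \<omega> = fst \<omega> - c + (l * snd \<omega>) *\<^sub>R c" for \<omega> :: "(real^3) \<times> real"
  define B where "B \<omega> = - (l * snd \<omega>)" for \<omega> :: "(real^3) \<times> real"
  have fstm: "fst \<in> borel_measurable M"
    unfolding M_def M1_def
    by (rule measurable_compose[OF measurable_fst continuous_lebesgue_on_measurable[OF continuous_on_id]])
  have sndm: "snd \<in> borel_measurable M"
    unfolding M_def M2_def
    by (rule measurable_compose[OF measurable_snd continuous_lebesgue_on_measurable[OF continuous_on_id]])
  interpret kernel_integral M A B
  proof
    show "A \<in> borel_measurable M" "B \<in> borel_measurable M"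
      unfolding A_def B_def using fstm sndm by measurable
    show "\<bar>B \<omega>\<bar> \<le> 1" if "\<omega> \<in> space M" for \<omega>
    proof -
      have "0 \<le> snd \<omega>" "snd \<omega> \<le> 1"
        using that by (auto simp: M_def space_pair_measure sp)
      then show ?thesis
        using l mult_mono[of l 1 "snd \<omega>" 1] by (simp add: B_def)
    qed
  qed
  have ui: "integrable M1 (\<lambda>z. u z $ i)" for i
    using L2_integrable[OF fin(1)] L2_vec_nth[OF u(1)] by (simp add: M1_def)
  have w: "integrable M (\<lambda>\<omega>. u (fst \<omega>) $ i)" for i
    unfolding M_def
  proof (rule P.Fubini_integrable)
    show "(\<lambda>\<omega>. u (fst \<omega>) $ i) \<in> borel_measurable (M1 \<Otimes>\<^sub>M M2)"
      by (rule measurable_compose[OF measurable_fst borel_measurable_integrable[OF ui]])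
    show "integrable M1 (\<lambda>x. LINT y|M2. norm (u (fst (x, y)) $ i))"
      using ui by simp
    show "AE x in M1. integrable M2 (\<lambda>y. u (fst (x, y)) $ i)"
      by simp
  qed
  define K where "K i x = (LINT \<omega>|M. u (fst \<omega>) $ i * \<zeta> (A \<omega> + B \<omega> *\<^sub>R x))" for i x
  have Ks: "smooth (K i)" for i
    unfolding K_def using w \<zeta> by (rule smooth_kernel)
  have dK: "partial j (K i) x = (LINT \<omega>|M. u (fst \<omega>) $ i * B \<omega> * partial j \<zeta> (A \<omega> + B \<omega> *\<^sub>R x))" for i j x
    unfolding K_def using w \<zeta> by (rule partial_kernel)
  have dint: "integrable M (\<lambda>\<omega>. u (fst \<omega>) $ i * B \<omega> * partial j \<zeta> (A \<omega> + B \<omega> *\<^sub>R x))" for i j x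
    using integrable_weight_B[OF w] smooth_continuous[OF smooth_partial[OF \<zeta>(1)]]
      compactly_supported_in_partial[OF \<zeta>(2)] by (rule integrable_kernel)
  have Kint: "integrable M (\<lambda>\<omega>. u (fst \<omega>) $ i * \<zeta> (A \<omega> + B \<omega> *\<^sub>R x))" for i x
    using w smooth_continuous[OF \<zeta>(1)] \<zeta>(2) by (rule integrable_kernel)
  have AB: "A (z, t) + B (z, t) *\<^sub>R x = z - (c + (l * t) *\<^sub>R (x - c))" for z t x
    by (simp add: A_def B_def algebra_simps)
  have snd_integral: "(LINT t|M2. LINT z|M1. f (z, t)) = integral\<^sup>L (M1 \<Otimes>\<^sub>M M2) f"
    if "integrable (M1 \<Otimes>\<^sub>M M2) f" for f :: "_ \<Rightarrow> real"
    using P.integral_snd[of "\<lambda>z t. f (z, t)"] that by simp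
  \<comment> \<open>For every t the translated mollifier is supported in \<open>E\<close>, so it is
    a test function for the weak curl of u. The symmetry holds slice by slice.\<close>
  have sym: "partial j (K i) x = partial i (K j) x" if x: "x \<in> E" for i j x
  proof -
    have slice: "partial j (K i) x = (LINT t|M2. LINT z|M1. - (l * t) * (u z $ i * partial j \<zeta> (z - (c + (l * t) *\<^sub>R (x - c)))))" for i j
    proof -
      have "partial j (K i) x = (LINT t|M2. LINT z|M1. u (fst (z, t)) $ i * B (z, t) * partial j \<zeta> (A (z, t) + B (z, t) *\<^sub>R x))"
        unfolding dK M_def by (rule snd_integral[OF dint[unfolded M_def], symmetric])
      then show ?thesis
        unfolding AB by (simp add: B_def mult_ac)
    qed
    show ?thesis
      unfolding slice
    proof (rule Bochner_Integration.integral_cong[OF refl])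
      fix t assume "t \<in> space M2"
      then have t: "0 \<le> t" "t \<le> 1"
        by (auto simp: sp)
      define s where "s = c + (l * t) *\<^sub>R (x - c)"
      have sub: "cball s ((1 - l) * r / 2) \<subseteq> E"
        unfolding s_def using l t x by (intro shrunk_ball_subset) auto
      have supp: "compactly_supported_in E (\<lambda>z. \<zeta> (z - s))"
        using sub mollifier_eq_0[OF \<epsilon>]
        by (intro compactly_supported_inI[of "cball s ((1 - l) * r / 2)"])
           (auto simp: \<zeta>_def dist_norm norm_minus_commute)
      have "(LINT z|M1. u z $ i * partial j \<zeta> (z - s)) = (LINT z|M1. u z $ j * partial i \<zeta> (z - s))"
        using weak_curl_zero_symmetric[OF E_bounded E_lebesgue u smooth_translate[OF \<zeta>(1)] supp, of i j]
        by (simp add: partial_translate[OF \<zeta>(1)] M1_def)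
      then show "(LINT z|M1. - (l * t) * (u z $ i * partial j \<zeta> (z - (c + (l * t) *\<^sub>R (x - c)))))
          = (LINT z|M1. - (l * t) * (u z $ j * partial i \<zeta> (z - (c + (l * t) *\<^sub>R (x - c)))))"
        by (simp flip: s_def)
    qed
  qed
  \<comment> \<open>K j x averages the j-th component of the mollified field over the segment from c
    to x; this sum is the line integral of the field.\<close>
  define \<psi> where "\<psi> x = (\<Sum>j\<in>UNIV. (x $ j - c $ j) * K j x)" for x
  have lin: "smooth (\<lambda>x. x $ j - c $ j)" for j
    by (intro smooth_diff smooth_component smooth_const)
  have \<psi>s: "smooth \<psi>"
    unfolding \<psi>_def by (intro smooth_sum smooth_mult lin Ks)
  have d\<psi>: "partial i \<psi> x = K i x + (\<Sum>j\<in>UNIV. (x $ j - c $ j) * partial i (K j) x)" for i x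
  proof -
    have "partial i \<psi> x = (\<Sum>j\<in>UNIV. partial i (\<lambda>x. (x $ j - c $ j) * K j x) x)"
      unfolding \<psi>_def by (intro partial_sum smooth_differentiable smooth_mult lin Ks)
    also have "\<dots> = (\<Sum>j\<in>UNIV. (x $ j - c $ j) * partial i (K j) x + (if i = j then K j x else 0))"
    proof (rule sum.cong[OF refl])
      fix j
      have "partial i (\<lambda>x. x $ j - c $ j) x = (if i = j then 1 else 0)"
        by (simp add: partial_diff smooth_differentiable smooth_component smooth_const partial_component)
      then show "partial i (\<lambda>x. (x $ j - c $ j) * K j x) x
          = (x $ j - c $ j) * partial i (K j) x + (if i = j then K j x else 0)"
        by (subst partial_mult[OF smooth_differentiable[OF lin] smooth_differentiable[OF Ks]]) simp
    qed
    also have "\<dots> = K i x + (\<Sum>j\<in>UNIV. (x $ j - c $ j) * partial i (K j) x)"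
      by (simp add: sum.distrib)
    finally show ?thesis .
  qed
  have "grad \<psi> x $ i = (LINT z|lebesgue_on E. u z $ i * \<zeta> (z - (c + l *\<^sub>R (x - c))))" if x: "x \<in> E" for x i
  proof -
    \<comment> \<open>The t-derivative of t \<zeta>(z - (c + l t (x - c))). After the symmetry of
      the derivatives has been used, the gradient is an integral of this expression and collapses to
      the value at t = 1.\<close>
    define k' where "k' z t = \<zeta> (z - (c + (l * t) *\<^sub>R (x - c)))
      - l * t * (grad \<zeta> (z - (c + (l * t) *\<^sub>R (x - c))) \<bullet> (x - c))" for z t
    have k'_eq: "u (fst \<omega>) $ i * \<zeta> (A \<omega> + B \<omega> *\<^sub>R x)
        + (\<Sum>j\<in>UNIV. (x $ j - c $ j) * (u (fst \<omega>) $ i * B \<omega> * partial j \<zeta> (A \<omega> + B \<omega> *\<^sub>R x)))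
        = u (fst \<omega>) $ i * k' (fst \<omega>) (snd \<omega>)" for \<omega>
    proof -
      obtain z t where \<omega>: "\<omega> = (z, t)"
        by (cases \<omega>)
      have "(\<Sum>j\<in>UNIV. (x $ j - c $ j) * (u z $ i * - (l * t) * partial j \<zeta> (z - (c + (l * t) *\<^sub>R (x - c)))))
          = u z $ i * (- (l * t) * (grad \<zeta> (z - (c + (l * t) *\<^sub>R (x - c))) \<bullet> (x - c)))"
        unfolding inner_vec_def grad_def by (simp add: sum_distrib_left mult_ac)
      then show ?thesis
        unfolding \<omega> AB by (simp add: B_def k'_def right_diff_distrib)
    qed
    have "grad \<psi> x $ i = K i x + (\<Sum>j\<in>UNIV. (x $ j - c $ j) * partial j (K i) x)"
      using sym[OF x, of i] by (simp add: grad_def d\<psi>)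
    also have "\<dots> = (LINT \<omega>|M. u (fst \<omega>) $ i * \<zeta> (A \<omega> + B \<omega> *\<^sub>R x)
        + (\<Sum>j\<in>UNIV. (x $ j - c $ j) * (u (fst \<omega>) $ i * B \<omega> * partial j \<zeta> (A \<omega> + B \<omega> *\<^sub>R x))))"
      unfolding dK K_def
      using Kint dint by (simp add: Bochner_Integration.integral_sum)
    also have "\<dots> = (LINT \<omega>|M. u (fst \<omega>) $ i * k' (fst \<omega>) (snd \<omega>))"
      by (simp only: k'_eq)
    also have "\<dots> = (LINT z|M1. LINT t|M2. u z $ i * k' z t)"
    proof -
      have "integrable M (\<lambda>\<omega>. u (fst \<omega>) $ i * \<zeta> (A \<omega> + B \<omega> *\<^sub>R x)
          + (\<Sum>j\<in>UNIV. (x $ j - c $ j) * (u (fst \<omega>) $ i * B \<omega> * partial j \<zeta> (A \<omega> + B \<omega> *\<^sub>R x))))"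
        using Kint dint by (intro Bochner_Integration.integrable_add Bochner_Integration.integrable_sum integrable_mult_right)
      then have "integrable M (\<lambda>\<omega>. u (fst \<omega>) $ i * k' (fst \<omega>) (snd \<omega>))"
        by (simp only: k'_eq)
      from P.integral_fst'[OF this[unfolded M_def]] show ?thesis
        by (simp add: M_def)
    qed
    also have "\<dots> = (LINT z|M1. u z $ i * \<zeta> (z - (c + l *\<^sub>R (x - c))))"
    proof (rule Bochner_Integration.integral_cong[OF refl])
      fix z
      define b where "b = - (l *\<^sub>R (x - c))"
      have arg: "z - (c + (l * t) *\<^sub>R (x - c)) = (z - c) + t *\<^sub>R b" for t
        by (simp add: b_def algebra_simps)
      define k where "k t = t * \<zeta> ((z - c) + t *\<^sub>R b)" for t
      have k'_line: "k' z t = t * (grad \<zeta> ((z - c) + t *\<^sub>R b) \<bullet> b) + 1 * \<zeta> ((z - c) + t *\<^sub>R b)" for t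
        unfolding k'_def arg by (simp add: b_def)
      have dk: "(k has_real_derivative k' z t) (at t)" for t
        unfolding k_def k'_line
        by (rule DERIV_mult'[OF DERIV_ident line_derivative[OF \<zeta>(1)]])
      have ck: "continuous_on UNIV (k' z)"
        unfolding k'_line
        by (intro continuous_intros continuous_on_compose2[OF continuous_grad[OF \<zeta>(1), of UNIV]]
            continuous_on_compose2[OF smooth_continuous[OF \<zeta>(1), of UNIV]]) auto
      have "(LINT t|M2. k' z t) = (LINT t|lebesgue. indicator {0..1} t *\<^sub>R k' z t)"
        unfolding M2_def by (intro integral_restrict_space) auto
      also have "\<dots> = (LINT t|lborel. indicator {0..1} t *\<^sub>R k' z t)"
        using borel_measurable_continuous_onI[OF ck] by (intro integral_completion) measurable
      also have "\<dots> = (LINT t|lborel. k' z t * indicator {0..1} t)"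
        by (simp add: mult.commute)
      also have "\<dots> = k 1 - k 0"
        using dk ck by (intro integral_FTC_Icc_real) (auto simp: continuous_on_eq_continuous_at)
      also have "\<dots> = \<zeta> (z - (c + l *\<^sub>R (x - c)))"
        by (simp add: k_def b_def algebra_simps)
      finally show "(LINT t|M2. u z $ i * k' z t) = u z $ i * \<zeta> (z - (c + l *\<^sub>R (x - c)))"
        by simp
    qed
    finally show ?thesis
      by (simp add: M1_def)
  qed
  then show ?thesis
    using \<psi>s unfolding \<zeta>_def by blast
qed

end

section \<open>Mollification after contraction towards the center\<close>

context mesh_element
begin

text \<open>The convolution is evaluated at the contracted point c + l (x - c), so that for x in
  \<open>E\<close> the support of the kernel stays inside \<open>E\<close> and f is never sampled
  beyond the boundary.\<close>

definition mollify :: "real \<Rightarrow> (real^3 \<Rightarrow> real) \<Rightarrow> real^3 \<Rightarrow> real" where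
  "mollify l f x = (LINT z|lebesgue_on E. f z * mollifier ((1 - l) * r / 2) (z - (c + l *\<^sub>R (x - c))))"

context
  fixes l :: real
  assumes l: "1 / 2 \<le> l" "l < 1"
begin

lemma eps_pos: "(1 - l) * r / 2 > 0"
  using l r_pos by simp

lemma mollify_kernel: "kernel_integral (lebesgue_on E) (\<lambda>z. z - (1 - l) *\<^sub>R c) (\<lambda>_. - l)"
proof
  show "(\<lambda>z. z - (1 - l) *\<^sub>R c) \<in> borel_measurable (lebesgue_on E)"
    by (intro continuous_lebesgue_on_measurable continuous_intros)
qed (use l in auto)

lemma mollify_eq_kernel:
  "mollify l f x = (LINT z|lebesgue_on E. f z * mollifier ((1 - l) * r / 2) ((z - (1 - l) *\<^sub>R c) + (- l) *\<^sub>R x))"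
  unfolding mollify_def by (simp add: algebra_simps)

lemma L2_integrable_E: "f \<in> L2 (lebesgue_on E) \<Longrightarrow> integrable (lebesgue_on E) f" for f :: "real^3 \<Rightarrow> real"
  using finite_measure_lebesgue_on_bounded[OF E_bounded E_lebesgue] by (rule L2_integrable)

lemma integrable_mollify:
  assumes "f \<in> L2 (lebesgue_on E)"
  shows "integrable (lebesgue_on E) (\<lambda>z. f z * mollifier ((1 - l) * r / 2) (z - (c + l *\<^sub>R (x - c))))"
proof -
  have "integrable (lebesgue_on E) (\<lambda>z. f z * mollifier ((1 - l) * r / 2) ((z - (1 - l) *\<^sub>R c) + (- l) *\<^sub>R x))"
    by (rule kernel_integral.integrable_kernel[OF mollify_kernel L2_integrable_E[OF assms]
          smooth_continuous[OF smooth_mollifier] mollifier_supported[OF eps_pos]])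
  then show ?thesis
    by (simp add: algebra_simps)
qed

lemma mollify_L2:
  assumes "f \<in> L2 (lebesgue_on E)"
  shows "mollify l f \<in> L2 (lebesgue_on E)"
proof -
  have "smooth (mollify l f)"
    unfolding mollify_eq_kernel[abs_def]
    by (rule kernel_integral.smooth_kernel[OF mollify_kernel L2_integrable_E[OF assms]
          smooth_mollifier mollifier_supported[OF eps_pos]])
  then show ?thesis
    by (intro continuous_L2[OF E_bounded E_lebesgue] smooth_continuous)
qed

lemma mollify_diff:
  assumes "f \<in> L2 (lebesgue_on E)" "g \<in> L2 (lebesgue_on E)"
  shows "mollify l (\<lambda>z. f z - g z) x = mollify l f x - mollify l g x"
  unfolding mollify_def using integrable_mollify[OF assms(1)] integrable_mollify[OF assms(2)]
  by (simp add: left_diff_distrib)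

lemma mollifier_support_in_E:
  assumes "x \<in> E" "z \<notin> E"
  shows "mollifier ((1 - l) * r / 2) (z - (c + l *\<^sub>R (x - c))) = 0"
proof (rule mollifier_eq_0[OF eps_pos])
  have "cball (c + (l * 1) *\<^sub>R (x - c)) ((1 - l) * r / 2) \<subseteq> E"
    using l assms(1) by (intro shrunk_ball_subset) auto
  then show "z - (c + l *\<^sub>R (x - c)) \<notin> cball 0 ((1 - l) * r / 2)"
    using assms(2) by (auto simp: dist_norm norm_minus_commute)
qed

lemma integral_mollifier_E:
  assumes "x \<in> E"
  shows "(LINT z|lebesgue_on E. mollifier ((1 - l) * r / 2) (z - (c + l *\<^sub>R (x - c)))) = 1"
proof -
  define s where "s = c + l *\<^sub>R (x - c)"
  have c: "continuous_on UNIV (mollifier ((1 - l) * r / 2))"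
    by (intro smooth_continuous smooth_mollifier)
  have "(LINT z|lebesgue_on E. mollifier ((1 - l) * r / 2) (z - s)) = (LINT z|lborel. mollifier ((1 - l) * r / 2) (z - s))"
    using E_lebesgue mollifier_support_in_E[OF assms]
    by (intro integral_lebesgue_on_eq_lborel borel_measurable_continuous_onI
        continuous_on_compose2[OF c] continuous_intros) (auto simp: s_def)
  also have "\<dots> = (LINT z|distr lborel borel ((+) (- s)). mollifier ((1 - l) * r / 2) z)"
    by (subst integral_distr) (auto intro: borel_measurable_continuous_onI[OF c])
  also have "\<dots> = 1"
    unfolding lborel_distr_plus using eps_pos by (rule integral_mollifier)
  finally show ?thesis
    by (simp add: s_def)
qed

text \<open>Jensen's inequality for the probability density given by the mollifier, obtained from
  Cauchy-Schwarz by splitting the kernel into two square roots.\<close>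

lemma mollify_pointwise_square:
  assumes f: "f \<in> L2 (lebesgue_on E)" and x: "x \<in> E"
  shows "ennreal ((mollify l f x)\<^sup>2)
    \<le> (\<integral>\<^sup>+z. ennreal ((f z)\<^sup>2 * mollifier ((1 - l) * r / 2) (z - (c + l *\<^sub>R (x - c)))) \<partial>lebesgue_on E)"
proof -
  define \<zeta> where "\<zeta> z = mollifier ((1 - l) * r / 2) (z - (c + l *\<^sub>R (x - c)))" for z
  have \<zeta>0: "0 \<le> \<zeta> z" for z
    unfolding \<zeta>_def by (rule mollifier_nonneg)
  have mc: "continuous_on UNIV (mollifier ((1 - l) * r / 2))"
    by (intro smooth_continuous smooth_mollifier)
  have \<zeta>c: "continuous_on UNIV \<zeta>"
    unfolding \<zeta>_def by (intro continuous_on_compose2[OF mc] continuous_intros) auto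
  have rc: "continuous_on UNIV (\<lambda>z. sqrt (\<zeta> z))"
    using \<zeta>c by (intro continuous_intros)
  obtain B where B: "\<And>z. \<bar>mollifier ((1 - l) * r / 2) z\<bar> \<le> B"
    using compactly_supported_bounded[OF mc mollifier_supported[OF eps_pos]] by blast
  have f1: "(\<lambda>z. f z * sqrt (\<zeta> z)) \<in> L2 (lebesgue_on E)"
  proof (rule L2_mult_bounded[OF f continuous_lebesgue_on_measurable[OF rc], where B = "sqrt B"])
    show "\<bar>sqrt (\<zeta> z)\<bar> \<le> sqrt B" for z
      using B[of "z - (c + l *\<^sub>R (x - c))"] \<zeta>0[of z] by (simp add: \<zeta>_def)
  qed
  have f2: "(\<lambda>z. sqrt (\<zeta> z)) \<in> L2 (lebesgue_on E)"
    using rc by (rule continuous_L2[OF E_bounded E_lebesgue])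
  have n1: "(l2_norm (lebesgue_on E) (\<lambda>z. f z * sqrt (\<zeta> z)))\<^sup>2 = (LINT z|lebesgue_on E. (f z)\<^sup>2 * \<zeta> z)"
    using \<zeta>0 by (simp add: l2_norm_power2_eq_integral power_mult_distrib)
  have n2: "(l2_norm (lebesgue_on E) (\<lambda>z. sqrt (\<zeta> z)))\<^sup>2 = 1"
    using \<zeta>0 integral_mollifier_E[OF x] by (simp add: l2_norm_power2_eq_integral \<zeta>_def)
  have "mollify l f x = l2_inner (lebesgue_on E) (\<lambda>z. f z * sqrt (\<zeta> z)) (\<lambda>z. sqrt (\<zeta> z))"
    using \<zeta>0 by (simp add: mollify_def l2_inner_def mult.assoc flip: \<zeta>_def)
  then have "\<bar>mollify l f x\<bar> \<le> l2_norm (lebesgue_on E) (\<lambda>z. f z * sqrt (\<zeta> z)) * l2_norm (lebesgue_on E) (\<lambda>z. sqrt (\<zeta> z))"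
    using l2_Cauchy_Schwarz[OF f1 f2] by simp
  then have "\<bar>mollify l f x\<bar>\<^sup>2 \<le> (l2_norm (lebesgue_on E) (\<lambda>z. f z * sqrt (\<zeta> z)) * l2_norm (lebesgue_on E) (\<lambda>z. sqrt (\<zeta> z)))\<^sup>2"
    by (intro power_mono) auto
  then have "(mollify l f x)\<^sup>2 \<le> (LINT z|lebesgue_on E. (f z)\<^sup>2 * \<zeta> z)"
    unfolding power_mult_distrib n1 n2 by simp
  then have "ennreal ((mollify l f x)\<^sup>2) \<le> ennreal (LINT z|lebesgue_on E. (f z)\<^sup>2 * \<zeta> z)"
    by (rule ennreal_leI)
  also have "\<dots> = (\<integral>\<^sup>+z. ennreal ((f z)\<^sup>2 * \<zeta> z) \<partial>lebesgue_on E)"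
    using L2_integrable_norm2[OF f1] \<zeta>0
    by (intro nn_integral_eq_integral[symmetric]) (simp_all add: power_mult_distrib)
  finally show ?thesis
    by (simp add: \<zeta>_def)
qed

text \<open>After exchanging integrations the kernel is integrated over x, where the contraction
  costs 1 / l^3, at most 8 since l is at least 1/2. The constant 3 is a convenient upper bound for
  the square root of 8.\<close>

lemma mollify_norm_bound:
  assumes f: "f \<in> L2 (lebesgue_on E)"
  shows "l2_norm (lebesgue_on E) (mollify l f) \<le> 3 * l2_norm (lebesgue_on E) f"
proof (rule power2_le_imp_le)
  define M where "M = lebesgue_on E"
  define m where "m = mollifier ((1 - l) * r / 2)"
  interpret M: finite_measure M
    unfolding M_def by (rule finite_measure_lebesgue_on_bounded[OF E_bounded E_lebesgue])
  interpret P: pair_sigma_finite lborel M ..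
  have mm [measurable]: "m \<in> borel_measurable borel"
    unfolding m_def by (intro borel_measurable_continuous_onI smooth_continuous smooth_mollifier)
  have m0: "0 \<le> m z" for z
    unfolding m_def by (rule mollifier_nonneg)
  have fm [measurable]: "f \<in> borel_measurable M"
    using f unfolding M_def by (rule L2_measurable)
  have id: "(\<lambda>z. z) \<in> borel_measurable M"
    unfolding M_def by (intro continuous_lebesgue_on_measurable continuous_intros)
  have "ennreal ((l2_norm M (mollify l f))\<^sup>2) = (\<integral>\<^sup>+x. ennreal ((norm (mollify l f x))\<^sup>2) * indicator E x \<partial>lborel)"
    unfolding M_def by (rule l2_norm_eq_nn_integral[OF mollify_L2[OF f] E_borel])
  also have "\<dots> \<le> (\<integral>\<^sup>+x. \<integral>\<^sup>+z. ennreal ((f z)\<^sup>2) * ennreal (m (z - (c + l *\<^sub>R (x - c)))) \<partial>M \<partial>lborel)"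
  proof (rule nn_integral_mono)
    fix x
    show "ennreal ((norm (mollify l f x))\<^sup>2) * indicator E x
        \<le> (\<integral>\<^sup>+z. ennreal ((f z)\<^sup>2) * ennreal (m (z - (c + l *\<^sub>R (x - c)))) \<partial>M)"
    proof (cases "x \<in> E")
      case True
      then show ?thesis
        using mollify_pointwise_square[OF f True] m0 by (simp add: M_def m_def ennreal_mult)
    qed simp
  qed
  also have "\<dots> = (\<integral>\<^sup>+z. \<integral>\<^sup>+x. ennreal ((f z)\<^sup>2) * ennreal (m (z - (c + l *\<^sub>R (x - c)))) \<partial>lborel \<partial>M)"
  proof (rule P.Fubini'[symmetric])
    have fs: "(\<lambda>p. f (snd p)) \<in> borel_measurable (lborel \<Otimes>\<^sub>M M)"
      by (rule measurable_compose[OF measurable_snd fm])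
    have ss: "(\<lambda>p. snd p) \<in> borel_measurable (lborel \<Otimes>\<^sub>M M)"
      by (rule measurable_compose[OF measurable_snd id])
    have fp: "(\<lambda>p. fst p) \<in> borel_measurable (lborel \<Otimes>\<^sub>M M)"
      using measurable_fst[of lborel M] by simp
    show "(\<lambda>(x, z). ennreal ((f z)\<^sup>2) * ennreal (m (z - (c + l *\<^sub>R (x - c))))) \<in> borel_measurable (lborel \<Otimes>\<^sub>M M)"
    proof -
      have "(\<lambda>p. snd p - (c + l *\<^sub>R (fst p - c))) \<in> borel_measurable (lborel \<Otimes>\<^sub>M M)"
        by (intro borel_measurable_diff borel_measurable_add borel_measurable_scaleR borel_measurable_const ss fp)
      from measurable_compose[OF this mm] have "(\<lambda>p. m (snd p - (c + l *\<^sub>R (fst p - c)))) \<in> borel_measurable (lborel \<Otimes>\<^sub>M M)" .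
      then show ?thesis
        unfolding case_prod_beta
        by (intro borel_measurable_times_ennreal measurable_compose[OF _ measurable_ennreal] borel_measurable_power fs)
    qed
  qed
  also have "\<dots> \<le> (\<integral>\<^sup>+z. ennreal ((f z)\<^sup>2) * 8 \<partial>M)"
  proof (rule nn_integral_mono)
    fix z
    have "(\<integral>\<^sup>+x. ennreal ((f z)\<^sup>2) * ennreal (m (z - (c + l *\<^sub>R (x - c)))) \<partial>lborel)
        = ennreal ((f z)\<^sup>2) * (\<integral>\<^sup>+x. ennreal (m (z - (c + l *\<^sub>R (x - c)))) \<partial>lborel)"
      by (rule nn_integral_cmult) measurable
    also have "(\<integral>\<^sup>+x. ennreal (m (z - (c + l *\<^sub>R (x - c)))) \<partial>lborel)
        = (\<integral>\<^sup>+x. ennreal (m ((z - c + l *\<^sub>R c) + (- l) *\<^sub>R x)) \<partial>lborel)"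
      by (simp add: algebra_simps)
    also have "ennreal ((f z)\<^sup>2) * \<dots> \<le> ennreal ((f z)\<^sup>2) * (8 * (\<integral>\<^sup>+x. ennreal (m x) \<partial>lborel))"
      using l by (intro mult_left_mono nn_integral_lborel_affine_le[of "\<lambda>x. ennreal (m x)"]) auto
    also have "(\<integral>\<^sup>+x. ennreal (m x) \<partial>lborel) = 1"
      using integrable_mollifier[OF eps_pos] integral_mollifier[OF eps_pos] m0
      unfolding m_def by (subst nn_integral_eq_integral) auto
    finally show "(\<integral>\<^sup>+x. ennreal ((f z)\<^sup>2) * ennreal (m (z - (c + l *\<^sub>R (x - c)))) \<partial>lborel) \<le> ennreal ((f z)\<^sup>2) * 8"
      by simp
  qed
  also have "\<dots> = ennreal ((l2_norm M f)\<^sup>2) * 8"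
  proof -
    have "(\<integral>\<^sup>+z. ennreal ((f z)\<^sup>2) \<partial>M) = ennreal ((l2_norm M f)\<^sup>2)"
      unfolding l2_norm_power2_eq_integral using L2_integrable_norm2[OF f]
      by (subst nn_integral_eq_integral) (auto simp: M_def)
    then show ?thesis
      by (simp add: nn_integral_multc)
  qed
  also have "\<dots> = ennreal (8 * (l2_norm M f)\<^sup>2)"
    by (simp add: ennreal_mult mult.commute)
  finally have "(l2_norm M (mollify l f))\<^sup>2 \<le> 8 * (l2_norm M f)\<^sup>2"
    by (subst (asm) ennreal_le_iff) auto
  then show "(l2_norm (lebesgue_on E) (mollify l f))\<^sup>2 \<le> (3 * l2_norm (lebesgue_on E) f)\<^sup>2"
    using order_trans[of "(l2_norm M (mollify l f))\<^sup>2" "8 * (l2_norm M f)\<^sup>2" "9 * (l2_norm M f)\<^sup>2"]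
    by (simp add: power_mult_distrib M_def)
qed (simp add: l2_norm_nonneg)

text \<open>The distance 2 (1 - l) h is the sum of the kernel radius, at most (1 - l) h, and the
  displacement of x by the contraction.\<close>

lemma mollify_continuous_close:
  assumes g: "continuous_on UNIV g" and x: "x \<in> E"
    and close: "\<And>z. z \<in> E \<Longrightarrow> dist z x \<le> (1 - l) * (2 * h) \<Longrightarrow> \<bar>g z - g x\<bar> \<le> \<eta>"
  shows "\<bar>mollify l g x - g x\<bar> \<le> \<eta>"
proof -
  define m where "m z = mollifier ((1 - l) * r / 2) (z - (c + l *\<^sub>R (x - c)))" for z
  have m0: "0 \<le> m z" for z
    unfolding m_def by (rule mollifier_nonneg)
  have gL2: "g \<in> L2 (lebesgue_on E)"
    using g by (rule continuous_L2[OF E_bounded E_lebesgue])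
  have oneL2: "(\<lambda>_. 1) \<in> L2 (lebesgue_on E)"
    by (intro continuous_L2[OF E_bounded E_lebesgue] continuous_intros)
  have im: "integrable (lebesgue_on E) m" and igm: "integrable (lebesgue_on E) (\<lambda>z. g z * m z)"
    using integrable_mollify[OF oneL2, of x] integrable_mollify[OF gL2, of x] by (simp_all add: m_def[abs_def])
  have one: "(LINT z|lebesgue_on E. m z) = 1"
    unfolding m_def by (rule integral_mollifier_E[OF x])
  have "mollify l g x - g x = (LINT z|lebesgue_on E. g z * m z) - g x * (LINT z|lebesgue_on E. m z)"
    by (simp add: mollify_def one flip: m_def)
  also have "\<dots> = (LINT z|lebesgue_on E. (g z - g x) * m z)"
    using im igm by (simp add: left_diff_distrib)
  also have "\<bar>\<dots>\<bar> \<le> (LINT z|lebesgue_on E. \<bar>(g z - g x) * m z\<bar>)"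
    by (rule integral_abs_bound)
  also have "\<dots> \<le> (LINT z|lebesgue_on E. \<eta> * m z)"
  proof (rule integral_mono)
    show "integrable (lebesgue_on E) (\<lambda>z. \<bar>(g z - g x) * m z\<bar>)"
      using im igm by (simp add: left_diff_distrib)
    fix z assume "z \<in> space (lebesgue_on E)"
    then have z: "z \<in> E"
      by simp
    show "\<bar>(g z - g x) * m z\<bar> \<le> \<eta> * m z"
    proof (cases "m z = 0")
      case False
      then have "norm (z - (c + l *\<^sub>R (x - c))) \<le> (1 - l) * r / 2"
        using mollifier_eq_0[OF eps_pos, of "z - (c + l *\<^sub>R (x - c))"] by (auto simp: m_def)
      also have "(1 - l) * r / 2 \<le> (1 - l) * h"
        using l r_le_h h_pos r_pos mult_left_mono[of "r / 2" h "1 - l"] by simp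
      finally have 1: "norm (z - (c + l *\<^sub>R (x - c))) \<le> (1 - l) * h" .
      have "norm (x - c) \<le> h"
        using E_subset_cball x by (auto simp: dist_norm norm_minus_commute)
      then have 2: "norm ((l - 1) *\<^sub>R (x - c)) \<le> (1 - l) * h"
        using l by (simp add: mult_left_mono)
      have eq: "z - x = (z - (c + l *\<^sub>R (x - c))) + (l - 1) *\<^sub>R (x - c)"
        by (simp add: algebra_simps)
      have "norm (z - x) \<le> (1 - l) * h + (1 - l) * h"
        unfolding eq by (rule order_trans[OF norm_triangle_ineq add_mono[OF 1 2]])
      then have "\<bar>g z - g x\<bar> \<le> \<eta>"
        using z by (intro close) (simp_all add: dist_norm algebra_simps)
      then show ?thesis
        using m0[of z] by (simp add: abs_mult mult_right_mono)
    qed simp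
  qed (use im in simp)
  also have "\<dots> = \<eta>"
    by (simp add: one)
  finally show ?thesis .
qed

end

text \<open>Density argument: convergence is uniform for continuous functions, and the operators are
  bounded independently of l, so it extends to all square integrable functions.\<close>

lemma mollify_converges:
  assumes f: "f \<in> L2 (lebesgue_on E)" and e: "e > 0"
  shows "\<exists>d>0. \<forall>l. 1 / 2 \<le> l \<and> l < 1 \<and> 1 - l < d \<longrightarrow> l2_norm (lebesgue_on E) (\<lambda>x. f x - mollify l f x) < e"
proof -
  \<comment> \<open>One share for f - g, one for g minus its mollification, and three for the
    mollification of g - f, whose norm bound has the factor 3.\<close>
  define e0 where "e0 = e / 5"
  have e0: "e0 > 0" "e = 5 * e0"
    using e by (auto simp: e0_def)
  obtain g where g: "continuous_on UNIV g" "l2_norm (lebesgue_on E) (\<lambda>x. f x - g x) < e0"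
    using L2_continuous_approximation[OF E_bounded E_lebesgue f e0(1)] by blast
  have gL2: "g \<in> L2 (lebesgue_on E)"
    using g(1) by (rule continuous_L2[OF E_bounded E_lebesgue])
  interpret fm: finite_measure "lebesgue_on E"
    by (rule finite_measure_lebesgue_on_bounded[OF E_bounded E_lebesgue])
  define V where "V = sqrt (measure (lebesgue_on E) (space (lebesgue_on E)))"
  have V: "V \<ge> 0"
    by (simp add: V_def)
  define \<eta> where "\<eta> = e0 / (V + 1)"
  have \<eta>: "\<eta> > 0" "\<eta> * V \<le> e0"
    using e0 V by (auto simp: \<eta>_def field_simps)
  have "compact (closure E)"
    using E_bounded by (simp add: compact_closure)
  then have "uniformly_continuous_on (closure E) g"
    using continuous_on_subset[OF g(1)] by (intro compact_uniformly_continuous) auto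
  then obtain d where d: "d > 0" "\<And>x z. x \<in> closure E \<Longrightarrow> z \<in> closure E \<Longrightarrow> dist z x < d \<Longrightarrow> dist (g z) (g x) < \<eta>"
    using \<eta>(1) unfolding uniformly_continuous_on_def by meson
  have "l2_norm (lebesgue_on E) (\<lambda>x. f x - mollify l f x) < e"
    if l: "1 / 2 \<le> l" "l < 1" "1 - l < d / (2 * h)" for l
  proof -
    have mg: "mollify l g \<in> L2 (lebesgue_on E)" and mf: "mollify l f \<in> L2 (lebesgue_on E)"
      using mollify_L2[OF l(1,2)] gL2 f by blast+
    have "\<bar>mollify l g x - g x\<bar> \<le> \<eta>" if x: "x \<in> E" for x
    proof (rule mollify_continuous_close[OF l(1,2) g(1) x])
      fix z assume z: "z \<in> E" "dist z x \<le> (1 - l) * (2 * h)"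
      have "(1 - l) * (2 * h) < d"
        using l(3) h_pos by (simp add: pos_less_divide_eq)
      then have "dist (g z) (g x) < \<eta>"
        using z x closure_subset by (intro d(2)) auto
      then show "\<bar>g z - g x\<bar> \<le> \<eta>"
        by (simp add: dist_real_def)
    qed
    then have "(l2_norm (lebesgue_on E) (\<lambda>x. g x - mollify l g x))\<^sup>2 \<le> \<eta>\<^sup>2 * measure (lebesgue_on E) (space (lebesgue_on E))"
      using L2_measurable[OF L2_diff[OF gL2 mg]] fm.finite_measure_axioms
      by (intro l2_norm_bounded) (auto simp: abs_minus_commute)
    also have "\<dots> = (\<eta> * V)\<^sup>2"
      unfolding V_def power_mult_distrib real_sqrt_pow2[OF measure_nonneg] ..
    finally have "l2_norm (lebesgue_on E) (\<lambda>x. g x - mollify l g x) \<le> \<eta> * V"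
      using \<eta>(1) V by (auto intro: power2_le_imp_le)
    then have 2: "l2_norm (lebesgue_on E) (\<lambda>x. g x - mollify l g x) \<le> e0"
      using \<eta>(2) by linarith
    have "l2_norm (lebesgue_on E) (mollify l (\<lambda>x. g x - f x)) \<le> 3 * l2_norm (lebesgue_on E) (\<lambda>x. g x - f x)"
      using l gL2 f by (intro mollify_norm_bound) auto
    then have 3: "l2_norm (lebesgue_on E) (\<lambda>x. mollify l g x - mollify l f x) < 3 * e0"
      using g(2) unfolding mollify_diff[OF l(1,2) gL2 f] l2_norm_minus_commute[of "lebesgue_on E" g f]
      by linarith
    have "l2_norm (lebesgue_on E) (\<lambda>x. f x - mollify l f x)
        = l2_norm (lebesgue_on E) (\<lambda>x. (f x - g x) + ((g x - mollify l g x) + (mollify l g x - mollify l f x)))"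
      by simp
    also have "\<dots> \<le> l2_norm (lebesgue_on E) (\<lambda>x. f x - g x)
        + l2_norm (lebesgue_on E) (\<lambda>x. (g x - mollify l g x) + (mollify l g x - mollify l f x))"
      by (intro l2_norm_triangle L2_add L2_diff f gL2 mg mf)
    also have "\<dots> \<le> l2_norm (lebesgue_on E) (\<lambda>x. f x - g x)
        + (l2_norm (lebesgue_on E) (\<lambda>x. g x - mollify l g x) + l2_norm (lebesgue_on E) (\<lambda>x. mollify l g x - mollify l f x))"
      by (intro add_left_mono l2_norm_triangle L2_diff f gL2 mg mf)
    also have "\<dots> < e"
      using g(2) 2 3 e0(2) by linarith
    finally show ?thesis .
  qed
  then show ?thesis
    using d(1) h_pos by (intro exI[of _ "d / (2 * h)"]) auto
qed

text \<open>On \<open>E\<close> the contracted mollification of u is a gradient, and it converges to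
  u in each component.\<close>

lemma curl_free_gradient_approximation:
  assumes u: "u \<in> L2 (lebesgue_on E)" "has_weak_curl E u (\<lambda>_. 0)" and e: "e > 0"
  obtains \<psi> where "smooth \<psi>" "l2_norm (lebesgue_on E) (\<lambda>x. u x - grad \<psi> x) < e"
proof -
  have "\<exists>d>0. \<forall>l. 1 / 2 \<le> l \<and> l < 1 \<and> 1 - l < d \<longrightarrow>
      l2_norm (lebesgue_on E) (\<lambda>x. u x $ i - mollify l (\<lambda>x. u x $ i) x) < e / 2" for i
    using e by (intro mollify_converges L2_vec_nth[OF u(1)]) simp
  then have "\<forall>i. \<exists>d. d > 0 \<and> (\<forall>l. 1 / 2 \<le> l \<and> l < 1 \<and> 1 - l < d \<longrightarrow>
      l2_norm (lebesgue_on E) (\<lambda>x. u x $ i - mollify l (\<lambda>x. u x $ i) x) < e / 2)"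
    by (rule allI)
  from choice[OF this] obtain d where
    d': "\<forall>i. d i > 0 \<and> (\<forall>l. 1 / 2 \<le> l \<and> l < 1 \<and> 1 - l < d i \<longrightarrow>
      l2_norm (lebesgue_on E) (\<lambda>x. u x $ i - mollify l (\<lambda>x. u x $ i) x) < e / 2)" ..
  have d: "d i > 0" "1 / 2 \<le> l \<Longrightarrow> l < 1 \<Longrightarrow> 1 - l < d i \<Longrightarrow>
      l2_norm (lebesgue_on E) (\<lambda>x. u x $ i - mollify l (\<lambda>x. u x $ i) x) < e / 2" for i l
    using spec[OF d', of i] by simp_all
  \<comment> \<open>One contraction factor has to serve all three components, hence the minimum of
    their thresholds; the entry 1/2 keeps l in the range of the mollification bounds.\<close>
  define \<delta>' where "\<delta>' = Min (insert (1 / 2) (range d))"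
  have \<delta>': "\<delta>' > 0" "\<delta>' \<le> 1 / 2" "\<delta>' \<le> d i" for i
    using d(1) unfolding \<delta>'_def by (subst Min_gr_iff; auto) (rule Min_le; auto)+
  define l where "l = 1 - \<delta>' / 2"
  have l: "1 / 2 \<le> l" "l < 1" "1 - l < d i" for i
    using \<delta>'(1,2) \<delta>'(3)[of i] by (auto simp: l_def)
  obtain \<psi> where \<psi>: "smooth \<psi>" "\<And>x i. x \<in> E \<Longrightarrow> grad \<psi> x $ i = mollify l (\<lambda>x. u x $ i) x"
    using smooth_potential_of_mollification[OF u, of l] l unfolding mollify_def by auto
  have gL2: "grad \<psi> \<in> L2 (lebesgue_on E)"
    by (intro continuous_L2[OF E_bounded E_lebesgue] continuous_grad \<psi>(1))
  have "(l2_norm (lebesgue_on E) (\<lambda>x. u x - grad \<psi> x))\<^sup>2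
      = (\<Sum>i\<in>UNIV. (l2_norm (lebesgue_on E) (\<lambda>x. (u x - grad \<psi> x) $ i))\<^sup>2)"
    using u(1) gL2 by (intro l2_norm_power2_vec L2_diff)
  also have "\<dots> \<le> (\<Sum>i\<in>(UNIV :: 3 set). (e / 2)\<^sup>2)"
  proof (rule sum_mono)
    fix i :: 3
    have "l2_norm (lebesgue_on E) (\<lambda>x. (u x - grad \<psi> x) $ i) = l2_norm (lebesgue_on E) (\<lambda>x. u x $ i - mollify l (\<lambda>x. u x $ i) x)"
      unfolding l2_norm_def l2_inner_def
      by (intro arg_cong[where f = sqrt] Bochner_Integration.integral_cong refl) (simp add: \<psi>(2))
    then show "(l2_norm (lebesgue_on E) (\<lambda>x. (u x - grad \<psi> x) $ i))\<^sup>2 \<le> (e / 2)\<^sup>2"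
      using d(2)[OF l(1,2) l(3)[of i]] by (intro power_mono l2_norm_nonneg) simp
  qed
  \<comment> \<open>Three components with error below e / 2 each; the total stays strictly below
    e.\<close>
  also have "\<dots> = 3 / 4 * e\<^sup>2"
    by (simp add: power_divide)
  also have "\<dots> < e\<^sup>2"
    using e by simp
  finally have "l2_norm (lebesgue_on E) (\<lambda>x. u x - grad \<psi> x) < e"
    using e by (auto intro: power2_less_imp_less)
  with \<psi>(1) show thesis
    by (rule that)
qed

text \<open>The bound for gradients passes to u by density. Replacing u by a gradient costs at most
  \<eta> V in the pairing and \<theta> \<eta> in the norm on the right.\<close>

lemma curl_free_pairing_bound:
  assumes v: "v \<in> L2 (lebesgue_on E)" and u: "u \<in> L2 (lebesgue_on E)" "has_weak_curl E u (\<lambda>_. 0)"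
    and \<theta>: "\<theta> \<ge> 0" "\<And>\<psi>. smooth \<psi> \<Longrightarrow>
      \<bar>l2_inner (lebesgue_on E) v (grad \<psi>)\<bar> \<le> \<theta> * l2_norm (lebesgue_on E) (grad \<psi>)"
  shows "\<bar>l2_inner (lebesgue_on E) v u\<bar> \<le> \<theta> * l2_norm (lebesgue_on E) u"
proof (rule field_le_epsilon)
  fix e :: real assume e: "e > 0"
  define V where "V = l2_norm (lebesgue_on E) v"
  have V: "V \<ge> 0"
    by (simp add: V_def l2_norm_nonneg)
  define \<eta> where "\<eta> = e / (V + \<theta> + 1)"
  have \<eta>: "\<eta> > 0" "\<eta> * (V + \<theta>) \<le> e"
    using e V \<theta>(1) by (auto simp: \<eta>_def field_simps)
  obtain \<psi> where \<psi>: "smooth \<psi>" "l2_norm (lebesgue_on E) (\<lambda>x. u x - grad \<psi> x) < \<eta>"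
    using curl_free_gradient_approximation[OF u \<eta>(1)] .
  have gL2: "grad \<psi> \<in> L2 (lebesgue_on E)"
    by (intro continuous_L2[OF E_bounded E_lebesgue] continuous_grad \<psi>(1))
  have dL2: "(\<lambda>x. u x - grad \<psi> x) \<in> L2 (lebesgue_on E)"
    using u(1) gL2 by (rule L2_diff)
  have "l2_inner (lebesgue_on E) v u = l2_inner (lebesgue_on E) v (\<lambda>x. (u x - grad \<psi> x) + grad \<psi> x)"
    by simp
  also have "\<dots> = l2_inner (lebesgue_on E) v (\<lambda>x. u x - grad \<psi> x) + l2_inner (lebesgue_on E) v (grad \<psi>)"
    by (rule l2_inner_add_right[OF dL2 gL2 v])
  finally have "\<bar>l2_inner (lebesgue_on E) v u\<bar>
      \<le> \<bar>l2_inner (lebesgue_on E) v (\<lambda>x. u x - grad \<psi> x)\<bar> + \<bar>l2_inner (lebesgue_on E) v (grad \<psi>)\<bar>"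
    by linarith
  also have "\<dots> \<le> V * \<eta> + \<theta> * (l2_norm (lebesgue_on E) u + \<eta>)"
  proof (rule add_mono)
    show "\<bar>l2_inner (lebesgue_on E) v (\<lambda>x. u x - grad \<psi> x)\<bar> \<le> V * \<eta>"
      using l2_Cauchy_Schwarz[OF v dL2] \<psi>(2) V mult_left_mono[of "l2_norm (lebesgue_on E) (\<lambda>x. u x - grad \<psi> x)" \<eta> V]
      by (simp add: V_def)
    have "l2_norm (lebesgue_on E) (\<lambda>x. u x - (u x - grad \<psi> x)) \<le> l2_norm (lebesgue_on E) u + l2_norm (lebesgue_on E) (\<lambda>x. u x - grad \<psi> x)"
      using u(1) dL2 by (rule l2_norm_triangle_diff)
    then have "l2_norm (lebesgue_on E) (grad \<psi>) \<le> l2_norm (lebesgue_on E) u + \<eta>"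
      using \<psi>(2) by simp
    then show "\<bar>l2_inner (lebesgue_on E) v (grad \<psi>)\<bar> \<le> \<theta> * (l2_norm (lebesgue_on E) u + \<eta>)"
      using \<theta>(2)[OF \<psi>(1)] \<theta>(1) by (meson mult_left_mono order_trans)
  qed
  also have "\<dots> = \<theta> * l2_norm (lebesgue_on E) u + \<eta> * (V + \<theta>)"
    by (simp add: algebra_simps)
  also have "\<dots> \<le> \<theta> * l2_norm (lebesgue_on E) u + e"
    using \<eta>(2) by simp
  finally show "\<bar>l2_inner (lebesgue_on E) v u\<bar> \<le> \<theta> * l2_norm (lebesgue_on E) u + e" .
qed

end

section \<open>Polynomial curl potentials\<close>

lemma compactly_supported_in_vec_nth:
  fixes \<psi> :: "real^3 \<Rightarrow> real^'n"
  assumes "compactly_supported_in E \<psi>"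
  shows "compactly_supported_in E (\<lambda>x. \<psi> x $ i)"
proof (rule compactly_supported_inI[where K = "closure {x. \<psi> x \<noteq> 0}"])
  fix x assume "x \<notin> closure {x. \<psi> x \<noteq> 0}"
  then have "\<psi> x = 0"
    using closure_subset[of "{x. \<psi> x \<noteq> 0}"] by blast
  then show "\<psi> x $ i = 0"
    by simp
qed (use assms in \<open>simp_all add: compactly_supported_in_def\<close>)

lemma compactly_supported_in_grad:
  assumes "compactly_supported_in E \<phi>"
  shows "compactly_supported_in E (grad \<phi>)"
proof (rule compactly_supported_inI[where K = "closure {x. \<phi> x \<noteq> 0}"])
  fix x assume x: "x \<notin> closure {x. \<phi> x \<noteq> 0}"
  have "compactly_supported_in (closure {x. \<phi> x \<noteq> 0}) \<phi>"
    using assms by (simp add: compactly_supported_in_def)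
  then have "partial i \<phi> x = 0" for i
    using compactly_supported_in_eq_0[OF compactly_supported_in_partial x] by blast
  then show "grad \<phi> x = 0"
    by (simp add: grad_def vec_eq_iff)
qed (use assms in \<open>simp_all add: compactly_supported_in_def\<close>)

lemma curl_grad_eq_0: "smooth \<phi> \<Longrightarrow> curl (grad \<phi>) x = 0"
  using partial_commute[of \<phi> _ _ x]
  by (simp add: curl_def grad_def vec_eq_iff forall_3)

lemma has_weak_curl_curl:
  assumes E: "bounded E" "E \<in> sets lebesgue" and q: "\<And>i. smooth (\<lambda>x. q x $ i)"
  shows "has_weak_curl E q (curl q)"
  unfolding has_weak_curl_def
proof (intro allI impI, elim conjE)
  fix \<psi> :: "real^3 \<Rightarrow> real^3"
  assume "\<forall>i. smooth (\<lambda>x. \<psi> x $ i)" and supp: "compactly_supported_in E \<psi>"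
  then have s: "smooth (\<lambda>x. \<psi> x $ i)" for i
    by simp
  have cs: "compactly_supported_in E (\<lambda>x. \<psi> x $ i)" for i
    using supp by (rule compactly_supported_in_vec_nth)
  have L: "smooth f \<Longrightarrow> f \<in> L2 (lebesgue_on E)" for f
    using E by (intro continuous_L2 smooth_continuous)
  have i1: "integrable (lebesgue_on E) (\<lambda>x. q x $ j * partial i (\<lambda>y. \<psi> y $ m) x)" for i j m
    using L2_integrable_inner[OF L[OF q[of j]] L[OF smooth_partial[OF s[of m]]], of i] by simp
  have i2: "integrable (lebesgue_on E) (\<lambda>x. partial i (\<lambda>y. q y $ j) x * \<psi> x $ m)" for i j m
    using L2_integrable_inner[OF L[OF smooth_partial[OF q[of j]]] L[OF s[of m]], of i] by simp
  have parts: "(LINT x|lebesgue_on E. q x $ j * partial i (\<lambda>y. \<psi> y $ m) x)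
      = - (LINT x|lebesgue_on E. partial i (\<lambda>y. q y $ j) x * \<psi> x $ m)" for i j m
    using E(2) q s cs by (rule integration_by_parts)
  have "l2_inner (lebesgue_on E) q (curl \<psi>) = (LINT x|lebesgue_on E.
      (q x $ 1 * partial 2 (\<lambda>y. \<psi> y $ 3) x - q x $ 1 * partial 3 (\<lambda>y. \<psi> y $ 2) x)
      + (q x $ 2 * partial 3 (\<lambda>y. \<psi> y $ 1) x - q x $ 2 * partial 1 (\<lambda>y. \<psi> y $ 3) x)
      + (q x $ 3 * partial 1 (\<lambda>y. \<psi> y $ 2) x - q x $ 3 * partial 2 (\<lambda>y. \<psi> y $ 1) x))"
    unfolding l2_inner_def
    by (rule Bochner_Integration.integral_cong[OF refl]) (simp add: curl_def inner_vec_def sum_3 algebra_simps)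
  also have "\<dots> = (LINT x|lebesgue_on E.
      (partial 2 (\<lambda>y. q y $ 3) x * \<psi> x $ 1 - partial 3 (\<lambda>y. q y $ 2) x * \<psi> x $ 1)
      + (partial 3 (\<lambda>y. q y $ 1) x * \<psi> x $ 2 - partial 1 (\<lambda>y. q y $ 3) x * \<psi> x $ 2)
      + (partial 1 (\<lambda>y. q y $ 2) x * \<psi> x $ 3 - partial 2 (\<lambda>y. q y $ 1) x * \<psi> x $ 3))"
    by (simp add: i1 i2 parts)
  also have "\<dots> = l2_inner (lebesgue_on E) (curl q) \<psi>"
    unfolding l2_inner_def
    by (rule Bochner_Integration.integral_cong[OF refl]) (simp add: curl_def inner_vec_def sum_3 algebra_simps)
  finally show "l2_inner (lebesgue_on E) q (curl \<psi>) = l2_inner (lebesgue_on E) (curl q) \<psi>" .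
qed

lemma polys_eq_0_if_l2_norm_0:
  assumes p: "p \<in> polys m" and R: "R > 0" and 0: "l2_norm (lebesgue_on (ball a R)) p = 0"
  shows "p = (\<lambda>_. 0)"
proof -
  obtain C where C: "C > 0"
    "\<And>p (a :: real^3) R x. p \<in> polys m \<Longrightarrow> R > 0 \<Longrightarrow> x \<in> cball a (1 * R) \<Longrightarrow>
      (p x)\<^sup>2 \<le> C / R ^ 3 * (l2_norm (lebesgue_on (ball a R)) p)\<^sup>2"
    using poly_sup_bound[of 1 m] by auto
  have "p x = 0" if "x \<in> ball a R" for x
    using C(2)[OF p R, of x a] that 0 by simp
  then show ?thesis
    by (rule polys_eq_0_if_zero_on_ball[OF p R])
qed

text \<open>The weak curl is tested with the gradient of D times a bump, whose curl vanishes.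
  Integration by parts turns this into orthogonality of the divergence D to D times the bump, so D
  is zero on a ball and, as a polynomial, everywhere.\<close>

lemma weak_curl_divergence_free:
  assumes E: "bounded E" "E \<in> sets lebesgue" and R: "R > 0" "cball a R \<subseteq> E"
    and c: "c \<in> vpolys m" "has_weak_curl E v c"
  shows "(\<Sum>i\<in>UNIV. partial i (\<lambda>y. c y $ i) x) = 0"
proof -
  define D where "D x = (\<Sum>i\<in>UNIV. partial i (\<lambda>y. c y $ i) x)" for x
  have ci: "(\<lambda>y. c y $ i) \<in> polys m" for i
    using c(1) by (rule vpolys_component)
  have D: "D \<in> polys m"
    unfolding D_def by (intro polys_sum polys_partial ci)
  define \<phi> where "\<phi> x = D x * bump a R x" for x
  have \<phi>: "smooth \<phi>" "compactly_supported_in E \<phi>"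
    unfolding \<phi>_def using smooth_polys[OF D] R
    by (auto intro!: smooth_mult compactly_supported_in_mult_left compactly_supported_bump)
  have L: "smooth f \<Longrightarrow> f \<in> L2 (lebesgue_on E)" for f
    using E by (intro continuous_L2 smooth_continuous)
  have sg: "\<forall>i. smooth (\<lambda>x. grad \<phi> x $ i)"
    using \<phi>(1) by (auto simp: grad_def)
  have "l2_inner (lebesgue_on E) c (grad \<phi>) = l2_inner (lebesgue_on E) v (curl (grad \<phi>))"
    using c(2) sg compactly_supported_in_grad[OF \<phi>(2)] unfolding has_weak_curl_def by simp
  also have "\<dots> = 0"
    by (simp add: curl_grad_eq_0[OF \<phi>(1)] l2_inner_def)
  finally have 0: "l2_inner (lebesgue_on E) c (grad \<phi>) = 0" .
  have i1: "integrable (lebesgue_on E) (\<lambda>x. c x $ i * partial i \<phi> x)" for i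
    using L2_integrable_inner[OF L[OF smooth_polys[OF ci[of i]]] L[OF smooth_partial[OF \<phi>(1)]], of i] by simp
  have i2: "integrable (lebesgue_on E) (\<lambda>x. partial i (\<lambda>y. c y $ i) x * \<phi> x)" for i
    using L2_integrable_inner[OF L[OF smooth_partial[OF smooth_polys[OF ci[of i]]]] L[OF \<phi>(1)], of i] by simp
  have "l2_inner (lebesgue_on E) c (grad \<phi>) = (\<Sum>i\<in>UNIV. LINT x|lebesgue_on E. c x $ i * partial i \<phi> x)"
    using i1 by (simp add: l2_inner_def inner_vec_def grad_def)
  also have "\<dots> = (\<Sum>i\<in>UNIV. - (LINT x|lebesgue_on E. partial i (\<lambda>y. c y $ i) x * \<phi> x))"
    by (intro sum.cong refl integration_by_parts E smooth_polys[OF ci] \<phi>)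
  also have "\<dots> = - (LINT x|lebesgue_on E. D x * \<phi> x)"
    using i2 by (simp add: D_def sum_distrib_right sum_negf)
  also have "\<dots> = - l2_inner (lebesgue_on E) D (\<lambda>x. bump a R x *\<^sub>R D x)"
    by (simp add: l2_inner_def \<phi>_def mult_ac)
  finally have "l2_inner (lebesgue_on E) D (\<lambda>x. bump a R x *\<^sub>R D x) = 0"
    using 0 by simp
  moreover have "ball a (R / 2) \<subseteq> E"
    using R by (intro order_trans[OF _ R(2)]) auto
  ultimately have "exp (-2) * (l2_norm (lebesgue_on (ball a (R / 2))) D)\<^sup>2 \<le> 0"
    using bump_inner_ge[OF E R(1) _ smooth_continuous[OF smooth_polys[OF D]], of a] by simp
  then have "l2_norm (lebesgue_on (ball a (R / 2))) D = 0"
    by (simp add: mult_le_0_iff)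
  then have "D = (\<lambda>_. 0)"
    using R(1) by (intro polys_eq_0_if_l2_norm_0[OF D, of "R / 2"]) simp_all
  then show ?thesis
    by (simp add: D_def fun_eq_iff)
qed

lemma radial_derivative:
  assumes "smooth f"
  shows "((\<lambda>t. t ^ Suc n * f (a + t *\<^sub>R b)) has_real_derivative
    t ^ n * (real (Suc n) * f (a + t *\<^sub>R b) + grad f (a + t *\<^sub>R b) \<bullet> (t *\<^sub>R b))) (at t)"
  by (rule derivative_eq_intros line_derivative[OF assms] refl)+ (simp add: algebra_simps)

text \<open>The Euler expression (n + 1) f + y . grad f is, up to the factor t^n, the derivative of
  t^(n+1) f along rays. The mean value theorem thus bounds f by the Euler expression with constant
  1.\<close>

lemma radial_bound:
  assumes f: "smooth f"
    and B: "\<And>t. 0 \<le> t \<Longrightarrow> t \<le> 1 \<Longrightarrow>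
      \<bar>real (Suc n) * f (a + t *\<^sub>R b) + grad f (a + t *\<^sub>R b) \<bullet> (t *\<^sub>R b)\<bar> \<le> B"
  shows "\<bar>f (a + b)\<bar> \<le> B"
proof -
  define g where "g t = t ^ Suc n * f (a + t *\<^sub>R b)" for t
  define g' where "g' t = t ^ n * (real (Suc n) * f (a + t *\<^sub>R b) + grad f (a + t *\<^sub>R b) \<bullet> (t *\<^sub>R b))" for t
  have "\<exists>z. z > 0 \<and> z < 1 \<and> g 1 - g 0 = (1 - 0) * g' z"
    using radial_derivative[OF f] by (intro MVT2) (auto simp: g_def g'_def)
  then obtain z where z: "0 < z" "z < 1" "g 1 = g' z"
    by (auto simp: g_def)
  have "z ^ n \<le> 1"
    using z by (intro power_le_one) auto
  then have "\<bar>g' z\<bar> \<le> 1 * B"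
    unfolding g'_def abs_mult using z B[of z] by (intro mult_mono) auto
  then show ?thesis
    using z(3) by (simp add: g_def)
qed

text \<open>
  Solves the Euler equation \<open>2 P + (x - a) \<bullet> grad P = p\<close>: a monomial of degree \<open>n\<close> in \<open>x - a\<close> is
  divided by \<open>n + 2\<close>.
\<close>

lemma polys_euler_preimage:
  assumes "p \<in> polys m"
  obtains P where "P \<in> polys m" "\<And>x. 2 * P x + grad P x \<bullet> (x - a) = p x"
proof -
  have "(\<lambda>x. p (a + x)) \<in> polys m"
    using polys_affine_compose[OF assms linear_id, of a] by simp
  then obtain c where c: "(\<lambda>x. p (a + x)) = (\<lambda>x. \<Sum>\<alpha> | (\<Sum>i\<in>UNIV. \<alpha> i) \<le> m. c \<alpha> * (\<Prod>i\<in>UNIV. (x $ i) ^ \<alpha> i))"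
    by (rule polys_expansion)
  define A where "A = {\<alpha> :: 3 \<Rightarrow> nat. (\<Sum>i\<in>UNIV. \<alpha> i) \<le> m}"
  define \<mu> where "\<mu> \<alpha> x = (\<Prod>i\<in>UNIV. (x $ i) ^ \<alpha> i)" for \<alpha> :: "3 \<Rightarrow> nat" and x :: "real^3"
  define w where "w \<alpha> = c \<alpha> / (real (\<Sum>i\<in>UNIV. \<alpha> i) + 2)" for \<alpha> :: "3 \<Rightarrow> nat"
  define Q where "Q x = (\<Sum>\<alpha>\<in>A. w \<alpha> * \<mu> \<alpha> x)" for x
  have \<mu>: "\<mu> \<alpha> \<in> polys m" if "\<alpha> \<in> A" for \<alpha>
    using that unfolding \<mu>_def[abs_def] A_def by (intro polys_monomial) simp
  have Q: "Q \<in> polys m"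
    unfolding Q_def using \<mu> by (intro polys_sum polys_cmult)
  have euler: "grad (\<mu> \<alpha>) x \<bullet> x = real (\<Sum>i\<in>UNIV. \<alpha> i) * \<mu> \<alpha> x" if "\<alpha> \<in> A" for \<alpha> x
  proof -
    have "\<mu> \<alpha> (0 + t *\<^sub>R x) = t ^ (\<Sum>i\<in>UNIV. \<alpha> i) * \<mu> \<alpha> x" for t
      by (simp add: \<mu>_def power_mult_distrib prod.distrib power_sum)
    then have "((\<lambda>t. t ^ (\<Sum>i\<in>UNIV. \<alpha> i) * \<mu> \<alpha> x) has_real_derivative grad (\<mu> \<alpha>) (0 + 1 *\<^sub>R x) \<bullet> x) (at 1)"
      using line_derivative[OF smooth_polys[OF \<mu>[OF that]], of 0 x 1] by simp
    moreover have "((\<lambda>t. t ^ (\<Sum>i\<in>UNIV. \<alpha> i) * \<mu> \<alpha> x) has_real_derivative real (\<Sum>i\<in>UNIV. \<alpha> i) * \<mu> \<alpha> x) (at 1)"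
      by (rule derivative_eq_intros refl)+ simp
    ultimately show ?thesis
      using DERIV_unique by fastforce
  qed
  have Qeq: "2 * Q x + grad Q x \<bullet> x = p (a + x)" for x
  proof -
    have "grad Q x \<bullet> x = (\<Sum>\<alpha>\<in>A. w \<alpha> * (grad (\<mu> \<alpha>) x \<bullet> x))"
    proof -
      have "(Q has_derivative (\<lambda>h. \<Sum>\<alpha>\<in>A. w \<alpha> * (grad (\<mu> \<alpha>) x \<bullet> h))) (at x)"
        unfolding Q_def[abs_def] using \<mu>
        by (intro has_derivative_sum has_derivative_mult_right smooth_has_derivative_grad smooth_polys)
      then have "(Q has_derivative (\<lambda>h. (\<Sum>\<alpha>\<in>A. w \<alpha> *\<^sub>R grad (\<mu> \<alpha>) x) \<bullet> h)) (at x)"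
        by (simp add: inner_sum_left)
      from grad_eq[OF this] show ?thesis
        by (simp add: inner_sum_left)
    qed
    also have "\<dots> = (\<Sum>\<alpha>\<in>A. real (\<Sum>i\<in>UNIV. \<alpha> i) * (w \<alpha> * \<mu> \<alpha> x))"
      by (intro sum.cong refl) (simp only: euler mult_ac)
    finally have "2 * Q x + grad Q x \<bullet> x = (\<Sum>\<alpha>\<in>A. (real (\<Sum>i\<in>UNIV. \<alpha> i) + 2) * (w \<alpha> * \<mu> \<alpha> x))"
      by (simp only: Q_def sum_distrib_left distrib_right sum.distrib add.commute)
    also have "\<dots> = (\<Sum>\<alpha>\<in>A. c \<alpha> * \<mu> \<alpha> x)"
    proof (intro sum.cong refl)
      fix \<alpha> :: "3 \<Rightarrow> nat"
      have "real (\<Sum>i\<in>UNIV. \<alpha> i) + 2 \<noteq> 0"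
        by linarith
      then show "(real (\<Sum>i\<in>UNIV. \<alpha> i) + 2) * (w \<alpha> * \<mu> \<alpha> x) = c \<alpha> * \<mu> \<alpha> x"
        by (simp add: w_def del: of_nat_sum)
    qed
    also have "\<dots> = p (a + x)"
      using fun_cong[OF c, of x] by (simp add: A_def \<mu>_def)
    finally show ?thesis .
  qed
  show thesis
  proof (rule that[of "\<lambda>x. Q ((- a) + 1 *\<^sub>R x)"])
    show "(\<lambda>x. Q ((- a) + 1 *\<^sub>R x)) \<in> polys m"
      using polys_affine_compose[OF Q linear_id, of "- a"] by simp
    fix x
    have "grad (\<lambda>x. Q ((- a) + 1 *\<^sub>R x)) x = grad Q (x - a)"
      by (simp only: grad_def partial_affine[OF smooth_polys[OF Q]]) simp
    then show "2 * Q ((- a) + 1 *\<^sub>R x) + grad (\<lambda>x. Q ((- a) + 1 *\<^sub>R x)) x \<bullet> (x - a) = p x"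
      using Qeq[of "x - a"] by simp
  qed
qed

lemma grad_inner_3: "grad f x \<bullet> y = partial 1 f x * y $ 1 + partial 2 f x * y $ 2 + partial 3 f x * y $ 3"
  by (simp add: inner_vec_def sum_3 grad_def)

text \<open>Writing y = x - a, vector calculus gives curl (P x y) = 2 P + (y . grad) P - y div P. So
  P is taken as the Euler preimage of c, and what has to be shown is that div P vanishes.\<close>

lemma vpolys_curl_potential:
  assumes c: "c \<in> vpolys m" and div: "\<And>x. (\<Sum>i\<in>UNIV. partial i (\<lambda>y. c y $ i) x) = 0"
  obtains q where "q \<in> vpolys (Suc m)" "curl q = c"
    "\<And>x h B. x \<in> cball a h \<Longrightarrow> \<forall>y\<in>cball a h. \<forall>i. \<bar>c y $ i\<bar> \<le> B \<Longrightarrow> (norm (q x))\<^sup>2 \<le> 12 * (h * B)\<^sup>2"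
proof -
  have "\<forall>i. \<exists>P. P \<in> polys m \<and> (\<forall>x. 2 * P x + grad P x \<bullet> (x - a) = c x $ i)"
  proof
    fix i
    obtain P where "P \<in> polys m" "\<And>x. 2 * P x + grad P x \<bullet> (x - a) = c x $ i"
      by (rule polys_euler_preimage[OF vpolys_component[OF c, of i], of a]) (rule that)
    then show "\<exists>P. P \<in> polys m \<and> (\<forall>x. 2 * P x + grad P x \<bullet> (x - a) = c x $ i)"
      by blast
  qed
  from choice[OF this] obtain P where
    "\<forall>i. P i \<in> polys m \<and> (\<forall>x. 2 * P i x + grad (P i) x \<bullet> (x - a) = c x $ i)" ..
  then have P: "P i \<in> polys m" and Pc: "2 * P i x + grad (P i) x \<bullet> (x - a) = c x $ i" for i x
    by simp_all
  have sP: "smooth (P i)" for i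
    using P by (rule smooth_polys)
  have diffP: "P i differentiable at x" for i x
    using sP by blast
  define D where "D x = (\<Sum>i\<in>UNIV. partial i (P i) x)" for x
  have sD: "smooth D"
    unfolding D_def by (intro smooth_sum smooth_partial sP)
  have y_diff: "(\<lambda>x. x $ j - a $ j) differentiable at x" and y_smooth: "smooth (\<lambda>x. x $ j - a $ j)"
    and y_partial: "partial i (\<lambda>x. x $ j - a $ j) x = (if i = j then 1 else 0)"
    for i j :: 3 and x :: "real^3"
  proof -
    show "smooth (\<lambda>x. x $ j - a $ j)"
      by (intro smooth_diff smooth_component smooth_const)
    then show "(\<lambda>x. x $ j - a $ j) differentiable at x"
      by blast
    show "partial i (\<lambda>x. x $ j - a $ j) x = (if i = j then 1 else 0)"
      using smooth_component smooth_const by (subst partial_diff) (auto simp: partial_component)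
  qed
  have partial_prod: "partial i (\<lambda>x. f x * (x $ j - a $ j)) x
      = f x * (if i = j then 1 else 0) + partial i f x * (x $ j - a $ j)" if "smooth f" for i j x f
    using that y_diff by (subst partial_mult) (auto simp: y_partial)
  \<comment> \<open>Divergence of the Euler equation: differentiating the factor x - a adds one more
    copy of D, hence 3 in place of 2, and the right side is div c = 0.\<close>
  have "3 * D x + grad D x \<bullet> (x - a) = 0" for x
  proof -
    have "partial i (\<lambda>y. c y $ i) x
        = 3 * partial i (P i) x + (\<Sum>j\<in>UNIV. partial j (partial i (P i)) x * (x $ j - a $ j))" for i
    proof -
      have "(\<lambda>y. c y $ i) = (\<lambda>x. 2 * P i x + (\<Sum>j\<in>UNIV. partial j (P i) x * (x $ j - a $ j)))"
        using Pc[of i] by (simp add: fun_eq_iff inner_vec_def grad_def)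
      then have "partial i (\<lambda>y. c y $ i) x
          = partial i (\<lambda>x. 2 * P i x) x + partial i (\<lambda>x. \<Sum>j\<in>UNIV. partial j (P i) x * (x $ j - a $ j)) x"
        using sP y_smooth by (simp only:) (rule partial_add; intro smooth_differentiable smooth_sum smooth_mult smooth_const smooth_partial)
      also have "partial i (\<lambda>x. 2 * P i x) x = 2 * partial i (P i) x"
        using partial_mult[of "\<lambda>_. 2" x "P i" i] diffP by simp
      also have "partial i (\<lambda>x. \<Sum>j\<in>UNIV. partial j (P i) x * (x $ j - a $ j)) x
          = (\<Sum>j\<in>UNIV. partial i (\<lambda>x. partial j (P i) x * (x $ j - a $ j)) x)"
        using sP y_smooth by (intro partial_sum smooth_differentiable smooth_mult smooth_partial)
      also have "\<dots> = (\<Sum>j\<in>UNIV. partial j (P i) x * (if i = j then 1 else 0)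
          + partial j (partial i (P i)) x * (x $ j - a $ j))"
        using sP by (simp add: partial_prod smooth_partial partial_commute[of _ i])
      also have "\<dots> = partial i (P i) x + (\<Sum>j\<in>UNIV. partial j (partial i (P i)) x * (x $ j - a $ j))"
        by (simp add: sum.distrib if_distrib[of "\<lambda>z. _ * z"] cong: if_cong)
      finally show ?thesis
        by simp
    qed
    then have "0 = (\<Sum>i\<in>UNIV. 3 * partial i (P i) x + (\<Sum>j\<in>UNIV. partial j (partial i (P i)) x * (x $ j - a $ j)))"
      using div[of x] by simp
    also have "\<dots> = 3 * D x + (\<Sum>j\<in>UNIV. \<Sum>i\<in>UNIV. partial j (partial i (P i)) x * (x $ j - a $ j))"
      unfolding sum.distrib D_def sum_distrib_left by (rule arg_cong, rule sum.swap)
    also have "(\<Sum>j\<in>UNIV. \<Sum>i\<in>UNIV. partial j (partial i (P i)) x * (x $ j - a $ j)) = grad D x \<bullet> (x - a)"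
    proof -
      have "partial j D x = (\<Sum>i\<in>UNIV. partial j (partial i (P i)) x)" for j
        unfolding D_def[abs_def] using sP by (intro partial_sum smooth_differentiable smooth_partial)
      then show ?thesis
        by (simp add: inner_vec_def grad_def sum_distrib_right)
    qed
    finally show ?thesis
      by simp
  qed
  from this[of "a + b" for b] have "3 * D (a + b) + grad D (a + b) \<bullet> b = 0" for b
    by simp
  \<comment> \<open>The homogeneous equation makes t^3 D constant along rays from a, with value 0 at
    t = 0; this is the radial bound with n = 2 and bound 0.\<close>
  from this[of "t *\<^sub>R b" for t b] have "\<bar>D (a + b)\<bar> \<le> 0" for b
    by (intro radial_bound[where n = 2, OF sD]) simp
  from this[of "x - a" for x] have D0: "D x = 0" for x
    by simp
  \<comment> \<open>The cross product of P with x - a, which raises the degree by one.\<close>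
  define q :: "real^3 \<Rightarrow> real^3" where "q x = vector
     [P 2 x * (x $ 3 - a $ 3) - P 3 x * (x $ 2 - a $ 2),
      P 3 x * (x $ 1 - a $ 1) - P 1 x * (x $ 3 - a $ 3),
      P 1 x * (x $ 2 - a $ 2) - P 2 x * (x $ 1 - a $ 1)]" for x
  have q3: "(\<lambda>x. q x $ 1) = (\<lambda>x. P 2 x * (x $ 3 - a $ 3) - P 3 x * (x $ 2 - a $ 2))"
    "(\<lambda>x. q x $ 2) = (\<lambda>x. P 3 x * (x $ 1 - a $ 1) - P 1 x * (x $ 3 - a $ 3))"
    "(\<lambda>x. q x $ 3) = (\<lambda>x. P 1 x * (x $ 2 - a $ 2) - P 2 x * (x $ 1 - a $ 1))"
    by (simp_all add: q_def)
  have pd: "partial i (\<lambda>x. P j x * (x $ m - a $ m) - P l x * (x $ n - a $ n)) x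
      = P j x * (if i = m then 1 else 0) + partial i (P j) x * (x $ m - a $ m)
        - (P l x * (if i = n then 1 else 0) + partial i (P l) x * (x $ n - a $ n))" for i j m l n x
    using sP y_smooth by (subst partial_diff) (simp_all add: partial_prod smooth_differentiable smooth_mult)
  show thesis
  proof (rule that)
    have "(\<lambda>x. P i x * (x $ j - a $ j)) \<in> polys (Suc m)" for i j
      using polys_mult[OF P[of i] polys_diff[OF polys_component[of j] polys_const[of "a $ j"]]] by simp
    then show "q \<in> vpolys (Suc m)"
      unfolding vpolys_def by (simp add: forall_3 q3 polys_diff)
    have D3: "partial 1 (P 1) x + partial 2 (P 2) x + partial 3 (P 3) x = 0" for x
      using D0[of x] by (simp add: D_def sum_3)
    show "curl q = c"
    proof
      fix x
      have "curl q x $ 1 = c x $ 1 - (x $ 1 - a $ 1) * (partial 1 (P 1) x + partial 2 (P 2) x + partial 3 (P 3) x)"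
        unfolding curl_def vector_3 q3 pd Pc[symmetric] grad_inner_3 by (simp add: algebra_simps)
      moreover have "curl q x $ 2 = c x $ 2 - (x $ 2 - a $ 2) * (partial 1 (P 1) x + partial 2 (P 2) x + partial 3 (P 3) x)"
        unfolding curl_def vector_3 q3 pd Pc[symmetric] grad_inner_3 by (simp add: algebra_simps)
      moreover have "curl q x $ 3 = c x $ 3 - (x $ 3 - a $ 3) * (partial 1 (P 1) x + partial 2 (P 2) x + partial 3 (P 3) x)"
        unfolding curl_def vector_3 q3 pd Pc[symmetric] grad_inner_3 by (simp add: algebra_simps)
      ultimately show "curl q x = c x"
        by (simp add: D3 vec_eq_iff forall_3)
    qed
    fix x h B
    assume x: "x \<in> cball a h" and "\<forall>y\<in>cball a h. \<forall>i. \<bar>c y $ i\<bar> \<le> B"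
    then have B: "\<bar>c y $ i\<bar> \<le> B" if "y \<in> cball a h" for y i
      using that by blast
    \<comment> \<open>Along the ray, t^2 P has derivative t c, so the size of P is controlled by
      that of c on the same ball without any dependence on the degree.\<close>
    have PB: "\<bar>P i x\<bar> \<le> B" for i
    proof -
      have "\<bar>P i (a + (x - a))\<bar> \<le> B"
      proof (rule radial_bound[where n = 1, OF sP])
        fix t :: real assume t: "0 \<le> t" "t \<le> 1"
        have "t * norm (x - a) \<le> 1 * norm (x - a)"
          using t by (intro mult_right_mono) auto
        then have "a + t *\<^sub>R (x - a) \<in> cball a h"
          using x t by (simp add: dist_norm norm_minus_commute)
        then show "\<bar>real (Suc 1) * P i (a + t *\<^sub>R (x - a)) + grad (P i) (a + t *\<^sub>R (x - a)) \<bullet> (t *\<^sub>R (x - a))\<bar> \<le> B"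
          using B[of "a + t *\<^sub>R (x - a)" i] Pc[of i "a + t *\<^sub>R (x - a)"] by simp
      qed
      then show ?thesis
        by simp
    qed
    have yh: "\<bar>x $ j - a $ j\<bar> \<le> h" for j
      using component_le_norm_cart[of "x - a" j] x by (simp add: dist_norm norm_minus_commute)
    have "(p * y - p' * y')\<^sup>2 \<le> 4 * (h * B)\<^sup>2"
      if "\<bar>p\<bar> \<le> B" "\<bar>p'\<bar> \<le> B" "\<bar>y\<bar> \<le> h" "\<bar>y'\<bar> \<le> h" for p p' y y' :: real
    proof -
      have "\<bar>p * y\<bar> \<le> B * h" "\<bar>p' * y'\<bar> \<le> B * h"
        unfolding abs_mult using that by (auto intro!: mult_mono)
      then have "\<bar>p * y - p' * y'\<bar> \<le> 2 * (h * B)"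
        by (simp add: abs_if mult.commute split: if_splits)
      then have "\<bar>p * y - p' * y'\<bar>\<^sup>2 \<le> (2 * (h * B))\<^sup>2"
        by (intro power_mono) auto
      then show ?thesis
        by (simp add: power_mult_distrib)
    qed
    note bound = this[OF PB PB yh yh]
    have "(norm (q x))\<^sup>2 = (q x $ 1)\<^sup>2 + (q x $ 2)\<^sup>2 + (q x $ 3)\<^sup>2"
      unfolding norm_vec_power2 sum_3 ..
    also have "\<dots> \<le> 4 * (h * B)\<^sup>2 + 4 * (h * B)\<^sup>2 + 4 * (h * B)\<^sup>2"
      unfolding q_def vector_3 by (intro add_mono bound)
    finally show "(norm (q x))\<^sup>2 \<le> 12 * (h * B)\<^sup>2"
      by simp
  qed
qed

section \<open>Projection onto polynomial fields\<close>

lemma vpolys_eq_0_if_l2_norm_0: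
  assumes q: "q \<in> vpolys m" and E: "bounded E" "E \<in> sets lebesgue" "R > 0" "ball a R \<subseteq> E"
    and 0: "l2_norm (lebesgue_on E) q = 0"
  shows "q = (\<lambda>_. 0)"
proof -
  have qL2: "q \<in> L2 (lebesgue_on E)" and qL2': "q \<in> L2 (lebesgue_on (ball a R))"
    using E by (auto intro!: continuous_L2 vpolys_continuous[OF q])
  have "(\<lambda>x. q x $ i) = (\<lambda>_. 0)" for i
  proof (rule polys_eq_0_if_l2_norm_0[OF vpolys_component[OF q, of i] E(3), of a])
    have "l2_norm (lebesgue_on (ball a R)) (\<lambda>x. q x $ i) \<le> l2_norm (lebesgue_on (ball a R)) q"
      by (rule l2_norm_component_le[OF qL2'])
    also have "\<dots> \<le> l2_norm (lebesgue_on E) q"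
      using E by (intro l2_norm_subset[OF qL2]) auto
    finally show "l2_norm (lebesgue_on (ball a R)) (\<lambda>x. q x $ i) = 0"
      using 0 l2_norm_nonneg[of "lebesgue_on (ball a R)" "\<lambda>x. q x $ i"] by linarith
  qed
  then show ?thesis
    by (simp add: fun_eq_iff vec_eq_iff)
qed

lemma vpolys_diff: "p \<in> vpolys m \<Longrightarrow> q \<in> vpolys m \<Longrightarrow> (\<lambda>x. p x - q x) \<in> vpolys m"
  by (auto simp: vpolys_def)

text \<open>Existence comes from the finite spanning family of monomial fields. Uniqueness, which
  the description by \<open>THE\<close> demands, holds because a polynomial field with norm 0 over
  \<open>E\<close> vanishes on a ball and hence everywhere.\<close>

lemma l2_proj_orthogonal:
  assumes E: "bounded E" "E \<in> sets lebesgue" "R > 0" "ball a R \<subseteq> E" and v: "v \<in> L2 (lebesgue_on E)"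
  shows "l2_proj m E v \<in> vpolys m"
    "\<And>q. q \<in> vpolys m \<Longrightarrow> l2_inner (lebesgue_on E) (\<lambda>x. v x - l2_proj m E v x) q = 0"
proof -
  define I where "I = {\<alpha> :: 3 \<Rightarrow> nat. (\<Sum>i\<in>UNIV. \<alpha> i) \<le> m} \<times> (UNIV :: 3 set)"
  define b where "b j x = (\<Prod>i\<in>UNIV. (x $ i) ^ fst j i) *\<^sub>R axis (snd j) (1 :: real)" for j :: "(3 \<Rightarrow> nat) \<times> 3" and x :: "real^3"
  have I: "finite I"
    unfolding I_def using finite_multi_indices by (intro finite_cartesian_product) auto
  have L: "q \<in> L2 (lebesgue_on E)" if "q \<in> vpolys m" for q
    using E by (intro continuous_L2 vpolys_continuous[OF that])
  have comb: "(\<lambda>x. \<Sum>j\<in>I. w j *\<^sub>R b j x) \<in> vpolys m" for w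
    unfolding vpolys_def b_def sum_component vector_scaleR_component
    by (auto simp: I_def axis_def split: prod.splits intro!: polys_sum polys_cmult polys_monomial)
  have b: "b j \<in> vpolys m" if "j \<in> I" for j
    using that unfolding vpolys_def b_def[abs_def]
    by (auto simp: I_def axis_def intro: polys_monomial)
  have span: "\<exists>w. q = (\<lambda>x. \<Sum>j\<in>I. w j *\<^sub>R b j x)" if q: "q \<in> vpolys m" for q
  proof -
    have "\<forall>i. \<exists>w. \<forall>x. q x $ i = (\<Sum>\<alpha> | (\<Sum>i\<in>UNIV. \<alpha> i) \<le> m. w \<alpha> * (\<Prod>i\<in>UNIV. (x $ i) ^ \<alpha> i))"
      using vpolys_component[OF q] unfolding polys_def by blast
    from choice[OF this] obtain w where
      w: "\<forall>i x. q x $ i = (\<Sum>\<alpha> | (\<Sum>i\<in>UNIV. \<alpha> i) \<le> m. w i \<alpha> * (\<Prod>i\<in>UNIV. (x $ i) ^ \<alpha> i))" ..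
    have "q x = (\<Sum>j\<in>I. w (snd j) (fst j) *\<^sub>R b j x)" for x
    proof -
      have "(\<Sum>j\<in>I. w (snd j) (fst j) *\<^sub>R b j x) $ i = q x $ i" for i
      proof -
        have "(\<Sum>j\<in>I. w (snd j) (fst j) *\<^sub>R b j x) $ i
            = (\<Sum>\<alpha> | (\<Sum>i\<in>UNIV. \<alpha> i) \<le> m. \<Sum>l\<in>UNIV. (w l \<alpha> * (\<Prod>i\<in>UNIV. (x $ i) ^ \<alpha> i)) * (if i = l then 1 else 0))"
          unfolding I_def sum.cartesian_product
          by (simp add: b_def axis_def mult.assoc case_prod_beta)
        also have "\<dots> = q x $ i"
          by (simp add: w if_distrib[of "\<lambda>z. _ * z"] cong: if_cong)
        finally show ?thesis .
      qed
      then show ?thesis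
        by (simp add: vec_eq_iff)
    qed
    then show ?thesis
      by (intro exI[of _ "\<lambda>j. w (snd j) (fst j)"] ext)
  qed
  define P where "P q \<longleftrightarrow> q \<in> vpolys m \<and> (\<forall>p\<in>vpolys m. l2_inner (lebesgue_on E) (\<lambda>x. v x - q x) p = 0)" for q
  obtain w where w: "\<forall>i\<in>I. l2_inner (lebesgue_on E) (\<lambda>x. v x - (\<Sum>j\<in>I. w j *\<^sub>R b j x)) (b i) = 0"
    using l2_projection_exists[where b = b, OF I L[OF b] v] by blast
  define q0 where "q0 x = (\<Sum>j\<in>I. w j *\<^sub>R b j x)" for x
  have q0: "q0 \<in> vpolys m"
    unfolding q0_def by (rule comb)
  have "l2_inner (lebesgue_on E) (\<lambda>x. v x - q0 x) p = 0" if "p \<in> vpolys m" for p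
  proof -
    obtain s where s: "p = (\<lambda>x. \<Sum>j\<in>I. s j *\<^sub>R b j x)"
      using span[OF \<open>p \<in> vpolys m\<close>] ..
    have "l2_inner (lebesgue_on E) (\<lambda>x. v x - q0 x) p
        = (\<Sum>j\<in>I. l2_inner (lebesgue_on E) (\<lambda>x. v x - q0 x) (\<lambda>x. s j *\<^sub>R b j x))"
      unfolding s using L[OF q0] v L[OF b] by (intro l2_inner_sum_right L2_diff L2_scaleR)
    also have "\<dots> = 0"
      using w by (simp add: l2_inner_scaleR_right q0_def)
    finally show ?thesis .
  qed
  with q0 have P0: "P q0"
    by (simp add: P_def)
  have "q = q0" if "P q" for q
  proof -
    have d: "(\<lambda>x. q x - q0 x) \<in> vpolys m"
      using that q0 by (intro vpolys_diff) (auto simp: P_def)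
    have qL: "q \<in> L2 (lebesgue_on E)"
      using that by (intro L) (simp add: P_def)
    have "(l2_norm (lebesgue_on E) (\<lambda>x. q x - q0 x))\<^sup>2
        = l2_inner (lebesgue_on E) (\<lambda>x. (v x - q0 x) - (v x - q x)) (\<lambda>x. q x - q0 x)"
      unfolding l2_norm_power2 by simp
    also have "\<dots> = 0"
      using that P0 d by (subst l2_inner_diff_left) (auto simp: P_def intro!: L2_diff v qL L[OF q0])
    finally have "(\<lambda>x. q x - q0 x) = (\<lambda>_. 0)"
      by (intro vpolys_eq_0_if_l2_norm_0[OF d E]) simp
    then show ?thesis
      by (simp add: fun_eq_iff)
  qed
  then have "l2_proj m E v = q0"
    unfolding l2_proj_def P_def[symmetric] using P0 by (intro the_equality)
  then show "l2_proj m E v \<in> vpolys m"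
    "\<And>q. q \<in> vpolys m \<Longrightarrow> l2_inner (lebesgue_on E) (\<lambda>x. v x - l2_proj m E v x) q = 0"
    using P0 by (auto simp: P_def)
qed

section \<open>The stabilization\<close>

text \<open>Also yields \<rho> \<le> 1: a ball of radius \<rho> h inside a set of diameter h forces
  2 \<rho> h \<le> h.\<close>

lemma mesh_regular_imp_mesh_element:
  assumes \<rho>: "\<rho> > 0" and E: "polyhedral_domain E Fs edges" "mesh_regular \<rho> E Fs edges"
  obtains c where "mesh_element E Fs edges c (\<rho> * diameter E) \<rho> (diameter E)"
proof -
  define h where "h = diameter E"
  have bE: "bounded E" "E \<noteq> {}" "open E"
    using E(1) by (auto simp: polyhedral_domain_def)
  have diam: "2 * s \<le> h" if "ball x s \<subseteq> E" "s > 0" for x s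
    using diameter_subset[OF that(1) bE(1)] that(2) by (simp add: h_def diameter_ball)
  obtain x s where "s > 0" "ball x s \<subseteq> E"
    using bE(2,3) by (meson all_not_in_conv open_contains_ball)
  then have h: "h > 0"
    using diam by force
  obtain c s where c: "s \<ge> \<rho> * h" "star_shaped_wrt E (ball c s)"
    using E(2) unfolding mesh_regular_def h_def by blast
  have "\<rho> * h > 0"
    using \<rho> h by simp
  then have "2 * s \<le> h"
    using c by (intro diam[of c]) (auto simp: star_shaped_wrt_def)
  then have "\<rho> * h \<le> 1 * h"
    using c(1) h by linarith
  then have \<rho>1: "\<rho> \<le> 1"
    using h by (simp only: mult_le_cancel_right_pos)
  have "ball c (\<rho> * h) \<subseteq> ball c s"
    using c(1) by (intro subset_ball)
  then have star: "star_shaped_wrt E (ball c (\<rho> * h))"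
    using c(2) unfolding star_shaped_wrt_def by blast
  have disk: "\<exists>x\<in>affine hull F. ball x (\<rho>\<^sup>2 * h) \<inter> affine hull F \<subseteq> F" if F: "F \<in> Fs" for F
  proof -
    have poly: "polygon_with_edges F (edges F)"
      using E(1) F by (auto simp: polyhedral_domain_def)
    obtain x s where x: "x \<in> affine hull F" "s \<ge> \<rho> * diameter F" "star_shaped_wrt F (ball x s \<inter> affine hull F)"
      using E(2) F unfolding mesh_regular_def by blast
    \<comment> \<open>The comparison of face and element diameters is stated edge by edge, so an
      edge must exist. A compact set of dimension 2 is not affine, hence its relative frontier, the
      union of the edges, is nonempty.\<close>
    have "\<not> affine F"
    proof
      assume "affine F"
      then have "F = {} \<or> (\<exists>a. F = {a})"
        using poly affine_bounded_eq_trivial[of F] by (auto simp: polygon_with_edges_def compact_imp_bounded)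
      then show False
        using poly by (auto simp: polygon_with_edges_def)
    qed
    then have "\<Union> (edges F) \<noteq> {}"
      using poly rel_frontier_eq_empty[of F] by (auto simp: polygon_with_edges_def)
    then obtain e where "e \<in> edges F"
      by blast
    then have "\<rho>\<^sup>2 * h \<le> s"
      using E(2) F x(2) unfolding mesh_regular_def h_def by fastforce
    then have "ball x (\<rho>\<^sup>2 * h) \<subseteq> ball x s"
      by (intro subset_ball)
    then show ?thesis
      using x unfolding star_shaped_wrt_def by blast
  qed
  have "star_polyhedron E Fs edges c (\<rho> * h)"
    using E(1) star \<open>\<rho> * h > 0\<close> by unfold_locales
  then have "mesh_element E Fs edges c (\<rho> * h) \<rho> h"
    using \<rho> \<rho>1 disk by (intro mesh_element.intro mesh_element_axioms.intro) (auto simp: h_def)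
  then show thesis
    unfolding h_def by (rule that)
qed

section \<open>Scaled estimates on a single element\<close>

context mesh_element
begin

lemma measure_E_le: "measure (lebesgue_on E) (space (lebesgue_on E)) \<le> unit_ball_vol 3 * h ^ 3"
proof -
  have "measure (lebesgue_on E) (space (lebesgue_on E)) = measure lebesgue E"
    using E_lebesgue by (simp add: measure_restrict_space)
  also have "\<dots> \<le> measure lebesgue (cball c h)"
    using E_subset_cball E_lebesgue by (intro measure_mono_fmeasurable) auto
  also have "\<dots> = unit_ball_vol 3 * h ^ 3"
    using h_pos by (simp add: content_cball)
  finally show ?thesis .
qed

lemma l2_norm_continuous_le:
  fixes f :: "real^3 \<Rightarrow> 'b::euclidean_space"
  assumes f: "continuous_on UNIV f" and B: "\<And>x. x \<in> cball c h \<Longrightarrow> (norm (f x))\<^sup>2 \<le> B"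
  shows "(l2_norm (lebesgue_on E) f)\<^sup>2 \<le> B * (unit_ball_vol 3 * h ^ 3)"
proof -
  have B0: "B \<ge> 0"
    using h_pos by (intro order_trans[OF zero_le_power2 B[of c]]) simp
  have "norm (f x) \<le> sqrt B" if "x \<in> E" for x
    using B[of x] E_subset_cball that by (intro real_le_rsqrt) auto
  then have "(l2_norm (lebesgue_on E) f)\<^sup>2 \<le> (sqrt B)\<^sup>2 * measure (lebesgue_on E) (space (lebesgue_on E))"
    using finite_measure_lebesgue_on_bounded[OF E_bounded E_lebesgue] f
    by (intro l2_norm_bounded continuous_lebesgue_on_measurable) auto
  also have "\<dots> \<le> B * (unit_ball_vol 3 * h ^ 3)"
    using B0 measure_E_le by (simp add: mult_left_mono)
  finally show ?thesis .
qed

context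
  fixes m :: nat and C :: real
  assumes C: "C > 0" "\<And>p (a :: real^3) R x. p \<in> polys m \<Longrightarrow> R > 0 \<Longrightarrow> x \<in> cball a (4 / \<rho> * R) \<Longrightarrow>
      (p x)\<^sup>2 \<le> C / R ^ 3 * (l2_norm (lebesgue_on (ball a R)) p)\<^sup>2"
begin

text \<open>The inverse estimates place a bump of radius r / 2 at the center and control norms on
  half of that radius. The ball of radius r / 4 enlarged by 4 / \<rho> has radius h and covers
  \<open>E\<close>; the factor 64 is 4^3.\<close>

lemma poly_sup_le:
  assumes "p \<in> polys m" "x \<in> cball c h"
  shows "(p x)\<^sup>2 \<le> 64 * C / r ^ 3 * (l2_norm (lebesgue_on (ball c (r / 4))) p)\<^sup>2"
proof -
  have "4 / \<rho> * (r / 4) = h"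
    using rho_pos by (simp add: r_eq)
  then show ?thesis
    using C(2)[OF assms(1), of "r / 4" x c] assms(2) r_pos by (simp add: power_divide mult_ac)
qed

lemma h_eq_r: "h = r / \<rho>"
  using rho_pos by (simp add: r_eq)

text \<open>The inverse estimate controls the divergence near the center only; equivalence of
  polynomial norms on comparable balls carries it to all of \<open>E\<close>.\<close>

lemma scaled_div_bound:
  assumes K: "\<And>E v d a R. bounded E \<Longrightarrow> E \<in> sets lebesgue \<Longrightarrow> R > 0 \<Longrightarrow> cball a R \<subseteq> E \<Longrightarrow> v \<in> L2 (lebesgue_on E) \<Longrightarrow>
      d \<in> polys m \<Longrightarrow> has_weak_div E v d \<Longrightarrow>
      (R * l2_norm (lebesgue_on (ball a (R / 2))) d)\<^sup>2 \<le> K * (l2_norm (lebesgue_on E) v)\<^sup>2"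
    and v: "v \<in> L2 (lebesgue_on E)" and d: "d \<in> polys m" "has_weak_div E v d"
  shows "h\<^sup>2 * (l2_norm (lebesgue_on E) d)\<^sup>2 \<le> 256 * C * unit_ball_vol 3 / \<rho> ^ 5 * K * (l2_norm (lebesgue_on E) v)\<^sup>2"
proof -
  define N where "N = l2_norm (lebesgue_on (ball c (r / 4))) d"
  have ball: "cball c (r / 2) \<subseteq> E"
    using center_ball_subset r_pos by (auto simp: subset_iff)
  have N: "(r / 2 * N)\<^sup>2 \<le> K * (l2_norm (lebesgue_on E) v)\<^sup>2"
    using K[OF E_bounded E_lebesgue _ ball v d] r_pos by (simp add: N_def)
  have "(l2_norm (lebesgue_on E) d)\<^sup>2 \<le> (64 * C / r ^ 3 * N\<^sup>2) * (unit_ball_vol 3 * h ^ 3)"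
    using poly_sup_le[OF d(1)] smooth_continuous[OF smooth_polys[OF d(1)]]
    by (intro l2_norm_continuous_le) (simp_all add: N_def)
  then have "h\<^sup>2 * (l2_norm (lebesgue_on E) d)\<^sup>2 \<le> h\<^sup>2 * ((64 * C / r ^ 3 * N\<^sup>2) * (unit_ball_vol 3 * h ^ 3))"
    by (intro mult_left_mono) auto
  \<comment> \<open>64 from the quarter radius and 4 from writing the inverse estimate with r / 2;
    the powers of h against those of r leave \<rho>^5 in the denominator.\<close>
  also have "\<dots> = 256 * C * unit_ball_vol 3 / \<rho> ^ 5 * (r / 2 * N)\<^sup>2"
    unfolding h_eq_r using r_pos rho_pos by (simp add: field_simps eval_nat_numeral)
  also have "\<dots> \<le> 256 * C * unit_ball_vol 3 / \<rho> ^ 5 * (K * (l2_norm (lebesgue_on E) v)\<^sup>2)"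
    using C(1) rho_pos unit_ball_vol_pos[of 3] by (intro mult_left_mono N) auto
  finally show ?thesis
    by (simp only: mult.assoc)
qed

text \<open>The potential bound asks for the curl on the whole ball of radius h about c, possibly
  outside \<open>E\<close>. There the polynomial extension is still controlled by its norm near the
  center.\<close>

lemma curl_potential_bound:
  assumes K: "\<And>E v d a R. bounded E \<Longrightarrow> E \<in> sets lebesgue \<Longrightarrow> R > 0 \<Longrightarrow> cball a R \<subseteq> E \<Longrightarrow> v \<in> L2 (lebesgue_on E) \<Longrightarrow>
      d \<in> vpolys m \<Longrightarrow> has_weak_curl E v d \<Longrightarrow>
      (R * l2_norm (lebesgue_on (ball a (R / 2))) d)\<^sup>2 \<le> K * (l2_norm (lebesgue_on E) v)\<^sup>2"
    and v: "v \<in> L2 (lebesgue_on E)" and d: "d \<in> vpolys m" "has_weak_curl E v d"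
  shows "\<exists>q\<in>vpolys (Suc m). has_weak_curl E q d \<and>
    (l2_norm (lebesgue_on E) q)\<^sup>2 \<le> 3072 * C * unit_ball_vol 3 / \<rho> ^ 5 * K * (l2_norm (lebesgue_on E) v)\<^sup>2"
proof -
  define N where "N = l2_norm (lebesgue_on (ball c (r / 4))) d"
  have ball: "cball c (r / 2) \<subseteq> E"
    using center_ball_subset r_pos by (auto simp: subset_iff)
  have N: "(r / 2 * N)\<^sup>2 \<le> K * (l2_norm (lebesgue_on E) v)\<^sup>2"
    using K[OF E_bounded E_lebesgue _ ball v d] r_pos by (simp add: N_def)
  have "(\<Sum>i\<in>UNIV. partial i (\<lambda>y. d y $ i) x) = 0" for x
    using r_pos by (intro weak_curl_divergence_free[OF E_bounded E_lebesgue _ ball d]) simp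
  then obtain q where q: "q \<in> vpolys (Suc m)" "curl q = d"
    "\<And>x h B. x \<in> cball c h \<Longrightarrow> \<forall>y\<in>cball c h. \<forall>i. \<bar>d y $ i\<bar> \<le> B \<Longrightarrow> (norm (q x))\<^sup>2 \<le> 12 * (h * B)\<^sup>2"
    by (rule vpolys_curl_potential[OF d(1), of c]) (rule that)
  define B where "B = sqrt (64 * C / r ^ 3 * N\<^sup>2)"
  have B2: "B\<^sup>2 = 64 * C / r ^ 3 * N\<^sup>2"
    using C(1) r_pos by (simp add: B_def)
  have "\<bar>d y $ i\<bar> \<le> B" if "y \<in> cball c h" for y i
    unfolding B_def
  proof (rule real_le_rsqrt)
    have "\<bar>d y $ i\<bar>\<^sup>2 \<le> 64 * C / r ^ 3 * (l2_norm (lebesgue_on (ball c (r / 4))) (\<lambda>y. d y $ i))\<^sup>2"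
      using poly_sup_le[OF vpolys_component[OF d(1)] that, of i] by simp
    also have "\<dots> \<le> 64 * C / r ^ 3 * N\<^sup>2"
      unfolding N_def using C(1) r_pos
      by (intro mult_left_mono power_mono l2_norm_component_le continuous_L2 vpolys_continuous[OF d(1)] l2_norm_nonneg) auto
    finally show "\<bar>d y $ i\<bar>\<^sup>2 \<le> 64 * C / r ^ 3 * N\<^sup>2" .
  qed
  then have "(norm (q x))\<^sup>2 \<le> 12 * (h * B)\<^sup>2" if "x \<in> cball c h" for x
    by (intro q(3)[OF that]) blast
  then have "(l2_norm (lebesgue_on E) q)\<^sup>2 \<le> (12 * (h * B)\<^sup>2) * (unit_ball_vol 3 * h ^ 3)"
    by (intro l2_norm_continuous_le vpolys_continuous[OF q(1)])
  \<comment> \<open>12 from the potential, 64 from the quarter radius, 4 from the radius r / 2 in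
    the inverse estimate.\<close>
  also have "\<dots> = 3072 * C * unit_ball_vol 3 / \<rho> ^ 5 * (r / 2 * N)\<^sup>2"
    unfolding power_mult_distrib B2 h_eq_r using r_pos rho_pos by (simp add: field_simps eval_nat_numeral)
  also have "\<dots> \<le> 3072 * C * unit_ball_vol 3 / \<rho> ^ 5 * (K * (l2_norm (lebesgue_on E) v)\<^sup>2)"
    using C(1) rho_pos unit_ball_vol_pos[of 3] by (intro mult_left_mono N) auto
  finally have "(l2_norm (lebesgue_on E) q)\<^sup>2 \<le> 3072 * C * unit_ball_vol 3 / \<rho> ^ 5 * K * (l2_norm (lebesgue_on E) v)\<^sup>2"
    by (simp only: mult.assoc)
  moreover have "has_weak_curl E q d"
    using has_weak_curl_curl[OF E_bounded E_lebesgue smooth_polys[OF vpolys_component[OF q(1)]]] q(2) by simp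
  ultimately show ?thesis
    using q(1) by blast
qed

end

lemma l2_proj_E:
  assumes v: "v \<in> L2 (lebesgue_on E)"
  shows "l2_proj m E v \<in> vpolys m" "l2_proj m E v \<in> L2 (lebesgue_on E)"
    "\<And>q. q \<in> vpolys m \<Longrightarrow> l2_inner (lebesgue_on E) v q = l2_inner (lebesgue_on E) (l2_proj m E v) q"
    "l2_norm (lebesgue_on E) (l2_proj m E v) \<le> l2_norm (lebesgue_on E) v"
proof -
  show P: "l2_proj m E v \<in> vpolys m"
    by (rule l2_proj_orthogonal(1)[OF E_bounded E_lebesgue r_pos center_ball_subset v])
  have L: "q \<in> L2 (lebesgue_on E)" if "q \<in> vpolys m" for q
    by (intro continuous_L2 E_bounded E_lebesgue vpolys_continuous[OF that])
  show PL: "l2_proj m E v \<in> L2 (lebesgue_on E)"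
    using P by (rule L)
  show eq: "l2_inner (lebesgue_on E) v q = l2_inner (lebesgue_on E) (l2_proj m E v) q" if "q \<in> vpolys m" for q
    using l2_proj_orthogonal(2)[OF E_bounded E_lebesgue r_pos center_ball_subset v that]
      l2_inner_diff_left[OF v PL L[OF that]] by simp
  define p where "p = l2_norm (lebesgue_on E) (l2_proj m E v)"
  have "p * p = l2_inner (lebesgue_on E) v (l2_proj m E v)"
    using eq[OF P] by (simp add: p_def l2_norm_power2 flip: power2_eq_square)
  also have "\<dots> \<le> l2_norm (lebesgue_on E) v * p"
    unfolding p_def using l2_Cauchy_Schwarz[OF v PL] by linarith
  finally show "l2_norm (lebesgue_on E) (l2_proj m E v) \<le> l2_norm (lebesgue_on E) v"
    using l2_norm_nonneg[of "lebesgue_on E" v] l2_norm_nonneg[of "lebesgue_on E" "l2_proj m E v"]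
    by (cases "p = 0") (auto simp: p_def)
qed

text \<open>Integrals do not see null sets, so the arbitrary choices inside \<open>S_f\<close> give
  way to any admissible divergence and trace, in particular to the polynomial ones.\<close>

lemma S_f_eq:
  assumes d: "d \<in> L2 (lebesgue_on E)" "has_weak_div E v d" and g: "has_normal_trace E Fs v g"
  shows "S_f k E Fs v v = h * (\<Sum>F\<in>Fs. (l2_norm (area_on F) (g F))\<^sup>2)
    + h\<^sup>2 * (l2_norm (lebesgue_on E) d)\<^sup>2 + (l2_norm (lebesgue_on E) (l2_proj (k + 1) E v))\<^sup>2"
proof -
  note wd = weak_div_AE_eq[OF E_open E_bounded d]
  have "l2_inner (lebesgue_on E) (weak_div E v) (weak_div E v) = l2_inner (lebesgue_on E) d d"
    by (intro l2_inner_AE_cong L2_measurable wd d(1))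
  moreover have "l2_inner (area_on F) (normal_trace E Fs v F) (normal_trace E Fs v F) = l2_inner (area_on F) (g F) (g F)"
    if "F \<in> Fs" for F
  proof -
    have "g F \<in> L2 (area_on F)"
      using g that by (simp add: has_normal_trace_def)
    then show ?thesis
      by (intro l2_inner_AE_cong L2_measurable normal_trace_AE_eq[OF g that])
  qed
  ultimately show ?thesis
    by (simp add: S_f_def h_eq l2_norm_power2)
qed

lemma green_identity:
  assumes d: "d \<in> L2 (lebesgue_on E)" "has_weak_div E v d" and g: "has_normal_trace E Fs v g" and \<phi>: "smooth \<phi>"
  shows "l2_inner (lebesgue_on E) v (grad \<phi>) + l2_inner (lebesgue_on E) d \<phi> = (\<Sum>F\<in>Fs. l2_inner (area_on F) (g F) \<phi>)"
proof -
  note wd = weak_div_AE_eq[OF E_open E_bounded d]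
  have "\<phi> \<in> L2 (lebesgue_on E)"
    by (intro continuous_L2 E_bounded E_lebesgue smooth_continuous \<phi>)
  then have "l2_inner (lebesgue_on E) (weak_div E v) \<phi> = l2_inner (lebesgue_on E) d \<phi>"
    by (intro l2_inner_AE_cong L2_measurable wd d(1)) auto
  moreover have "l2_inner (lebesgue_on E) v (grad \<phi>) + l2_inner (lebesgue_on E) (weak_div E v) \<phi>
      = (\<Sum>F\<in>Fs. l2_inner (area_on F) (g F) \<phi>)"
    using g \<phi> unfolding has_normal_trace_def by blast
  ultimately show ?thesis
    by (simp only:)
qed

text \<open>
  Subtracting from \<open>v\<close> a polynomial field \<open>q\<close> with the same curl leaves a curl-free field. It pairs
  with \<open>v\<close> through the divergence and the normal trace, whereas \<open>q\<close> only sees the projection of \<open>v\<close>.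
\<close>

lemma l2_norm_le_stabilization:
  assumes v: "v \<in> L2 (lebesgue_on E)" and d: "d \<in> L2 (lebesgue_on E)" "has_weak_div E v d"
    and g: "has_normal_trace E Fs v g" and w: "has_weak_curl E v w"
    and q: "q \<in> vpolys m" "has_weak_curl E q w" "l2_norm (lebesgue_on E) q \<le> K * l2_norm (lebesgue_on E) v"
    and K: "K \<ge> 0"
  shows "l2_norm (lebesgue_on E) v \<le> (K + pairing_const \<rho> * (1 + K))
    * (l2_norm (lebesgue_on E) (l2_proj m E v)
      + h * l2_norm (lebesgue_on E) d + sqrt (h * (\<Sum>F\<in>Fs. (l2_norm (area_on F) (g F))\<^sup>2)))"
proof -
  define V where "V = l2_norm (lebesgue_on E) v"
  define p where "p = l2_norm (lebesgue_on E) (l2_proj m E v)"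
  define s where "s = h * l2_norm (lebesgue_on E) d + sqrt (h * (\<Sum>F\<in>Fs. (l2_norm (area_on F) (g F))\<^sup>2))"
  define A where "A = pairing_const \<rho>"
  have V: "V \<ge> 0" and p: "p \<ge> 0"
    by (simp_all add: V_def p_def l2_norm_nonneg)
  have s: "s \<ge> 0"
    unfolding s_def using h_pos by (auto intro!: add_nonneg_nonneg mult_nonneg_nonneg l2_norm_nonneg sum_nonneg)
  have A: "A \<ge> 0"
    using rho_pos unfolding A_def pairing_const_def poincare_const_def by (auto intro!: add_nonneg_nonneg divide_nonneg_pos)
  have qL: "q \<in> L2 (lebesgue_on E)"
    by (intro continuous_L2 E_bounded E_lebesgue vpolys_continuous[OF q(1)])
  define u where "u x = v x - q x" for x
  have uL: "u \<in> L2 (lebesgue_on E)"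
    unfolding u_def using v qL by (rule L2_diff)
  have uc: "has_weak_curl E u (\<lambda>_. 0)"
    unfolding has_weak_curl_def
  proof (intro allI impI)
    fix \<psi> :: "real^3 \<Rightarrow> real^3"
    assume \<psi>: "(\<forall>i. smooth (\<lambda>x. \<psi> x $ i)) \<and> compactly_supported_in E \<psi>"
    then have "curl \<psi> \<in> L2 (lebesgue_on E)"
      by (intro continuous_L2 E_bounded E_lebesgue continuous_curl) simp
    then have "l2_inner (lebesgue_on E) u (curl \<psi>) = l2_inner (lebesgue_on E) v (curl \<psi>) - l2_inner (lebesgue_on E) q (curl \<psi>)"
      unfolding u_def by (rule l2_inner_diff_left[OF v qL])
    also have "\<dots> = 0"
      using w q(2) \<psi> by (simp add: has_weak_curl_def)
    finally show "l2_inner (lebesgue_on E) u (curl \<psi>) = l2_inner (lebesgue_on E) (\<lambda>_. 0) \<psi>"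
      by (simp add: l2_inner_def)
  qed
  have gL: "g F \<in> L2 (area_on F)" if "F \<in> Fs" for F
    using g that by (simp add: has_normal_trace_def)
  have "l2_inner (lebesgue_on E) v u \<le> (A * s) * l2_norm (lebesgue_on E) u"
  proof -
    have "\<bar>l2_inner (lebesgue_on E) v u\<bar> \<le> (A * s) * l2_norm (lebesgue_on E) u"
      using A s unfolding A_def s_def
      by (intro curl_free_pairing_bound[OF v uL uc] gradient_pairing_bound[OF v d(1) gL green_identity[OF d g]]) auto
    then show ?thesis
      by linarith
  qed
  also have "\<dots> \<le> (A * s) * ((1 + K) * V)"
  proof (rule mult_left_mono)
    have "l2_norm (lebesgue_on E) u \<le> V + l2_norm (lebesgue_on E) q"
      unfolding u_def V_def using v qL by (rule l2_norm_triangle_diff)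
    then show "l2_norm (lebesgue_on E) u \<le> (1 + K) * V"
      using q(3) by (simp add: V_def distrib_right)
  qed (use A s in simp)
  finally have 1: "l2_inner (lebesgue_on E) v u \<le> (A * s) * ((1 + K) * V)" .
  have "l2_inner (lebesgue_on E) v q = l2_inner (lebesgue_on E) (l2_proj m E v) q"
    by (rule l2_proj_E(3)[OF v q(1)])
  also have "\<dots> \<le> p * l2_norm (lebesgue_on E) q"
    using l2_Cauchy_Schwarz[OF l2_proj_E(2)[OF v] qL, of m] by (simp add: p_def)
  also have "\<dots> \<le> p * (K * V)"
    using p q(3) by (intro mult_left_mono) (auto simp: V_def)
  finally have 2: "l2_inner (lebesgue_on E) v q \<le> p * (K * V)" .
  have "V * V = l2_inner (lebesgue_on E) v (\<lambda>x. u x + q x)"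
    by (simp add: u_def V_def l2_norm_power2 flip: power2_eq_square)
  also have "\<dots> = l2_inner (lebesgue_on E) v u + l2_inner (lebesgue_on E) v q"
    by (rule l2_inner_add_right[OF uL qL v])
  also have "\<dots> \<le> (A * s) * ((1 + K) * V) + p * (K * V)"
    using 1 2 by (rule add_mono)
  also have "\<dots> = (A * (1 + K) * s + K * p) * V"
    by (simp add: algebra_simps)
  also have "\<dots> \<le> ((K + A * (1 + K)) * (p + s)) * V"
  proof (rule mult_right_mono[OF _ V])
    have "0 \<le> A * (1 + K) * p + K * s"
      using A K p s by simp
    then show "A * (1 + K) * s + K * p \<le> (K + A * (1 + K)) * (p + s)"
      by (simp add: algebra_simps)
  qed
  finally have "V \<le> (K + A * (1 + K)) * (p + s) \<or> V = 0"
    using V by (auto simp: mult_le_cancel_right)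
  moreover have "0 \<le> (K + A * (1 + K)) * (p + s)"
    using A K p s by simp
  ultimately have "V \<le> (K + A * (1 + K)) * (p + s)"
    by auto
  then show ?thesis
    by (simp only: V_def p_def s_def A_def add.assoc)
qed

end

theorem theorem5p3:
  fixes k :: nat and \<rho> :: real
  assumes "k \<ge> 1" and "\<rho> > 0"
  shows "\<exists>C1 C2 :: real. C1 > 0 \<and> C2 > 0 \<and>
    (\<forall>E Fs edges. polyhedral_domain E Fs edges \<and> mesh_regular \<rho> E Fs edges \<longrightarrow>
      (\<forall>v\<in>face_space k E Fs.
         C1 * (l2_norm (lebesgue_on E) v)\<^sup>2 \<le> S_f k E Fs v v \<and>
         S_f k E Fs v v \<le> C2 * (l2_norm (lebesgue_on E) v)\<^sup>2))"
proof (cases "\<rho> \<le> 1")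
  \<comment> \<open>For \<rho> > 1 no element satisfies the mesh assumption, and any positive
    constants do.\<close>
  case False
  have "\<not> (polyhedral_domain E Fs edges \<and> mesh_regular \<rho> E Fs edges)" for E Fs edges
  proof
    assume *: "polyhedral_domain E Fs edges \<and> mesh_regular \<rho> E Fs edges"
    obtain c where "mesh_element E Fs edges c (\<rho> * diameter E) \<rho> (diameter E)"
      by (rule mesh_regular_imp_mesh_element[OF assms(2)]) (use * in auto)
    then show False
      using mesh_element.rho_le_1 False by blast
  qed
  then show ?thesis
    by (intro exI[of _ 1]) (simp only: zero_less_one simp_thms)
next
  case True
  have \<kappa>: "4 / \<rho> \<ge> 1" "80 / \<rho> ^ 3 \<ge> 1"
    using assms(2) True power_le_one[of \<rho> 3] by (auto simp: pos_le_divide_eq)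
  define \<omega> :: real where "\<omega> = unit_ball_vol 3"
  have \<omega>: "\<omega> > 0"
    by (simp add: \<omega>_def unit_ball_vol_pos)
  \<comment> \<open>All constants are fixed from here on before any element is introduced, so they
    depend on k and \<rho> only.\<close>
  obtain Kd :: real where Kd: "Kd > 0"
    "\<And>E v d a R. bounded E \<Longrightarrow> E \<in> sets lebesgue \<Longrightarrow> R > 0 \<Longrightarrow> cball a R \<subseteq> E \<Longrightarrow> v \<in> L2 (lebesgue_on E) \<Longrightarrow>
      d \<in> polys (k - 1) \<Longrightarrow> has_weak_div E v d \<Longrightarrow>
      (R * l2_norm (lebesgue_on (ball a (R / 2))) d)\<^sup>2 \<le> Kd * (l2_norm (lebesgue_on E) v)\<^sup>2"
    by (rule weak_div_inverse_estimate[of "k - 1"]) (rule that)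
  obtain Kc :: real where Kc: "Kc > 0"
    "\<And>E v d a R. bounded E \<Longrightarrow> E \<in> sets lebesgue \<Longrightarrow> R > 0 \<Longrightarrow> cball a R \<subseteq> E \<Longrightarrow> v \<in> L2 (lebesgue_on E) \<Longrightarrow>
      d \<in> vpolys k \<Longrightarrow> has_weak_curl E v d \<Longrightarrow>
      (R * l2_norm (lebesgue_on (ball a (R / 2))) d)\<^sup>2 \<le> Kc * (l2_norm (lebesgue_on E) v)\<^sup>2"
    by (rule weak_curl_inverse_estimate[of k]) (rule that)
  obtain Sd :: real where Sd: "Sd > 0"
    "\<And>p (a :: real^3) R x. p \<in> polys (k - 1) \<Longrightarrow> R > 0 \<Longrightarrow> x \<in> cball a (4 / \<rho> * R) \<Longrightarrow>
      (p x)\<^sup>2 \<le> Sd / R ^ 3 * (l2_norm (lebesgue_on (ball a R)) p)\<^sup>2"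
    by (rule poly_sup_bound[OF \<kappa>(1), of "k - 1"]) (rule that)
  obtain Sc :: real where Sc: "Sc > 0"
    "\<And>p (a :: real^3) R x. p \<in> polys k \<Longrightarrow> R > 0 \<Longrightarrow> x \<in> cball a (4 / \<rho> * R) \<Longrightarrow>
      (p x)\<^sup>2 \<le> Sc / R ^ 3 * (l2_norm (lebesgue_on (ball a R)) p)\<^sup>2"
    by (rule poly_sup_bound[OF \<kappa>(1), of k]) (rule that)
  obtain St :: real where St: "St > 0"
    "\<And>p (a :: real^3) R x. p \<in> polys (k - 1) \<Longrightarrow> R > 0 \<Longrightarrow> x \<in> cball a (80 / \<rho> ^ 3 * R) \<Longrightarrow>
      (p x)\<^sup>2 \<le> St / R ^ 3 * (l2_norm (lebesgue_on (ball a R)) p)\<^sup>2"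
    by (rule poly_sup_bound[OF \<kappa>(2), of "k - 1"]) (rule that)
  obtain Bt :: real where Bt: "Bt > 0"
    "\<And>p (a :: real^3) R x. p \<in> polys (k - 1) \<Longrightarrow> R > 0 \<Longrightarrow>
      (p x * bump a R x)\<^sup>2 \<le> Bt / R ^ 3 * (l2_norm (lebesgue_on (ball a (R / 2))) p)\<^sup>2"
    "\<And>p (a :: real^3) R x i. p \<in> polys (k - 1) \<Longrightarrow> R > 0 \<Longrightarrow>
      (R * partial i (\<lambda>x. p x * bump a R x) x)\<^sup>2 \<le> Bt / R ^ 3 * (l2_norm (lebesgue_on (ball a (R / 2))) p)\<^sup>2"
    by (rule bubble_bounds[of "k - 1"]) (rule that)
  \<comment> \<open>\<open>D\<close> bounds the scaled divergence term, \<open>Q\<close> the squared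
    norm of the curl potential and \<open>T\<close> the trace term, each relative to squared volume
    norms; \<open>L\<close> is the factor of the lower estimate with K = sqrt Q.\<close>
  define D where "D = 256 * Sd * \<omega> / \<rho> ^ 5 * Kd"
  define Q where "Q = 3072 * Sc * \<omega> / \<rho> ^ 5 * Kc"
  define T where "T = 48 * pi * exp 4 * Bt * St * \<omega> * (40 / \<rho> ^ 3) ^ 3"
  define L where "L = sqrt Q + pairing_const \<rho> * (1 + sqrt Q)"
  have D: "D \<ge> 0" and Q: "Q \<ge> 0" and T: "T \<ge> 0"
    using Sd(1) Kd(1) Sc(1) Kc(1) Bt(1) St(1) assms(2) \<omega> by (simp_all add: D_def Q_def T_def)
  have main: "(l2_norm (lebesgue_on E) v)\<^sup>2 \<le> (3 * L\<^sup>2 + 1) * S_f k E Fs v v \<and>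
      S_f k E Fs v v \<le> (T * (1 + D) + D + 1) * (l2_norm (lebesgue_on E) v)\<^sup>2"
    if E: "polyhedral_domain E Fs edges" "mesh_regular \<rho> E Fs edges" and vf: "v \<in> face_space k E Fs" for E Fs edges v
  proof -
    obtain c where "mesh_element E Fs edges c (\<rho> * diameter E) \<rho> (diameter E)"
      using assms(2) E by (rule mesh_regular_imp_mesh_element)
    then interpret mesh_element E Fs edges c "\<rho> * diameter E" \<rho> "diameter E" .
    obtain d w g where v: "v \<in> L2 (lebesgue_on E)" and d: "d \<in> polys (k - 1)" "has_weak_div E v d"
      and w: "w \<in> vpolys k" "has_weak_curl E v w"
      and g: "\<And>F. F \<in> Fs \<Longrightarrow> g F \<in> polys (k - 1)" "has_normal_trace E Fs v g"
      using vf unfolding face_space_def by blast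
    have dL: "d \<in> L2 (lebesgue_on E)"
      by (intro continuous_L2 E_bounded E_lebesgue smooth_continuous smooth_polys[OF d(1)])
    define V where "V = l2_norm (lebesgue_on E) v"
    define p where "p = l2_norm (lebesgue_on E) (l2_proj (k + 1) E v)"
    define a where "a = diameter E * l2_norm (lebesgue_on E) d"
    define s2 where "s2 = diameter E * (\<Sum>F\<in>Fs. (l2_norm (area_on F) (g F))\<^sup>2)"
    have s2: "s2 \<ge> 0"
      unfolding s2_def using h_pos by (intro mult_nonneg_nonneg sum_nonneg) auto
    have S: "S_f k E Fs v v = s2 + a\<^sup>2 + p\<^sup>2"
      using S_f_eq[OF dL d(2) g(2)] by (simp add: s2_def a_def p_def power_mult_distrib)
    have "p\<^sup>2 \<le> V\<^sup>2"
      unfolding p_def V_def by (intro power_mono l2_proj_E(4)[OF v] l2_norm_nonneg)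
    moreover have aV: "a\<^sup>2 \<le> D * V\<^sup>2"
    proof -
      have "(diameter E)\<^sup>2 * (l2_norm (lebesgue_on E) d)\<^sup>2
          \<le> 256 * Sd * unit_ball_vol 3 / \<rho> ^ 5 * Kd * (l2_norm (lebesgue_on E) v)\<^sup>2"
        by (rule scaled_div_bound[where C = Sd and m = "k - 1" and K = Kd]) (fact Sd Kd(2) v d)+
      then show ?thesis
        by (simp add: a_def V_def D_def \<omega>_def power_mult_distrib)
    qed
    moreover have "s2 \<le> T * (1 + D) * V\<^sup>2"
    proof -
      have "s2 \<le> (48 * pi * exp 4 * Bt * St * unit_ball_vol 3 * (40 / \<rho> ^ 3) ^ 3)
          * ((l2_norm (lebesgue_on E) v)\<^sup>2 + (diameter E)\<^sup>2 * (l2_norm (lebesgue_on E) d)\<^sup>2)"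
        unfolding s2_def
        by (rule trace_inverse_estimate[where m = "k - 1"])
          (fact Bt St v dL g(1) green_identity[OF dL d(2) g(2)])+
      then have "s2 \<le> T * (V\<^sup>2 + a\<^sup>2)"
        by (simp add: T_def V_def a_def \<omega>_def power_mult_distrib)
      also have "\<dots> \<le> T * (V\<^sup>2 + D * V\<^sup>2)"
        using T aV by (intro mult_left_mono add_left_mono) auto
      finally show ?thesis
        by (simp add: algebra_simps)
    qed
    ultimately have upper: "S_f k E Fs v v \<le> (T * (1 + D) + D + 1) * V\<^sup>2"
      unfolding S by (simp add: distrib_right)
    have "\<exists>q\<in>vpolys (Suc k). has_weak_curl E q w \<and>
        (l2_norm (lebesgue_on E) q)\<^sup>2 \<le> 3072 * Sc * unit_ball_vol 3 / \<rho> ^ 5 * Kc * (l2_norm (lebesgue_on E) v)\<^sup>2"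
      by (rule curl_potential_bound[where C = Sc and m = k and K = Kc]) (fact Sc Kc(2) v w)+
    then obtain q where q: "q \<in> vpolys (Suc k)" "has_weak_curl E q w"
      "(l2_norm (lebesgue_on E) q)\<^sup>2 \<le> 3072 * Sc * unit_ball_vol 3 / \<rho> ^ 5 * Kc * (l2_norm (lebesgue_on E) v)\<^sup>2"
      by blast
    have "l2_norm (lebesgue_on E) q \<le> sqrt Q * V"
    proof (rule power2_le_imp_le)
      show "(l2_norm (lebesgue_on E) q)\<^sup>2 \<le> (sqrt Q * V)\<^sup>2"
        using q(3) Q by (simp add: power_mult_distrib Q_def \<omega>_def V_def)
    qed (use Q in \<open>simp add: V_def l2_norm_nonneg\<close>)
    then have "V \<le> L * (p + a + sqrt s2)"
      using l2_norm_le_stabilization[OF v dL d(2) g(2) w(2) q(1,2), of "sqrt Q"] Q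
      by (simp add: V_def L_def p_def a_def s2_def)
    then have "V\<^sup>2 \<le> (L * (p + a + sqrt s2))\<^sup>2"
      by (intro power_mono) (auto simp: V_def l2_norm_nonneg)
    also have "\<dots> = L\<^sup>2 * (p + a + sqrt s2)\<^sup>2"
      by (rule power_mult_distrib)
    also have "\<dots> \<le> L\<^sup>2 * (3 * (p\<^sup>2 + a\<^sup>2 + (sqrt s2)\<^sup>2))"
    proof (rule mult_left_mono)
      \<comment> \<open>The difference between three times the sum of squares and the square of the
        sum is exactly this sum.\<close>
      have "0 \<le> (p - a)\<^sup>2 + (a - sqrt s2)\<^sup>2 + (p - sqrt s2)\<^sup>2"
        by simp
      then show "(p + a + sqrt s2)\<^sup>2 \<le> 3 * (p\<^sup>2 + a\<^sup>2 + (sqrt s2)\<^sup>2)"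
        unfolding power2_eq_square by (simp add: algebra_simps)
    qed simp
    also have "\<dots> = 3 * L\<^sup>2 * S_f k E Fs v v"
      using s2 by (simp add: S)
    \<comment> \<open>The added 1 makes the constant positive whatever \<open>L\<close> is, so that
      it can be inverted for the lower bound.\<close>
    also have "\<dots> \<le> (3 * L\<^sup>2 + 1) * S_f k E Fs v v"
      using s2 by (intro mult_right_mono) (auto simp: S)
    finally show ?thesis
      using upper by (simp add: V_def)
  qed
  show ?thesis
  proof (rule exI[of _ "1 / (3 * L\<^sup>2 + 1)"], rule exI[of _ "T * (1 + D) + D + 1"], intro conjI allI impI ballI)
    have L: "3 * L\<^sup>2 + 1 > 0"
      using zero_le_power2[of L] by linarith
    then show "1 / (3 * L\<^sup>2 + 1) > 0"
      by simp
    show "T * (1 + D) + D + 1 > 0"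
      using T D by (intro add_nonneg_pos add_nonneg_nonneg mult_nonneg_nonneg) auto
    fix E Fs edges v
    assume E: "polyhedral_domain E Fs edges \<and> mesh_regular \<rho> E Fs edges" and v: "v \<in> face_space k E Fs"
    note m = main[OF conjunct1[OF E] conjunct2[OF E] v]
    show "1 / (3 * L\<^sup>2 + 1) * (l2_norm (lebesgue_on E) v)\<^sup>2 \<le> S_f k E Fs v v"
      using L conjunct1[OF m] by (simp add: pos_divide_le_eq mult.commute)
    show "S_f k E Fs v v \<le> (T * (1 + D) + D + 1) * (l2_norm (lebesgue_on E) v)\<^sup>2"
      by (rule conjunct2[OF m])
  qed
qed

end
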